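(* Let $X$ be a proper metric measure space with a non-atomic measure, and let $D_0\subset X$ be a uniformly discrete subspace. Let $p_\phi$ be a Wannier projection with set of localization centers $D_0$, and let $D\subset X$ be a uniformly discrete subspace such that $D_0\subset D$ and $D$ is coarsely equivalent to $X$. Then the following are equivalent: (i) $[p_\phi]=0$ in $K_0(C^*_{\mathbb C}(X))$; (ii) $[i_D(\iota_{\mathbb C}(1_{D_0}))]=0$ in $K_0(C^*_H(D))$.
   Context: A proper metric measure space $X$ is a set with a metric $d$ and a measure $m$ defined on the Borel $\sigma$-algebra of the metric topology, such that all balls are compact. Standing assumption on the $C_0(X)$-module $L^2(X)$ (with $C_0(X)$ acting by multiplication): $C_0(X)L^2(X)$ is dense in $L^2(X)$, and multiplication by any non-zero $f\in C_0(X)$ is not a compact operator (in particular $m$ is non-zero on non-empty open sets). A subset $D\subset X$ is uniformly discrete if $\inf_{g,h\in D,\,g\neq h}d(g,h)>0$; it is regarded as a metric measure space with counting measure. $D$ is coarsely equivalent to $X$ if there is $C>0$ such that for every $x\in X$ there is $y\in D$ with $d(x,y)<C$. Roe algebras: for $Y=X$ or $Y=D$ (or $D_0$) and a Hilbert space $K$, $C^*_K(Y)$ is the norm closure in $\mathbb B(L^2(Y)\otimes K)$ of the $*$-algebra of locally compact, finite propagation operators, where $C_0(Y)$ acts by multiplication on $L^2(Y)$; $T$ is locally compact if $Tf,fT$ are compact for all $f\in C_0(Y)$, and has finite propagation if there is $R>0$ with $fTg=0$ whenever $f,g\in C_0(Y)$ have supports at distance greater than $R$. Here $H$ denotes a fixed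 infinite-dimensional Hilbert space; $C^*_H(D)$ is the Roe algebra and $C^*_{\mathbb C}(D)$ the uniform Roe algebra of $D$. $1_{D_0}$ is the unit of $C^*_{\mathbb C}(D_0)$, and $\iota_{\mathbb C}:C^*_{\mathbb C}(D_0)\to C^*_{\mathbb C}(D)$ is the inclusion induced by $D_0\subset D$, so $\iota_{\mathbb C}(1_{D_0})$ is the projection of $l^2(D)$ onto $l^2(D_0)$. The map $i_D:C^*_{\mathbb C}(D)\to C^*_H(D)$ is $i_D(T)=T\otimes e$, where $e\in\mathbb K(H)$ is a rank one projection (the induced map in $K$-theory does not depend on $e$). Wannier projections: an orthonormal set $\{\phi_x:x\in D_0\}\subset L^2(X)$ is a $D_0$-compactly supported Wannier basis if there is $R>0$ with $\operatorname{supp}\phi_x\subset B_R(x)$ for all $x\in D_0$, where $B_R(x)$ is the ball of radius $R$ centered at $x$. The orthogonal projection $p_\phi\in C^*_{\mathbb C}(X)$ onto the closed linear span of $\{\phi_x\}$ is a Wannier projection with set of localization centers $D_0$. *)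

theory Defs
  imports "HOL-Analysis.Analysis" "HOL-Algebra.Coset" "HOL-Algebra.Module"
begin

section \<open>Complex Hilbert spaces\<close>

class chilbert_space = banach +
  fixes scaleC :: "complex \<Rightarrow> 'a \<Rightarrow> 'a" (infixr "*\<^sub>C" 75)
    and cinner :: "'a \<Rightarrow> 'a \<Rightarrow> complex"
  assumes scaleC_add_right: "c *\<^sub>C (x + y) = c *\<^sub>C x + c *\<^sub>C y"
    and scaleC_add_left: "(c + d) *\<^sub>C x = c *\<^sub>C x + d *\<^sub>C x"
    and scaleC_scaleC: "c *\<^sub>C (d *\<^sub>C x) = (c * d) *\<^sub>C x"
    and scaleC_of_real: "complex_of_real r *\<^sub>C x = r *\<^sub>R x"
    and cinner_commute: "cinner x y = cnj (cinner y x)"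
    and cinner_add_right: "cinner x (y + z) = cinner x y + cinner x z"
    and cinner_scaleC_right: "cinner x (c *\<^sub>C y) = c * cinner x y"
    and norm_eq_sqrt_cinner: "norm x = sqrt (Re (cinner x x))"

instantiation complex :: chilbert_space
begin

definition scaleC_complex :: "complex \<Rightarrow> complex \<Rightarrow> complex"
  where "scaleC_complex c x = c * x"

definition cinner_complex :: "complex \<Rightarrow> complex \<Rightarrow> complex"
  where "cinner_complex x y = cnj x * y"

instance
proof
  fix x y z c d :: complex and r :: real
  show "norm x = sqrt (Re (cinner x x))"
    by (simp add: cinner_complex_def cmod_def power2_eq_square)
qed (simp_all add: scaleC_complex_def cinner_complex_def algebra_simps scaleR_conv_of_real)

end

definition cfinite_dim :: "'h::chilbert_space itself \<Rightarrow> bool"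
  where "cfinite_dim _ \<longleftrightarrow>
    (\<exists>B::'h set. finite B \<and> (\<forall>v. \<exists>c. v = (\<Sum>b\<in>B. c b *\<^sub>C b)))"

definition rank_one_projection :: "('h::chilbert_space \<Rightarrow> 'h) \<Rightarrow> bool"
  where "rank_one_projection e \<longleftrightarrow>
    (\<forall>v w. e (v + w) = e v + e w) \<and> (\<forall>c v. e (c *\<^sub>C v) = c *\<^sub>C e v) \<and>
    (\<forall>v. e (e v) = e v) \<and> (\<forall>v w. cinner (e v) w = cinner v (e w)) \<and>
    (\<exists>u. u \<noteq> 0 \<and> range e = range (\<lambda>c. c *\<^sub>C u))"

text \<open>
  Inner product spaces with an explicit carrier, needed because $L^2$-spaces depend on a measure.
  As in the record \<open>module\<close> itself, the inherited fields \<open>mult\<close> and \<open>one\<close> carry no meaning here.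
\<close>

record 'v ip_space = "(complex, 'v) module" +
  ip :: "'v \<Rightarrow> 'v \<Rightarrow> complex"

definition hnorm :: "('v, 'z) ip_space_scheme \<Rightarrow> 'v \<Rightarrow> real"
  where "hnorm V v = sqrt (Re (ip V v v))"

definition hdist :: "('v, 'z) ip_space_scheme \<Rightarrow> 'v \<Rightarrow> 'v \<Rightarrow> real"
  where "hdist V v w = hnorm V (v \<ominus>\<^bsub>V\<^esub> w)"

definition closed_subspace :: "('v, 'z) ip_space_scheme \<Rightarrow> 'v set \<Rightarrow> bool"
  where "closed_subspace V U \<longleftrightarrow>
    U \<subseteq> carrier V \<and> \<zero>\<^bsub>V\<^esub> \<in> U \<and>
    (\<forall>v\<in>U. \<forall>w\<in>U. v \<oplus>\<^bsub>V\<^esub> w \<in> U) \<and> (\<forall>c. \<forall>v\<in>U. c \<odot>\<^bsub>V\<^esub> v \<in> U) \<and>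
    (\<forall>s. \<forall>l\<in>carrier V. (\<forall>n::nat. s n \<in> U) \<and> (\<lambda>n. hdist V (s n) l) \<longlonglongrightarrow> 0 \<longrightarrow> l \<in> U)"

definition closed_span :: "('v, 'z) ip_space_scheme \<Rightarrow> 'v set \<Rightarrow> 'v set"
  where "closed_span V S = \<Inter>{U. closed_subspace V U \<and> S \<subseteq> U}"

definition orth_proj :: "('v, 'z) ip_space_scheme \<Rightarrow> 'v set \<Rightarrow> 'v \<Rightarrow> 'v"
  where "orth_proj V U =
    (\<lambda>v\<in>carrier V. THE w. w \<in> U \<and> (\<forall>u\<in>U. ip V u (v \<ominus>\<^bsub>V\<^esub> w) = 0))"

subsection \<open>Bounded operators\<close>

text \<open>Operators are extensional functions on the carrier, so that they are equal as functions iff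
  they agree on the carrier.\<close>

definition bounded_ops :: "('v, 'z) ip_space_scheme \<Rightarrow> ('v \<Rightarrow> 'v) set"
  where "bounded_ops V = {T \<in> carrier V \<rightarrow>\<^sub>E carrier V.
    (\<forall>v\<in>carrier V. \<forall>w\<in>carrier V. T (v \<oplus>\<^bsub>V\<^esub> w) = T v \<oplus>\<^bsub>V\<^esub> T w) \<and>
    (\<forall>c. \<forall>v\<in>carrier V. T (c \<odot>\<^bsub>V\<^esub> v) = c \<odot>\<^bsub>V\<^esub> T v) \<and>
    (\<exists>C. \<forall>v\<in>carrier V. hnorm V (T v) \<le> C * hnorm V v)}"

definition op_id :: "('v, 'z) ip_space_scheme \<Rightarrow> 'v \<Rightarrow> 'v"
  where "op_id V = (\<lambda>v\<in>carrier V. v)"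

definition op_zero :: "('v, 'z) ip_space_scheme \<Rightarrow> 'v \<Rightarrow> 'v"
  where "op_zero V = (\<lambda>v\<in>carrier V. \<zero>\<^bsub>V\<^esub>)"

definition op_add :: "('v, 'z) ip_space_scheme \<Rightarrow> ('v \<Rightarrow> 'v) \<Rightarrow> ('v \<Rightarrow> 'v) \<Rightarrow> 'v \<Rightarrow> 'v"
  where "op_add V S T = (\<lambda>v\<in>carrier V. S v \<oplus>\<^bsub>V\<^esub> T v)"

definition op_scale :: "('v, 'z) ip_space_scheme \<Rightarrow> complex \<Rightarrow> ('v \<Rightarrow> 'v) \<Rightarrow> 'v \<Rightarrow> 'v"
  where "op_scale V c T = (\<lambda>v\<in>carrier V. c \<odot>\<^bsub>V\<^esub> T v)"

definition op_mult :: "('v, 'z) ip_space_scheme \<Rightarrow> ('v \<Rightarrow> 'v) \<Rightarrow> ('v \<Rightarrow> 'v) \<Rightarrow> 'v \<Rightarrow> 'v"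
  where "op_mult V S T = compose (carrier V) S T"

definition adjoint :: "('v, 'z) ip_space_scheme \<Rightarrow> ('v \<Rightarrow> 'v) \<Rightarrow> 'v \<Rightarrow> 'v"
  where "adjoint V T =
    (\<lambda>v\<in>carrier V. THE w. w \<in> carrier V \<and> (\<forall>u\<in>carrier V. ip V (T u) v = ip V u w))"

definition op_dist :: "('v, 'z) ip_space_scheme \<Rightarrow> ('v \<Rightarrow> 'v) \<Rightarrow> ('v \<Rightarrow> 'v) \<Rightarrow> real"
  where "op_dist V S T = (SUP v \<in> {v \<in> carrier V. hnorm V v \<le> 1}. hdist V (S v) (T v))"

definition compact_op :: "('v, 'z) ip_space_scheme \<Rightarrow> ('v \<Rightarrow> 'v) \<Rightarrow> bool"
  where "compact_op V T \<longleftrightarrow> T \<in> bounded_ops V \<and>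
    (\<forall>s C. (\<forall>n::nat. s n \<in> carrier V \<and> hnorm V (s n) \<le> C) \<longrightarrow>
      (\<exists>r. \<exists>l\<in>carrier V. strict_mono r \<and> (\<lambda>n. hdist V (T (s (r n))) l) \<longlonglongrightarrow> 0))"

section \<open>The Hilbert space \<open>L\<^sup>2(Y) \<otimes> K = L\<^sup>2(Y; K)\<close>\<close>

text \<open>
  A metric measure space \<open>Y\<close> is given by a measure \<open>M\<close> on an ambient metric space with
  \<open>space M = Y\<close>; a discrete set \<open>D\<close> with counting measure is \<open>count_space D\<close>. The tensor product is
  realised as the space of classes of strongly measurable, square integrable functions with values
  in \<open>K\<close>, the class \<open>'k\<close>; the separability condition makes measurability strong
  and is vacuous for separable \<open>K\<close>. For \<open>K = \<complex>\<close> this is \<open>L\<^sup>2(Y)\<close>.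
\<close>

definition square_int :: "'x measure \<Rightarrow> ('x \<Rightarrow> 'k::chilbert_space) set"
  where "square_int M = {f. f \<in> borel_measurable M \<and>
    (\<exists>C. countable C \<and> f ` space M \<subseteq> closure C) \<and> integrable M (\<lambda>x. (norm (f x))\<^sup>2)}"

definition L2_class :: "'x measure \<Rightarrow> ('x \<Rightarrow> 'k::chilbert_space) \<Rightarrow> ('x \<Rightarrow> 'k) set"
  where "L2_class M f = {g \<in> square_int M. AE x in M. g x = f x}"

definition rep :: "('x \<Rightarrow> 'k) set \<Rightarrow> 'x \<Rightarrow> 'k"
  where "rep a = (SOME f. f \<in> a)"

definition L2 :: "'x measure \<Rightarrow> ('x \<Rightarrow> 'k::chilbert_space) set ip_space"
  where "L2 M = \<lparr>carrier = L2_class M ` square_int M, mult = undefined, one = undefined,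
    zero = L2_class M (\<lambda>x. 0),
    add = (\<lambda>a b. L2_class M (\<lambda>x. rep a x + rep b x)),
    smult = (\<lambda>c a. L2_class M (\<lambda>x. c *\<^sub>C rep a x)),
    ip = (\<lambda>a b. \<integral>x. cinner (rep a x) (rep b x) \<partial>M)\<rparr>"

text \<open>The operator \<open>T \<otimes> S\<close> on \<open>L\<^sup>2(Y) \<otimes> K\<close>, determined by its values on elementary tensors.\<close>

definition elem_tensor ::
    "'x measure \<Rightarrow> ('x \<Rightarrow> complex) set \<Rightarrow> 'k::chilbert_space \<Rightarrow> ('x \<Rightarrow> 'k) set"
  where "elem_tensor M a v = L2_class M (\<lambda>x. rep a x *\<^sub>C v)"

definition tensor_op ::
    "'x measure \<Rightarrow> (('x \<Rightarrow> complex) set \<Rightarrow> ('x \<Rightarrow> complex) set) \<Rightarrow>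
     ('k::chilbert_space \<Rightarrow> 'k) \<Rightarrow> ('x \<Rightarrow> 'k) set \<Rightarrow> ('x \<Rightarrow> 'k) set"
  where "tensor_op M T S = (THE W. W \<in> bounded_ops (L2 M) \<and>
    (\<forall>a\<in>carrier (L2 M). \<forall>v. W (elem_tensor M a v) = elem_tensor M (T a) (S v)))"

section \<open>Metric measure spaces\<close>

definition proper_metric_measure :: "'x::metric_space measure \<Rightarrow> bool"
  where "proper_metric_measure m \<longleftrightarrow>
    sets m = sets borel \<and> (\<forall>(x::'x) r. compact (cball x r))"

definition non_atomic :: "'x measure \<Rightarrow> bool"
  where "non_atomic m \<longleftrightarrow> (\<forall>A\<in>sets m. emeasure m A > 0 \<longrightarrow>
    (\<exists>B\<in>sets m. B \<subseteq> A \<and> 0 < emeasure m B \<and> emeasure m B < emeasure m A))"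

definition coarsely_equivalent :: "'x::metric_space set \<Rightarrow> bool"
  where "coarsely_equivalent D \<longleftrightarrow> (\<exists>C>0. \<forall>x. \<exists>y\<in>D. dist x y < C)"

definition C0 :: "'x::metric_space set \<Rightarrow> ('x \<Rightarrow> complex) set"
  where "C0 Y = {f. continuous_on Y f \<and>
    (\<forall>\<epsilon>>0. \<exists>K\<subseteq>Y. compact K \<and> (\<forall>x\<in>Y - K. cmod (f x) < \<epsilon>))}"

definition supp :: "'x::metric_space set \<Rightarrow> ('x \<Rightarrow> complex) \<Rightarrow> 'x set"
  where "supp Y f = Y \<inter> closure {x\<in>Y. f x \<noteq> 0}"

definition mult_op ::
    "'x measure \<Rightarrow> ('x \<Rightarrow> complex) \<Rightarrow> ('x \<Rightarrow> 'k::chilbert_space) set \<Rightarrow> ('x \<Rightarrow> 'k) set"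
  where "mult_op M f = (\<lambda>a\<in>carrier (L2 M). L2_class M (\<lambda>x. f x *\<^sub>C rep a x))"

text \<open>The standing assumption on the \<open>C\<^sub>0(X)\<close>-module \<open>L\<^sup>2(X)\<close>.\<close>

definition ample_L2 :: "'x::metric_space measure \<Rightarrow> bool"
  where "ample_L2 m \<longleftrightarrow>
    (\<forall>a\<in>carrier (L2 m :: ('x \<Rightarrow> complex) set ip_space). \<forall>\<epsilon>>0.
      \<exists>f\<in>C0 (space m). \<exists>b\<in>carrier (L2 m). hdist (L2 m) a (mult_op m f b) < \<epsilon>) \<and>
    (\<forall>f\<in>C0 (space m). (\<exists>x\<in>space m. f x \<noteq> 0) \<longrightarrow>
      \<not> compact_op (L2 m :: ('x \<Rightarrow> complex) set ip_space) (mult_op m f))"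

section \<open>Roe algebras\<close>

definition locally_compact ::
    "'x::metric_space measure \<Rightarrow> (('x \<Rightarrow> 'k::chilbert_space) set \<Rightarrow> ('x \<Rightarrow> 'k) set) \<Rightarrow> bool"
  where "locally_compact M T \<longleftrightarrow> (\<forall>f\<in>C0 (space M).
    compact_op (L2 M) (op_mult (L2 M) T (mult_op M f)) \<and>
    compact_op (L2 M) (op_mult (L2 M) (mult_op M f) T))"

definition finite_propagation ::
    "'x::metric_space measure \<Rightarrow> (('x \<Rightarrow> 'k::chilbert_space) set \<Rightarrow> ('x \<Rightarrow> 'k) set) \<Rightarrow> bool"
  where "finite_propagation M T \<longleftrightarrow> (\<exists>R>0. \<forall>f\<in>C0 (space M). \<forall>g\<in>C0 (space M).
    setdist (supp (space M) f) (supp (space M) g) > R \<longrightarrow>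
    op_mult (L2 M) (mult_op M f) (op_mult (L2 M) T (mult_op M g)) = op_zero (L2 M))"

record 'a star_algebra = "(complex, 'a) module" +
  star :: "'a \<Rightarrow> 'a"

text \<open>
  The Roe algebra \<open>C\<^sup>*\<^sub>K(Y)\<close>. Its field \<open>one\<close> is the identity operator, which belongs to the carrier
  only if the algebra is unital (e.g. for uniform Roe algebras of uniformly discrete subsets of a
  proper space).
\<close>

definition roe ::
    "'x::metric_space measure \<Rightarrow>
     (('x \<Rightarrow> 'k::chilbert_space) set \<Rightarrow> ('x \<Rightarrow> 'k) set) star_algebra"
  where "roe M = \<lparr>carrier = {T \<in> bounded_ops (L2 M). \<forall>\<epsilon>>0. \<exists>S\<in>bounded_ops (L2 M).
      locally_compact M S \<and> finite_propagation M S \<and> op_dist (L2 M) T S < \<epsilon>},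
    mult = op_mult (L2 M), one = op_id (L2 M), zero = op_zero (L2 M), add = op_add (L2 M),
    smult = op_scale (L2 M), star = adjoint (L2 M)\<rparr>"

abbreviation uniform_roe ::
    "'x::metric_space set \<Rightarrow> (('x \<Rightarrow> complex) set \<Rightarrow> ('x \<Rightarrow> complex) set) star_algebra"
  where "uniform_roe D \<equiv> roe (count_space D)"

text \<open>The inclusion \<open>\<iota>\<^sub>\<complex>\<close> induced by \<open>D\<^sub>0 \<subseteq> D\<close>: restrict to \<open>D\<^sub>0\<close>, apply the operator, extend by zero.\<close>

definition iota_C ::
    "'x set \<Rightarrow> 'x set \<Rightarrow> (('x \<Rightarrow> complex) set \<Rightarrow> ('x \<Rightarrow> complex) set) \<Rightarrow>
     ('x \<Rightarrow> complex) set \<Rightarrow> ('x \<Rightarrow> complex) set"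
  where "iota_C D0 D T = (\<lambda>a\<in>carrier (L2 (count_space D)).
    L2_class (count_space D)
      (\<lambda>x. if x \<in> D0 then rep (T (L2_class (count_space D0) (rep a))) x else 0))"

definition i_D ::
    "'x set \<Rightarrow> ('h::chilbert_space \<Rightarrow> 'h) \<Rightarrow>
     (('x \<Rightarrow> complex) set \<Rightarrow> ('x \<Rightarrow> complex) set) \<Rightarrow> ('x \<Rightarrow> 'h) set \<Rightarrow> ('x \<Rightarrow> 'h) set"
  where "i_D D e T = tensor_op (count_space D) T e"

section \<open>Wannier projections\<close>

definition ess_supp :: "'x::metric_space measure \<Rightarrow> ('x \<Rightarrow> complex) set \<Rightarrow> 'x set"
  where "ess_supp m a = space m - \<Union>{U. open U \<and> (AE x in m. x \<in> U \<longrightarrow> rep a x = 0)}"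

definition wannier_basis ::
    "'x::metric_space measure \<Rightarrow> 'x set \<Rightarrow> ('x \<Rightarrow> ('x \<Rightarrow> complex) set) \<Rightarrow> bool"
  where "wannier_basis m D0 \<phi> \<longleftrightarrow>
    (\<forall>x\<in>D0. \<phi> x \<in> carrier (L2 m)) \<and>
    (\<forall>x\<in>D0. \<forall>y\<in>D0. ip (L2 m) (\<phi> x) (\<phi> y) = (if x = y then 1 else 0)) \<and>
    (\<exists>R>0. \<forall>x\<in>D0. ess_supp m (\<phi> x) \<subseteq> cball x R)"

definition wannier_projection ::
    "'x::metric_space measure \<Rightarrow> 'x set \<Rightarrow> (('x \<Rightarrow> complex) set \<Rightarrow> ('x \<Rightarrow> complex) set) \<Rightarrow> bool"
  where "wannier_projection m D0 p \<longleftrightarrow>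
    (\<exists>\<phi>. wannier_basis m D0 \<phi> \<and> p = orth_proj (L2 m) (closed_span (L2 m) (\<phi> ` D0)))"

section \<open>\<open>K\<^sub>0\<close> of a C*-algebra\<close>

subsection \<open>Matrices and projections over a unital *-algebra\<close>

definition mats :: "('a, 'z) star_algebra_scheme \<Rightarrow> nat \<Rightarrow> nat \<Rightarrow> (nat \<times> nat \<Rightarrow> 'a) set"
  where "mats B m n = ({..<m} \<times> {..<n}) \<rightarrow>\<^sub>E carrier B"

definition mat_mult ::
    "('a, 'z) star_algebra_scheme \<Rightarrow> nat \<Rightarrow> nat \<Rightarrow> nat \<Rightarrow>
     (nat \<times> nat \<Rightarrow> 'a) \<Rightarrow> (nat \<times> nat \<Rightarrow> 'a) \<Rightarrow> nat \<times> nat \<Rightarrow> 'a"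
  where "mat_mult B m n k x y =
    (\<lambda>(i, j)\<in>{..<m} \<times> {..<k}. \<Oplus>\<^bsub>B\<^esub>l\<in>{..<n}. x (i, l) \<otimes>\<^bsub>B\<^esub> y (l, j))"

definition mat_star ::
    "('a, 'z) star_algebra_scheme \<Rightarrow> nat \<Rightarrow> nat \<Rightarrow> (nat \<times> nat \<Rightarrow> 'a) \<Rightarrow> nat \<times> nat \<Rightarrow> 'a"
  where "mat_star B m n x = (\<lambda>(i, j)\<in>{..<n} \<times> {..<m}. star B (x (j, i)))"

definition projections :: "('a, 'z) star_algebra_scheme \<Rightarrow> (nat \<times> (nat \<times> nat \<Rightarrow> 'a)) set"
  where "projections B =
    {(n, p). p \<in> mats B n n \<and> mat_mult B n n n p p = p \<and> mat_star B n n p = p}"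

text \<open>Murray--von Neumann equivalence of projections of possibly different sizes.\<close>

definition mvn ::
    "('a, 'z) star_algebra_scheme \<Rightarrow>
     ((nat \<times> (nat \<times> nat \<Rightarrow> 'a)) \<times> (nat \<times> (nat \<times> nat \<Rightarrow> 'a))) set"
  where "mvn B = {((m, p), (n, q)). (m, p) \<in> projections B \<and> (n, q) \<in> projections B \<and>
    (\<exists>v\<in>mats B n m. mat_mult B m n m (mat_star B n m v) v = p \<and>
                    mat_mult B n m n v (mat_star B n m v) = q)}"

fun dsum ::
    "('a, 'z) star_algebra_scheme \<Rightarrow> nat \<times> (nat \<times> nat \<Rightarrow> 'a) \<Rightarrow>
     nat \<times> (nat \<times> nat \<Rightarrow> 'a) \<Rightarrow> nat \<times> (nat \<times> nat \<Rightarrow> 'a)"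
  where "dsum B (m, p) (n, q) = (m + n, \<lambda>(i, j)\<in>{..<m+n} \<times> {..<m+n}.
    if i < m \<and> j < m then p (i, j)
    else if m \<le> i \<and> m \<le> j then q (i - m, j - m) else \<zero>\<^bsub>B\<^esub>)"

definition mat1 :: "'a \<Rightarrow> nat \<times> (nat \<times> nat \<Rightarrow> 'a)"
  where "mat1 a = (1, \<lambda>(i, j)\<in>{..<1} \<times> {..<1}. a)"

text \<open>The abelian monoid of equivalence classes, written multiplicatively as in HOL-Algebra.\<close>

definition V_monoid ::
    "('a, 'z) star_algebra_scheme \<Rightarrow> (nat \<times> (nat \<times> nat \<Rightarrow> 'a)) set monoid"
  where "V_monoid B = \<lparr>carrier = projections B // mvn B,
    mult = (\<lambda>P Q. \<Union>p\<in>P. \<Union>q\<in>Q. mvn B `` {dsum B p q}),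
    one = mvn B `` {mat1 \<zero>\<^bsub>B\<^esub>}\<rparr>"

subsection \<open>The Grothendieck group of an abelian monoid\<close>

definition groth_rel :: "('s, 'z) monoid_scheme \<Rightarrow> (('s \<times> 's) \<times> ('s \<times> 's)) set"
  where "groth_rel S = {((a, b), (c, d)). {a, b, c, d} \<subseteq> carrier S \<and>
    (\<exists>k\<in>carrier S. a \<otimes>\<^bsub>S\<^esub> d \<otimes>\<^bsub>S\<^esub> k = c \<otimes>\<^bsub>S\<^esub> b \<otimes>\<^bsub>S\<^esub> k)}"

definition groth :: "('s, 'z) monoid_scheme \<Rightarrow> ('s \<times> 's) set monoid"
  where "groth S = \<lparr>carrier = (carrier S \<times> carrier S) // groth_rel S,
    mult = (\<lambda>x y. \<Union>(a, b)\<in>x. \<Union>(c, d)\<in>y. groth_rel S `` {(a \<otimes>\<^bsub>S\<^esub> c, b \<otimes>\<^bsub>S\<^esub> d)}),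
    one = groth_rel S `` {(\<one>\<^bsub>S\<^esub>, \<one>\<^bsub>S\<^esub>)}\<rparr>"

definition groth_map ::
    "('t, 'z) monoid_scheme \<Rightarrow> ('s \<Rightarrow> 't) \<Rightarrow> ('s \<times> 's) set \<Rightarrow> ('t \<times> 't) set"
  where "groth_map T h x = (\<Union>(a, b)\<in>x. groth_rel T `` {(h a, h b)})"

subsection \<open>\<open>K\<^sub>0\<close>\<close>

text \<open>\<open>K00 B\<close> is the usual \<open>K\<^sub>0(B)\<close> for unital \<open>B\<close>; \<open>K00_map C h\<close> is induced by a unital *-homomorphism
  \<open>h\<close> into \<open>C\<close>.\<close>

definition K00 ::
    "('a, 'z) star_algebra_scheme \<Rightarrow>
     ((nat \<times> (nat \<times> nat \<Rightarrow> 'a)) set \<times> (nat \<times> (nat \<times> nat \<Rightarrow> 'a)) set) set monoid"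
  where "K00 B = groth (V_monoid B)"

definition K00_map ::
    "('b, 'z) star_algebra_scheme \<Rightarrow> ('a \<Rightarrow> 'b) \<Rightarrow>
     ((nat \<times> (nat \<times> nat \<Rightarrow> 'a)) set \<times> (nat \<times> (nat \<times> nat \<Rightarrow> 'a)) set) set \<Rightarrow>
     ((nat \<times> (nat \<times> nat \<Rightarrow> 'b)) set \<times> (nat \<times> (nat \<times> nat \<Rightarrow> 'b)) set) set"
  where "K00_map C h = groth_map (V_monoid C)
    (\<lambda>P. \<Union>(n, p)\<in>P. mvn C `` {(n, \<lambda>ij\<in>{..<n} \<times> {..<n}. h (p ij))})"

definition unitization :: "('a, 'z) star_algebra_scheme \<Rightarrow> ('a \<times> complex) star_algebra"
  where "unitization A = \<lparr>carrier = carrier A \<times> UNIV,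
    mult = (\<lambda>(a, s) (b, t). ((a \<otimes>\<^bsub>A\<^esub> b) \<oplus>\<^bsub>A\<^esub> (s \<odot>\<^bsub>A\<^esub> b) \<oplus>\<^bsub>A\<^esub> (t \<odot>\<^bsub>A\<^esub> a), s * t)),
    one = (\<zero>\<^bsub>A\<^esub>, 1), zero = (\<zero>\<^bsub>A\<^esub>, 0),
    add = (\<lambda>(a, s) (b, t). (a \<oplus>\<^bsub>A\<^esub> b, s + t)),
    smult = (\<lambda>c (a, s). (c \<odot>\<^bsub>A\<^esub> a, c * s)),
    star = (\<lambda>(a, s). (star A a, cnj s))\<rparr>"

definition complex_algebra :: "complex star_algebra"
  where "complex_algebra = \<lparr>carrier = UNIV, mult = (*), one = 1, zero = 0, add = (+),
    smult = (*), star = cnj\<rparr>"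

text \<open>\<open>K\<^sub>0(A)\<close> for an arbitrary, possibly non-unital \<open>A\<close>: the kernel of \<open>K\<^sub>0(A\<^sup>+) \<rightarrow> K\<^sub>0(\<complex>)\<close>. The group is
  written multiplicatively, so that its neutral element is \<open>\<one>\<close>.\<close>

definition K0 ::
    "('a, 'z) star_algebra_scheme \<Rightarrow>
     ((nat \<times> (nat \<times> nat \<Rightarrow> 'a \<times> complex)) set \<times>
      (nat \<times> (nat \<times> nat \<Rightarrow> 'a \<times> complex)) set) set monoid"
  where "K0 A = (K00 (unitization A))\<lparr>carrier :=
    kernel (K00 (unitization A)) (K00 complex_algebra) (K00_map complex_algebra snd)\<rparr>"

definition K0_class ::
    "('a, 'z) star_algebra_scheme \<Rightarrow> 'a \<Rightarrow>
     ((nat \<times> (nat \<times> nat \<Rightarrow> 'a \<times> complex)) set \<times>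
      (nat \<times> (nat \<times> nat \<Rightarrow> 'a \<times> complex)) set) set"
  where "K0_class A p = groth_rel (V_monoid (unitization A)) ``
    {(mvn (unitization A) `` {mat1 (p, 0)}, \<one>\<^bsub>V_monoid (unitization A)\<^esub>)}"

end

theory Submission
  imports Defs
begin

text \<open>Both \<open>L\<^sup>2(X)\<close> and \<open>\<ell>\<^sup>2(D) \<otimes> H\<close> decompose orthogonally over \<open>D\<close>: the former into the functions on
  the cells of points nearest to a given \<open>d \<in> D\<close>, the latter into copies of \<open>H\<close>. In terms of this
  decomposition the Roe algebra consists of the norm limits of operators with finite propagation
  whose corners are compact. The class of a projection \<open>p\<close> vanishes in \<open>K\<^sub>0\<close> iff \<open>p \<oplus> q \<sim> q\<close> for some
  projection \<open>q\<close> over the unitization, and this identity involves only finitely many operators.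
  Each of their corners is compact, so for a basis adapted to the cells these operators kill all
  but countably many basis vectors in each cell. Since every cell is infinite-dimensional in both
  modules, a cell-preserving partial isometry moves these vectors into the other module, and
  conjugation with it respects the identity \<open>p \<oplus> q \<sim> q\<close>. It takes \<open>p\<^sub>\<phi>\<close> to the projection onto the
  span of another localised orthonormal family indexed by \<open>D\<^sub>0\<close>, and any two such projections are
  equivalent through the partial isometry matching the families. The argument is symmetric in the
  two modules, and \<open>1\<^bsub>D\<^sub>0\<^esub> \<otimes> e\<close> is itself such a projection.\<close>

section \<open>Hilbert spaces with explicit carrier\<close>

text \<open>Neither \<open>H\<close> nor the cells of \<open>L2(X)\<close> are assumed separable, so
  their dimensions may differ and no cell-preserving unitary between the modules need exist. Hence
  the partial isometry \<open>J\<close> depends on the given finite set of operators. Conjugation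
  with \<open>J\<close> is multiplicative only on operators that the initial projection of
  \<open>J\<close> fixes from both sides. It stays inside the Roe algebra because \<open>J\<close>
  commutes with the projections onto the cells, and on the unitization the scalar part is carried
  along unchanged.

  The partial isometry matching two localised families lies in the Roe algebra because balls contain
  finitely many points of \<open>D\<close>: each of its corners has finite rank.

  Nearest-point cells are chosen because each contains a ball around its centre. If such a cell were
  finite-dimensional, a bump function supported in that ball would act as a compact operator,
  against the standing assumption on \<open>L2(X)\<close>.

  Adjoints, partial isometries and tensor products are all described weakly, through inner products
  with arbitrary vectors, so only series of complex numbers occur.\<close>

definition vsub :: "('v, 'z) ip_space_scheme \<Rightarrow> 'v \<Rightarrow> 'v \<Rightarrow> 'v"
  where "vsub V u v = u \<oplus>\<^bsub>V\<^esub> (-1) \<odot>\<^bsub>V\<^esub> v"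

text \<open>The axiom \<open>ip_eqI\<close> (nondegeneracy) lets every vector identity be checked by expanding inner
  products; completeness is phrased with \<open>vsub\<close> because the subtraction of HOL-Algebra depends on
  the carrier, which would get in the way for closed subspaces.\<close>

locale hilb =
  fixes V :: "('v, 'z) ip_space_scheme" (structure)
  assumes zero_closed [simp, intro]: "\<zero> \<in> carrier V"
    and add_closed [simp, intro]: "\<lbrakk>u \<in> carrier V; v \<in> carrier V\<rbrakk> \<Longrightarrow> u \<oplus> v \<in> carrier V"
    and smult_closed [simp, intro]: "v \<in> carrier V \<Longrightarrow> c \<odot> v \<in> carrier V"
    and ip_zero_right [simp]: "u \<in> carrier V \<Longrightarrow> ip V u \<zero> = 0"
    and ip_add_right [simp]:
      "\<lbrakk>u \<in> carrier V; v \<in> carrier V; w \<in> carrier V\<rbrakk> \<Longrightarrow> ip V u (v \<oplus> w) = ip V u v + ip V u w"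
    and ip_smult_right [simp]:
      "\<lbrakk>u \<in> carrier V; v \<in> carrier V\<rbrakk> \<Longrightarrow> ip V u (c \<odot> v) = c * ip V u v"
    and ip_cnj: "\<lbrakk>u \<in> carrier V; v \<in> carrier V\<rbrakk> \<Longrightarrow> ip V u v = cnj (ip V v u)"
    and ip_nonneg: "v \<in> carrier V \<Longrightarrow> 0 \<le> Re (ip V v v)"
    and ip_eqI: "\<lbrakk>u \<in> carrier V; v \<in> carrier V; \<And>w. w \<in> carrier V \<Longrightarrow> ip V w u = ip V w v\<rbrakk> \<Longrightarrow> u = v"
    and complete: "\<lbrakk>\<And>n. s n \<in> carrier V;
        \<And>\<epsilon>. \<epsilon> > 0 \<Longrightarrow> \<exists>N. \<forall>i\<ge>N. \<forall>j\<ge>N. hnorm V (vsub V (s i) (s j)) < \<epsilon>\<rbrakk> \<Longrightarrow>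
        \<exists>l\<in>carrier V. (\<lambda>n::nat. hnorm V (vsub V (s n) l)) \<longlonglongrightarrow> 0"
begin

lemma vsub_closed [simp, intro]: "\<lbrakk>u \<in> carrier V; v \<in> carrier V\<rbrakk> \<Longrightarrow> vsub V u v \<in> carrier V"
  by (simp add: vsub_def)

lemma ip_zero_left [simp]: "u \<in> carrier V \<Longrightarrow> ip V \<zero> u = 0"
  by (subst ip_cnj) simp_all

lemma ip_add_left [simp]:
  "\<lbrakk>u \<in> carrier V; v \<in> carrier V; w \<in> carrier V\<rbrakk> \<Longrightarrow> ip V (v \<oplus> w) u = ip V v u + ip V w u"
  by (subst (1 2 3) ip_cnj) simp_all

lemma ip_smult_left [simp]:
  "\<lbrakk>u \<in> carrier V; v \<in> carrier V\<rbrakk> \<Longrightarrow> ip V (c \<odot> v) u = cnj c * ip V v u"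
  by (subst (1 2) ip_cnj) simp_all

lemma ip_vsub_right [simp]:
  "\<lbrakk>u \<in> carrier V; v \<in> carrier V; w \<in> carrier V\<rbrakk> \<Longrightarrow> ip V u (vsub V v w) = ip V u v - ip V u w"
  by (simp add: vsub_def)

lemma ip_vsub_left [simp]:
  "\<lbrakk>u \<in> carrier V; v \<in> carrier V; w \<in> carrier V\<rbrakk> \<Longrightarrow> ip V (vsub V v w) u = ip V v u - ip V w u"
  by (simp add: vsub_def)

section \<open>Norm, Cauchy--Schwarz inequality and the induced metric\<close>

lemma ip_self: "v \<in> carrier V \<Longrightarrow> ip V v v = complex_of_real ((hnorm V v)\<^sup>2)"
  using ip_cnj[of v v] ip_nonneg[of v]
  by (simp add: hnorm_def complex_eq_iff)

lemma hnorm_sq: "v \<in> carrier V \<Longrightarrow> (hnorm V v)\<^sup>2 = Re (ip V v v)"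
  using ip_nonneg[of v] by (simp add: hnorm_def)

lemma hnorm_nonneg [simp]: "v \<in> carrier V \<Longrightarrow> 0 \<le> hnorm V v"
  using ip_nonneg[of v] by (simp add: hnorm_def)

lemma hnorm_zero [simp]: "hnorm V \<zero> = 0"
  by (simp add: hnorm_def)

text \<open>The squared norm of \<open>u - t a v\<close> with \<open>a = <v, u>\<close> is
  nonnegative for every real \<open>t\<close>; the value \<open>t = 1 / |v|^2\<close> gives the
  claim. The case \<open>|v| = 0\<close> needs its own argument: that a null vector is zero is a
  consequence of this inequality.\<close>

lemma cauchy_schwarz_sq:
  assumes [simp]: "u \<in> carrier V" "v \<in> carrier V"
  shows "(cmod (ip V v u))\<^sup>2 \<le> (hnorm V v)\<^sup>2 * (hnorm V u)\<^sup>2"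
proof -
  define a where "a = ip V v u"
  define N where "N = (hnorm V v)\<^sup>2"
  have uv: "ip V u v = cnj a" unfolding a_def by (rule ip_cnj) simp_all
  have vv: "ip V v v = of_real N" by (simp add: ip_self N_def)
  have key: "0 \<le> Re (ip V u u) - 2 * t * (cmod a)\<^sup>2 + t\<^sup>2 * (cmod a)\<^sup>2 * N" for t :: real
  proof -
    have "0 \<le> Re (ip V (vsub V u ((of_real t * a) \<odot> v)) (vsub V u ((of_real t * a) \<odot> v)))"
      by (rule ip_nonneg) simp
    also have "\<dots> = Re (ip V u u) - 2 * t * (cmod a)\<^sup>2 + t\<^sup>2 * (cmod a)\<^sup>2 * N"
      unfolding cmod_power2
      by (simp add: uv vv a_def[symmetric]) (simp add: power2_eq_square algebra_simps)
    finally show ?thesis .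
  qed
  have hu: "(hnorm V u)\<^sup>2 = Re (ip V u u)" by (simp add: hnorm_sq)
  show ?thesis
  proof (cases "N = 0")
    case True
    have "(cmod a)\<^sup>2 = 0"
    proof (rule ccontr)
      assume "(cmod a)\<^sup>2 \<noteq> 0"
      then have "(cmod a)\<^sup>2 > 0" by simp
      \<comment> \<open>With \<open>N = 0\<close> the expression is affine in \<open>t\<close>; this
        \<open>t\<close> brings it down to \<open>-1\<close>.\<close>
      then show False
        using key[of "(Re (ip V u u) + 1) / (2 * (cmod a)\<^sup>2)"] True by simp
    qed
    then show ?thesis using True by (simp add: a_def N_def)
  next
    case False
    then have "N > 0" by (simp add: N_def)
    then have "2 * (1 / N) * (cmod a)\<^sup>2 - (1 / N)\<^sup>2 * (cmod a)\<^sup>2 * N = (cmod a)\<^sup>2 / N"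
      by (simp add: field_simps power2_eq_square)
    with key[of "1 / N"] have "(cmod a)\<^sup>2 / N \<le> Re (ip V u u)" by linarith
    then have "(cmod a)\<^sup>2 \<le> Re (ip V u u) * N" using \<open>N > 0\<close> by (simp add: pos_divide_le_eq)
    then show ?thesis unfolding a_def N_def hu by (simp only: mult.commute)
  qed
qed

lemma cauchy_schwarz:
  assumes "u \<in> carrier V" "v \<in> carrier V"
  shows "cmod (ip V u v) \<le> hnorm V u * hnorm V v"
  using cauchy_schwarz_sq[of v u] assms
  by (intro power2_le_imp_le[OF _ mult_nonneg_nonneg]) (simp_all add: power_mult_distrib)

text \<open>By Cauchy--Schwarz a null vector is orthogonal to everything, and nondegeneracy then
  identifies it with zero.\<close>

lemma hnorm_eq_0: assumes "v \<in> carrier V" "hnorm V v = 0" shows "v = \<zero>"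
proof (rule ip_eqI)
  fix w assume w: "w \<in> carrier V"
  show "ip V w v = ip V w \<zero>"
    using cauchy_schwarz[OF w assms(1)] assms w by simp
qed (use assms in simp_all)

lemma hnorm_smult [simp]: "v \<in> carrier V \<Longrightarrow> hnorm V (c \<odot> v) = cmod c * hnorm V v"
proof -
  assume v: "v \<in> carrier V"
  have "(hnorm V (c \<odot> v))\<^sup>2 = Re (cnj c * (c * ip V v v))"
    unfolding hnorm_sq[OF smult_closed[OF v]]
    by (rule arg_cong[of _ _ Re]) (use v in simp)
  also have "\<dots> = (cmod c * hnorm V v)\<^sup>2"
    unfolding ip_self[OF v] power_mult_distrib cmod_power2
    by (simp add: algebra_simps power2_eq_square)
  finally have "(hnorm V (c \<odot> v))\<^sup>2 = (cmod c * hnorm V v)\<^sup>2" .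
  then show ?thesis by (rule power2_eq_imp_eq) (use v in simp_all)
qed

lemma hnorm_triangle:
  assumes "u \<in> carrier V" "v \<in> carrier V"
  shows "hnorm V (u \<oplus> v) \<le> hnorm V u + hnorm V v"
proof (rule power2_le_imp_le)
  have "(hnorm V (u \<oplus> v))\<^sup>2 = (hnorm V u)\<^sup>2 + (hnorm V v)\<^sup>2 + 2 * Re (ip V u v)"
    using assms ip_cnj[of v u] by (simp add: hnorm_sq)
  also have "\<dots> \<le> (hnorm V u)\<^sup>2 + (hnorm V v)\<^sup>2 + 2 * (hnorm V u * hnorm V v)"
    using cauchy_schwarz[OF assms] complex_Re_le_cmod[of "ip V u v"] by linarith
  finally show "(hnorm V (u \<oplus> v))\<^sup>2 \<le> (hnorm V u + hnorm V v)\<^sup>2"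
    by (simp add: power2_sum)
qed (use assms in simp)

lemma hnorm_vsub_triangle:
  assumes "u \<in> carrier V" "v \<in> carrier V" "w \<in> carrier V"
  shows "hnorm V (vsub V u w) \<le> hnorm V (vsub V u v) + hnorm V (vsub V v w)"
proof -
  have "vsub V u w = vsub V u v \<oplus> vsub V v w"
    by (rule ip_eqI) (use assms in simp_all)
  then show ?thesis using hnorm_triangle assms by simp
qed

lemma hnorm_vsub_commute:
  assumes "u \<in> carrier V" "v \<in> carrier V"
  shows "hnorm V (vsub V u v) = hnorm V (vsub V v u)"
  using assms by (simp add: hnorm_def)

lemma hnorm_le_add:
  assumes "u \<in> carrier V" "v \<in> carrier V"
  shows "hnorm V u \<le> hnorm V v + hnorm V (vsub V u v)"
proof -
  have "u = v \<oplus> vsub V u v" by (rule ip_eqI) (use assms in simp_all)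
  then show ?thesis using hnorm_triangle[of v "vsub V u v"] assms by simp
qed

lemma vsub_eq_zero:
  assumes "u \<in> carrier V" "v \<in> carrier V" "hnorm V (vsub V u v) = 0"
  shows "u = v"
proof (rule ip_eqI)
  fix w assume "w \<in> carrier V"
  have "vsub V u v = \<zero>" using assms by (intro hnorm_eq_0) simp_all
  then have "ip V w (vsub V u v) = 0" using \<open>w \<in> carrier V\<close> by simp
  then show "ip V w u = ip V w v" using assms \<open>w \<in> carrier V\<close> by simp
qed (use assms in simp_all)

lemma vsub_self [simp]: "u \<in> carrier V \<Longrightarrow> hnorm V (vsub V u u) = 0"
  by (simp add: hnorm_def)

text \<open>Gives meaning to the HOL-Algebra subtraction on which \<open>hdist\<close> and
  \<open>orth_proj\<close> are built, so that it can be exchanged for \<open>vsub\<close>.\<close>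

sublocale abelian_group V
proof (rule abelian_groupI)
  fix x assume x: "x \<in> carrier V"
  show "\<exists>y\<in>carrier V. y \<oplus> x = \<zero>"
    by (rule bexI[of _ "(-1) \<odot> x"], rule ip_eqI) (use x in simp_all)
next
  fix x y z assume "x \<in> carrier V" "y \<in> carrier V" "z \<in> carrier V"
  then show "x \<oplus> y \<oplus> z = x \<oplus> (y \<oplus> z)" by (intro ip_eqI) simp_all
next
  fix x y assume "x \<in> carrier V" "y \<in> carrier V"
  then show "x \<oplus> y = y \<oplus> x" by (intro ip_eqI) simp_all
next
  fix x assume "x \<in> carrier V"
  then show "\<zero> \<oplus> x = x" by (intro ip_eqI) simp_all
qed simp_all

lemma minus_eq_vsub: assumes "u \<in> carrier V" "v \<in> carrier V" shows "u \<ominus> v = vsub V u v"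
proof -
  have "\<ominus> v = (-1) \<odot> v"
  proof (rule minus_equality)
    show "(-1) \<odot> v \<oplus> v = \<zero>" by (rule ip_eqI) (use assms in simp_all)
  qed (use assms in simp_all)
  then show ?thesis by (simp add: a_minus_def vsub_def)
qed

lemma hdist_eq: "\<lbrakk>u \<in> carrier V; v \<in> carrier V\<rbrakk> \<Longrightarrow> hdist V u v = hnorm V (vsub V u v)"
  by (simp add: hdist_def minus_eq_vsub)

text \<open>Provides total boundedness for the study of compact operators. Symmetry and
  nonnegativity of the distance are required on the whole type, hence the value 0 off the
  carrier.\<close>

sublocale MS: Metric_space "carrier V" "\<lambda>u v. if u \<in> carrier V \<and> v \<in> carrier V then hnorm V (vsub V u v) else 0"
proof
  fix x y z
  assume "x \<in> carrier V" "y \<in> carrier V" "z \<in> carrier V"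
  then show "(if x \<in> carrier V \<and> z \<in> carrier V then hnorm V (vsub V x z) else 0)
    \<le> (if x \<in> carrier V \<and> y \<in> carrier V then hnorm V (vsub V x y) else 0) +
       (if y \<in> carrier V \<and> z \<in> carrier V then hnorm V (vsub V y z) else 0)"
    using hnorm_vsub_triangle by simp
next
  fix x y
  assume "x \<in> carrier V" "y \<in> carrier V"
  then show "((if x \<in> carrier V \<and> y \<in> carrier V then hnorm V (vsub V x y) else 0) = 0) = (x = y)"
    using vsub_eq_zero by auto
qed (auto simp: hnorm_vsub_commute)

lemma ip_tendsto_left:
  assumes "\<And>n. s n \<in> carrier V" "l \<in> carrier V" "u \<in> carrier V"
    "(\<lambda>n. hnorm V (vsub V (s n) l)) \<longlonglongrightarrow> 0"
  shows "(\<lambda>n. ip V u (s n)) \<longlonglongrightarrow> ip V u l"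
proof -
  have "(\<lambda>n. ip V u (s n) - ip V u l) \<longlonglongrightarrow> 0"
  proof (rule Lim_null_comparison)
    show "(\<lambda>n. hnorm V u * hnorm V (vsub V (s n) l)) \<longlonglongrightarrow> 0"
      using tendsto_mult_right_zero[OF assms(4)] by simp
    show "\<forall>\<^sub>F n in sequentially. norm (ip V u (s n) - ip V u l) \<le> hnorm V u * hnorm V (vsub V (s n) l)"
      using cauchy_schwarz[of u "vsub V (s _) l"] assms by simp
  qed
  then show ?thesis by (simp add: LIM_zero_iff)
qed

lemma hnorm_tendsto:
  assumes "\<And>n. s n \<in> carrier V" "l \<in> carrier V"
    "(\<lambda>n. hnorm V (vsub V (s n) l)) \<longlonglongrightarrow> 0"
  shows "(\<lambda>n. hnorm V (s n)) \<longlonglongrightarrow> hnorm V l"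
proof -
  have "(\<lambda>n. hnorm V (s n) - hnorm V l) \<longlonglongrightarrow> 0"
  proof (rule Lim_null_comparison[OF _ assms(3)])
    show "\<forall>\<^sub>F n in sequentially. norm (hnorm V (s n) - hnorm V l) \<le> hnorm V (vsub V (s n) l)"
      using hnorm_le_add[of "s _" l] hnorm_le_add[of l "s _"] hnorm_vsub_commute[of l "s _"] assms
      by (intro always_eventually allI) (smt (verit) real_norm_def)
  qed
  then show ?thesis by (simp add: LIM_zero_iff)
qed

subsection \<open>The Riesz representation theorem\<close>

text \<open>The representing vector minimises \<open>\<parallel>v\<parallel>\<^sup>2 - 2 Re (f v)\<close>; minimising sequences are Cauchy by the
  parallelogram law.\<close>

theorem riesz:
  assumes add: "\<And>u v. \<lbrakk>u \<in> carrier V; v \<in> carrier V\<rbrakk> \<Longrightarrow> f (u \<oplus> v) = f u + f v"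
    and smult: "\<And>c v. v \<in> carrier V \<Longrightarrow> f (c \<odot> v) = c * f v"
    and bound: "\<And>v. v \<in> carrier V \<Longrightarrow> cmod (f v) \<le> C * hnorm V v"
  shows "\<exists>w\<in>carrier V. \<forall>v\<in>carrier V. f v = ip V w v"
proof -
  define J where "J v = (hnorm V v)\<^sup>2 - 2 * Re (f v)" for v
  have Jlow: "- C\<^sup>2 \<le> J v" if v: "v \<in> carrier V" for v
  proof -
    have "Re (f v) \<le> C * hnorm V v" using bound[OF v] complex_Re_le_cmod[of "f v"] by linarith
    moreover have "0 \<le> (hnorm V v - C)\<^sup>2" by simp
    ultimately show ?thesis by (simp add: J_def power2_diff mult.commute)
  qed
  define I where "I = Inf (J ` carrier V)"
  have bdd: "bdd_below (J ` carrier V)" using Jlow by (intro bdd_belowI[of _ "- C\<^sup>2"]) auto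
  have ne: "J ` carrier V \<noteq> {}" using zero_closed by blast
  have I_le: "I \<le> J v" if "v \<in> carrier V" for v
    unfolding I_def using bdd that by (simp add: cInf_lower)
  have "\<exists>v\<in>carrier V. J v < I + 1 / real (Suc n)" for n
  proof -
    have "I < I + 1 / real (Suc n)" by simp
    then obtain x where "x \<in> J ` carrier V" "x < I + 1 / real (Suc n)"
      unfolding I_def using cInf_lessD[OF ne] by blast
    then show ?thesis by auto
  qed
  then obtain s where s: "\<And>n. s n \<in> carrier V" "\<And>n. J (s n) < I + 1 / real (Suc n)"
    by metis
  have f_vsub: "f (vsub V u v) = f u - f v" if "u \<in> carrier V" "v \<in> carrier V" for u v
    using that by (simp add: vsub_def add smult)
  have par: "(hnorm V (vsub V u v))\<^sup>2 \<le> 2 * (J u - I) + 2 * (J v - I)"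
    if uv[simp]: "u \<in> carrier V" "v \<in> carrier V" for u v
  proof -
    define z where "z = (1/2) \<odot> (u \<oplus> v)"
    have z: "z \<in> carrier V" by (simp add: z_def)
    have "2 * J u + 2 * J v - 4 * J z = (hnorm V (vsub V u v))\<^sup>2"
      unfolding J_def z_def by (simp add: hnorm_sq add smult algebra_simps del: hnorm_smult)
    moreover have "2 * (J u - I) + 2 * (J v - I) = (2 * J u + 2 * J v - 4 * J z) + 4 * (J z - I)"
      by (simp add: algebra_simps)
    ultimately show ?thesis using I_le[OF z] by simp
  qed
  have "\<exists>l\<in>carrier V. (\<lambda>n::nat. hnorm V (vsub V (s n) l)) \<longlonglongrightarrow> 0"
  proof (rule complete[OF s(1)])
    fix \<epsilon> :: real assume "\<epsilon> > 0"
    then have "\<epsilon>\<^sup>2 / 4 > 0" by simp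
    then obtain N where N: "inverse (real (Suc N)) < \<epsilon>\<^sup>2 / 4" using reals_Archimedean by blast
    have "hnorm V (vsub V (s i) (s j)) < \<epsilon>" if "i \<ge> N" "j \<ge> N" for i j
    proof -
      have "J (s k) - I < \<epsilon>\<^sup>2 / 4" if "k \<ge> N" for k
      proof -
        have "1 / real (Suc k) \<le> inverse (real (Suc N))" using that by (simp add: field_simps)
        then show ?thesis using s(2)[of k] N by linarith
      qed
      from this[OF that(1)] this[OF that(2)] par[OF s(1)[of i] s(1)[of j]]
      have "(hnorm V (vsub V (s i) (s j)))\<^sup>2 < \<epsilon>\<^sup>2" by argo
      then show ?thesis using \<open>\<epsilon> > 0\<close> by (simp add: power2_less_imp_less)
    qed
    then show "\<exists>N. \<forall>i\<ge>N. \<forall>j\<ge>N. hnorm V (vsub V (s i) (s j)) < \<epsilon>" by blast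
  qed
  then obtain w where w[simp]: "w \<in> carrier V" and lim: "(\<lambda>n. hnorm V (vsub V (s n) w)) \<longlonglongrightarrow> 0"
    by blast
  have "(\<lambda>n. f (s n) - f w) \<longlonglongrightarrow> 0"
  proof (rule Lim_null_comparison)
    show "(\<lambda>n. C * hnorm V (vsub V (s n) w)) \<longlonglongrightarrow> 0"
      using tendsto_mult_right_zero[OF lim] by simp
    show "\<forall>\<^sub>F n in sequentially. norm (f (s n) - f w) \<le> C * hnorm V (vsub V (s n) w)"
      using bound[of "vsub V (s _) w"] s(1) by (simp add: f_vsub)
  qed
  then have "(\<lambda>n. f (s n)) \<longlonglongrightarrow> f w" by (simp add: LIM_zero_iff)
  then have "(\<lambda>n. J (s n)) \<longlonglongrightarrow> J w"
    unfolding J_def using hnorm_tendsto[OF s(1) w lim] by (intro tendsto_intros)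
  moreover have "(\<lambda>n. I + 1 / real (Suc n)) \<longlonglongrightarrow> I + 0"
    by (intro tendsto_intros LIMSEQ_Suc[OF lim_1_over_n])
  ultimately have "J w \<le> I + 0"
    using s(2) by (intro LIMSEQ_le) (auto intro: less_imp_le)
  then have min: "J w \<le> J v" if "v \<in> carrier V" for v using I_le[OF that] by linarith
  have re: "Re (f v) = Re (ip V w v)" if v[simp]: "v \<in> carrier V" for v
  proof -
    define b where "b = Re (ip V w v) - Re (f v)"
    have "0 \<le> 2 * t * b + t\<^sup>2 * (hnorm V v)\<^sup>2" for t :: real
    proof -
      have "J w \<le> J (w \<oplus> of_real t \<odot> v)" by (rule min) simp
      also have "\<dots> = J w + 2 * t * b + t\<^sup>2 * (hnorm V v)\<^sup>2"
      proof -
        have "(hnorm V (w \<oplus> of_real t \<odot> v))\<^sup>2 = (hnorm V w)\<^sup>2 + 2 * t * Re (ip V w v) + t\<^sup>2 * (hnorm V v)\<^sup>2"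
          using ip_cnj[OF v w]
          by (simp add: hnorm_sq) (simp add: power2_eq_square algebra_simps)
        then show ?thesis by (simp add: J_def b_def add smult algebra_simps)
      qed
      finally show ?thesis by simp
    qed
    note quad = this
    define N where "N = (hnorm V v)\<^sup>2"
    have N: "N \<ge> 0" by (simp add: N_def)
    \<comment> \<open>A test value near the minimum of the quadratic makes it negative unless
      \<open>b = 0\<close>; dividing by \<open>N + 1\<close> instead of \<open>N\<close> keeps the
      case \<open>|v| = 0\<close> legitimate.\<close>
    have "2 * (- b / (N + 1)) * b + (- b / (N + 1))\<^sup>2 * N = - (b\<^sup>2 * (N + 2)) / (N + 1)\<^sup>2"
      using N by (simp add: field_simps power2_eq_square add_nonneg_eq_0_iff)
    with quad[of "- b / (N + 1)"] have "b\<^sup>2 * (N + 2) / (N + 1)\<^sup>2 \<le> 0"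
      unfolding N_def by simp
    moreover have "(N + 1)\<^sup>2 > 0" using N by simp
    ultimately have "b\<^sup>2 * (N + 2) \<le> 0" by (simp add: divide_le_0_iff)
    moreover have "b\<^sup>2 * (N + 2) > 0" if "b \<noteq> 0" using that N by simp
    ultimately have "b = 0" by (meson not_less)
    then show ?thesis by (simp add: b_def)
  qed
  have "f v = ip V w v" if v: "v \<in> carrier V" for v
  proof (rule complex_eqI)
    show "Re (f v) = Re (ip V w v)" by (rule re[OF v])
    \<comment> \<open>By linearity the real part at \<open>i v\<close> is minus the imaginary part
      at \<open>v\<close>.\<close>
    show "Im (f v) = Im (ip V w v)" using re[of "\<i> \<odot> v"] v by (simp add: smult)
  qed
  then show ?thesis using w by blast
qed

end

lemma LIMSEQ_null_less: "\<lbrakk>X \<longlonglongrightarrow> 0; 0 < d\<rbrakk> \<Longrightarrow> \<exists>N. \<forall>n\<ge>N. X n < (d::real)"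
  using order_tendstoD(2)[of X 0 sequentially d] by (simp add: eventually_sequentially)

subsection \<open>Bounded operators and adjoints\<close>

context hilb
begin

lemma bounded_opsD:
  assumes "T \<in> bounded_ops V"
  shows bo_closed: "\<And>v. v \<in> carrier V \<Longrightarrow> T v \<in> carrier V"
    and bo_add: "\<And>u v. \<lbrakk>u \<in> carrier V; v \<in> carrier V\<rbrakk> \<Longrightarrow> T (u \<oplus> v) = T u \<oplus> T v"
    and bo_smult: "\<And>c v. v \<in> carrier V \<Longrightarrow> T (c \<odot> v) = c \<odot> T v"
    and bo_ext: "T \<in> extensional (carrier V)"
  using assms by (auto simp: bounded_ops_def PiE_def)

lemma bo_bound:
  assumes "T \<in> bounded_ops V"
  obtains C where "C \<ge> 0" "\<And>v. v \<in> carrier V \<Longrightarrow> hnorm V (T v) \<le> C * hnorm V v"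
proof -
  from assms obtain C where C: "\<And>v. v \<in> carrier V \<Longrightarrow> hnorm V (T v) \<le> C * hnorm V v"
    unfolding bounded_ops_def by blast
  have "hnorm V (T v) \<le> max C 0 * hnorm V v" if "v \<in> carrier V" for v
    using C[OF that] mult_right_mono[of C "max C 0" "hnorm V v"] that by simp
  then show ?thesis using that[of "max C 0"] by simp
qed

lemma bo_vsub: "\<lbrakk>T \<in> bounded_ops V; u \<in> carrier V; v \<in> carrier V\<rbrakk> \<Longrightarrow> T (vsub V u v) = vsub V (T u) (T v)"
  by (simp add: vsub_def bo_add bo_smult)

lemma bo_zero: assumes "T \<in> bounded_ops V" shows "T \<zero> = \<zero>"
proof -
  have z: "\<zero> = 0 \<odot> \<zero>" by (rule ip_eqI) simp_all
  then have "T \<zero> = 0 \<odot> T \<zero>" using bo_smult[OF assms zero_closed, of 0] by simp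
  also have "\<dots> = \<zero>" by (rule ip_eqI) (use bo_closed[OF assms zero_closed] in simp_all)
  finally show ?thesis .
qed

text \<open>Linearity is automatic once an adjoint \<open>S\<close> is exhibited: both sides of a
  linearity identity have the same inner products.\<close>

lemma bounded_opsI:
  assumes T: "T \<in> carrier V \<rightarrow>\<^sub>E carrier V"
    and S: "\<And>v. v \<in> carrier V \<Longrightarrow> S v \<in> carrier V"
    and adj: "\<And>u v. \<lbrakk>u \<in> carrier V; v \<in> carrier V\<rbrakk> \<Longrightarrow> ip V u (T v) = ip V (S u) v"
    and C: "\<And>v. v \<in> carrier V \<Longrightarrow> hnorm V (T v) \<le> C * hnorm V v"
  shows "T \<in> bounded_ops V"
proof -
  have Tc: "T v \<in> carrier V" if "v \<in> carrier V" for v using T that by auto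
  have "T (u \<oplus> v) = T u \<oplus> T v" if "u \<in> carrier V" "v \<in> carrier V" for u v
    by (rule ip_eqI) (use that in \<open>simp_all add: Tc adj S\<close>)
  moreover have "T (c \<odot> v) = c \<odot> T v" if "v \<in> carrier V" for c v
    by (rule ip_eqI) (use that in \<open>simp_all add: Tc adj S\<close>)
  ultimately show ?thesis using T C unfolding bounded_ops_def by blast
qed

lemma op_eqI:
  assumes "S \<in> extensional (carrier V)" "T \<in> extensional (carrier V)"
    and "\<And>v. v \<in> carrier V \<Longrightarrow> S v \<in> carrier V" "\<And>v. v \<in> carrier V \<Longrightarrow> T v \<in> carrier V"
    and "\<And>u v. \<lbrakk>u \<in> carrier V; v \<in> carrier V\<rbrakk> \<Longrightarrow> ip V u (S v) = ip V u (T v)"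
  shows "S = T"
  by (rule extensionalityI[OF assms(1,2)], rule ip_eqI) (use assms in auto)

lemma bo_eqI:
  assumes "S \<in> bounded_ops V" "T \<in> bounded_ops V"
    and "\<And>u v. \<lbrakk>u \<in> carrier V; v \<in> carrier V\<rbrakk> \<Longrightarrow> ip V u (S v) = ip V u (T v)"
  shows "S = T"
  using assms by (intro op_eqI) (auto simp: bo_ext bo_closed)

lemma adjoint_ex1:
  assumes T: "T \<in> bounded_ops V" and v: "v \<in> carrier V"
  shows "\<exists>!w. w \<in> carrier V \<and> (\<forall>u\<in>carrier V. ip V (T u) v = ip V u w)"
proof -
  obtain C where C: "C \<ge> 0" "\<And>v. v \<in> carrier V \<Longrightarrow> hnorm V (T v) \<le> C * hnorm V v"
    using bo_bound[OF T] by blast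
  have "\<exists>w\<in>carrier V. \<forall>u\<in>carrier V. ip V v (T u) = ip V w u"
  proof (rule riesz)
    fix u assume u: "u \<in> carrier V"
    have "cmod (ip V v (T u)) \<le> hnorm V v * hnorm V (T u)"
      by (rule cauchy_schwarz) (use v u bo_closed[OF T] in auto)
    also have "\<dots> \<le> hnorm V v * (C * hnorm V u)"
      by (rule mult_left_mono) (use C u v in auto)
    finally show "cmod (ip V v (T u)) \<le> (hnorm V v * C) * hnorm V u" by (simp add: mult.assoc)
  qed (use v T in \<open>simp_all add: bo_add bo_smult bo_closed\<close>)
  then obtain w where w: "w \<in> carrier V" "\<And>u. u \<in> carrier V \<Longrightarrow> ip V v (T u) = ip V w u" by blast
  have "ip V (T u) v = ip V u w" if "u \<in> carrier V" for u
    using w(2)[OF that] ip_cnj[of "T u" v] ip_cnj[of u w] bo_closed[OF T that] v w(1) that by simp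
  with w(1) show ?thesis by (intro ex1I[of _ w]) (auto intro!: ip_eqI)
qed

lemma
  assumes T: "T \<in> bounded_ops V"
  shows adjoint_closed: "v \<in> carrier V \<Longrightarrow> adjoint V T v \<in> carrier V"
    and ip_adjoint_right: "\<lbrakk>u \<in> carrier V; v \<in> carrier V\<rbrakk> \<Longrightarrow> ip V u (adjoint V T v) = ip V (T u) v"
    and ip_adjoint_left: "\<lbrakk>u \<in> carrier V; v \<in> carrier V\<rbrakk> \<Longrightarrow> ip V (adjoint V T u) v = ip V u (T v)"
proof -
  have *: "adjoint V T v \<in> carrier V \<and> (\<forall>u\<in>carrier V. ip V (T u) v = ip V u (adjoint V T v))"
    if v: "v \<in> carrier V" for v
  proof -
    have eq: "adjoint V T v = (THE w. w \<in> carrier V \<and> (\<forall>u\<in>carrier V. ip V (T u) v = ip V u w))"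
      using v by (simp add: adjoint_def)
    show ?thesis unfolding eq by (rule theI'[OF adjoint_ex1[OF T v]])
  qed
  show "v \<in> carrier V \<Longrightarrow> adjoint V T v \<in> carrier V" using * by blast
  show "\<lbrakk>u \<in> carrier V; v \<in> carrier V\<rbrakk> \<Longrightarrow> ip V u (adjoint V T v) = ip V (T u) v" using * by simp
  show "ip V (adjoint V T u) v = ip V u (T v)" if "u \<in> carrier V" "v \<in> carrier V"
  proof -
    have "ip V (adjoint V T u) v = cnj (ip V v (adjoint V T u))" using * that by (intro ip_cnj) auto
    also have "\<dots> = cnj (ip V (T v) u)" using * that by simp
    also have "\<dots> = ip V u (T v)" using bo_closed[OF T] that by (intro ip_cnj[symmetric]) auto
    finally show ?thesis .
  qed
qed

text \<open>\<open>|T* v|^2 = <T T* v, v>\<close> is at most \<open>C |T* v| |v|\<close>, and one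
  factor cancels.\<close>

lemma adjoint_norm_le:
  assumes T: "T \<in> bounded_ops V" and C: "C \<ge> 0" "\<And>v. v \<in> carrier V \<Longrightarrow> hnorm V (T v) \<le> C * hnorm V v"
    and v: "v \<in> carrier V"
  shows "hnorm V (adjoint V T v) \<le> C * hnorm V v"
proof -
  define w where "w = adjoint V T v"
  have w: "w \<in> carrier V" unfolding w_def by (rule adjoint_closed[OF T v])
  have "ip V w w = ip V (T w) v"
    using ip_adjoint_right[OF T w v] by (simp add: w_def)
  then have "(hnorm V w)\<^sup>2 = Re (ip V (T w) v)" by (simp add: hnorm_sq[OF w])
  also have "\<dots> \<le> hnorm V (T w) * hnorm V v"
    using cauchy_schwarz[of "T w" v] complex_Re_le_cmod[of "ip V (T w) v"] bo_closed[OF T w] v by linarith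
  also have "\<dots> \<le> (C * hnorm V w) * hnorm V v"
    by (rule mult_right_mono) (use C w v in auto)
  finally have *: "hnorm V w * hnorm V w \<le> hnorm V w * (C * hnorm V v)"
    by (simp add: power2_eq_square mult_ac)
  show ?thesis
  proof (cases "hnorm V w = 0")
    case True then show ?thesis using C v by (simp add: w_def[symmetric])
  next
    case False
    then have "hnorm V w > 0" using hnorm_nonneg[OF w] by linarith
    then show ?thesis using * by (simp add: w_def[symmetric])
  qed
qed

lemma adjoint_bounded [simp, intro]: 
  assumes T: "T \<in> bounded_ops V" shows "adjoint V T \<in> bounded_ops V"
proof -
  obtain C where C: "C \<ge> 0" "\<And>v. v \<in> carrier V \<Longrightarrow> hnorm V (T v) \<le> C * hnorm V v"
    using bo_bound[OF T] by blast
  show ?thesis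
  proof (rule bounded_opsI)
    show "adjoint V T \<in> carrier V \<rightarrow>\<^sub>E carrier V"
      using adjoint_closed[OF T] by (auto simp: adjoint_def)
    show "\<And>v. v \<in> carrier V \<Longrightarrow> hnorm V (adjoint V T v) \<le> C * hnorm V v"
      by (rule adjoint_norm_le[OF T C])
  qed (use T in \<open>auto simp: ip_adjoint_right bo_closed\<close>)
qed

lemma adjointI:
  assumes T: "T \<in> bounded_ops V" and S: "S \<in> bounded_ops V"
    and "\<And>u v. \<lbrakk>u \<in> carrier V; v \<in> carrier V\<rbrakk> \<Longrightarrow> ip V (T u) v = ip V u (S v)"
  shows "adjoint V T = S"
  by (rule bo_eqI) (use assms in \<open>simp_all add: ip_adjoint_right\<close>)

lemma adjoint_adjoint: "T \<in> bounded_ops V \<Longrightarrow> adjoint V (adjoint V T) = T"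
  by (rule adjointI) (simp_all add: ip_adjoint_left)

section \<open>Algebra of bounded operators and the operator norm distance\<close>

lemma op_apply [simp]:
  assumes "v \<in> carrier V"
  shows "op_add V S T v = S v \<oplus> T v" "op_mult V S T v = S (T v)" "op_scale V c T v = c \<odot> T v"
    "op_zero V v = \<zero>" "op_id V v = v"
  using assms by (simp_all add: op_add_def op_mult_def op_scale_def op_zero_def op_id_def compose_def)

lemma op_zero_bounded [simp, intro]: "op_zero V \<in> bounded_ops V"
  by (rule bounded_opsI[of _ "\<lambda>_. \<zero>" 0]) (auto simp: op_zero_def)

lemma op_id_bounded [simp, intro]: "op_id V \<in> bounded_ops V"
  by (rule bounded_opsI[of _ "\<lambda>v. v" 1]) (auto simp: op_id_def)

lemma op_mult_bounded [simp, intro]: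
  assumes S: "S \<in> bounded_ops V" and T: "T \<in> bounded_ops V"
  shows "op_mult V S T \<in> bounded_ops V"
proof -
  obtain A where A: "A \<ge> 0" "\<And>v. v \<in> carrier V \<Longrightarrow> hnorm V (S v) \<le> A * hnorm V v"
    using bo_bound[OF S] by blast
  obtain B where B: "B \<ge> 0" "\<And>v. v \<in> carrier V \<Longrightarrow> hnorm V (T v) \<le> B * hnorm V v"
    using bo_bound[OF T] by blast
  show ?thesis
  proof (rule bounded_opsI[where S = "\<lambda>v. adjoint V T (adjoint V S v)" and C = "A * B"])
    fix v assume v: "v \<in> carrier V"
    have "hnorm V (S (T v)) \<le> A * hnorm V (T v)" using A bo_closed[OF T v] by blast
    also have "\<dots> \<le> A * (B * hnorm V v)" by (rule mult_left_mono) (use A B v in auto)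
    finally show "hnorm V (op_mult V S T v) \<le> A * B * hnorm V v" using v by (simp add: mult.assoc)
  qed (use S T in \<open>auto simp: ip_adjoint_left adjoint_closed bo_closed op_mult_def compose_def\<close>)
qed

lemma op_add_bounded [simp, intro]:
  assumes S: "S \<in> bounded_ops V" and T: "T \<in> bounded_ops V"
  shows "op_add V S T \<in> bounded_ops V"
proof -
  obtain A where A: "A \<ge> 0" "\<And>v. v \<in> carrier V \<Longrightarrow> hnorm V (S v) \<le> A * hnorm V v"
    using bo_bound[OF S] by blast
  obtain B where B: "B \<ge> 0" "\<And>v. v \<in> carrier V \<Longrightarrow> hnorm V (T v) \<le> B * hnorm V v"
    using bo_bound[OF T] by blast
  show ?thesis
  proof (rule bounded_opsI[where S = "\<lambda>v. adjoint V S v \<oplus> adjoint V T v" and C = "A + B"])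
    fix v assume v: "v \<in> carrier V"
    have "hnorm V (S v \<oplus> T v) \<le> hnorm V (S v) + hnorm V (T v)"
      using bo_closed[OF T v] bo_closed[OF S v] by (rule hnorm_triangle[rotated])
    then show "hnorm V (op_add V S T v) \<le> (A + B) * hnorm V v"
      using v A(2)[OF v] B(2)[OF v] by (simp add: algebra_simps)
  qed (use S T in \<open>auto simp: ip_adjoint_left adjoint_closed bo_closed op_add_def\<close>)
qed

lemma op_scale_bounded [simp, intro]:
  assumes T: "T \<in> bounded_ops V"
  shows "op_scale V c T \<in> bounded_ops V"
proof -
  obtain B where B: "B \<ge> 0" "\<And>v. v \<in> carrier V \<Longrightarrow> hnorm V (T v) \<le> B * hnorm V v"
    using bo_bound[OF T] by blast
  show ?thesis
  proof (rule bounded_opsI[where S = "\<lambda>v. cnj c \<odot> adjoint V T v" and C = "cmod c * B"])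
    fix v assume v: "v \<in> carrier V"
    show "hnorm V (op_scale V c T v) \<le> cmod c * B * hnorm V v"
      using v B(2)[OF v] bo_closed[OF T v] by (simp add: mult.assoc mult_left_mono)
  qed (use T in \<open>auto simp: ip_adjoint_left adjoint_closed bo_closed op_scale_def\<close>)
qed

lemma adjoint_mult:
  "\<lbrakk>S \<in> bounded_ops V; T \<in> bounded_ops V\<rbrakk> \<Longrightarrow>
    adjoint V (op_mult V S T) = op_mult V (adjoint V T) (adjoint V S)"
  by (rule adjointI) (simp_all add: ip_adjoint_right bo_closed adjoint_closed)

lemma op_mult_zero [simp]:
  "T \<in> bounded_ops V \<Longrightarrow> op_mult V T (op_zero V) = op_zero V"
  "T \<in> bounded_ops V \<Longrightarrow> op_mult V (op_zero V) T = op_zero V"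
  by (rule bo_eqI; simp add: bo_closed bo_zero)+

lemma adjoint_add:
  "\<lbrakk>S \<in> bounded_ops V; T \<in> bounded_ops V\<rbrakk> \<Longrightarrow>
    adjoint V (op_add V S T) = op_add V (adjoint V S) (adjoint V T)"
  by (rule adjointI) (simp_all add: ip_adjoint_right bo_closed adjoint_closed)

lemma adjoint_scale:
  "T \<in> bounded_ops V \<Longrightarrow> adjoint V (op_scale V c T) = op_scale V (cnj c) (adjoint V T)"
  by (rule adjointI) (simp_all add: ip_adjoint_right bo_closed adjoint_closed)

lemma op_mult_assoc:
  "\<lbrakk>R \<in> bounded_ops V; S \<in> bounded_ops V; T \<in> bounded_ops V\<rbrakk> \<Longrightarrow>
    op_mult V (op_mult V R S) T = op_mult V R (op_mult V S T)"
  by (rule bo_eqI) (simp_all add: bo_closed)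

text \<open>The supremum of an unbounded set of reals is unspecified, so any estimate read off from
  \<open>op_dist\<close> rests on this.\<close>

lemma op_dist_set:
  assumes S: "S \<in> bounded_ops V" and T: "T \<in> bounded_ops V"
  shows "bdd_above ((\<lambda>v. hdist V (S v) (T v)) ` {v \<in> carrier V. hnorm V v \<le> 1})"
proof -
  obtain A where A: "A \<ge> 0" "\<And>v. v \<in> carrier V \<Longrightarrow> hnorm V (S v) \<le> A * hnorm V v"
    using bo_bound[OF S] by blast
  obtain B where B: "B \<ge> 0" "\<And>v. v \<in> carrier V \<Longrightarrow> hnorm V (T v) \<le> B * hnorm V v"
    using bo_bound[OF T] by blast
  have "hdist V (S v) (T v) \<le> A + B" if v: "v \<in> carrier V" "hnorm V v \<le> 1" for v
  proof -
    have c: "S v \<in> carrier V" "T v \<in> carrier V" using v bo_closed S T by auto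
    have "vsub V (S v) (T v) = S v \<oplus> (-1) \<odot> T v" by (simp add: vsub_def)
    then have "hdist V (S v) (T v) \<le> hnorm V (S v) + hnorm V (T v)"
      using hnorm_triangle[of "S v" "(-1) \<odot> T v"] c by (simp add: hdist_eq)
    also have "\<dots> \<le> A * 1 + B * 1"
      using A(2)[OF v(1)] B(2)[OF v(1)] mult_left_mono[OF v(2) A(1)] mult_left_mono[OF v(2) B(1)] by linarith
    finally show ?thesis by simp
  qed
  then show ?thesis by (intro bdd_aboveI[of _ "A + B"]) auto
qed

text \<open>Rescaling to the unit ball. With \<open>op_dist_le\<close> it converts the norm distance
  of the Roe algebra into the pointwise estimate that all approximation arguments use.\<close>

lemma op_dist_bound:
  assumes S: "S \<in> bounded_ops V" and T: "T \<in> bounded_ops V" and v: "v \<in> carrier V"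
  shows "hnorm V (vsub V (S v) (T v)) \<le> op_dist V S T * hnorm V v"
proof (cases "hnorm V v = 0")
  case True
  then have "v = \<zero>" using hnorm_eq_0 v by blast
  then show ?thesis using S T by (simp add: bo_zero)
next
  case False
  then have p: "hnorm V v > 0" using hnorm_nonneg[OF v] by linarith
  define c where "c = complex_of_real (1 / hnorm V v)"
  have cv: "c \<odot> v \<in> carrier V" "hnorm V (c \<odot> v) \<le> 1" using v p by (auto simp: c_def norm_divide)
  have "hdist V (S (c \<odot> v)) (T (c \<odot> v)) \<le> op_dist V S T"
    unfolding op_dist_def by (rule cSUP_upper) (use cv op_dist_set[OF S T] in auto)
  moreover have "hdist V (S (c \<odot> v)) (T (c \<odot> v)) = hnorm V (vsub V (S v) (T v)) / hnorm V v"
  proof -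
    have cl: "S v \<in> carrier V" "T v \<in> carrier V" using v bo_closed S T by auto
    have "vsub V (c \<odot> S v) (c \<odot> T v) = c \<odot> vsub V (S v) (T v)"
      by (rule ip_eqI) (use cl in \<open>simp_all add: algebra_simps\<close>)
    then show ?thesis using cl v S T p by (simp add: hdist_eq bo_smult c_def norm_divide)
  qed
  ultimately show ?thesis using p by (simp add: field_simps)
qed

lemma op_dist_le:
  assumes S: "S \<in> bounded_ops V" and T: "T \<in> bounded_ops V" and "c \<ge> 0"
    and "\<And>v. v \<in> carrier V \<Longrightarrow> hnorm V (vsub V (S v) (T v)) \<le> c * hnorm V v"
  shows "op_dist V S T \<le> c"
  unfolding op_dist_def
proof (rule cSUP_least)
  show "{v \<in> carrier V. hnorm V v \<le> 1} \<noteq> {}" by (auto intro!: exI[of _ \<zero>])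
  fix v assume v: "v \<in> {v \<in> carrier V. hnorm V v \<le> 1}"
  then have "hnorm V (vsub V (S v) (T v)) \<le> c * hnorm V v" using assms by blast
  also have "\<dots> \<le> c * 1" using v assms by (intro mult_left_mono) auto
  finally show "hdist V (S v) (T v) \<le> c" using v S T by (simp add: hdist_eq bo_closed)
qed

subsection \<open>Compact operators\<close>

lemma compact_opI:
  assumes T: "T \<in> bounded_ops V"
    and "\<And>s C. (\<And>n::nat. s n \<in> carrier V \<and> hnorm V (s n) \<le> C) \<Longrightarrow>
      \<exists>r. \<exists>l\<in>carrier V. strict_mono r \<and> (\<lambda>n. hnorm V (vsub V (T (s (r n))) l)) \<longlonglongrightarrow> 0"
  shows "compact_op V T"
  unfolding compact_op_def
proof (intro conjI allI impI)
  fix s and C :: real assume s: "\<forall>n::nat. s n \<in> carrier V \<and> hnorm V (s n) \<le> C"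
  then obtain r l where rl: "l \<in> carrier V" "strict_mono r"
      "(\<lambda>n. hnorm V (vsub V (T (s (r n))) l)) \<longlonglongrightarrow> 0"
    using assms(2)[of s C] by blast
  have "hdist V (T (s (r n))) l = hnorm V (vsub V (T (s (r n))) l)" for n
    using s rl(1) bo_closed[OF T] by (intro hdist_eq) auto
  then show "\<exists>r. \<exists>l\<in>carrier V. strict_mono r \<and> (\<lambda>n. hdist V (T (s (r n))) l) \<longlonglongrightarrow> 0"
    using rl by (intro exI[of _ r] bexI[of _ l]) auto
qed (rule T)

lemma compact_opD:
  assumes "compact_op V T" "\<And>n::nat. s n \<in> carrier V" "\<And>n. hnorm V (s n) \<le> C"
  obtains r l where "l \<in> carrier V" "strict_mono r" 
    "(\<lambda>n. hnorm V (vsub V (T (s (r n))) l)) \<longlonglongrightarrow> 0"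
proof -
  have T: "T \<in> bounded_ops V" using assms by (simp add: compact_op_def)
  obtain r l where rl: "l \<in> carrier V" "strict_mono r" "(\<lambda>n. hdist V (T (s (r n))) l) \<longlonglongrightarrow> 0"
    using assms unfolding compact_op_def by blast
  have "hdist V (T (s (r n))) l = hnorm V (vsub V (T (s (r n))) l)" for n
    using assms(2) rl(1) bo_closed[OF T] by (intro hdist_eq) auto
  then show ?thesis using that rl by simp
qed

lemma compact_op_bounded: "compact_op V T \<Longrightarrow> T \<in> bounded_ops V"
  by (simp add: compact_op_def)

lemma tendsto_hnorm_image:
  assumes T: "T \<in> bounded_ops V" and s: "\<And>n. s n \<in> carrier V" and l: "l \<in> carrier V"
    and lim: "(\<lambda>n::nat. hnorm V (vsub V (s n) l)) \<longlonglongrightarrow> 0"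
  shows "(\<lambda>n. hnorm V (vsub V (T (s n)) (T l))) \<longlonglongrightarrow> 0"
proof -
  obtain A where A: "A \<ge> 0" "\<And>v. v \<in> carrier V \<Longrightarrow> hnorm V (T v) \<le> A * hnorm V v"
    using bo_bound[OF T] by blast
  show ?thesis
  proof (rule Lim_null_comparison)
    show "(\<lambda>n. A * hnorm V (vsub V (s n) l)) \<longlonglongrightarrow> 0"
      using tendsto_mult_right_zero[OF lim] by simp
    show "\<forall>\<^sub>F n in sequentially. norm (hnorm V (vsub V (T (s n)) (T l))) \<le> A * hnorm V (vsub V (s n) l)"
      using A(2)[of "vsub V (s _) l"] s l T by (simp add: bo_vsub bo_closed)
  qed
qed

lemma compact_op_mult_left:
  assumes K: "compact_op V K" and T: "T \<in> bounded_ops V"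
  shows "compact_op V (op_mult V T K)"
proof (rule compact_opI)
  show "op_mult V T K \<in> bounded_ops V" using K T by (simp add: compact_op_bounded)
  fix s and C :: real assume s: "\<And>n::nat. s n \<in> carrier V \<and> hnorm V (s n) \<le> C"
  then obtain r l where rl: "l \<in> carrier V" "strict_mono r"
      "(\<lambda>n. hnorm V (vsub V (K (s (r n))) l)) \<longlonglongrightarrow> 0"
    using compact_opD[OF K, of s C] by blast
  have "(\<lambda>n. hnorm V (vsub V (T (K (s (r n)))) (T l))) \<longlonglongrightarrow> 0"
    using s rl bo_closed[OF compact_op_bounded[OF K]] by (intro tendsto_hnorm_image[OF T]) auto
  then show "\<exists>r. \<exists>l\<in>carrier V. strict_mono r \<and> (\<lambda>n. hnorm V (vsub V (op_mult V T K (s (r n))) l)) \<longlonglongrightarrow> 0"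
    using rl s bo_closed[OF T] by (intro exI[of _ r] bexI[of _ "T l"]) auto
qed

lemma compact_op_mult_right:
  assumes K: "compact_op V K" and T: "T \<in> bounded_ops V"
  shows "compact_op V (op_mult V K T)"
proof (rule compact_opI)
  show "op_mult V K T \<in> bounded_ops V" using K T by (simp add: compact_op_bounded)
  fix s and C :: real assume s: "\<And>n::nat. s n \<in> carrier V \<and> hnorm V (s n) \<le> C"
  obtain A where A: "A \<ge> 0" "\<And>v. v \<in> carrier V \<Longrightarrow> hnorm V (T v) \<le> A * hnorm V v"
    using bo_bound[OF T] by blast
  have Tc: "T (s n) \<in> carrier V" for n using s bo_closed[OF T] by blast
  have TC: "hnorm V (T (s n)) \<le> A * C" for n
    using A(2)[of "s n"] s[of n] mult_left_mono[of "hnorm V (s n)" C A] A(1) by linarith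
  obtain r l where rl: "l \<in> carrier V" "strict_mono r"
      "(\<lambda>n. hnorm V (vsub V (K (T (s (r n)))) l)) \<longlonglongrightarrow> 0"
    using compact_opD[OF K, of "\<lambda>n. T (s n)" "A * C", OF Tc TC] by blast
  then show "\<exists>r. \<exists>l\<in>carrier V. strict_mono r \<and> (\<lambda>n. hnorm V (vsub V (op_mult V K T (s (r n))) l)) \<longlonglongrightarrow> 0"
    using s by (intro exI[of _ r] bexI[of _ l]) auto
qed

lemma compact_op_zero [simp, intro]: "compact_op V (op_zero V)"
  by (rule compact_opI) (auto intro!: exI[of _ id] bexI[of _ \<zero>] simp: strict_mono_def)

lemma compact_op_add:
  assumes K: "compact_op V K" and L: "compact_op V L"
  shows "compact_op V (op_add V K L)"
proof (rule compact_opI)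
  have Kb: "K \<in> bounded_ops V" and Lb: "L \<in> bounded_ops V" using K L by (simp_all add: compact_op_bounded)
  then show "op_add V K L \<in> bounded_ops V" by simp
  fix s and C :: real assume s: "\<And>n::nat. s n \<in> carrier V \<and> hnorm V (s n) \<le> C"
  then obtain r l where rl: "l \<in> carrier V" "strict_mono r"
      "(\<lambda>n. hnorm V (vsub V (K (s (r n))) l)) \<longlonglongrightarrow> 0"
    using compact_opD[OF K, of s C] by blast
  from s obtain q k where qk: "k \<in> carrier V" "strict_mono q"
      "(\<lambda>n. hnorm V (vsub V (L (s (r (q n)))) k)) \<longlonglongrightarrow> 0"
    using compact_opD[OF L, of "\<lambda>n. s (r n)" C] by blast
  have 1: "(\<lambda>n. hnorm V (vsub V (K (s (r (q n)))) l)) \<longlonglongrightarrow> 0"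
    using LIMSEQ_subseq_LIMSEQ[OF rl(3) qk(2)] by (simp add: o_def)
  have "(\<lambda>n. hnorm V (vsub V (op_add V K L (s (r (q n)))) (l \<oplus> k))) \<longlonglongrightarrow> 0"
  proof (rule Lim_null_comparison)
    show "(\<lambda>n. hnorm V (vsub V (K (s (r (q n)))) l) + hnorm V (vsub V (L (s (r (q n)))) k)) \<longlonglongrightarrow> 0"
      using tendsto_add[OF 1 qk(3)] by simp
    show "\<forall>\<^sub>F n in sequentially. norm (hnorm V (vsub V (op_add V K L (s (r (q n)))) (l \<oplus> k)))
        \<le> hnorm V (vsub V (K (s (r (q n)))) l) + hnorm V (vsub V (L (s (r (q n)))) k)"
    proof (intro always_eventually allI)
      fix n
      define x where "x = s (r (q n))"
      have x: "x \<in> carrier V" using s by (simp add: x_def)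
      have cl: "K x \<in> carrier V" "L x \<in> carrier V" using x bo_closed Kb Lb by auto
      have "vsub V (K x \<oplus> L x) (l \<oplus> k) = vsub V (K x) l \<oplus> vsub V (L x) k"
        by (rule ip_eqI) (use cl rl qk in simp_all)
      then show "norm (hnorm V (vsub V (op_add V K L (s (r (q n)))) (l \<oplus> k)))
        \<le> hnorm V (vsub V (K (s (r (q n)))) l) + hnorm V (vsub V (L (s (r (q n)))) k)"
        using hnorm_triangle[of "vsub V (K x) l" "vsub V (L x) k"] cl rl qk x
        by (simp add: x_def[symmetric])
    qed
  qed
  then show "\<exists>r. \<exists>l\<in>carrier V. strict_mono r \<and> (\<lambda>n. hnorm V (vsub V (op_add V K L (s (r n))) l)) \<longlonglongrightarrow> 0"
    using rl qk by (intro exI[of _ "r \<circ> q"] bexI[of _ "l \<oplus> k"]) (auto simp: strict_mono_o)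
qed

text \<open>\<open>\<parallel>T* x\<parallel>\<^sup>2 = \<langle>x, T T* x\<rangle>\<close>, so a subsequence along which \<open>T T*\<close> converges makes \<open>T*\<close> Cauchy.\<close>

lemma compact_op_adjoint:
  assumes K: "compact_op V K"
  shows "compact_op V (adjoint V K)"
proof (rule compact_opI)
  have Kb: "K \<in> bounded_ops V" using K by (simp add: compact_op_bounded)
  then show "adjoint V K \<in> bounded_ops V" by simp
  let ?T = "op_mult V K (adjoint V K)"
  have T: "compact_op V ?T" using K Kb by (simp add: compact_op_mult_right)
  fix s and C :: real assume s: "\<And>n::nat. s n \<in> carrier V \<and> hnorm V (s n) \<le> C"
  have C0: "C \<ge> 0" using s[of 0] hnorm_nonneg[of "s 0"] by linarith
  from s obtain r l where rl: "l \<in> carrier V" "strict_mono r"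
      "(\<lambda>n. hnorm V (vsub V (?T (s (r n))) l)) \<longlonglongrightarrow> 0"
    using compact_opD[OF T, of s C] by blast
  define t where "t n = adjoint V K (s (r n))" for n
  have tc: "t n \<in> carrier V" for n using s Kb by (simp add: t_def adjoint_closed)
  have "\<exists>l\<in>carrier V. (\<lambda>n::nat. hnorm V (vsub V (t n) l)) \<longlonglongrightarrow> 0"
  proof (rule complete[OF tc])
    fix \<epsilon> :: real assume e: "\<epsilon> > 0"
    \<comment> \<open>Makes \<open>2 C * 2 \<delta>\<close> equal to
      \<open>\<epsilon>^2 * C / (C + 1)\<close>, strictly below \<open>\<epsilon>^2\<close>; the
      added 1 covers \<open>C = 0\<close>.\<close>
    define \<delta> where "\<delta> = \<epsilon>\<^sup>2 / (4 * (C + 1))"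
    have d: "\<delta> > 0" using e C0 by (simp add: \<delta>_def)
    from LIMSEQ_null_less[OF rl(3) d] obtain N where N: "\<And>n. n \<ge> N \<Longrightarrow> hnorm V (vsub V (?T (s (r n))) l) < \<delta>" by blast
    have "hnorm V (vsub V (t i) (t j)) < \<epsilon>" if "i \<ge> N" "j \<ge> N" for i j
    proof -
      define x where "x = s (r i)"
      define y where "y = s (r j)"
      have xy: "x \<in> carrier V" "y \<in> carrier V" "hnorm V x \<le> C" "hnorm V y \<le> C"
        using s by (auto simp: x_def y_def)
      define z where "z = vsub V x y"
      have z: "z \<in> carrier V" using xy by (simp add: z_def)
      have Tb: "?T \<in> bounded_ops V" using Kb by simp
      have zn: "hnorm V z \<le> 2 * C"
        using hnorm_triangle[of x "(-1) \<odot> y"] xy by (simp add: z_def vsub_def)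
      have tz: "vsub V (t i) (t j) = adjoint V K z"
        using xy Kb by (simp add: t_def z_def x_def[symmetric] y_def[symmetric] bo_vsub)
      have "(hnorm V (adjoint V K z))\<^sup>2 = Re (ip V z (?T z))"
        using z Kb by (simp add: hnorm_sq adjoint_closed ip_adjoint_left)
      also have "\<dots> \<le> hnorm V z * hnorm V (?T z)"
        using cauchy_schwarz[of z "?T z"] complex_Re_le_cmod[of "ip V z (?T z)"] z bo_closed[OF Tb z] by linarith
      also have "\<dots> \<le> (2 * C) * hnorm V (?T z)"
        by (rule mult_right_mono[OF zn]) (use bo_closed[OF Tb z] in simp)
      also have "\<dots> \<le> (2 * C) * (2 * \<delta>)"
      proof (rule mult_left_mono)
        have e: "?T z = vsub V (?T x) (?T y)" unfolding z_def by (rule bo_vsub[OF Tb xy(1,2)])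
        have 1: "hnorm V (vsub V (?T x) (?T y)) \<le> hnorm V (vsub V (?T x) l) + hnorm V (vsub V l (?T y))"
          by (rule hnorm_vsub_triangle) (use bo_closed[OF Tb] xy rl in auto)
        have 2: "hnorm V (vsub V l (?T y)) = hnorm V (vsub V (?T y) l)"
          by (rule hnorm_vsub_commute) (use bo_closed[OF Tb] xy rl in auto)
        show "hnorm V (?T z) \<le> 2 * \<delta>"
          unfolding e using N[OF that(1)] N[OF that(2)] 1 2 unfolding x_def y_def by linarith
      qed (use C0 in simp)
      also have "\<dots> < \<epsilon>\<^sup>2"
      proof -
        have "2 * C * (2 * \<delta>) = \<epsilon>\<^sup>2 * (C / (C + 1))" using C0 by (simp add: \<delta>_def field_simps)
        also have "\<dots> < \<epsilon>\<^sup>2 * 1" using e C0 by (intro mult_strict_left_mono) (auto simp: field_simps)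
        finally show ?thesis by simp
      qed
      finally show ?thesis using e by (simp add: tz power2_less_imp_less)
    qed
    then show "\<exists>N. \<forall>i\<ge>N. \<forall>j\<ge>N. hnorm V (vsub V (t i) (t j)) < \<epsilon>" by blast
  qed
  then show "\<exists>r. \<exists>l\<in>carrier V. strict_mono r \<and> (\<lambda>n. hnorm V (vsub V (adjoint V K (s (r n))) l)) \<longlonglongrightarrow> 0"
    using rl by (auto simp: t_def)
qed

text \<open>By completeness, convergent subsequences and Cauchy subsequences are the same thing.
  Total boundedness allows finite nets in place of a diagonal sequence when norm limits are
  taken.\<close>

lemma compact_op_iff_totally_bounded:
  assumes T: "T \<in> bounded_ops V"
  shows "compact_op V T \<longleftrightarrow> (\<forall>C. MS.mtotally_bounded (T ` {v \<in> carrier V. hnorm V v \<le> C}))"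
proof safe
  fix C assume K: "compact_op V T"
  show "MS.mtotally_bounded (T ` {v \<in> carrier V. hnorm V v \<le> C})"
    unfolding MS.mtotally_bounded_sequentially
  proof (intro conjI allI impI)
    show "T ` {v \<in> carrier V. hnorm V v \<le> C} \<subseteq> carrier V" using bo_closed[OF T] by auto
    fix \<sigma> :: "nat \<Rightarrow> 'v" assume "range \<sigma> \<subseteq> T ` {v \<in> carrier V. hnorm V v \<le> C}"
    then have "\<forall>n. \<exists>v. v \<in> carrier V \<and> hnorm V v \<le> C \<and> \<sigma> n = T v" by blast
    then obtain s where s: "\<And>n. s n \<in> carrier V" "\<And>n. hnorm V (s n) \<le> C" "\<And>n. \<sigma> n = T (s n)" by metis
    obtain r l where rl: "l \<in> carrier V" "strict_mono r"
      "(\<lambda>n. hnorm V (vsub V (T (s (r n))) l)) \<longlonglongrightarrow> 0" using compact_opD[OF K s(1,2)] .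
    have sc: "\<sigma> n \<in> carrier V" for n using s bo_closed[OF T] by simp
    have "MS.MCauchy (\<sigma> \<circ> r)"
      unfolding MS.MCauchy_def
    proof (intro conjI allI impI)
      show "range (\<sigma> \<circ> r) \<subseteq> carrier V" using sc by auto
      fix \<epsilon> :: real assume e: "\<epsilon> > 0"
      then have "\<epsilon> / 2 > 0" by simp
      from LIMSEQ_null_less[OF rl(3) this] obtain N where N: "\<And>n. n \<ge> N \<Longrightarrow> hnorm V (vsub V (\<sigma> (r n)) l) < \<epsilon> / 2"
        unfolding s(3) by blast
      have "hnorm V (vsub V (\<sigma> (r i)) (\<sigma> (r j))) < \<epsilon>" if "N \<le> i" "N \<le> j" for i j
        using N[OF that(1)] N[OF that(2)] hnorm_vsub_triangle[OF sc rl(1) sc, of "r i" "r j"]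
          hnorm_vsub_commute[OF rl(1) sc, of "r j"] by linarith
      then show "\<exists>N. \<forall>n n'. N \<le> n \<longrightarrow> N \<le> n' \<longrightarrow> (if (\<sigma> \<circ> r) n \<in> carrier V \<and> (\<sigma> \<circ> r) n' \<in> carrier V
        then hnorm V (vsub V ((\<sigma> \<circ> r) n) ((\<sigma> \<circ> r) n')) else 0) < \<epsilon>"
        using sc by auto
    qed
    then show "\<exists>r. strict_mono r \<and> MS.MCauchy (\<sigma> \<circ> r)" using rl by blast
  qed
next
  assume tb: "\<forall>C. MS.mtotally_bounded (T ` {v \<in> carrier V. hnorm V v \<le> C})"
  show "compact_op V T"
  proof (rule compact_opI[OF T])
    fix s and C :: real assume s: "\<And>n::nat. s n \<in> carrier V \<and> hnorm V (s n) \<le> C"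
    have "range (\<lambda>n. T (s n)) \<subseteq> T ` {v \<in> carrier V. hnorm V v \<le> C}" using s by auto
    then obtain r where r: "strict_mono r" "MS.MCauchy ((\<lambda>n. T (s n)) \<circ> r)"
      using tb unfolding MS.mtotally_bounded_sequentially by blast
    have sc: "T (s n) \<in> carrier V" for n using s bo_closed[OF T] by simp
    have "\<exists>l\<in>carrier V. (\<lambda>n. hnorm V (vsub V (T (s (r n))) l)) \<longlonglongrightarrow> 0"
    proof (rule complete[OF sc])
      fix \<epsilon> :: real assume "\<epsilon> > 0"
      then show "\<exists>N. \<forall>i\<ge>N. \<forall>j\<ge>N. hnorm V (vsub V (T (s (r i))) (T (s (r j)))) < \<epsilon>"
        using r(2) sc unfolding MS.MCauchy_def by (simp add: o_def)
    qed
    then show "\<exists>r. \<exists>l\<in>carrier V. strict_mono r \<and> (\<lambda>n. hnorm V (vsub V (T (s (r n))) l)) \<longlonglongrightarrow> 0"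
      using r by blast
  qed
qed

text \<open>Take a finite net of the image of a ball under a close compact \<open>K\<close>, and
  choose preimages of its centres in the ball. The images of these preimages under \<open>T\<close>
  form a net again: passing from \<open>T g\<close> to \<open>K g\<close> to \<open>K v\<close> to
  \<open>T v\<close> costs three quarters of \<open>\<epsilon>\<close>.\<close>

lemma compact_op_limit:
  assumes T: "T \<in> bounded_ops V"
    and lim: "\<And>\<epsilon>. \<epsilon> > 0 \<Longrightarrow> \<exists>K. compact_op V K \<and>
      (\<forall>v\<in>carrier V. hnorm V (vsub V (T v) (K v)) \<le> \<epsilon> * hnorm V v)"
  shows "compact_op V T"
  unfolding compact_op_iff_totally_bounded[OF T] MS.mtotally_bounded_def
proof (intro allI impI)
  fix C \<epsilon> :: real assume e: "\<epsilon> > 0"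
  define B where "B = {v \<in> carrier V. hnorm V v \<le> C}"
  \<comment> \<open>Here \<open>C\<close> is an arbitrary real, possibly negative;
    \<open>\<bar>C\<bar> + 1\<close> is a positive bound for the norms in the ball.\<close>
  define \<delta> where "\<delta> = \<epsilon> / (4 * (\<bar>C\<bar> + 1))"
  have d: "\<delta> > 0" using e by (simp add: \<delta>_def)
  have dC: "\<delta> * (\<bar>C\<bar> + 1) = \<epsilon> / 4" by (simp add: \<delta>_def field_simps)
  obtain K where K: "compact_op V K" "\<And>v. v \<in> carrier V \<Longrightarrow> hnorm V (vsub V (T v) (K v)) \<le> \<delta> * hnorm V v"
    using lim[OF d] by blast
  have Kb: "K \<in> bounded_ops V" using K compact_op_bounded by blast
  have TK: "hnorm V (vsub V (T v) (K v)) \<le> \<epsilon> / 4" if "v \<in> B" for v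
  proof -
    have v: "v \<in> carrier V" "hnorm V v \<le> \<bar>C\<bar> + 1" using that by (auto simp: B_def)
    have "hnorm V (vsub V (T v) (K v)) \<le> \<delta> * hnorm V v" using K v by blast
    also have "\<dots> \<le> \<delta> * (\<bar>C\<bar> + 1)" using v d by (intro mult_left_mono) auto
    finally show ?thesis unfolding dC .
  qed
  have "MS.mtotally_bounded (K ` B)" using K(1) compact_op_iff_totally_bounded[OF Kb] by (simp add: B_def)
  then obtain F where F: "finite F" "F \<subseteq> K ` B" "K ` B \<subseteq> (\<Union>x\<in>F. MS.mball x (\<epsilon> / 4))"
    unfolding MS.mtotally_bounded_def using e by (meson zero_less_divide_iff zero_less_numeral)
  from F(1,2) obtain G where G: "G \<subseteq> B" "finite G" "F = K ` G" by (meson finite_subset_image)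
  have "T ` B \<subseteq> (\<Union>x\<in>T ` G. MS.mball x \<epsilon>)"
  proof safe
    fix v assume v: "v \<in> B"
    then have "K v \<in> (\<Union>x\<in>F. MS.mball x (\<epsilon> / 4))" using F(3) by blast
    then obtain g where g: "g \<in> G" "K v \<in> MS.mball (K g) (\<epsilon> / 4)" unfolding G(3) by blast
    have gB: "g \<in> B" using g G by auto
    have c: "v \<in> carrier V" "g \<in> carrier V" using v gB by (auto simp: B_def)
    have cl: "T v \<in> carrier V" "T g \<in> carrier V" "K v \<in> carrier V" "K g \<in> carrier V"
      using c bo_closed T Kb by auto
    have "hnorm V (vsub V (K g) (K v)) < \<epsilon> / 4" using g cl by (simp add: MS.mball_def)
    moreover have "hnorm V (vsub V (T g) (T v)) \<le> hnorm V (vsub V (T g) (K g)) + hnorm V (vsub V (K g) (T v))"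
      using cl by (intro hnorm_vsub_triangle)
    moreover have "hnorm V (vsub V (K g) (T v)) \<le> hnorm V (vsub V (K g) (K v)) + hnorm V (vsub V (K v) (T v))"
      using cl by (intro hnorm_vsub_triangle)
    moreover have "hnorm V (vsub V (K v) (T v)) = hnorm V (vsub V (T v) (K v))"
      using cl by (intro hnorm_vsub_commute)
    ultimately have "hnorm V (vsub V (T g) (T v)) < \<epsilon>" using TK[OF v] TK[OF gB] e by linarith
    then show "T v \<in> (\<Union>x\<in>T ` G. MS.mball x \<epsilon>)" using g(1) cl by (auto simp: MS.mball_def)
  qed
  then show "\<exists>F. finite F \<and> F \<subseteq> T ` {v \<in> carrier V. hnorm V v \<le> C} \<and>
      T ` {v \<in> carrier V. hnorm V v \<le> C} \<subseteq> (\<Union>x\<in>F. MS.mball x \<epsilon>)"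
    using G by (intro exI[of _ "T ` G"]) (auto simp: B_def)
qed

text \<open>The scalars \<open><a, s n>\<close> are bounded, so Bolzano--Weierstrass in the complex
  plane yields the convergent subsequence.\<close>

lemma compact_op_rank_one:
  assumes a: "a \<in> carrier V" and b: "b \<in> carrier V"
  shows "compact_op V (\<lambda>v\<in>carrier V. ip V a v \<odot> b)"
proof (rule compact_opI)
  show "(\<lambda>v\<in>carrier V. ip V a v \<odot> b) \<in> bounded_ops V"
  proof (rule bounded_opsI[where S = "\<lambda>v. ip V b v \<odot> a" and C = "hnorm V a * hnorm V b"])
    fix u v assume "u \<in> carrier V" "v \<in> carrier V"
    then show "ip V u ((\<lambda>v\<in>carrier V. ip V a v \<odot> b) v) = ip V (ip V b u \<odot> a) v"
      using a b ip_cnj[of u b] by (simp add: mult.commute)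
  next
    fix v assume v: "v \<in> carrier V"
    then show "hnorm V ((\<lambda>v\<in>carrier V. ip V a v \<odot> b) v) \<le> hnorm V a * hnorm V b * hnorm V v"
      using a b cauchy_schwarz[OF a v] mult_right_mono[of "cmod (ip V a v)" "hnorm V a * hnorm V v" "hnorm V b"]
      by (simp add: mult_ac)
  qed (use a b in auto)
  fix s and C :: real assume s: "\<And>n::nat. s n \<in> carrier V \<and> hnorm V (s n) \<le> C"
  have "cmod (ip V a (s n)) \<le> hnorm V a * C" for n
    using cauchy_schwarz[of a "s n"] a s[of n] mult_left_mono[of "hnorm V (s n)" C "hnorm V a"] by auto
  then have "bounded (range (\<lambda>n. ip V a (s n)))" by (intro boundedI[of _ "hnorm V a * C"]) auto
  then obtain c r where r: "strict_mono r" "((\<lambda>n. ip V a (s n)) \<circ> r) \<longlonglongrightarrow> c"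
    using bounded_imp_convergent_subsequence by blast
  have "(\<lambda>n. hnorm V (vsub V ((\<lambda>v\<in>carrier V. ip V a v \<odot> b) (s (r n))) (c \<odot> b))) \<longlonglongrightarrow> 0"
  proof -
    have "vsub V (x \<odot> b) (c \<odot> b) = (x - c) \<odot> b" for x
      by (rule ip_eqI) (use b in \<open>simp_all add: algebra_simps\<close>)
    then have "hnorm V (vsub V ((\<lambda>v\<in>carrier V. ip V a v \<odot> b) (s (r n))) (c \<odot> b)) =
        cmod (ip V a (s (r n)) - c) * hnorm V b" for n
      using s b by simp
    moreover have "(\<lambda>n. cmod (ip V a (s (r n)) - c) * hnorm V b) \<longlonglongrightarrow> 0"
      using tendsto_mult_left_zero[OF tendsto_norm_zero[OF LIM_zero[OF r(2)]]] by (simp add: o_def)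
    ultimately show ?thesis by simp
  qed
  then show "\<exists>r. \<exists>l\<in>carrier V. strict_mono r \<and>
      (\<lambda>n. hnorm V (vsub V ((\<lambda>v\<in>carrier V. ip V a v \<odot> b) (s (r n))) l)) \<longlonglongrightarrow> 0"
    using r(1) b by blast
qed

text \<open>The decomposition is tested weakly, so it is a sum of complex numbers and no
  operator-valued sum over \<open>F\<close> has to be formed.\<close>

lemma compact_op_finite_sum:
  assumes F: "finite F" and K: "\<And>i. i \<in> F \<Longrightarrow> compact_op V (K i)"
    and T: "T \<in> bounded_ops V"
    and TK: "\<And>u v. \<lbrakk>u \<in> carrier V; v \<in> carrier V\<rbrakk> \<Longrightarrow> ip V u (T v) = (\<Sum>i\<in>F. ip V u (K i v))"
  shows "compact_op V T"
proof -
  have "\<exists>S. compact_op V S \<and> (\<forall>u\<in>carrier V. \<forall>v\<in>carrier V. ip V u (S v) = (\<Sum>i\<in>F. ip V u (K i v)))"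
    using F K
  proof (induction F)
    case empty
    show ?case by (rule exI[of _ "op_zero V"]) simp
  next
    case (insert i F)
    then obtain S where S: "compact_op V S"
        "\<And>u v. \<lbrakk>u \<in> carrier V; v \<in> carrier V\<rbrakk> \<Longrightarrow> ip V u (S v) = (\<Sum>i\<in>F. ip V u (K i v))" by blast
    have Ki: "compact_op V (K i)" using insert by simp
    show ?case
      using insert S compact_op_add[OF Ki S(1)] bo_closed[OF compact_op_bounded[OF Ki]]
        bo_closed[OF compact_op_bounded[OF S(1)]]
      by (intro exI[of _ "op_add V (K i) S"]) auto
  qed
  then obtain S where S: "compact_op V S"
    "\<And>u v. \<lbrakk>u \<in> carrier V; v \<in> carrier V\<rbrakk> \<Longrightarrow> ip V u (S v) = (\<Sum>i\<in>F. ip V u (K i v))" by blast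
  have "T = S" by (rule bo_eqI[OF T compact_op_bounded[OF S(1)]]) (simp add: TK S(2))
  then show ?thesis using S by simp
qed

end

subsection \<open>Orthonormal families\<close>

text \<open>A family rather than a set, because one index set will run through families in two
  different spaces.\<close>

definition onf :: "('v, 'z) ip_space_scheme \<Rightarrow> 'i set \<Rightarrow> ('i \<Rightarrow> 'v) \<Rightarrow> bool"
  where "onf V I a \<longleftrightarrow> (\<forall>i\<in>I. a i \<in> carrier V) \<and>
    (\<forall>i\<in>I. \<forall>j\<in>I. ip V (a i) (a j) = (if i = j then 1 else 0))"

lemma onf_closed: "onf V I a \<Longrightarrow> i \<in> I \<Longrightarrow> a i \<in> carrier V"
  by (simp add: onf_def)

lemma onf_ip: "onf V I a \<Longrightarrow> i \<in> I \<Longrightarrow> j \<in> I \<Longrightarrow> ip V (a i) (a j) = (if i = j then 1 else 0)"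
  by (simp add: onf_def)

lemma onf_subset: "onf V I a \<Longrightarrow> J \<subseteq> I \<Longrightarrow> onf V J a"
  unfolding onf_def by blast

lemma onf_reindex: "\<lbrakk>onf V I a; inj_on f J; f ` J \<subseteq> I\<rbrakk> \<Longrightarrow> onf V J (\<lambda>j. a (f j))"
  unfolding onf_def by (auto simp: inj_on_def image_subset_iff)

lemma infsum_single:
  fixes f :: "'i \<Rightarrow> 'b::{comm_monoid_add, t2_space}"
  assumes "\<And>j. j \<in> I \<Longrightarrow> j \<noteq> i \<Longrightarrow> f j = 0"
  shows "infsum f I = (if i \<in> I then f i else 0)"
proof -
  have "infsum f I = infsum f (I \<inter> {i})"
    by (rule infsum_cong_neutral) (use assms in auto)
  then show ?thesis by auto
qed

context hilb
begin

text \<open>Subtracting the component along the new vector leaves the remaining coefficients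
  unchanged and lowers the squared norm by exactly the square of the removed coefficient.\<close>

lemma bessel:
  assumes a: "onf V I a" and F: "finite F" "F \<subseteq> I" and v: "v \<in> carrier V"
  shows "(\<Sum>i\<in>F. (cmod (ip V (a i) v))\<^sup>2) \<le> (hnorm V v)\<^sup>2"
  using F v
proof (induction F arbitrary: v)
  case (insert j F)
  have j: "j \<in> I" and aj: "a j \<in> carrier V" using insert.prems a onf_closed by auto
  define c where "c = ip V (a j) v"
  define v' where "v' = vsub V v (c \<odot> a j)"
  have v': "v' \<in> carrier V" using insert.prems aj by (simp add: v'_def)
  have "ip V (a i) v' = ip V (a i) v" if "i \<in> F" for i
  proof -
    have i: "i \<in> I" "i \<noteq> j" using that insert.prems insert.hyps by auto
    have ai: "a i \<in> carrier V" by (rule onf_closed[OF a i(1)])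
    show ?thesis using onf_ip[OF a i(1) j] insert.prems aj ai i by (simp add: v'_def)
  qed
  then have "(\<Sum>i\<in>F. (cmod (ip V (a i) v))\<^sup>2) \<le> (hnorm V v')\<^sup>2"
    using insert.IH[of v'] insert.prems v' by simp
  moreover have "(hnorm V v')\<^sup>2 = (hnorm V v)\<^sup>2 - (cmod c)\<^sup>2"
  proof -
    have jj: "ip V (a j) (a j) = 1" using onf_ip[OF a j j] by simp
    have jv: "ip V v (a j) = cnj c" unfolding c_def using insert.prems aj by (intro ip_cnj) auto
    have "ip V v' v' = ip V v v - c * cnj c"
      unfolding v'_def using insert.prems aj by (simp add: jj jv c_def[symmetric] algebra_simps)
    then have "Re (ip V v' v') = Re (ip V v v) - (cmod c)\<^sup>2" by (simp add: complex_mult_cnj cmod_def)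
    then show ?thesis using v' insert.prems by (simp add: hnorm_sq)
  qed
  ultimately show ?case using insert.hyps by (simp add: c_def)
qed simp

text \<open>Weak convergence of an orthonormal sequence to 0: by Bessel the squared coefficients
  form a convergent series.\<close>

lemma onf_tendsto_0:
  assumes a: "onf V (UNIV::nat set) a" and v: "v \<in> carrier V"
  shows "(\<lambda>n. ip V v (a n)) \<longlonglongrightarrow> 0"
proof -
  have "summable (\<lambda>n. (cmod (ip V (a n) v))\<^sup>2)"
  proof (rule summableI_nonneg_bounded)
    show "(\<Sum>i<n. (cmod (ip V (a i) v))\<^sup>2) \<le> (hnorm V v)\<^sup>2" for n
      by (rule bessel[OF a]) (use v in auto)
  qed simp
  then have "(\<lambda>n. (cmod (ip V (a n) v))\<^sup>2) \<longlonglongrightarrow> 0" by (rule summable_LIMSEQ_zero)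
  from tendsto_real_sqrt[OF this] have "(\<lambda>n. cmod (ip V (a n) v)) \<longlonglongrightarrow> 0" by simp
  from tendsto_cnj[OF tendsto_norm_zero_cancel[OF this]]
  have "(\<lambda>n. cnj (ip V (a n) v)) \<longlonglongrightarrow> 0" by simp
  moreover have "cnj (ip V (a n) v) = ip V v (a n)" for n
    using ip_cnj[of v "a n"] v onf_closed[OF a] by simp
  ultimately show ?thesis by simp
qed

end

text \<open>The partial isometry \<open>v |-> sum of <a i, v> b i\<close>, carrying
  \<open>a i\<close> to \<open>b i\<close> and vanishing on the complement; for \<open>a = b\<close>
  it is the projection onto the closed span. The value is pinned down by its inner products, which
  are absolutely convergent scalar series.\<close>

definition frame ::
    "('v, 'y) ip_space_scheme \<Rightarrow> ('w, 'z) ip_space_scheme \<Rightarrow> 'i set \<Rightarrow> ('i \<Rightarrow> 'v) \<Rightarrow> ('i \<Rightarrow> 'w) \<Rightarrow> 'v \<Rightarrow> 'w"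
  where "frame V W I a b = (\<lambda>v\<in>carrier V. SOME z. z \<in> carrier W \<and>
    (\<forall>w\<in>carrier W. ip W w z = (\<Sum>\<^sub>\<infinity>i\<in>I. ip V (a i) v * ip W w (b i))))"

locale hilb_pair = V: hilb V + W: hilb W
  for V :: "('v, 'y) ip_space_scheme" and W :: "('w, 'z) ip_space_scheme" +
  fixes I :: "'i set" and a :: "'i \<Rightarrow> 'v" and b :: "'i \<Rightarrow> 'w"
  assumes a: "onf V I a" and b: "onf W I b"
begin

text \<open>Cauchy--Schwarz for finite sums, followed by Bessel for each of the two families. The
  bound does not depend on \<open>F\<close>, which gives summability over any index set.\<close>

lemma finite_sum_bound:
  assumes F: "finite F" "F \<subseteq> I" and v: "v \<in> carrier V" and w: "w \<in> carrier W"
  shows "(\<Sum>i\<in>F. cmod (ip V (a i) v * ip W w (b i))) \<le> hnorm V v * hnorm W w"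
proof -
  have "(\<Sum>i\<in>F. cmod (ip V (a i) v * ip W w (b i))) =
      (\<Sum>i\<in>F. \<bar>cmod (ip V (a i) v)\<bar> * \<bar>cmod (ip W (b i) w)\<bar>)"
    using W.ip_cnj[OF w onf_closed[OF b]] F
    by (intro sum.cong refl) (auto simp: norm_mult)
  also have "\<dots> \<le> L2_set (\<lambda>i. cmod (ip V (a i) v)) F * L2_set (\<lambda>i. cmod (ip W (b i) w)) F"
    by (rule L2_set_mult_ineq)
  also have "\<dots> \<le> hnorm V v * hnorm W w"
  proof (rule mult_mono)
    show "L2_set (\<lambda>i. cmod (ip V (a i) v)) F \<le> hnorm V v"
      unfolding L2_set_def using V.bessel[OF a F v] v real_le_lsqrt by (simp add: real_le_lsqrt)
    show "L2_set (\<lambda>i. cmod (ip W (b i) w)) F \<le> hnorm W w"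
      unfolding L2_set_def using W.bessel[OF b F w] w by (simp add: real_le_lsqrt)
  qed (use v in \<open>auto simp: L2_set_nonneg\<close>)
  finally show ?thesis .
qed

lemma abs_summable:
  assumes v: "v \<in> carrier V" and w: "w \<in> carrier W"
  shows "(\<lambda>i. cmod (ip V (a i) v * ip W w (b i))) summable_on I"
proof (rule nonneg_bdd_above_summable_on)
  show "bdd_above (sum (\<lambda>i. norm (ip V (a i) v * ip W w (b i))) ` {F. F \<subseteq> I \<and> finite F})"
    proof (rule bdd_aboveI[of _ "hnorm V v * hnorm W w"])
    fix x assume "x \<in> sum (\<lambda>i. norm (ip V (a i) v * ip W w (b i))) ` {F. F \<subseteq> I \<and> finite F}"
    then show "x \<le> hnorm V v * hnorm W w" using finite_sum_bound[OF _ _ v w] by blast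
  qed
qed simp

lemma infsum_bound:
  assumes v: "v \<in> carrier V" and w: "w \<in> carrier W"
  shows "cmod (\<Sum>\<^sub>\<infinity>i\<in>I. ip V (a i) v * ip W w (b i)) \<le> hnorm V v * hnorm W w"
proof -
  have "cmod (\<Sum>\<^sub>\<infinity>i\<in>I. ip V (a i) v * ip W w (b i)) \<le> (\<Sum>\<^sub>\<infinity>i\<in>I. cmod (ip V (a i) v * ip W w (b i)))"
    by (rule norm_infsum_bound[OF abs_summable[OF v w]])
  also have "\<dots> \<le> hnorm V v * hnorm W w"
    by (rule infsum_le_finite_sums[OF abs_summable[OF v w]]) (use finite_sum_bound[OF _ _ v w] in auto)
  finally show ?thesis .
qed

text \<open>The series is conjugate linear in \<open>w\<close>, so its complex conjugate is the
  functional to which the Riesz theorem applies.\<close>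

lemma frame_ex:
  assumes v: "v \<in> carrier V"
  shows "\<exists>z. z \<in> carrier W \<and> (\<forall>w\<in>carrier W. ip W w z = (\<Sum>\<^sub>\<infinity>i\<in>I. ip V (a i) v * ip W w (b i)))"
proof -
  define g where "g w = (\<Sum>\<^sub>\<infinity>i\<in>I. ip V (a i) v * ip W w (b i))" for w
  have sm: "(\<lambda>i. ip V (a i) v * ip W w (b i)) summable_on I" if "w \<in> carrier W" for w
    by (rule abs_summable_summable[OF abs_summable[OF v that]])
  have "\<exists>z\<in>carrier W. \<forall>w\<in>carrier W. cnj (g w) = ip W z w"
  proof (rule W.riesz)
    fix u w assume uw: "u \<in> carrier W" "w \<in> carrier W"
    have "g (u \<oplus>\<^bsub>W\<^esub> w) = (\<Sum>\<^sub>\<infinity>i\<in>I. ip V (a i) v * ip W u (b i) + ip V (a i) v * ip W w (b i))"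
      unfolding g_def by (rule infsum_cong) (use uw onf_closed[OF b] in \<open>simp add: algebra_simps\<close>)
    also have "\<dots> = g u + g w"
      unfolding g_def by (rule infsum_add[OF sm[OF uw(1)] sm[OF uw(2)]])
    finally show "cnj (g (u \<oplus>\<^bsub>W\<^esub> w)) = cnj (g u) + cnj (g w)" by simp
  next
    fix c w assume w: "w \<in> carrier W"
    have "g (c \<odot>\<^bsub>W\<^esub> w) = (\<Sum>\<^sub>\<infinity>i\<in>I. cnj c * (ip V (a i) v * ip W w (b i)))"
      unfolding g_def by (rule infsum_cong) (use w onf_closed[OF b] in \<open>simp add: algebra_simps\<close>)
    also have "\<dots> = cnj c * g w" unfolding g_def by (rule infsum_cmult_right')
    finally show "cnj (g (c \<odot>\<^bsub>W\<^esub> w)) = c * cnj (g w)" by simp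
  next
    fix w assume w: "w \<in> carrier W"
    show "cmod (cnj (g w)) \<le> hnorm V v * hnorm W w" using infsum_bound[OF v w] by (simp add: g_def)
  qed
  then obtain z where z: "z \<in> carrier W" "\<And>w. w \<in> carrier W \<Longrightarrow> cnj (g w) = ip W z w" by blast
  have "ip W w z = g w" if w: "w \<in> carrier W" for w
    using W.ip_cnj[OF w z(1)] z(2)[OF w, symmetric] by simp
  then show ?thesis using z(1) unfolding g_def by blast
qed

lemma
  assumes v: "v \<in> carrier V"
  shows frame_closed [simp, intro]: "frame V W I a b v \<in> carrier W"
    and frame_ip: "w \<in> carrier W \<Longrightarrow>
      ip W w (frame V W I a b v) = (\<Sum>\<^sub>\<infinity>i\<in>I. ip V (a i) v * ip W w (b i))"
  using someI_ex[OF frame_ex[OF v]] v by (simp_all add: frame_def)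

lemma frame_ext [simp, intro]: "frame V W I a b \<in> extensional (carrier V)"
  by (simp add: frame_def)

lemma frame_norm:
  assumes v: "v \<in> carrier V"
  shows "hnorm W (frame V W I a b v) \<le> hnorm V v"
proof -
  define z where "z = frame V W I a b v"
  have z: "z \<in> carrier W" using v by (simp add: z_def)
  have "(hnorm W z)\<^sup>2 = Re (ip W z z)" by (rule W.hnorm_sq[OF z])
  also have "ip W z z = (\<Sum>\<^sub>\<infinity>i\<in>I. ip V (a i) v * ip W z (b i))"
    using frame_ip[OF v z] by (simp add: z_def)
  also have "Re \<dots> \<le> hnorm V v * hnorm W z"
    using infsum_bound[OF v z] complex_Re_le_cmod order_trans by blast
  finally have "hnorm W z * hnorm W z \<le> hnorm V v * hnorm W z" by (simp add: power2_eq_square)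
  then show ?thesis
    using W.hnorm_nonneg[OF z] V.hnorm_nonneg[OF v] unfolding z_def
    by (cases "hnorm W (frame V W I a b v) = 0") auto
qed

lemma hilb_pair_swap: "hilb_pair W V I b a"
  by unfold_locales (rule b, rule a)

lemma frame_adjoint:
  assumes v: "v \<in> carrier V" and w: "w \<in> carrier W"
  shows "ip W w (frame V W I a b v) = ip V (frame W V I b a w) v"
proof -
  interpret S: hilb_pair W V I b a by (rule hilb_pair_swap)
  have "ip V (frame W V I b a w) v = cnj (ip V v (frame W V I b a w))"
    using v w by (intro V.ip_cnj) auto
  also have "\<dots> = cnj (\<Sum>\<^sub>\<infinity>i\<in>I. ip W (b i) w * ip V v (a i))" using S.frame_ip[OF w v] by simp
  also have "\<dots> = (\<Sum>\<^sub>\<infinity>i\<in>I. cnj (ip W (b i) w * ip V v (a i)))" by (rule infsum_cnj[symmetric])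
  also have "\<dots> = (\<Sum>\<^sub>\<infinity>i\<in>I. ip V (a i) v * ip W w (b i))"
    using onf_closed[OF a] onf_closed[OF b] V.ip_cnj[of "a _" v] W.ip_cnj[of w "b _"] v w
    by (intro infsum_cong) simp
  also have "\<dots> = ip W w (frame V W I a b v)" using frame_ip[OF v w] by simp
  finally show ?thesis by simp
qed

lemma ip_basis_frame:
  assumes v: "v \<in> carrier V" and i: "i \<in> I"
  shows "ip W (b i) (frame V W I a b v) = ip V (a i) v"
proof -
  have "(\<Sum>\<^sub>\<infinity>j\<in>I. ip V (a j) v * ip W (b i) (b j)) = (if i \<in> I then ip V (a i) v * ip W (b i) (b i) else 0)"
    by (rule infsum_single) (use onf_ip[OF b i] in auto)
  then show ?thesis using frame_ip[OF v onf_closed[OF b i]] onf_ip[OF b i i] i by simp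
qed

lemma frame_basis:
  assumes i: "i \<in> I"
  shows "frame V W I a b (a i) = b i"
proof (rule W.ip_eqI)
  fix w assume w: "w \<in> carrier W"
  have "(\<Sum>\<^sub>\<infinity>j\<in>I. ip V (a j) (a i) * ip W w (b j)) = (if i \<in> I then ip V (a i) (a i) * ip W w (b i) else 0)"
    by (rule infsum_single) (use onf_ip[OF a _ i] in auto)
  then show "ip W w (frame V W I a b (a i)) = ip W w (b i)"
    using frame_ip[OF onf_closed[OF a i] w] onf_ip[OF a i i] i by simp
qed (use i onf_closed[OF a i] onf_closed[OF b i] in auto)

end

text \<open>The intermediate vector has at \<open>b i\<close> the coefficient that \<open>v\<close>
  has at \<open>a i\<close>, so the middle family drops out.\<close>

lemma frame_compose:
  assumes VW: "hilb_pair V W I a b" and WU: "hilb_pair W U I b c" and v: "v \<in> carrier V"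
  shows "frame W U I b c (frame V W I a b v) = frame V U I a c v"
proof -
  interpret A: hilb_pair V W I a b by (rule VW)
  interpret B: hilb_pair W U I b c by (rule WU)
  interpret C: hilb_pair V U I a c by unfold_locales (rule A.a, rule B.b)
  show ?thesis
  proof (rule B.W.ip_eqI)
    fix u assume u: "u \<in> carrier U"
    have "(\<Sum>\<^sub>\<infinity>i\<in>I. ip W (b i) (frame V W I a b v) * ip U u (c i)) = (\<Sum>\<^sub>\<infinity>i\<in>I. ip V (a i) v * ip U u (c i))"
      by (rule infsum_cong) (use A.ip_basis_frame v in simp)
    then show "ip U u (frame W U I b c (frame V W I a b v)) = ip U u (frame V U I a c v)"
      using v u B.frame_ip C.frame_ip by simp
  qed (use v in auto)
qed

context hilb
begin

lemma frame_bounded: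
  assumes "onf V I a" "onf V I b"
  shows "frame V V I a b \<in> bounded_ops V"
proof -
  interpret A: hilb_pair V V I a b by unfold_locales (use assms in auto)
  interpret B: hilb_pair V V I b a by (rule A.hilb_pair_swap)
  show ?thesis
    by (rule bounded_opsI[where S = "frame V V I b a" and C = 1])
       (auto simp: A.frame_adjoint A.frame_norm A.frame_ext PiE_def)
qed

lemma adjoint_frame:
  assumes "onf V I a" "onf V I b"
  shows "adjoint V (frame V V I a b) = frame V V I b a"
proof -
  interpret A: hilb_pair V V I b a by unfold_locales (use assms in auto)
  show ?thesis by (rule adjointI) (use assms in \<open>auto simp: frame_bounded A.frame_adjoint\<close>)
qed

text \<open>Zorn's lemma within a prescribed set \<open>S\<close>. Taking for \<open>S\<close> the
  vectors over single cells later produces a basis adapted to the cells.\<close>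

lemma max_onf_ex:
  assumes S: "S \<subseteq> carrier V"
  shows "\<exists>E\<subseteq>S. onf V E (\<lambda>e. e) \<and> (\<forall>x\<in>S. ip V x x = 1 \<longrightarrow> (\<forall>e\<in>E. ip V e x = 0) \<longrightarrow> False)"
proof -
  let ?A = "{E. E \<subseteq> S \<and> onf V E (\<lambda>e. e)}"
  have "\<exists>M\<in>?A. \<forall>X\<in>?A. M \<subseteq> X \<longrightarrow> X = M"
  proof (rule subset_Zorn')
    fix C assume C: "subset.chain ?A C"
    have "ip V e f = (if e = f then 1 else 0)" if ef: "e \<in> \<Union>C" "f \<in> \<Union>C" for e f
    proof -
      from ef obtain X Y where XY: "X \<in> C" "e \<in> X" "Y \<in> C" "f \<in> Y" by blast
      from C XY have "X \<subseteq> Y \<or> Y \<subseteq> X" unfolding subset.chain_def by blast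
      then obtain Z where "Z \<in> C" "e \<in> Z" "f \<in> Z" using XY by blast
      moreover have "Z \<in> ?A" using C \<open>Z \<in> C\<close> unfolding subset.chain_def by blast
      ultimately show ?thesis unfolding onf_def by blast
    qed
    moreover have "\<Union>C \<subseteq> S" using C unfolding subset.chain_def by blast
    ultimately show "\<Union>C \<in> ?A" using S by (auto simp: onf_def)
  qed
  then obtain E where EA: "E \<in> ?A" and mx: "\<forall>X\<in>?A. E \<subseteq> X \<longrightarrow> X = E" by (rule bexE)
  have E: "E \<subseteq> S" "onf V E (\<lambda>e. e)" using EA by simp_all
  have max: "X = E" if "X \<subseteq> S" "onf V X (\<lambda>e. e)" "E \<subseteq> X" for X
    using mx that by simp
  have False if x: "x \<in> S" "ip V x x = 1" and o: "\<forall>e\<in>E. ip V e x = 0" for x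
  proof -
    have xE: "x \<notin> E" using o x by auto
    have xe: "ip V x e = 0" if "e \<in> E" for e
    proof -
      have "ip V x e = cnj (ip V e x)" using that x E S by (intro ip_cnj) auto
      then show ?thesis using o that by simp
    qed
    have "onf V (insert x E) (\<lambda>e. e)"
      unfolding onf_def
    proof (intro conjI ballI)
      fix i j assume "i \<in> insert x E" "j \<in> insert x E"
      then show "ip V i j = (if i = j then 1 else 0)"
        using onf_ip[OF E(2), of i j] x(2) o xe xE by (cases "i = x"; cases "j = x") auto
    qed (use E(1) x(1) S in blast)
    then have "insert x E = E" using max[of "insert x E"] x(1) E(1) by blast
    then show False using xE by blast
  qed
  then show ?thesis using E by blast
qed

subsection \<open>Closed subspaces and orthogonal projections\<close>

lemma closed_subspaceD:
  assumes "closed_subspace V U"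
  shows "U \<subseteq> carrier V" "\<zero> \<in> U" "\<lbrakk>v \<in> U; w \<in> U\<rbrakk> \<Longrightarrow> v \<oplus> w \<in> U" "v \<in> U \<Longrightarrow> c \<odot> v \<in> U"
    "\<lbrakk>v \<in> U; w \<in> U\<rbrakk> \<Longrightarrow> vsub V v w \<in> U"
    "\<lbrakk>\<And>n::nat. s n \<in> U; l \<in> carrier V; (\<lambda>n. hdist V (s n) l) \<longlonglongrightarrow> 0\<rbrakk> \<Longrightarrow> l \<in> U"
  using assms unfolding closed_subspace_def vsub_def by blast+

text \<open>Makes the Riesz theorem available inside a closed subspace. Nondegeneracy is tested with
  the difference \<open>u - v\<close>, which lies in \<open>U\<close>; completeness is inherited
  through closedness.\<close>

lemma closed_subspace_hilb:
  assumes U: "closed_subspace V U"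
  shows "hilb (V\<lparr>carrier := U\<rparr>)"
proof -
  note D = closed_subspaceD[OF U]
  have sub: "u \<in> U \<Longrightarrow> u \<in> carrier V" for u using D(1) by blast
  show ?thesis
  proof
  fix u v assume uv: "u \<in> carrier (V\<lparr>carrier := U\<rparr>)" "v \<in> carrier (V\<lparr>carrier := U\<rparr>)"
    and eq: "\<And>w. w \<in> carrier (V\<lparr>carrier := U\<rparr>) \<Longrightarrow> ip (V\<lparr>carrier := U\<rparr>) w u = ip (V\<lparr>carrier := U\<rparr>) w v"
  have uv: "u \<in> U" "v \<in> U" using uv by simp_all
  have "ip V (vsub V u v) (vsub V u v) = 0" using eq[of "vsub V u v"] D(5)[OF uv] sub[OF uv(1)] sub[OF uv(2)] by simp
  then have "hnorm V (vsub V u v) = 0" by (simp add: hnorm_def)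
  then show "u = v" using sub[OF uv(1)] sub[OF uv(2)] by (rule_tac vsub_eq_zero)
next
  have e: "hnorm (V\<lparr>carrier := U\<rparr>) (vsub (V\<lparr>carrier := U\<rparr>) x y) = hnorm V (vsub V x y)" for x y
    by (simp add: hnorm_def vsub_def)
  fix s :: "nat \<Rightarrow> 'v"
  assume s: "\<And>n. s n \<in> carrier (V\<lparr>carrier := U\<rparr>)"
    and c: "\<And>\<epsilon>. \<epsilon> > 0 \<Longrightarrow> \<exists>N. \<forall>i\<ge>N. \<forall>j\<ge>N.
      hnorm (V\<lparr>carrier := U\<rparr>) (vsub (V\<lparr>carrier := U\<rparr>) (s i) (s j)) < \<epsilon>"
  have sU: "s n \<in> U" for n using s by simp
  have "\<exists>l\<in>carrier V. (\<lambda>n. hnorm V (vsub V (s n) l)) \<longlonglongrightarrow> 0"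
    by (rule complete) (use c sub[OF sU] in \<open>auto simp: e\<close>)
  then obtain l where l: "l \<in> carrier V" "(\<lambda>n. hnorm V (vsub V (s n) l)) \<longlonglongrightarrow> 0" by blast
  have "l \<in> U" by (rule D(6)[of s]) (use sU l sub in \<open>simp_all add: hdist_eq\<close>)
  then show "\<exists>l\<in>carrier (V\<lparr>carrier := U\<rparr>).
      (\<lambda>n. hnorm (V\<lparr>carrier := U\<rparr>) (vsub (V\<lparr>carrier := U\<rparr>) (s n) l)) \<longlonglongrightarrow> 0"
    using l by (auto simp: e)
next
  fix u v assume "u \<in> carrier (V\<lparr>carrier := U\<rparr>)" "v \<in> carrier (V\<lparr>carrier := U\<rparr>)"
  then show "ip (V\<lparr>carrier := U\<rparr>) u v = cnj (ip (V\<lparr>carrier := U\<rparr>) v u)"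
    using ip_cnj[of u v] sub by simp
qed (simp_all add: D(2,3,4) sub ip_nonneg)
qed

text \<open>The functional \<open>u |-> <v, u>\<close> restricted to \<open>U\<close> is represented
  by a vector of \<open>U\<close>, and this vector is the orthogonal projection of
  \<open>v\<close>.\<close>

lemma projection_ex:
  assumes U: "closed_subspace V U" and v: "v \<in> carrier V"
  shows "\<exists>w\<in>U. \<forall>u\<in>U. ip V u (vsub V v w) = 0"
proof -
  interpret S: hilb "V\<lparr>carrier := U\<rparr>" by (rule closed_subspace_hilb[OF U])
  have sub: "u \<in> U \<Longrightarrow> u \<in> carrier V" for u using closed_subspaceD(1)[OF U] by blast
  have "\<exists>w\<in>carrier (V\<lparr>carrier := U\<rparr>). \<forall>u\<in>carrier (V\<lparr>carrier := U\<rparr>). ip V v u = ip (V\<lparr>carrier := U\<rparr>) w u"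
  proof (rule S.riesz)
    fix u assume "u \<in> carrier (V\<lparr>carrier := U\<rparr>)"
    then show "cmod (ip V v u) \<le> hnorm V v * hnorm (V\<lparr>carrier := U\<rparr>) u"
      using cauchy_schwarz[OF v sub[of u]] by (simp add: hnorm_def)
  qed (use v sub in simp_all)
  then obtain w where w: "w \<in> U" "\<And>u. u \<in> U \<Longrightarrow> ip V v u = ip V w u" by auto
  have "ip V u (vsub V v w) = 0" if "u \<in> U" for u
    using ip_cnj[of u v] ip_cnj[of u w] w(2)[OF that] v sub[OF that] sub[OF w(1)] by simp
  then show ?thesis using w(1) by blast
qed

lemma carrier_closed_subspace: "closed_subspace V (carrier V)"
  by (simp add: closed_subspace_def)

lemma closed_span_subspace:
  assumes "S \<subseteq> carrier V"
  shows "closed_subspace V (closed_span V S)" "S \<subseteq> closed_span V S"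
proof -
  \<comment> \<open>The intersection over an empty family would be the whole type.\<close>
  have ne: "carrier V \<in> {U. closed_subspace V U \<and> S \<subseteq> U}" using assms carrier_closed_subspace by simp
  show "S \<subseteq> closed_span V S" unfolding closed_span_def by blast
  define \<C> where "\<C> = {U. closed_subspace V U \<and> S \<subseteq> U}"
  have cs: "closed_subspace V U" if "U \<in> \<C>" for U using that by (simp add: \<C>_def)
  have "closed_subspace V (\<Inter>\<C>)"
    unfolding closed_subspace_def
  proof (intro conjI allI ballI impI)
    show "\<Inter>\<C> \<subseteq> carrier V" using ne unfolding \<C>_def by blast
    show "\<zero> \<in> \<Inter>\<C>" using closed_subspaceD(2)[OF cs] by blast
    show "v \<oplus> w \<in> \<Inter>\<C>" if "v \<in> \<Inter>\<C>" "w \<in> \<Inter>\<C>" for v w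
      using closed_subspaceD(3)[OF cs] that by blast
    show "c \<odot> v \<in> \<Inter>\<C>" if "v \<in> \<Inter>\<C>" for c v
      using closed_subspaceD(4)[OF cs] that by blast
    fix s :: "nat \<Rightarrow> 'v" and l
    assume l: "l \<in> carrier V"
      and s: "(\<forall>n. s n \<in> \<Inter>\<C>) \<and> (\<lambda>n. hdist V (s n) l) \<longlonglongrightarrow> 0"
    show "l \<in> \<Inter>\<C>"
    proof
      fix U assume U: "U \<in> \<C>"
      show "l \<in> U" by (rule closed_subspaceD(6)[OF cs[OF U], of s, OF _ l]) (use s U in auto)
    qed
  qed
  then show "closed_subspace V (closed_span V S)" by (simp add: closed_span_def \<C>_def)
qed

lemma orth_complement_subspace:
  assumes z: "z \<in> carrier V"
  shows "closed_subspace V {u \<in> carrier V. ip V z u = 0}"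
  unfolding closed_subspace_def
proof (intro conjI allI ballI impI)
  fix s :: "nat \<Rightarrow> 'v" and l
  assume l: "l \<in> carrier V"
    and s: "(\<forall>n. s n \<in> {u \<in> carrier V. ip V z u = 0}) \<and> (\<lambda>n. hdist V (s n) l) \<longlonglongrightarrow> 0"
  have sc: "s n \<in> carrier V" "ip V z (s n) = 0" for n using s by auto
  have "(\<lambda>n. ip V z (s n)) \<longlonglongrightarrow> ip V z l"
    by (rule ip_tendsto_left[OF _ l z]) (use s l sc(1) in \<open>simp_all add: hdist_eq\<close>)
  then have "ip V z l = 0" using sc(2) LIMSEQ_const_iff[of 0 "ip V z l"] by simp
  then show "l \<in> {u \<in> carrier V. ip V z u = 0}" using l by simp
qed (use z in auto)

text \<open>Brings a Wannier projection into the form of a frame. For the value \<open>q\<close> of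
  the frame at \<open>v\<close>, the difference \<open>v - q\<close> is orthogonal to every
  \<open>a i\<close>, hence to the smallest closed subspace containing them. That \<open>q\<close>
  itself lies in this subspace has to be shown separately, since \<open>q\<close> is only known
  through its inner products.\<close>

lemma orth_proj_closed_span:
  assumes a: "onf V I a"
  shows "orth_proj V (closed_span V (a ` I)) = frame V V I a a"
proof
  interpret A: hilb_pair V V I a a by unfold_locales (use a in auto)
  define U where "U = closed_span V (a ` I)"
  have ac: "a ` I \<subseteq> carrier V" using onf_closed[OF a] by auto
  have U: "closed_subspace V U" and aU: "a ` I \<subseteq> U" using closed_span_subspace[OF ac] by (auto simp: U_def)
  note D = closed_subspaceD[OF U]
  have sub: "u \<in> U \<Longrightarrow> u \<in> carrier V" for u using D(1) by blast
  fix v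
  show "orth_proj V (closed_span V (a ` I)) v = frame V V I a a v"
  proof (cases "v \<in> carrier V")
    case True
    define q where "q = frame V V I a a v"
    have q: "q \<in> carrier V" using True by (simp add: q_def)
    obtain w where w: "w \<in> U" "\<And>u. u \<in> U \<Longrightarrow> ip V u (vsub V q w) = 0"
      using projection_ex[OF U q] by blast
    have wc: "w \<in> carrier V" using w sub by blast
    have z: "vsub V q w \<in> carrier V" using q wc by simp
    have 0: "ip V (vsub V q w) u = 0" if "u \<in> U" for u
      using ip_cnj[OF z sub[OF that]] w(2)[OF that] by simp
    \<comment> \<open>The part of \<open>q\<close> orthogonal to \<open>U\<close> is orthogonal to
      every term of the series describing \<open>q\<close>, hence to \<open>q\<close>, and therefore
      vanishes.\<close>
    have "ip V (vsub V q w) q = (\<Sum>\<^sub>\<infinity>i\<in>I. ip V (a i) v * ip V (vsub V q w) (a i))"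
      unfolding q_def by (rule A.frame_ip[OF True]) (use z in \<open>simp add: q_def\<close>)
    also have "\<dots> = 0" by (rule infsum_0) (use 0 aU in auto)
    finally have "ip V (vsub V q w) (vsub V q w) = 0"
      using 0[OF w(1)] z q wc by (subst ip_vsub_right) auto
    then have "hnorm V (vsub V q w) = 0" by (simp add: hnorm_def)
    then have "q = w" by (rule vsub_eq_zero[OF q wc])
    then have qU: "q \<in> U" using w by simp
    have orth: "ip V u (vsub V v q) = 0" if u: "u \<in> U" for u
    proof -
      have vq: "vsub V v q \<in> carrier V" using True q by simp
      have "closed_subspace V {u \<in> carrier V. ip V (vsub V v q) u = 0}" by (rule orth_complement_subspace[OF vq])
      moreover have "a ` I \<subseteq> {u \<in> carrier V. ip V (vsub V v q) u = 0}"
      proof safe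
        fix i assume i: "i \<in> I"
        then show ai: "a i \<in> carrier V" using ac by blast
        have "ip V (a i) (vsub V v q) = 0" using A.ip_basis_frame[OF True i] True q ai by (simp add: q_def)
        then show "ip V (vsub V v q) (a i) = 0" using ip_cnj[OF vq ai] by simp
      qed
      ultimately have "U \<subseteq> {u \<in> carrier V. ip V (vsub V v q) u = 0}" unfolding U_def closed_span_def by blast
      then have "ip V (vsub V v q) u = 0" using u by blast
      then show ?thesis using ip_cnj[OF sub[OF u] vq] by simp
    qed
    have "(THE w. w \<in> U \<and> (\<forall>u\<in>U. ip V u (v \<ominus> w) = 0)) = q"
    proof (rule the_equality)
      show "q \<in> U \<and> (\<forall>u\<in>U. ip V u (v \<ominus> q) = 0)" using qU orth True q by (simp add: minus_eq_vsub)
      fix w assume w: "w \<in> U \<and> (\<forall>u\<in>U. ip V u (v \<ominus> w) = 0)"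
      then have wc: "w \<in> carrier V" and wo: "\<And>u. u \<in> U \<Longrightarrow> ip V u (vsub V v w) = 0"
        using sub True by (auto simp: minus_eq_vsub)
      have d: "vsub V w q \<in> U" using w qU D(5) by blast
      have "ip V (vsub V w q) (vsub V w q) = 0"
        using wo[OF d] orth[OF d] sub[OF d] True q wc by simp
      then have "hnorm V (vsub V w q) = 0" by (simp add: hnorm_def)
      then show "w = q" by (rule vsub_eq_zero[OF wc q])
    qed
    then show ?thesis using True by (simp add: orth_proj_def U_def q_def)
  next
    case False
    then show ?thesis by (simp add: orth_proj_def frame_def)
  qed
qed

end

section \<open>\<open>K\<close>-theory of unital *-rings\<close>

text \<open>Murray--von Neumann equivalence and the Grothendieck group involve only sums, products
  and the involution, so this part is pure algebra.\<close>

locale star_ring = ring B for B :: "('a, 'z) star_algebra_scheme" (structure) +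
  assumes star_closed [simp, intro]: "x \<in> carrier B \<Longrightarrow> star B x \<in> carrier B"
    and star_star [simp]: "x \<in> carrier B \<Longrightarrow> star B (star B x) = x"
    and star_mult: "\<lbrakk>x \<in> carrier B; y \<in> carrier B\<rbrakk> \<Longrightarrow> star B (x \<otimes> y) = star B y \<otimes> star B x"
    and star_add: "\<lbrakk>x \<in> carrier B; y \<in> carrier B\<rbrakk> \<Longrightarrow> star B (x \<oplus> y) = star B x \<oplus> star B y"
begin

section \<open>Finite sums and rectangular matrices over a ring with involution\<close>

lemma fsum_cong:
  "\<lbrakk>\<And>i. i \<in> A \<Longrightarrow> f i = g i; \<And>i. i \<in> A \<Longrightarrow> g i \<in> carrier B\<rbrakk> \<Longrightarrow> finsum B f A = finsum B g A"
  by (rule finsum_cong') auto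

lemma fsum_closed: "(\<And>i. i \<in> A \<Longrightarrow> f i \<in> carrier B) \<Longrightarrow> finsum B f A \<in> carrier B"
  by (rule finsum_closed) auto

lemma fsum_zero: "(\<And>i. i \<in> A \<Longrightarrow> f i = \<zero>) \<Longrightarrow> finsum B f A = \<zero>"
  using fsum_cong[of A f "\<lambda>_. \<zero>"] by (simp add: finsum_zero)

lemma fsum_swap:
  assumes "finite A" "finite C" "\<And>i j. \<lbrakk>i \<in> A; j \<in> C\<rbrakk> \<Longrightarrow> f i j \<in> carrier B"
  shows "(\<Oplus>i\<in>A. \<Oplus>j\<in>C. f i j) = (\<Oplus>j\<in>C. \<Oplus>i\<in>A. f i j)"
  using assms(1,3)
proof (induction A)
  case empty
  then show ?case by (simp add: finsum_zero)
next
  case (insert a A)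
  have "(\<Oplus>j\<in>C. \<Oplus>i\<in>insert a A. f i j) = (\<Oplus>j\<in>C. f a j \<oplus> (\<Oplus>i\<in>A. f i j))"
    using insert by (intro fsum_cong) (auto intro!: finsum_insert fsum_closed)
  also have "\<dots> = (\<Oplus>j\<in>C. f a j) \<oplus> (\<Oplus>j\<in>C. \<Oplus>i\<in>A. f i j)"
    using insert by (intro finsum_addf) (auto intro!: fsum_closed)
  also have "\<dots> = (\<Oplus>j\<in>C. f a j) \<oplus> (\<Oplus>i\<in>A. \<Oplus>j\<in>C. f i j)"
    using insert by simp
  also have "\<dots> = (\<Oplus>i\<in>insert a A. \<Oplus>j\<in>C. f i j)"
    using insert by (intro finsum_insert[symmetric]) (auto intro!: fsum_closed)
  finally show ?case by simp
qed

lemma fsum_split: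
  fixes f :: "nat \<Rightarrow> 'a"
  assumes "\<And>l. l < n + n' \<Longrightarrow> f l \<in> carrier B"
  shows "(\<Oplus>l\<in>{..<n + n'}. f l) = (\<Oplus>l\<in>{..<n}. f l) \<oplus> (\<Oplus>l\<in>{..<n'}. f (n + l))"
proof -
  have e: "{..<n + n'} = {..<n} \<union> (\<lambda>l. n + l) ` {..<n'}"
  proof -
    have "l \<in> (\<lambda>l. n + l) ` {..<n'}" if "l < n + n'" "\<not> l < n" for l
      by (rule image_eqI[of _ _ "l - n"]) (use that in auto)
    then show ?thesis by auto
  qed
  have "(\<Oplus>l\<in>{..<n + n'}. f l) = (\<Oplus>l\<in>{..<n}. f l) \<oplus> (\<Oplus>l\<in>(\<lambda>l. n + l) ` {..<n'}. f l)"
    unfolding e by (rule finsum_Un_disjoint) (use assms in auto)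
  also have "(\<Oplus>l\<in>(\<lambda>l. n + l) ` {..<n'}. f l) = (\<Oplus>l\<in>{..<n'}. f (n + l))"
    by (rule finsum_reindex) (use assms in auto)
  finally show ?thesis .
qed

lemma star_zero [simp]: "star B \<zero> = \<zero>"
proof -
  have "star B \<zero> = star B \<zero> \<oplus> star B \<zero>" using star_add[of \<zero> \<zero>] by simp
  then show ?thesis by (metis add.l_cancel_one' star_closed zero_closed)
qed

lemma star_sum:
  assumes "finite A" "\<And>i. i \<in> A \<Longrightarrow> f i \<in> carrier B"
  shows "star B (\<Oplus>i\<in>A. f i) = (\<Oplus>i\<in>A. star B (f i))"
  using assms
proof (induction A)
  case (insert a A)
  have "star B (\<Oplus>i\<in>insert a A. f i) = star B (f a \<oplus> (\<Oplus>i\<in>A. f i))"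
    using insert by (subst finsum_insert) auto
  also have "\<dots> = star B (f a) \<oplus> (\<Oplus>i\<in>A. star B (f i))"
    using insert by (subst star_add) (auto intro!: fsum_closed)
  also have "\<dots> = (\<Oplus>i\<in>insert a A. star B (f i))"
    using insert by (subst finsum_insert) auto
  finally show ?case .
qed simp

lemma mat_closed [simp]: "\<lbrakk>x \<in> mats B m n; i < m; j < n\<rbrakk> \<Longrightarrow> x (i, j) \<in> carrier B"
  by (auto simp: mats_def)

lemma mats_eqI:
  assumes "x \<in> mats B m n" "y \<in> mats B m n" "\<And>i j. \<lbrakk>i < m; j < n\<rbrakk> \<Longrightarrow> x (i, j) = y (i, j)"
  shows "x = y"
proof (rule extensionalityI[of _ "{..<m} \<times> {..<n}"])
  show "x \<in> extensional ({..<m} \<times> {..<n})" "y \<in> extensional ({..<m} \<times> {..<n})"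
    using assms by (auto simp: mats_def PiE_def)
qed (use assms in auto)

lemma mats_restrictI: "(\<And>i j. \<lbrakk>i < m; j < n\<rbrakk> \<Longrightarrow> f i j \<in> carrier B) \<Longrightarrow>
    (\<lambda>(i, j)\<in>{..<m} \<times> {..<n}. f i j) \<in> mats B m n"
  by (auto simp: mats_def)

lemma mat_mult_apply [simp]: "\<lbrakk>i < m; j < k\<rbrakk> \<Longrightarrow>
    mat_mult B m n k x y (i, j) = (\<Oplus>l\<in>{..<n}. x (i, l) \<otimes> y (l, j))"
  by (simp add: mat_mult_def)

lemma mat_star_apply [simp]: "\<lbrakk>i < n; j < m\<rbrakk> \<Longrightarrow> mat_star B m n x (i, j) = star B (x (j, i))"
  by (simp add: mat_star_def)

lemma mat_mult_closed [simp, intro]: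
  "\<lbrakk>x \<in> mats B m n; y \<in> mats B n k\<rbrakk> \<Longrightarrow> mat_mult B m n k x y \<in> mats B m k"
  unfolding mat_mult_def by (rule mats_restrictI) (auto intro!: fsum_closed)

lemma mat_star_closed [simp, intro]: "x \<in> mats B m n \<Longrightarrow> mat_star B m n x \<in> mats B n m"
  unfolding mat_star_def by (rule mats_restrictI) auto

lemma mat_star_star [simp]: "x \<in> mats B m n \<Longrightarrow> mat_star B n m (mat_star B m n x) = x"
  by (rule mats_eqI) auto

lemma mat_star_mult:
  assumes x: "x \<in> mats B m n" and y: "y \<in> mats B n k"
  shows "mat_star B m k (mat_mult B m n k x y) = mat_mult B k n m (mat_star B n k y) (mat_star B m n x)"
proof (rule mats_eqI)
  fix i j assume ij: "i < k" "j < m"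
  have "mat_star B m k (mat_mult B m n k x y) (i, j) = star B (\<Oplus>l\<in>{..<n}. x (j, l) \<otimes> y (l, i))"
    using ij by simp
  also have "\<dots> = (\<Oplus>l\<in>{..<n}. star B (x (j, l) \<otimes> y (l, i)))"
    using x y ij by (intro star_sum) auto
  also have "\<dots> = (\<Oplus>l\<in>{..<n}. star B (y (l, i)) \<otimes> star B (x (j, l)))"
    using x y ij by (intro fsum_cong) (auto simp: star_mult)
  also have "\<dots> = (\<Oplus>l\<in>{..<n}. mat_star B n k y (i, l) \<otimes> mat_star B m n x (l, j))"
    using x y ij by (intro fsum_cong) auto
  finally show "mat_star B m k (mat_mult B m n k x y) (i, j) =
      mat_mult B k n m (mat_star B n k y) (mat_star B m n x) (i, j)"
    using ij by simp
qed (use x y in auto)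

lemma mat_mult_assoc:
  assumes x: "x \<in> mats B m n" and y: "y \<in> mats B n k" and z: "z \<in> mats B k r"
  shows "mat_mult B m k r (mat_mult B m n k x y) z = mat_mult B m n r x (mat_mult B n k r y z)"
proof (rule mats_eqI)
  fix i j assume ij: "i < m" "j < r"
  have "mat_mult B m k r (mat_mult B m n k x y) z (i, j) = (\<Oplus>t\<in>{..<k}. (\<Oplus>l\<in>{..<n}. x (i, l) \<otimes> y (l, t)) \<otimes> z (t, j))"
    using x y z ij by (simp, intro fsum_cong) (auto intro!: fsum_closed)
  also have "\<dots> = (\<Oplus>t\<in>{..<k}. \<Oplus>l\<in>{..<n}. x (i, l) \<otimes> y (l, t) \<otimes> z (t, j))"
    using x y z ij by (intro fsum_cong finsum_ldistr) (auto intro!: fsum_closed)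
  also have "\<dots> = (\<Oplus>l\<in>{..<n}. \<Oplus>t\<in>{..<k}. x (i, l) \<otimes> y (l, t) \<otimes> z (t, j))"
    using x y z ij by (intro fsum_swap) auto
  also have "\<dots> = (\<Oplus>l\<in>{..<n}. \<Oplus>t\<in>{..<k}. x (i, l) \<otimes> (y (l, t) \<otimes> z (t, j)))"
    using x y z ij by (intro fsum_cong m_assoc) (auto intro!: fsum_closed)
  also have "\<dots> = (\<Oplus>l\<in>{..<n}. x (i, l) \<otimes> (\<Oplus>t\<in>{..<k}. y (l, t) \<otimes> z (t, j)))"
    using x y z ij by (intro fsum_cong finsum_rdistr[symmetric]) (auto intro!: fsum_closed)
  also have "\<dots> = mat_mult B m n r x (mat_mult B n k r y z) (i, j)"
    using x y z ij by (simp, intro fsum_cong) (auto intro!: fsum_closed)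
  finally show "mat_mult B m k r (mat_mult B m n k x y) z (i, j) = mat_mult B m n r x (mat_mult B n k r y z) (i, j)" .
qed (use x y z in auto)

subsection \<open>Murray--von Neumann equivalence\<close>

lemma projectionsD:
  assumes "(n, p) \<in> projections B"
  shows "p \<in> mats B n n" "mat_mult B n n n p p = p" "mat_star B n n p = p"
  using assms by (auto simp: projections_def)

lemma mvnD:
  assumes "((m, p), (n, q)) \<in> mvn B"
  obtains v where "v \<in> mats B n m" "mat_mult B m n m (mat_star B n m v) v = p"
    "mat_mult B n m n v (mat_star B n m v) = q"
  using assms by (auto simp: mvn_def)

lemma mvnI:
  assumes "(m, p) \<in> projections B" "(n, q) \<in> projections B" "v \<in> mats B n m"
    "mat_mult B m n m (mat_star B n m v) v = p" "mat_mult B n m n v (mat_star B n m v) = q"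
  shows "((m, p), (n, q)) \<in> mvn B"
  using assms by (auto simp: mvn_def)

lemma mvn_projections: "(x, y) \<in> mvn B \<Longrightarrow> x \<in> projections B \<and> y \<in> projections B"
  by (auto simp: mvn_def)

lemma mvn_refl: "x \<in> projections B \<Longrightarrow> (x, x) \<in> mvn B"
proof (cases x)
  fix n p assume x: "x \<in> projections B" "x = (n, p)"
  note P = projectionsD[OF x(1)[unfolded x(2)]]
  show ?thesis unfolding x(2) by (rule mvnI[of _ _ _ _ p]) (use x P in simp_all)
qed

lemma mvn_sym: "(x, y) \<in> mvn B \<Longrightarrow> (y, x) \<in> mvn B"
proof (cases x; cases y)
  fix m p n q assume xy: "(x, y) \<in> mvn B" "x = (m, p)" "y = (n, q)"
  then obtain v where v: "v \<in> mats B n m" "mat_mult B m n m (mat_star B n m v) v = p"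
    "mat_mult B n m n v (mat_star B n m v) = q" by (auto elim: mvnD)
  show ?thesis unfolding xy(2,3)
    by (rule mvnI[of _ _ _ _ "mat_star B n m v"]) (use v mvn_projections[OF xy(1)] xy(2,3) in auto)
qed

text \<open>The product \<open>w v\<close> implements the equivalence. The relations
  \<open>q v = v p\<close> and \<open>q w* = w* r\<close> push the middle projection out to the
  ends, where it is absorbed.\<close>

lemma mvn_trans: assumes "(x, y) \<in> mvn B" "(y, z) \<in> mvn B" shows "(x, z) \<in> mvn B"
proof (cases x; cases y; cases z)
  fix m p n q k r assume xyz: "x = (m, p)" "y = (n, q)" "z = (k, r)"
  obtain v where v: "v \<in> mats B n m" "mat_mult B m n m (mat_star B n m v) v = p"
    "mat_mult B n m n v (mat_star B n m v) = q" using assms(1) xyz by (auto elim: mvnD)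
  obtain w where w: "w \<in> mats B k n" "mat_mult B n k n (mat_star B k n w) w = q"
    "mat_mult B k n k w (mat_star B k n w) = r" using assms(2) xyz by (auto elim: mvnD)
  have xP: "x \<in> projections B" "y \<in> projections B" "z \<in> projections B"
    using assms mvn_projections by blast+
  have p: "p \<in> mats B m m" "mat_mult B m m m p p = p" and q: "q \<in> mats B n n"
    and r: "r \<in> mats B k k" "mat_mult B k k k r r = r"
    using xP xyz projectionsD by blast+
  let ?vs = "mat_star B n m v" and ?ws = "mat_star B k n w"
  have vs: "?vs \<in> mats B m n" and ws: "?ws \<in> mats B n k" using v w by auto
  define u where "u = mat_mult B k n m w v"
  have us: "mat_star B k m u = mat_mult B m n k ?vs ?ws" unfolding u_def by (rule mat_star_mult[OF w(1) v(1)])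
  have u: "u \<in> mats B k m" using v w by (auto simp: u_def)
  have "mat_mult B m k m (mat_star B k m u) u = mat_mult B m n m ?vs (mat_mult B n k m ?ws u)"
    unfolding us by (rule mat_mult_assoc[OF vs ws u])
  also have "mat_mult B n k m ?ws u = mat_mult B n n m q v"
    unfolding u_def using mat_mult_assoc[OF ws w(1) v(1)] w(2) by simp
  also have "mat_mult B n n m q v = mat_mult B n m m v p"
    using mat_mult_assoc[OF v(1) vs v(1)] v(2,3) by simp
  also have "mat_mult B m n m ?vs (mat_mult B n m m v p) = p"
    using mat_mult_assoc[OF vs v(1) p(1)] v(2) p(2) by simp
  finally have 1: "mat_mult B m k m (mat_star B k m u) u = p" .
  have "mat_mult B k m k u (mat_star B k m u) = mat_mult B k n k w (mat_mult B n m k v (mat_star B k m u))"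
    unfolding u_def by (rule mat_mult_assoc[OF w(1) v(1)]) (use us vs ws in \<open>auto simp: u_def[symmetric]\<close>)
  also have "mat_mult B n m k v (mat_star B k m u) = mat_mult B n n k q ?ws"
    unfolding us using mat_mult_assoc[OF v(1) vs ws] v(3) by simp
  also have "mat_mult B n n k q ?ws = mat_mult B n k k ?ws r"
    using mat_mult_assoc[OF ws w(1) ws] w(2,3) by simp
  also have "mat_mult B k n k w (mat_mult B n k k ?ws r) = r"
    using mat_mult_assoc[OF w(1) ws r(1)] w(3) r(2) by simp
  finally have 2: "mat_mult B k m k u (mat_star B k m u) = r" .
  show ?thesis unfolding xyz by (rule mvnI[OF _ _ u 1 2]) (use xP xyz in auto)
qed

text \<open>Moving the entries of a projection along an injection of the index set and padding with zeros
  does not change its class.\<close>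

lemma mvn_reindex:
  assumes P: "(m, p) \<in> projections B" and f: "inj_on f {..<m}" "f ` {..<m} \<subseteq> {..<n}"
    and q: "q \<in> mats B n n"
    and qf: "\<And>i j. \<lbrakk>i < m; j < m\<rbrakk> \<Longrightarrow> q (f i, f j) = p (i, j)"
    and q0: "\<And>i j. \<lbrakk>i < n; j < n; i \<notin> f ` {..<m} \<or> j \<notin> f ` {..<m}\<rbrakk> \<Longrightarrow> q (i, j) = \<zero>"
  shows "((m, p), (n, q)) \<in> mvn B"
proof -
  note p = projectionsD[OF P]
  have pp: "(\<Oplus>l\<in>{..<m}. p (i, l) \<otimes> p (l, j)) = p (i, j)" if "i < m" "j < m" for i j
    using mat_mult_apply[OF that, of m p p] unfolding p(2) by simp
  have ps: "star B (p (j, i)) = p (i, j)" if "i < m" "j < m" for i j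
    using mat_star_apply[OF that, of p] unfolding p(3) by simp
  define g where "g = the_inv_into {..<m} f"
  have gf: "g (f i) = i" if "i < m" for i using that f by (simp add: g_def the_inv_into_f_f)
  have fl: "f i < n" if "i < m" for i using f that by auto
  \<comment> \<open>The product of the 0-1 matrix of \<open>f\<close> with \<open>p\<close>: row
    \<open>i\<close> of \<open>p\<close> is placed in row \<open>f i\<close>, and all other rows are
    zero.\<close>
  define v where "v = (\<lambda>(i, j)\<in>{..<n} \<times> {..<m}. if i \<in> f ` {..<m} then p (g i, j) else \<zero>)"
  have v: "v \<in> mats B n m" unfolding v_def using p(1) gf by (intro mats_restrictI) auto
  have vf: "v (f i, j) = p (i, j)" if "i < m" "j < m" for i j using that gf fl by (simp add: v_def)
  have v0: "v (i, j) = \<zero>" if "i < n" "j < m" "i \<notin> f ` {..<m}" for i j using that by (simp add: v_def)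
  have vs: "mat_star B n m v \<in> mats B m n" using v by simp
  have 1: "mat_mult B m n m (mat_star B n m v) v = p"
  proof (rule mats_eqI)
    fix i j assume ij: "i < m" "j < m"
    have c: "star B (v (l, i)) \<otimes> v (l, j) \<in> carrier B" if "l < n" for l using v ij that by auto
    have "mat_mult B m n m (mat_star B n m v) v (i, j) = (\<Oplus>l\<in>{..<n}. star B (v (l, i)) \<otimes> v (l, j))"
      using ij v by (simp, intro fsum_cong) auto
    also have "\<dots> = (\<Oplus>l\<in>f ` {..<m}. star B (v (l, i)) \<otimes> v (l, j))"
      by (rule add.finprod_mono_neutral_cong_left[symmetric]) (use f c v0 ij v in auto)
    also have "\<dots> = (\<Oplus>s\<in>{..<m}. star B (v (f s, i)) \<otimes> v (f s, j))"
      by (rule finsum_reindex) (use f fl c in auto)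
    also have "\<dots> = (\<Oplus>s\<in>{..<m}. p (i, s) \<otimes> p (s, j))"
      using ij p(1) by (intro fsum_cong) (auto simp: vf ps)
    finally show "mat_mult B m n m (mat_star B n m v) v (i, j) = p (i, j)" using pp ij by simp
  qed (use vs v p in auto)
  have 2: "mat_mult B n m n v (mat_star B n m v) = q"
  proof (rule mats_eqI)
    fix i j assume ij: "i < n" "j < n"
    have e: "mat_mult B n m n v (mat_star B n m v) (i, j) = (\<Oplus>l\<in>{..<m}. v (i, l) \<otimes> star B (v (j, l)))"
      using ij v by (simp, intro fsum_cong) auto
    show "mat_mult B n m n v (mat_star B n m v) (i, j) = q (i, j)"
    proof (cases "i \<in> f ` {..<m} \<and> j \<in> f ` {..<m}")
      case True
      then obtain s t where st: "s < m" "t < m" "i = f s" "j = f t" by auto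
      have "(\<Oplus>l\<in>{..<m}. v (i, l) \<otimes> star B (v (j, l))) = (\<Oplus>l\<in>{..<m}. p (s, l) \<otimes> p (l, t))"
        using st p(1) by (intro fsum_cong) (auto simp: vf ps)
      then show ?thesis unfolding e using pp st qf by simp
    next
      case False
      have "(\<Oplus>l\<in>{..<m}. v (i, l) \<otimes> star B (v (j, l))) = \<zero>"
        by (rule fsum_zero) (use False v0 ij v in auto)
      then show ?thesis unfolding e using q0[OF ij] False by auto
    qed
  qed (use vs v q in auto)
  have vp: "mat_mult B n m m v p = v"
  proof (rule mats_eqI)
    fix i j assume ij: "i < n" "j < m"
    show "mat_mult B n m m v p (i, j) = v (i, j)"
    proof (cases "i \<in> f ` {..<m}")
      case True
      then obtain s where s: "s < m" "i = f s" by auto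
      have "(\<Oplus>l\<in>{..<m}. v (i, l) \<otimes> p (l, j)) = (\<Oplus>l\<in>{..<m}. p (s, l) \<otimes> p (l, j))"
        using s ij p(1) by (intro fsum_cong) (auto simp: vf)
      then show ?thesis using ij pp s by (simp add: vf)
    next
      case False
      have "(\<Oplus>l\<in>{..<m}. v (i, l) \<otimes> p (l, j)) = \<zero>"
        by (rule fsum_zero) (use False v0 ij p in auto)
      then show ?thesis using ij v0 False by simp
    qed
  qed (use v p in auto)
  \<comment> \<open>That \<open>q\<close> is a projection follows from \<open>v* v = p\<close>,
    \<open>v v* = q\<close> and \<open>v p = v\<close>.\<close>
  have "mat_mult B n n n q q = mat_mult B n m n v (mat_mult B m n n (mat_star B n m v) q)"
    using mat_mult_assoc[OF v vs q] 2 by simp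
  also have "mat_mult B m n n (mat_star B n m v) q = mat_mult B m m n p (mat_star B n m v)"
    using mat_mult_assoc[OF vs v vs] 1 2 by simp
  also have "mat_mult B n m n v (mat_mult B m m n p (mat_star B n m v)) = q"
    using mat_mult_assoc[OF v p(1) vs] vp 2 by simp
  finally have qq: "mat_mult B n n n q q = q" .
  have "mat_star B n n q = q" using mat_star_mult[OF v vs] v 2 by simp
  then have "(n, q) \<in> projections B" using q qq by (simp add: projections_def)
  then show ?thesis by (rule mvnI[OF P _ v 1 2])
qed

text \<open>\<open>dsum\<close> for rectangular blocks: partial isometries between projections of
  different sizes have to be added as well.\<close>

definition bdiag :: "nat \<Rightarrow> nat \<Rightarrow> nat \<Rightarrow> nat \<Rightarrow> (nat \<times> nat \<Rightarrow> 'a) \<Rightarrow> (nat \<times> nat \<Rightarrow> 'a) \<Rightarrow> nat \<times> nat \<Rightarrow> 'a"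
  where "bdiag m n m' n' x y = (\<lambda>(i, j)\<in>{..<m+m'} \<times> {..<n+n'}.
    if i < m \<and> j < n then x (i, j) else if m \<le> i \<and> n \<le> j then y (i - m, j - n) else \<zero>)"

lemma bdiag_closed [simp, intro]:
  "\<lbrakk>x \<in> mats B m n; y \<in> mats B m' n'\<rbrakk> \<Longrightarrow> bdiag m n m' n' x y \<in> mats B (m + m') (n + n')"
  unfolding bdiag_def by (rule mats_restrictI) auto

lemma bdiag_apply:
  assumes "i < m + m'" "j < n + n'"
  shows "bdiag m n m' n' x y (i, j) =
    (if i < m \<and> j < n then x (i, j) else if m \<le> i \<and> n \<le> j then y (i - m, j - n) else \<zero>)"
  using assms by (simp add: bdiag_def)

lemma bdiag_mult:
  assumes x: "x \<in> mats B m n" and y: "y \<in> mats B m' n'" and x': "x' \<in> mats B n k" and y': "y' \<in> mats B n' k'"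
  shows "mat_mult B (m + m') (n + n') (k + k') (bdiag m n m' n' x y) (bdiag n k n' k' x' y') =
    bdiag m k m' k' (mat_mult B m n k x x') (mat_mult B m' n' k' y y')" (is "?L = ?R")
proof (rule mats_eqI)
  have X: "bdiag m n m' n' x y \<in> mats B (m + m') (n + n')" and Y: "bdiag n k n' k' x' y' \<in> mats B (n + n') (k + k')"
    using assms by auto
  fix i j assume ij: "i < m + m'" "j < k + k'"
  let ?f = "\<lambda>l. bdiag m n m' n' x y (i, l) \<otimes> bdiag n k n' k' x' y' (l, j)"
  have fc: "?f l \<in> carrier B" if "l < n + n'" for l using mat_closed[OF X ij(1) that] mat_closed[OF Y that ij(2)] by simp
  have L: "?L (i, j) = (\<Oplus>l\<in>{..<n}. ?f l) \<oplus> (\<Oplus>l\<in>{..<n'}. ?f (n + l))"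
    using ij fsum_split[of n n' ?f] fc by simp
  have s1: "(\<Oplus>l\<in>{..<n}. ?f l) = (if i < m \<and> j < k then mat_mult B m n k x x' (i, j) else \<zero>)"
  proof (cases "i < m \<and> j < k")
    case True
    then have "(\<Oplus>l\<in>{..<n}. ?f l) = (\<Oplus>l\<in>{..<n}. x (i, l) \<otimes> x' (l, j))"
      using x x' by (intro fsum_cong) (auto simp: bdiag_apply)
    then show ?thesis using True by simp
  next
    case False
    have "(\<Oplus>l\<in>{..<n}. ?f l) = \<zero>"
      by (rule fsum_zero) (use False ij x x' in \<open>auto simp: bdiag_apply\<close>)
    then show ?thesis using False by auto
  qed
  have s2: "(\<Oplus>l\<in>{..<n'}. ?f (n + l)) = (if m \<le> i \<and> k \<le> j then mat_mult B m' n' k' y y' (i - m, j - k) else \<zero>)"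
  proof (cases "m \<le> i \<and> k \<le> j")
    case True
    then have b: "i - m < m'" "j - k < k'" using ij by auto
    have "(\<Oplus>l\<in>{..<n'}. ?f (n + l)) = (\<Oplus>l\<in>{..<n'}. y (i - m, l) \<otimes> y' (l, j - k))"
      using True y y' ij b by (intro fsum_cong) (auto simp: bdiag_apply)
    then show ?thesis using True b by simp
  next
    case False
    have "(\<Oplus>l\<in>{..<n'}. ?f (n + l)) = \<zero>"
      by (rule fsum_zero) (use False ij y y' in \<open>auto simp: bdiag_apply\<close>)
    then show ?thesis using False by auto
  qed
  have c1: "mat_mult B m n k x x' (i, j) \<in> carrier B" if "i < m" "j < k"
    using mat_closed[OF mat_mult_closed[OF x x'] that] .
  have c2: "mat_mult B m' n' k' y y' (i - m, j - k) \<in> carrier B" if "m \<le> i" "k \<le> j"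
    using mat_closed[OF mat_mult_closed[OF y y'], of "i - m" "j - k"] that ij by auto
  show "?L (i, j) = ?R (i, j)"
    unfolding L s1 s2 bdiag_apply[OF ij] using c1 c2 by auto
qed (use assms in auto)

lemma bdiag_star:
  assumes "x \<in> mats B m n" "y \<in> mats B m' n'"
  shows "mat_star B (m + m') (n + n') (bdiag m n m' n' x y) =
    bdiag n m n' m' (mat_star B m n x) (mat_star B m' n' y)"
proof (rule mats_eqI)
  fix i j assume ij: "i < n + n'" "j < m + m'"
  show "mat_star B (m + m') (n + n') (bdiag m n m' n' x y) (i, j) =
    bdiag n m n' m' (mat_star B m n x) (mat_star B m' n' y) (i, j)"
    using ij assms by (auto simp: bdiag_apply)
qed (use assms in auto)

lemma dsum_bdiag: "dsum B (m, p) (n, q) = (m + n, bdiag m m n n p q)"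
  by (simp add: bdiag_def)

lemma dsum_projections:
  assumes "x \<in> projections B" "y \<in> projections B"
  shows "dsum B x y \<in> projections B"
proof (cases x; cases y)
  fix m p n q assume xy: "x = (m, p)" "y = (n, q)"
  have P: "p \<in> mats B m m" "mat_mult B m m m p p = p" "mat_star B m m p = p"
    and Q: "q \<in> mats B n n" "mat_mult B n n n q q = q" "mat_star B n n q = q"
    using assms xy projectionsD by blast+
  show ?thesis unfolding xy dsum_bdiag projections_def
    by (simp add: bdiag_mult[OF P(1) Q(1) P(1) Q(1)] bdiag_star[OF P(1) Q(1)] bdiag_closed[OF P(1) Q(1)] P Q)
qed

lemma dsum_mvn:
  assumes "(x, x') \<in> mvn B" "(y, y') \<in> mvn B"
  shows "(dsum B x y, dsum B x' y') \<in> mvn B"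
proof (cases x; cases y; cases x'; cases y')
  fix m p n q m' p' n' q' assume xy: "x = (m, p)" "y = (n, q)" "x' = (m', p')" "y' = (n', q')"
  obtain v where v: "v \<in> mats B m' m" "mat_mult B m m' m (mat_star B m' m v) v = p"
    "mat_mult B m' m m' v (mat_star B m' m v) = p'" using assms(1) xy by (auto elim: mvnD)
  obtain w where w: "w \<in> mats B n' n" "mat_mult B n n' n (mat_star B n' n w) w = q"
    "mat_mult B n' n n' w (mat_star B n' n w) = q'" using assms(2) xy by (auto elim: mvnD)
  show ?thesis
    unfolding xy dsum_bdiag
    by (rule mvnI[of _ _ _ _ "bdiag m' m n' n v w"])
       (use dsum_projections assms xy v w mvn_projections[OF assms(1)] mvn_projections[OF assms(2)]
         in \<open>auto simp: dsum_bdiag[symmetric] bdiag_star bdiag_mult simp del: dsum.simps\<close>)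
qed

lemma dsum_assoc:
  assumes "x \<in> projections B" "y \<in> projections B" "z \<in> projections B"
  shows "dsum B (dsum B x y) z = dsum B x (dsum B y z)"
proof (cases x; cases y; cases z)
  fix m p n q k r assume xyz: "x = (m, p)" "y = (n, q)" "z = (k, r)"
  have P: "p \<in> mats B m m" "q \<in> mats B n n" "r \<in> mats B k k" using assms xyz projectionsD by blast+
  have "bdiag (m + n) (m + n) k k (bdiag m m n n p q) r = bdiag m m (n + k) (n + k) p (bdiag n n k k q r)"
  proof (rule mats_eqI[of _ "m + n + k" "m + n + k"])
    fix i j assume ij: "i < m + n + k" "j < m + n + k"
    have ij': "i < m + (n + k)" "j < m + (n + k)" using ij by auto
    show "bdiag (m + n) (m + n) k k (bdiag m m n n p q) r (i, j) = bdiag m m (n + k) (n + k) p (bdiag n n k k q r) (i, j)"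
    proof -
      consider "i < m" | "m \<le> i" "i < m + n" | "m + n \<le> i" by linarith
      then show ?thesis
      proof cases
        case 1
        then show ?thesis unfolding bdiag_apply[OF ij] bdiag_apply[OF ij'] by (auto simp: bdiag_apply)
      next
        case 2
        then have "i - m < n" by linarith
        with 2 show ?thesis unfolding bdiag_apply[OF ij] bdiag_apply[OF ij']
          using ij by (cases "j < m"; cases "j < m + n") (auto simp: bdiag_apply)
      next
        case 3
        then have "\<not> i - m < n" "n \<le> i - m" by linarith+
        with 3 show ?thesis unfolding bdiag_apply[OF ij] bdiag_apply[OF ij']
          using ij by (cases "j < m"; cases "j < m + n") (auto simp: bdiag_apply diff_diff_add add.commute)
      qed
    qed
  qed (use P bdiag_closed[OF P(1) bdiag_closed[OF P(2,3)]] bdiag_closed[OF bdiag_closed[OF P(1,2)] P(3)]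
       in \<open>simp_all add: add.assoc\<close>)
  then show ?thesis unfolding xyz dsum_bdiag by (simp add: add.assoc)
qed

lemma dsum_comm:
  assumes "x \<in> projections B" "y \<in> projections B"
  shows "(dsum B x y, dsum B y x) \<in> mvn B"
proof (cases x; cases y)
  fix m p n q assume xy: "x = (m, p)" "y = (n, q)"
  have P: "p \<in> mats B m m" "q \<in> mats B n n" using assms xy projectionsD by blast+
  \<comment> \<open>The rotation of the indices that exchanges the two diagonal blocks.\<close>
  let ?f = "\<lambda>i. if i < m then i + n else i - m"
  have bij: "?f ` {..<m + n} = {..<n + m}"
  proof
    show "{..<n + m} \<subseteq> ?f ` {..<m + n}"
    proof
      fix i assume i: "i \<in> {..<n + m}"
      show "i \<in> ?f ` {..<m + n}"
        by (rule image_eqI[of _ _ "if i < n then i + m else i - n"]) (use i in auto)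
    qed
  qed auto
  show ?thesis unfolding xy dsum_bdiag
  proof (rule mvn_reindex[where f = ?f])
    show "(m + n, bdiag m m n n p q) \<in> projections B" using dsum_projections[OF assms] unfolding xy dsum_bdiag .
    show "inj_on ?f {..<m + n}" by (auto simp: inj_on_def split: if_splits)
    show "?f ` {..<m + n} \<subseteq> {..<n + m}" using bij by simp
    show "bdiag n n m m q p \<in> mats B (n + m) (n + m)" using P by auto
    fix i j assume ij: "i < m + n" "j < m + n"
    then show "bdiag n n m m q p (?f i, ?f j) = bdiag m m n n p q (i, j)"
      by (cases "i < m"; cases "j < m") (auto simp: bdiag_apply)
  next
    fix i j assume ij: "i < n + m" "j < n + m" "i \<notin> ?f ` {..<m + n} \<or> j \<notin> ?f ` {..<m + n}"
    then show "bdiag n n m m q p (i, j) = \<zero>" unfolding bij by auto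
  qed
qed

lemma mat1_projections:
  assumes "a \<in> carrier B" "a \<otimes> a = a" "star B a = a"
  shows "mat1 a \<in> projections B"
proof -
  have m: "(\<lambda>(i, j)\<in>{..<1} \<times> {..<1}. a) \<in> mats B 1 1" by (rule mats_restrictI) (use assms in auto)
  have "mat_mult B 1 1 1 (\<lambda>(i, j)\<in>{..<1} \<times> {..<1}. a) (\<lambda>(i, j)\<in>{..<1} \<times> {..<1}. a) = (\<lambda>(i, j)\<in>{..<1} \<times> {..<1}. a)"
    by (rule mats_eqI) (use m assms in \<open>auto simp: lessThan_Suc\<close>)
  moreover have "mat_star B 1 1 (\<lambda>(i, j)\<in>{..<1} \<times> {..<1}. a) = (\<lambda>(i, j)\<in>{..<1} \<times> {..<1}. a)"
    by (rule mats_eqI) (use m assms in auto)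
  ultimately show ?thesis using m by (simp add: mat1_def projections_def)
qed

lemma mvn_mat1:
  assumes "mat1 a \<in> projections B" "mat1 b \<in> projections B" "v \<in> carrier B" "a \<in> carrier B" "b \<in> carrier B"
    "star B v \<otimes> v = a" "v \<otimes> star B v = b"
  shows "(mat1 a, mat1 b) \<in> mvn B"
proof -
  have m: "(\<lambda>(i, j)\<in>{..<1} \<times> {..<1}. x) \<in> mats B 1 1" if "x \<in> carrier B" for x by (rule mats_restrictI) (use that in auto)
  show ?thesis unfolding mat1_def
  proof (rule mvnI[of _ _ _ _ "\<lambda>(i, j)\<in>{..<1} \<times> {..<1}. v"])
    let ?v = "\<lambda>(i, j)\<in>{..<1::nat} \<times> {..<1::nat}. v"
    show "mat_mult B 1 1 1 (mat_star B 1 1 ?v) ?v = (\<lambda>(i, j)\<in>{..<1} \<times> {..<1}. a)"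
      by (rule mats_eqI) (use m assms in \<open>auto simp: lessThan_Suc\<close>)
    show "mat_mult B 1 1 1 ?v (mat_star B 1 1 ?v) = (\<lambda>(i, j)\<in>{..<1} \<times> {..<1}. b)"
      by (rule mats_eqI) (use m assms in \<open>auto simp: lessThan_Suc\<close>)
  qed (use assms m in \<open>auto simp: mat1_def\<close>)
qed

text \<open>The neutral class is represented by a zero matrix of size 1, so adding it shifts all
  indices by one.\<close>

lemma dsum_zero:
  assumes "x \<in> projections B"
  shows "(x, dsum B (mat1 \<zero>) x) \<in> mvn B"
proof (cases x)
  fix m p assume x: "x = (m, p)"
  have P: "p \<in> mats B m m" using assms x projectionsD by blast
  have Z: "(\<lambda>(i, j)\<in>{..<1} \<times> {..<1}. \<zero>) \<in> mats B 1 1" by (rule mats_restrictI) auto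
  have im: "i \<in> Suc ` {..<m}" if "i < 1 + m" "i \<noteq> 0" for i
    using that by (cases i) auto
  show ?thesis unfolding x mat1_def dsum_bdiag
  proof (rule mvn_reindex[where f = Suc])
    show "bdiag 1 1 m m (\<lambda>(i, j)\<in>{..<1} \<times> {..<1}. \<zero>) p \<in> mats B (1 + m) (1 + m)" using P Z by blast
  next
    fix i j assume ij: "i < 1 + m" "j < 1 + m" "i \<notin> Suc ` {..<m} \<or> j \<notin> Suc ` {..<m}"
    then have "i = 0 \<or> j = 0" using im by blast
    then show "bdiag 1 1 m m (\<lambda>(i, j)\<in>{..<1} \<times> {..<1}. \<zero>) p (i, j) = \<zero>"
      using ij by (auto simp: bdiag_apply)
  qed (use assms x in \<open>auto simp: bdiag_apply\<close>)
qed

subsection \<open>The monoid of projections and its Grothendieck group\<close>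

definition cls :: "nat \<times> (nat \<times> nat \<Rightarrow> 'a) \<Rightarrow> (nat \<times> (nat \<times> nat \<Rightarrow> 'a)) set"
  where "cls x = mvn B `` {x}"

lemma cls_eq_iff:
  assumes "x \<in> projections B" "y \<in> projections B"
  shows "cls x = cls y \<longleftrightarrow> (x, y) \<in> mvn B"
proof
  assume "cls x = cls y"
  then show "(x, y) \<in> mvn B" using mvn_refl[OF assms(2)] by (auto simp: cls_def)
next
  assume xy: "(x, y) \<in> mvn B"
  show "cls x = cls y"
    unfolding cls_def using xy mvn_trans[OF xy] mvn_trans[OF mvn_sym[OF xy]] by blast
qed

lemma V_carrier: "carrier (V_monoid B) = cls ` projections B"
  by (auto simp: V_monoid_def quotient_def cls_def)

lemma V_one: "\<one>\<^bsub>V_monoid B\<^esub> = cls (mat1 \<zero>)"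
  by (simp add: V_monoid_def cls_def)

lemma zero_projection: "mat1 \<zero> \<in> projections B"
  by (rule mat1_projections) auto

lemma V_mult:
  assumes x: "x \<in> projections B" and y: "y \<in> projections B"
  shows "cls x \<otimes>\<^bsub>V_monoid B\<^esub> cls y = cls (dsum B x y)"
proof -
  have eq: "mvn B `` {dsum B p q} = cls (dsum B x y)" if "p \<in> cls x" "q \<in> cls y" for p q
  proof -
    have "(x, p) \<in> mvn B" "(y, q) \<in> mvn B" using that by (auto simp: cls_def)
    then have xp: "(dsum B x y, dsum B p q) \<in> mvn B" by (rule dsum_mvn)
    show ?thesis unfolding cls_def[symmetric]
      using cls_eq_iff xp mvn_projections[OF xp] by blast
  qed
  have "x \<in> cls x" "y \<in> cls y" using mvn_refl x y by (auto simp: cls_def)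
  have "cls x \<otimes>\<^bsub>V_monoid B\<^esub> cls y = (\<Union>p\<in>cls x. \<Union>q\<in>cls y. mvn B `` {dsum B p q})"
    by (simp add: V_monoid_def)
  also have "\<dots> = (\<Union>p\<in>cls x. \<Union>q\<in>cls y. cls (dsum B x y))" using eq by simp
  also have "\<dots> = cls (dsum B x y)" using \<open>x \<in> cls x\<close> \<open>y \<in> cls y\<close> by blast
  finally show ?thesis .
qed

lemma V_comm_monoid: "comm_monoid (V_monoid B)"
proof (rule comm_monoidI)
  show "\<one>\<^bsub>V_monoid B\<^esub> \<in> carrier (V_monoid B)"
    unfolding V_carrier V_one using zero_projection by blast
next
  fix P Q assume "P \<in> carrier (V_monoid B)" "Q \<in> carrier (V_monoid B)"
  then obtain x y where xy: "x \<in> projections B" "y \<in> projections B" "P = cls x" "Q = cls y"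
    unfolding V_carrier by blast
  show "P \<otimes>\<^bsub>V_monoid B\<^esub> Q \<in> carrier (V_monoid B)"
    unfolding xy V_mult[OF xy(1,2)] V_carrier using dsum_projections xy by blast
  show "P \<otimes>\<^bsub>V_monoid B\<^esub> Q = Q \<otimes>\<^bsub>V_monoid B\<^esub> P"
    unfolding xy V_mult[OF xy(1,2)] V_mult[OF xy(2,1)]
    using cls_eq_iff dsum_comm dsum_projections xy by blast
next
  fix P Q R assume "P \<in> carrier (V_monoid B)" "Q \<in> carrier (V_monoid B)" "R \<in> carrier (V_monoid B)"
  then obtain x y z where xyz: "x \<in> projections B" "y \<in> projections B" "z \<in> projections B"
      "P = cls x" "Q = cls y" "R = cls z"
    unfolding V_carrier by blast
  then show "P \<otimes>\<^bsub>V_monoid B\<^esub> Q \<otimes>\<^bsub>V_monoid B\<^esub> R = P \<otimes>\<^bsub>V_monoid B\<^esub> (Q \<otimes>\<^bsub>V_monoid B\<^esub> R)"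
    by (simp add: V_mult dsum_projections dsum_assoc)
next
  fix P assume "P \<in> carrier (V_monoid B)"
  then obtain x where x: "x \<in> projections B" "P = cls x" unfolding V_carrier by blast
  have "cls x = cls (dsum B (mat1 \<zero>) x)"
    using cls_eq_iff dsum_zero[OF x(1)] x dsum_projections[OF zero_projection x(1)] by blast
  then show "\<one>\<^bsub>V_monoid B\<^esub> \<otimes>\<^bsub>V_monoid B\<^esub> P = P"
    unfolding V_one x V_mult[OF zero_projection x(1)] by simp
qed

text \<open>Equality of the classes is checked member by member, with no appeal to transitivity of
  \<open>groth_rel\<close>: a witness \<open>j\<close> for one relation, multiplied by an element
  \<open>k\<close> that swallows \<open>cls x\<close>, becomes a witness for the other.\<close>

lemma groth_trivial_iff:
  assumes x: "x \<in> projections B"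
  shows "groth_rel (V_monoid B) `` {(cls x, \<one>\<^bsub>V_monoid B\<^esub>)} =
      groth_rel (V_monoid B) `` {(\<one>\<^bsub>V_monoid B\<^esub>, \<one>\<^bsub>V_monoid B\<^esub>)} \<longleftrightarrow>
    (\<exists>y\<in>projections B. (dsum B x y, y) \<in> mvn B)"
proof -
  interpret M: comm_monoid "V_monoid B" by (rule V_comm_monoid)
  let ?V = "V_monoid B"
  have cx: "cls x \<in> carrier ?V" using x by (auto simp: V_carrier)
  have iff: "(\<exists>k\<in>carrier ?V. cls x \<otimes>\<^bsub>?V\<^esub> k = k) \<longleftrightarrow> (\<exists>y\<in>projections B. (dsum B x y, y) \<in> mvn B)"
    using x by (auto simp: V_carrier V_mult cls_eq_iff dsum_projections)
  show ?thesis unfolding iff[symmetric]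
  proof
    assume "groth_rel ?V `` {(cls x, \<one>\<^bsub>?V\<^esub>)} = groth_rel ?V `` {(\<one>\<^bsub>?V\<^esub>, \<one>\<^bsub>?V\<^esub>)}"
    moreover have "(\<one>\<^bsub>?V\<^esub>, \<one>\<^bsub>?V\<^esub>) \<in> groth_rel ?V `` {(\<one>\<^bsub>?V\<^esub>, \<one>\<^bsub>?V\<^esub>)}"
      by (auto simp: groth_rel_def)
    ultimately have "((cls x, \<one>\<^bsub>?V\<^esub>), (\<one>\<^bsub>?V\<^esub>, \<one>\<^bsub>?V\<^esub>)) \<in> groth_rel ?V" by blast
    then show "\<exists>k\<in>carrier ?V. cls x \<otimes>\<^bsub>?V\<^esub> k = k" using cx by (auto simp: groth_rel_def)
  next
    assume "\<exists>k\<in>carrier ?V. cls x \<otimes>\<^bsub>?V\<^esub> k = k"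
    then obtain k where k: "k \<in> carrier ?V" "cls x \<otimes>\<^bsub>?V\<^esub> k = k" by blast
    have "(\<exists>j\<in>carrier ?V. cls x \<otimes>\<^bsub>?V\<^esub> d \<otimes>\<^bsub>?V\<^esub> j = c \<otimes>\<^bsub>?V\<^esub> \<one>\<^bsub>?V\<^esub> \<otimes>\<^bsub>?V\<^esub> j) \<longleftrightarrow>
        (\<exists>j\<in>carrier ?V. \<one>\<^bsub>?V\<^esub> \<otimes>\<^bsub>?V\<^esub> d \<otimes>\<^bsub>?V\<^esub> j = c \<otimes>\<^bsub>?V\<^esub> \<one>\<^bsub>?V\<^esub> \<otimes>\<^bsub>?V\<^esub> j)"
      if cd: "c \<in> carrier ?V" "d \<in> carrier ?V" for c d
    proof -
      have absorb: "cls x \<otimes>\<^bsub>?V\<^esub> d \<otimes>\<^bsub>?V\<^esub> (j \<otimes>\<^bsub>?V\<^esub> k) = d \<otimes>\<^bsub>?V\<^esub> (j \<otimes>\<^bsub>?V\<^esub> k)" if j: "j \<in> carrier ?V" for j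
      proof -
        have "cls x \<otimes>\<^bsub>?V\<^esub> d \<otimes>\<^bsub>?V\<^esub> (j \<otimes>\<^bsub>?V\<^esub> k) = d \<otimes>\<^bsub>?V\<^esub> (j \<otimes>\<^bsub>?V\<^esub> (cls x \<otimes>\<^bsub>?V\<^esub> k))"
          using cx cd j k(1) by (simp add: M.m_ac)
        then show ?thesis by (simp add: k(2))
      qed
      show ?thesis
      proof
        assume "\<exists>j\<in>carrier ?V. cls x \<otimes>\<^bsub>?V\<^esub> d \<otimes>\<^bsub>?V\<^esub> j = c \<otimes>\<^bsub>?V\<^esub> \<one>\<^bsub>?V\<^esub> \<otimes>\<^bsub>?V\<^esub> j"
        then obtain j where j: "j \<in> carrier ?V" "cls x \<otimes>\<^bsub>?V\<^esub> d \<otimes>\<^bsub>?V\<^esub> j = c \<otimes>\<^bsub>?V\<^esub> j" using cd by auto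
        have "d \<otimes>\<^bsub>?V\<^esub> (j \<otimes>\<^bsub>?V\<^esub> k) = c \<otimes>\<^bsub>?V\<^esub> (j \<otimes>\<^bsub>?V\<^esub> k)"
          using absorb[OF j(1)] j cx cd k(1) by (metis M.m_assoc M.m_closed)
        then show "\<exists>j\<in>carrier ?V. \<one>\<^bsub>?V\<^esub> \<otimes>\<^bsub>?V\<^esub> d \<otimes>\<^bsub>?V\<^esub> j = c \<otimes>\<^bsub>?V\<^esub> \<one>\<^bsub>?V\<^esub> \<otimes>\<^bsub>?V\<^esub> j"
          using cd j k by (intro bexI[of _ "j \<otimes>\<^bsub>?V\<^esub> k"]) auto
      next
        assume "\<exists>j\<in>carrier ?V. \<one>\<^bsub>?V\<^esub> \<otimes>\<^bsub>?V\<^esub> d \<otimes>\<^bsub>?V\<^esub> j = c \<otimes>\<^bsub>?V\<^esub> \<one>\<^bsub>?V\<^esub> \<otimes>\<^bsub>?V\<^esub> j"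
        then obtain j where j: "j \<in> carrier ?V" "d \<otimes>\<^bsub>?V\<^esub> j = c \<otimes>\<^bsub>?V\<^esub> j" using cd by auto
        have "d \<otimes>\<^bsub>?V\<^esub> (j \<otimes>\<^bsub>?V\<^esub> k) = c \<otimes>\<^bsub>?V\<^esub> (j \<otimes>\<^bsub>?V\<^esub> k)"
          using j cx cd k(1) by (metis M.m_assoc)
        then show "\<exists>j\<in>carrier ?V. cls x \<otimes>\<^bsub>?V\<^esub> d \<otimes>\<^bsub>?V\<^esub> j = c \<otimes>\<^bsub>?V\<^esub> \<one>\<^bsub>?V\<^esub> \<otimes>\<^bsub>?V\<^esub> j"
          using cd j k absorb[OF j(1)] by (intro bexI[of _ "j \<otimes>\<^bsub>?V\<^esub> k"]) auto
      qed
    qed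
    note key = this
    have "((cls x, \<one>\<^bsub>?V\<^esub>), (c, d)) \<in> groth_rel ?V \<longleftrightarrow> ((\<one>\<^bsub>?V\<^esub>, \<one>\<^bsub>?V\<^esub>), (c, d)) \<in> groth_rel ?V" for c d
    proof (cases "c \<in> carrier ?V \<and> d \<in> carrier ?V")
      case True
      then show ?thesis using key[of c d] cx unfolding groth_rel_def by simp
    next
      case False
      then show ?thesis by (auto simp: groth_rel_def)
    qed
    then show "groth_rel ?V `` {(cls x, \<one>\<^bsub>?V\<^esub>)} = groth_rel ?V `` {(\<one>\<^bsub>?V\<^esub>, \<one>\<^bsub>?V\<^esub>)}"
      by auto
  qed
qed

end

text \<open>Passing to the kernel changes only the carrier, so the neutral element of
  \<open>K0 A\<close> is that of the Grothendieck group of the unitization.\<close>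

lemma K0_class_trivial_iff:
  assumes "star_ring (unitization A)" and "mat1 (p, 0) \<in> projections (unitization A)"
  shows "K0_class A p = \<one>\<^bsub>K0 A\<^esub> \<longleftrightarrow>
    (\<exists>y\<in>projections (unitization A).
      (dsum (unitization A) (mat1 (p, 0)) y, y) \<in> mvn (unitization A))"
proof -
  interpret star_ring "unitization A" by (rule assms)
  show ?thesis
    using groth_trivial_iff[OF assms(2)]
    by (simp add: K0_class_def K0_def K00_def groth_def cls_def)
qed

subsection \<open>Transport along a partially defined homomorphism\<close>

text \<open>The domain \<open>A1\<close> has to be stable under exactly the operations from which
  matrix products, adjoints and direct sums are formed; these do not involve a unit.\<close>

locale partial_star_hom = A: star_ring A + B: star_ring B
  for A :: "('a, 'y) star_algebra_scheme" and B :: "('b, 'z) star_algebra_scheme" +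
  fixes A1 :: "'a set" and h :: "'a \<Rightarrow> 'b"
  assumes A1_sub: "A1 \<subseteq> carrier A"
    and A1_zero: "\<zero>\<^bsub>A\<^esub> \<in> A1"
    and A1_add: "\<lbrakk>x \<in> A1; y \<in> A1\<rbrakk> \<Longrightarrow> x \<oplus>\<^bsub>A\<^esub> y \<in> A1"
    and A1_mult: "\<lbrakk>x \<in> A1; y \<in> A1\<rbrakk> \<Longrightarrow> x \<otimes>\<^bsub>A\<^esub> y \<in> A1"
    and A1_star: "x \<in> A1 \<Longrightarrow> star A x \<in> A1"
    and h_closed: "x \<in> A1 \<Longrightarrow> h x \<in> carrier B"
    and h_zero: "h \<zero>\<^bsub>A\<^esub> = \<zero>\<^bsub>B\<^esub>"
    and h_add: "\<lbrakk>x \<in> A1; y \<in> A1\<rbrakk> \<Longrightarrow> h (x \<oplus>\<^bsub>A\<^esub> y) = h x \<oplus>\<^bsub>B\<^esub> h y"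
    and h_mult: "\<lbrakk>x \<in> A1; y \<in> A1\<rbrakk> \<Longrightarrow> h (x \<otimes>\<^bsub>A\<^esub> y) = h x \<otimes>\<^bsub>B\<^esub> h y"
    and h_star: "x \<in> A1 \<Longrightarrow> h (star A x) = star B (h x)"
begin

lemma sum_A1:
  assumes "finite I" "\<And>i. i \<in> I \<Longrightarrow> f i \<in> A1"
  shows "finsum A f I \<in> A1 \<and> h (finsum A f I) = (\<Oplus>\<^bsub>B\<^esub>i\<in>I. h (f i))"
  using assms
proof (induction I)
  case empty
  then show ?case using A1_zero h_zero by simp
next
  case (insert i I)
  have c: "f \<in> I \<rightarrow> carrier A" "f i \<in> carrier A" using insert A1_sub by auto
  have hc: "(\<lambda>i. h (f i)) \<in> I \<rightarrow> carrier B" "h (f i) \<in> carrier B" using insert h_closed by auto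
  have IH: "finsum A f I \<in> A1" "h (finsum A f I) = (\<Oplus>\<^bsub>B\<^esub>i\<in>I. h (f i))" using insert by auto
  show ?case
    using insert c hc IH by (simp add: A1_add h_add A.finsum_insert B.finsum_insert)
qed

definition hmat :: "nat \<Rightarrow> nat \<Rightarrow> (nat \<times> nat \<Rightarrow> 'a) \<Rightarrow> nat \<times> nat \<Rightarrow> 'b"
  where "hmat m n x = (\<lambda>(i, j)\<in>{..<m} \<times> {..<n}. h (x (i, j)))"

definition in_A1 :: "nat \<Rightarrow> nat \<Rightarrow> (nat \<times> nat \<Rightarrow> 'a) \<Rightarrow> bool"
  where "in_A1 m n x \<longleftrightarrow> (\<forall>i<m. \<forall>j<n. x (i, j) \<in> A1)"

lemma hmat_apply [simp]: "\<lbrakk>i < m; j < n\<rbrakk> \<Longrightarrow> hmat m n x (i, j) = h (x (i, j))"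
  by (simp add: hmat_def)

lemma hmat_closed: "in_A1 m n x \<Longrightarrow> hmat m n x \<in> mats B m n"
  unfolding hmat_def by (rule B.mats_restrictI) (simp add: in_A1_def h_closed)

lemma hmat_mult:
  assumes "in_A1 m n x" "in_A1 n k y"
  shows "hmat m k (mat_mult A m n k x y) = mat_mult B m n k (hmat m n x) (hmat n k y)"
    and "in_A1 m k (mat_mult A m n k x y)"
proof -
  have e: "x (i, l) \<otimes>\<^bsub>A\<^esub> y (l, j) \<in> A1" if "i < m" "l < n" "j < k" for i j l
    using that assms by (simp add: in_A1_def A1_mult)
  show i1: "in_A1 m k (mat_mult A m n k x y)"
    unfolding in_A1_def using sum_A1[of "{..<n}"] e by simp
  show "hmat m k (mat_mult A m n k x y) = mat_mult B m n k (hmat m n x) (hmat n k y)"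
  proof (rule B.mats_eqI)
    fix i j assume ij: "i < m" "j < k"
    have "h (finsum A (\<lambda>l. x (i, l) \<otimes>\<^bsub>A\<^esub> y (l, j)) {..<n}) = (\<Oplus>\<^bsub>B\<^esub>l\<in>{..<n}. h (x (i, l) \<otimes>\<^bsub>A\<^esub> y (l, j)))"
      using sum_A1[of "{..<n}" "\<lambda>l. x (i, l) \<otimes>\<^bsub>A\<^esub> y (l, j)"] e ij by simp
    also have "\<dots> = (\<Oplus>\<^bsub>B\<^esub>l\<in>{..<n}. hmat m n x (i, l) \<otimes>\<^bsub>B\<^esub> hmat n k y (l, j))"
      using ij assms by (intro B.fsum_cong) (auto simp: h_mult h_closed in_A1_def)
    finally show "hmat m k (mat_mult A m n k x y) (i, j) = mat_mult B m n k (hmat m n x) (hmat n k y) (i, j)"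
      using ij by simp
  qed (use hmat_closed i1 assms in auto)
qed

lemma hmat_star:
  assumes "in_A1 m n x"
  shows "hmat n m (mat_star A m n x) = mat_star B m n (hmat m n x)" "in_A1 n m (mat_star A m n x)"
proof -
  show i1: "in_A1 n m (mat_star A m n x)" using assms A1_star by (simp add: in_A1_def)
  show "hmat n m (mat_star A m n x) = mat_star B m n (hmat m n x)"
    by (rule B.mats_eqI) (use assms i1 hmat_closed h_star in \<open>auto simp: in_A1_def\<close>)
qed

lemma hmat_projection:
  assumes "(n, p) \<in> projections A" "in_A1 n n p"
  shows "(n, hmat n n p) \<in> projections B"
  using A.projectionsD[OF assms(1)] hmat_mult(1)[OF assms(2,2)] hmat_star(1)[OF assms(2)] hmat_closed[OF assms(2)]
  by (simp add: projections_def)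

lemma hmat_mvn:
  assumes "((m, p), (n, q)) \<in> mvn A" "in_A1 m m p" "in_A1 n n q"
    and v: "in_A1 n m v" "mat_mult A m n m (mat_star A n m v) v = p"
    "mat_mult A n m n v (mat_star A n m v) = q"
  shows "((m, hmat m m p), (n, hmat n n q)) \<in> mvn B"
proof (rule B.mvnI)
  show "(m, hmat m m p) \<in> projections B" "(n, hmat n n q) \<in> projections B"
    using assms A.mvn_projections hmat_projection by blast+
  show "hmat n m v \<in> mats B n m" by (rule hmat_closed[OF v(1)])
  show "mat_mult B m n m (mat_star B n m (hmat n m v)) (hmat n m v) = hmat m m p"
    using hmat_mult(1)[OF hmat_star(2)[OF v(1)] v(1)] hmat_star(1)[OF v(1)] v(2) by simp
  show "mat_mult B n m n (hmat n m v) (mat_star B n m (hmat n m v)) = hmat n n q"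
    using hmat_mult(1)[OF v(1) hmat_star(2)[OF v(1)]] hmat_star(1)[OF v(1)] v(3) by simp
qed

lemma hmat_dsum:
  assumes "in_A1 m m p" "in_A1 n n q"
  shows "dsum B (m, hmat m m p) (n, hmat n n q) = (m + n, hmat (m + n) (m + n) (A.bdiag m m n n p q))"
    and "in_A1 (m + n) (m + n) (A.bdiag m m n n p q)"
proof -
  show i1: "in_A1 (m + n) (m + n) (A.bdiag m m n n p q)"
    using assms A1_zero by (auto simp: in_A1_def A.bdiag_apply)
  have "B.bdiag m m n n (hmat m m p) (hmat n n q) = hmat (m + n) (m + n) (A.bdiag m m n n p q)"
    by (rule B.mats_eqI) (use assms i1 hmat_closed h_zero in \<open>auto simp: A.bdiag_apply B.bdiag_apply\<close>)
  then show "dsum B (m, hmat m m p) (n, hmat n n q) = (m + n, hmat (m + n) (m + n) (A.bdiag m m n n p q))"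
    by (simp only: B.dsum_bdiag)
qed

end

text \<open>Only finitely many ring elements enter a Murray--von Neumann equivalence of matrices, so it
  suffices to have homomorphisms defined near every finite subset.\<close>

lemma absorbing_transfer:
  assumes A: "star_ring A" and B: "star_ring B"
    and x: "mat1 a \<in> projections A" and x': "mat1 a' \<in> projections B"
    and loc: "\<And>F. \<lbrakk>finite F; F \<subseteq> carrier A\<rbrakk> \<Longrightarrow> \<exists>A1 h. partial_star_hom A B A1 h \<and> F \<subseteq> A1 \<and>
      (a \<in> A1 \<longrightarrow> mat1 (h a) \<in> projections B \<longrightarrow> (mat1 (h a), mat1 a') \<in> mvn B)"
    and ex: "\<exists>y\<in>projections A. (dsum A (mat1 a) y, y) \<in> mvn A"
  shows "\<exists>y\<in>projections B. (dsum B (mat1 a') y, y) \<in> mvn B"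
proof -
  interpret A: star_ring A by (rule A)
  interpret B: star_ring B by (rule B)
  obtain n q where y: "(n, q) \<in> projections A" "(dsum A (mat1 a) (n, q), (n, q)) \<in> mvn A" using ex by auto
  define p where "p = (\<lambda>(i, j)\<in>{..<1::nat} \<times> {..<1::nat}. a)"
  have m1: "mat1 a = (1, p)" by (simp add: mat1_def p_def)
  have D: "dsum A (mat1 a) (n, q) = (1 + n, A.bdiag 1 1 n n p q)" by (simp only: m1 A.dsum_bdiag)
  obtain v where v: "v \<in> mats A n (1 + n)" 
    "mat_mult A (1 + n) n (1 + n) (mat_star A n (1 + n) v) v = A.bdiag 1 1 n n p q"
    "mat_mult A n (1 + n) n v (mat_star A n (1 + n) v) = q"
    using y(2) unfolding D by (rule A.mvnD)
  have q: "q \<in> mats A n n" using A.projectionsD y(1) by blast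
  have p: "p \<in> mats A 1 1" using A.projectionsD x unfolding m1 by blast
  define F where "F = p ` ({..<1} \<times> {..<1}) \<union> q ` ({..<n} \<times> {..<n}) \<union> v ` ({..<n} \<times> {..<1 + n})"
  have F: "finite F" "F \<subseteq> carrier A" using p q v(1) by (auto simp: F_def mats_def)
  obtain A1 h where h: "partial_star_hom A B A1 h" "F \<subseteq> A1"
      "a \<in> A1 \<longrightarrow> mat1 (h a) \<in> projections B \<longrightarrow> (mat1 (h a), mat1 a') \<in> mvn B"
    using loc[OF F] by blast
  interpret h: partial_star_hom A B A1 h by (rule h(1))
  have i: "h.in_A1 1 1 p" "h.in_A1 n n q" "h.in_A1 n (1 + n) v"
    using h(2) by (auto simp: F_def h.in_A1_def)
  have aA1: "a \<in> A1" using i(1) by (simp add: h.in_A1_def p_def)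
  have hp: "(1, h.hmat 1 1 p) = mat1 (h a)"
    unfolding mat1_def h.hmat_def by (auto simp: p_def restrict_def)
  have P1: "mat1 (h a) \<in> projections B" using h.hmat_projection[of 1 p] x m1 i(1) hp by simp
  have Pq: "(n, h.hmat n n q) \<in> projections B" using h.hmat_projection y(1) i(2) by blast
  have 1: "(mat1 a', mat1 (h a)) \<in> mvn B" using h(3) aA1 P1 B.mvn_sym by blast
  have "((1 + n, h.hmat (1 + n) (1 + n) (A.bdiag 1 1 n n p q)), (n, h.hmat n n q)) \<in> mvn B"
    by (rule h.hmat_mvn[OF _ h.hmat_dsum(2)[OF i(1,2)] i(2,3) v(2,3)]) (use y(2) in \<open>simp only: D\<close>)
  then have 2: "(dsum B (mat1 (h a)) (n, h.hmat n n q), (n, h.hmat n n q)) \<in> mvn B"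
    unfolding hp[symmetric] h.hmat_dsum(1)[OF i(1,2)] .
  \<comment> \<open>The transported identity speaks of \<open>h a\<close>; adding the same summand
    to both sides of \<open>a' ~ h a\<close> replaces it by \<open>a'\<close>.\<close>
  have "(dsum B (mat1 a') (n, h.hmat n n q), (n, h.hmat n n q)) \<in> mvn B"
    by (rule B.mvn_trans[OF B.dsum_mvn[OF 1 B.mvn_refl[OF Pq]] 2])
  then show ?thesis using Pq by blast
qed

section \<open>Operator algebras on a Hilbert space\<close>

text \<open>The operations of \<open>roe\<close> with a free carrier: both Roe algebras are
  instances once their carriers are described by cells.\<close>

definition op_algebra :: "('v, 'z) ip_space_scheme \<Rightarrow> ('v \<Rightarrow> 'v) set \<Rightarrow> ('v \<Rightarrow> 'v) star_algebra"
  where "op_algebra V \<A> = \<lparr>carrier = \<A>, mult = op_mult V, one = op_id V, zero = op_zero V,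
    add = op_add V, smult = op_scale V, star = adjoint V\<rparr>"

locale op_star_algebra = hilb V for V :: "('v, 'z) ip_space_scheme" (structure) +
  fixes \<A> :: "('v \<Rightarrow> 'v) set"
  assumes alg_bounded: "T \<in> \<A> \<Longrightarrow> T \<in> bounded_ops V"
    and alg_zero: "op_zero V \<in> \<A>"
    and alg_add: "\<lbrakk>S \<in> \<A>; T \<in> \<A>\<rbrakk> \<Longrightarrow> op_add V S T \<in> \<A>"
    and alg_mult: "\<lbrakk>S \<in> \<A>; T \<in> \<A>\<rbrakk> \<Longrightarrow> op_mult V S T \<in> \<A>"
    and alg_scale: "T \<in> \<A> \<Longrightarrow> op_scale V c T \<in> \<A>"
    and alg_adjoint: "T \<in> \<A> \<Longrightarrow> adjoint V T \<in> \<A>"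
begin

abbreviation "Au \<equiv> unitization (op_algebra V \<A>)"

lemma Au_carrier: "carrier Au = \<A> \<times> UNIV"
  by (simp add: unitization_def op_algebra_def)

lemma Au_simps:
  "\<zero>\<^bsub>Au\<^esub> = (op_zero V, 0)" "\<one>\<^bsub>Au\<^esub> = (op_zero V, 1)"
  "(S, s) \<oplus>\<^bsub>Au\<^esub> (T, t) = (op_add V S T, s + t)"
  "(S, s) \<otimes>\<^bsub>Au\<^esub> (T, t) = (op_add V (op_add V (op_mult V S T) (op_scale V s T)) (op_scale V t S), s * t)"
  "star Au (S, s) = (adjoint V S, cnj s)"
  by (simp_all add: unitization_def op_algebra_def)

lemmas alg_simps = alg_bounded bo_closed bo_add bo_smult bo_zero

text \<open>Each axiom splits into an identity of scalars and one of operators, the latter being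
  verified by inner products.\<close>

lemma Au_ring: "ring Au"
proof (rule ringI)
  show "abelian_group Au"
  proof (rule abelian_groupI)
    fix x assume x: "x \<in> carrier Au"
    obtain S s where [simp]: "x = (S, s)" by (cases x)
    have S: "S \<in> \<A>" using x by (simp add: Au_carrier)
    have "op_add V (op_scale V (-1) S) S = op_zero V"
      by (rule bo_eqI) (use S in \<open>simp_all add: alg_simps\<close>)
    then show "\<exists>y\<in>carrier Au. y \<oplus>\<^bsub>Au\<^esub> x = \<zero>\<^bsub>Au\<^esub>"
      using S alg_scale by (intro bexI[of _ "(op_scale V (-1) S, - s)"]) (auto simp: Au_simps Au_carrier)
    have "op_add V (op_zero V) S = S" by (rule bo_eqI) (use S in \<open>simp_all add: alg_simps\<close>)
    then show "\<zero>\<^bsub>Au\<^esub> \<oplus>\<^bsub>Au\<^esub> x = x" by (simp add: Au_simps)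
  next
    fix x y assume xy: "x \<in> carrier Au" "y \<in> carrier Au"
    obtain S s T t where [simp]: "x = (S, s)" "y = (T, t)" by (cases x; cases y)
    have ST: "S \<in> \<A>" "T \<in> \<A>" using xy by (simp_all add: Au_carrier)
    show "x \<oplus>\<^bsub>Au\<^esub> y \<in> carrier Au" using ST by (simp add: Au_simps Au_carrier alg_add)
    have "op_add V S T = op_add V T S" by (rule bo_eqI) (use ST in \<open>simp_all add: alg_simps\<close>)
    then show "x \<oplus>\<^bsub>Au\<^esub> y = y \<oplus>\<^bsub>Au\<^esub> x" by (simp add: Au_simps)
    fix z assume z: "z \<in> carrier Au"
    obtain R r where [simp]: "z = (R, r)" by (cases z)
    have R: "R \<in> \<A>" using z by (simp add: Au_carrier)
    have "op_add V (op_add V S T) R = op_add V S (op_add V T R)"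
      by (rule bo_eqI) (use ST R in \<open>simp_all add: alg_simps\<close>)
    then show "x \<oplus>\<^bsub>Au\<^esub> y \<oplus>\<^bsub>Au\<^esub> z = x \<oplus>\<^bsub>Au\<^esub> (y \<oplus>\<^bsub>Au\<^esub> z)" by (simp add: Au_simps)
  qed (simp add: Au_simps Au_carrier alg_zero)
  show "monoid Au"
  proof (rule monoidI)
    fix x assume x: "x \<in> carrier Au"
    obtain S s where [simp]: "x = (S, s)" by (cases x)
    have S: "S \<in> \<A>" using x by (simp add: Au_carrier)
    have "op_add V (op_add V (op_mult V (op_zero V) S) (op_scale V 1 S)) (op_scale V s (op_zero V)) = S"
      by (rule bo_eqI) (use S in \<open>simp_all add: alg_simps\<close>)
    then show "\<one>\<^bsub>Au\<^esub> \<otimes>\<^bsub>Au\<^esub> x = x" by (simp add: Au_simps)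
    have "op_add V (op_add V (op_mult V S (op_zero V)) (op_scale V s (op_zero V))) (op_scale V 1 S) = S"
      by (rule bo_eqI) (use S in \<open>simp_all add: alg_simps\<close>)
    then show "x \<otimes>\<^bsub>Au\<^esub> \<one>\<^bsub>Au\<^esub> = x" by (simp add: Au_simps)
  next
    fix x y assume xy: "x \<in> carrier Au" "y \<in> carrier Au"
    obtain S s T t where [simp]: "x = (S, s)" "y = (T, t)" by (cases x; cases y)
    have ST: "S \<in> \<A>" "T \<in> \<A>" using xy by (simp_all add: Au_carrier)
    show "x \<otimes>\<^bsub>Au\<^esub> y \<in> carrier Au" using ST by (simp add: Au_simps Au_carrier alg_add alg_mult alg_scale)
    fix z assume z: "z \<in> carrier Au"
    obtain R r where [simp]: "z = (R, r)" by (cases z)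
    have R: "R \<in> \<A>" using z by (simp add: Au_carrier)
    show "x \<otimes>\<^bsub>Au\<^esub> y \<otimes>\<^bsub>Au\<^esub> z = x \<otimes>\<^bsub>Au\<^esub> (y \<otimes>\<^bsub>Au\<^esub> z)"
      by (simp add: Au_simps, rule bo_eqI) (use ST R in \<open>simp_all add: alg_simps algebra_simps\<close>)
  qed (simp add: Au_simps Au_carrier alg_zero)
next
  fix x y z assume xyz: "x \<in> carrier Au" "y \<in> carrier Au" "z \<in> carrier Au"
  obtain S s T t R r where [simp]: "x = (S, s)" "y = (T, t)" "z = (R, r)" by (cases x; cases y; cases z)
  have STR: "S \<in> \<A>" "T \<in> \<A>" "R \<in> \<A>" using xyz by (simp_all add: Au_carrier)
  show "(x \<oplus>\<^bsub>Au\<^esub> y) \<otimes>\<^bsub>Au\<^esub> z = x \<otimes>\<^bsub>Au\<^esub> z \<oplus>\<^bsub>Au\<^esub> y \<otimes>\<^bsub>Au\<^esub> z"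
    by (simp add: Au_simps algebra_simps, rule bo_eqI) (use STR in \<open>simp_all add: alg_simps algebra_simps\<close>)
  show "z \<otimes>\<^bsub>Au\<^esub> (x \<oplus>\<^bsub>Au\<^esub> y) = z \<otimes>\<^bsub>Au\<^esub> x \<oplus>\<^bsub>Au\<^esub> z \<otimes>\<^bsub>Au\<^esub> y"
    by (simp add: Au_simps algebra_simps, rule bo_eqI) (use STR in \<open>simp_all add: alg_simps algebra_simps\<close>)
qed

sublocale U: star_ring Au
proof (rule star_ring.intro[OF Au_ring], unfold_locales)
  fix x assume x: "x \<in> carrier Au"
  obtain S s where [simp]: "x = (S, s)" by (cases x)
  have S: "S \<in> \<A>" using x by (simp add: Au_carrier)
  show "star Au x \<in> carrier Au" using S by (simp add: Au_simps Au_carrier alg_adjoint)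
  show "star Au (star Au x) = x" using S by (simp add: Au_simps adjoint_adjoint alg_bounded)
  fix y assume y: "y \<in> carrier Au"
  obtain T t where [simp]: "y = (T, t)" by (cases y)
  have T: "T \<in> \<A>" using y by (simp add: Au_carrier)
  show "star Au (x \<oplus>\<^bsub>Au\<^esub> y) = star Au x \<oplus>\<^bsub>Au\<^esub> star Au y"
    using S T by (simp add: Au_simps adjoint_add alg_bounded)
  show "star Au (x \<otimes>\<^bsub>Au\<^esub> y) = star Au y \<otimes>\<^bsub>Au\<^esub> star Au x"
    using S T
    by (simp add: Au_simps adjoint_add adjoint_mult adjoint_scale alg_bounded, intro conjI bo_eqI)
       (simp_all add: alg_simps alg_adjoint algebra_simps)
qed

lemma Au_mult_0:
  assumes "S \<in> \<A>" "T \<in> \<A>"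
  shows "(S, 0) \<otimes>\<^bsub>Au\<^esub> (T, 0) = (op_mult V S T, 0)"
proof -
  have "op_add V (op_add V (op_mult V S T) (op_scale V 0 T)) (op_scale V 0 S) = op_mult V S T"
    by (rule bo_eqI) (use assms in \<open>simp_all add: alg_simps\<close>)
  then show ?thesis by (simp add: Au_simps)
qed

lemma mat1_projection:
  assumes "T \<in> \<A>" "op_mult V T T = T" "adjoint V T = T"
  shows "mat1 (T, 0) \<in> projections Au"
proof (rule U.mat1_projections)
  show "(T, 0) \<otimes>\<^bsub>Au\<^esub> (T, 0) = (T, 0)" unfolding Au_mult_0[OF assms(1,1)] assms(2) ..
qed (use assms in \<open>simp_all add: Au_carrier Au_simps\<close>)

end

section \<open>Geometric modules over a discrete space\<close>

text \<open>\<open>P d\<close> is the projection onto the part of the module over \<open>d\<close>: multiplication by the indicator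
  function of a cell for \<open>L\<^sup>2(X)\<close>, evaluation at the point \<open>d\<close> for \<open>\<ell>\<^sup>2(D) \<otimes> H\<close>.\<close>

locale gmod = hilb V for V :: "('v, 'z) ip_space_scheme" (structure) +
  fixes P :: "'d::metric_space \<Rightarrow> 'v \<Rightarrow> 'v" and D :: "'d set"
  assumes P_bounded [simp]: "d \<in> D \<Longrightarrow> P d \<in> bounded_ops V"
    and P_adj: "\<lbrakk>d \<in> D; u \<in> carrier V; v \<in> carrier V\<rbrakk> \<Longrightarrow> ip V (P d u) v = ip V u (P d v)"
    and P_idem [simp]: "\<lbrakk>d \<in> D; v \<in> carrier V\<rbrakk> \<Longrightarrow> P d (P d v) = P d v"
    and P_orth: "\<lbrakk>d \<in> D; d' \<in> D; d \<noteq> d'; v \<in> carrier V\<rbrakk> \<Longrightarrow> P d (P d' v) = \<zero>"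
    and P_total: "\<lbrakk>u \<in> carrier V; v \<in> carrier V; \<And>d. d \<in> D \<Longrightarrow> P d u = \<zero> \<or> P d v = \<zero>\<rbrakk> \<Longrightarrow> ip V u v = 0"
    and balls_finite: "\<And>x r. finite {d \<in> D. dist x d \<le> r}"
begin

lemma P_closed [simp]: "\<lbrakk>d \<in> D; v \<in> carrier V\<rbrakk> \<Longrightarrow> P d v \<in> carrier V"
  by (rule bo_closed) simp_all

lemma P_adjoint: "d \<in> D \<Longrightarrow> adjoint V (P d) = P d"
  by (rule adjointI) (simp_all add: P_adj)

text \<open>The axiom \<open>P_total\<close> with \<open>u = v\<close>. That axiom stands in for the
  \<open>P d\<close> summing up to the identity and spares a sum over all cells.\<close>

lemma P_eq_zero: "\<lbrakk>v \<in> carrier V; \<And>d. d \<in> D \<Longrightarrow> P d v = \<zero>\<rbrakk> \<Longrightarrow> v = \<zero>"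
  using P_total[of v v] by (intro hnorm_eq_0) (simp_all add: hnorm_def)

definition propagation_le :: "('v \<Rightarrow> 'v) \<Rightarrow> real \<Rightarrow> bool"
  where "propagation_le S R \<longleftrightarrow>
    (\<forall>d\<in>D. \<forall>d'\<in>D. dist d d' > R \<longrightarrow> (\<forall>v\<in>carrier V. P d (S (P d' v)) = \<zero>))"

text \<open>Local compactness and finite propagation seen through the projections onto single cells;
  \<open>nice_iff\<close> identifies this with their description by \<open>C0\<close>
  functions.\<close>

definition nice :: "('v \<Rightarrow> 'v) \<Rightarrow> bool"
  where "nice S \<longleftrightarrow> S \<in> bounded_ops V \<and>
    (\<forall>d\<in>D. compact_op V (op_mult V (P d) S) \<and> compact_op V (op_mult V S (P d))) \<and>
    (\<exists>R. propagation_le S R)"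

definition roe_set :: "('v \<Rightarrow> 'v) set"
  where "roe_set = {T \<in> bounded_ops V. \<forall>\<epsilon>>0. \<exists>S. nice S \<and>
    (\<forall>v\<in>carrier V. hnorm V (vsub V (T v) (S v)) \<le> \<epsilon> * hnorm V v)}"

lemma nice_bounded: "nice S \<Longrightarrow> S \<in> bounded_ops V"
  by (simp add: nice_def)

lemma nice_compact:
  assumes "nice S" "d \<in> D"
  shows "compact_op V (op_mult V (P d) S)" "compact_op V (op_mult V S (P d))"
  using assms by (simp_all add: nice_def)

lemma nice_roe: "nice S \<Longrightarrow> S \<in> roe_set"
  unfolding roe_set_def nice_def by (auto intro!: exI[of _ S] simp: bo_closed mult_nonneg_nonneg)

lemma nice_zero: "nice (op_zero V)"
  by (simp add: nice_def propagation_le_def bo_zero)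

lemma op_mult_distrib:
  "\<lbrakk>R \<in> bounded_ops V; S \<in> bounded_ops V; T \<in> bounded_ops V\<rbrakk> \<Longrightarrow>
    op_mult V R (op_add V S T) = op_add V (op_mult V R S) (op_mult V R T)"
  "\<lbrakk>R \<in> bounded_ops V; S \<in> bounded_ops V; T \<in> bounded_ops V\<rbrakk> \<Longrightarrow>
    op_mult V (op_add V S T) R = op_add V (op_mult V S R) (op_mult V T R)"
  by (rule bo_eqI; simp add: bo_closed bo_add)+

lemma propagation_mono: "propagation_le S R \<Longrightarrow> R \<le> R' \<Longrightarrow> propagation_le S R'"
  unfolding propagation_le_def by force

lemma nice_add:
  assumes S: "nice S" and T: "nice T"
  shows "nice (op_add V S T)"
proof -
  have b: "S \<in> bounded_ops V" "T \<in> bounded_ops V" using S T nice_bounded by auto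
  obtain R R' where "propagation_le S R" "propagation_le T R'" using S T unfolding nice_def by blast
  then have p: "propagation_le S (max R R')" "propagation_le T (max R R')"
    using propagation_mono max.cobounded1 max.cobounded2 by blast+
  have zz: "\<zero> \<oplus> \<zero> = \<zero>" by simp
  have "propagation_le (op_add V S T) (max R R')"
    unfolding propagation_le_def
  proof (intro ballI impI)
    fix d d' v assume d: "d \<in> D" "d' \<in> D" "max R R' < dist d d'" "v \<in> carrier V"
    then have "P d (S (P d' v)) = \<zero>" "P d (T (P d' v)) = \<zero>" using p unfolding propagation_le_def by blast+
    then show "P d (op_add V S T (P d' v)) = \<zero>"
      using d b by (simp add: bo_add bo_closed)
  qed
  moreover have "compact_op V (op_mult V (P d) (op_add V S T)) \<and> compact_op V (op_mult V (op_add V S T) (P d))"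
    if d: "d \<in> D" for d
    using S T d b by (simp add: op_mult_distrib nice_def compact_op_add)
  ultimately show ?thesis using b unfolding nice_def by blast
qed

lemma nice_adjoint:
  assumes S: "nice S"
  shows "nice (adjoint V S)"
proof -
  have b: "S \<in> bounded_ops V" using S nice_bounded by auto
  obtain R where p: "propagation_le S R" using S unfolding nice_def by blast
  have "propagation_le (adjoint V S) R"
    unfolding propagation_le_def
  proof (intro ballI impI)
    fix d d' v assume d: "d \<in> D" "d' \<in> D" "R < dist d d'" "v \<in> carrier V"
    show "P d (adjoint V S (P d' v)) = \<zero>"
    proof (rule ip_eqI)
      fix u assume u: "u \<in> carrier V"
      have z: "P d' (S (P d u)) = \<zero>" using p d u unfolding propagation_le_def by (metis dist_commute)
      have "ip V u (P d (adjoint V S (P d' v))) = ip V (P d u) (adjoint V S (P d' v))"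
        by (rule P_adj[symmetric]) (use d u b in \<open>simp_all add: adjoint_closed\<close>)
      also have "\<dots> = ip V (S (P d u)) (P d' v)" by (rule ip_adjoint_right[OF b]) (use d u in simp_all)
      also have "\<dots> = ip V (P d' (S (P d u))) v" by (rule P_adj[symmetric]) (use d u b in \<open>simp_all add: bo_closed\<close>)
      finally show "ip V u (P d (adjoint V S (P d' v))) = ip V u \<zero>" using z u d by simp
    qed (use d b in \<open>simp_all add: adjoint_closed\<close>)
  qed
  moreover have "compact_op V (op_mult V (P d) (adjoint V S)) \<and> compact_op V (op_mult V (adjoint V S) (P d))"
    if d: "d \<in> D" for d
  proof -
    have "op_mult V (P d) (adjoint V S) = adjoint V (op_mult V S (P d))"
      "op_mult V (adjoint V S) (P d) = adjoint V (op_mult V (P d) S)"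
      using b d by (simp_all add: adjoint_mult P_adjoint)
    then show ?thesis using S d compact_op_adjoint unfolding nice_def by auto
  qed
  ultimately show ?thesis using b unfolding nice_def by blast
qed

text \<open>Matrix entries of the product are inner products of \<open>S* P d u\<close> and
  \<open>T P d' v\<close>. If \<open>d\<close> and \<open>d'\<close> are far apart, no cell can be
  near both, so the two vectors live over disjoint sets of cells and \<open>P_total\<close> applies.
  For this the propagation of the adjoint of \<open>S\<close> is needed.\<close>

lemma nice_mult:
  assumes S: "nice S" and T: "nice T"
  shows "nice (op_mult V S T)"
proof -
  have b: "S \<in> bounded_ops V" "T \<in> bounded_ops V" using S T nice_bounded by auto
  obtain R where pS: "propagation_le S R" using S unfolding nice_def by blast
  obtain R' where pT: "propagation_le T R'" using T unfolding nice_def by blast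
  obtain R'' where pA: "propagation_le (adjoint V S) R''" using nice_adjoint[OF S] unfolding nice_def by blast
  have "propagation_le (op_mult V S T) (R'' + R')"
    unfolding propagation_le_def
  proof (intro ballI impI)
    fix d d' v assume d: "d \<in> D" "d' \<in> D" "R'' + R' < dist d d'" "v \<in> carrier V"
    show "P d (op_mult V S T (P d' v)) = \<zero>"
    proof (rule ip_eqI)
      fix u assume u: "u \<in> carrier V"
      have "ip V u (P d (op_mult V S T (P d' v))) = ip V (P d u) (S (T (P d' v)))"
        using d u b by (subst P_adj) (simp_all add: bo_closed)
      also have "\<dots> = ip V (adjoint V S (P d u)) (T (P d' v))"
        by (rule ip_adjoint_left[OF b(1), symmetric]) (use d u b in \<open>simp_all add: bo_closed\<close>)
      also have "\<dots> = 0"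
      proof (rule P_total)
        fix e assume e: "e \<in> D"
        have "dist d d' \<le> dist d e + dist e d'" by (rule dist_triangle)
        then have "R'' < dist e d \<or> R' < dist e d'" using d(3) by (auto simp: dist_commute)
        then show "P e (adjoint V S (P d u)) = \<zero> \<or> P e (T (P d' v)) = \<zero>"
          using pA pT d u e unfolding propagation_le_def by blast
      qed (use d u b in \<open>simp_all add: bo_closed adjoint_closed\<close>)
      finally show "ip V u (P d (op_mult V S T (P d' v))) = ip V u \<zero>" using u by simp
    qed (use d b in \<open>simp_all add: bo_closed\<close>)
  qed
  moreover have "compact_op V (op_mult V (P d) (op_mult V S T)) \<and> compact_op V (op_mult V (op_mult V S T) (P d))"
    if d: "d \<in> D" for d
  proof -
    have 1: "compact_op V (op_mult V (op_mult V (P d) S) T)"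
      by (rule compact_op_mult_right[OF nice_compact(1)[OF S d] b(2)])
    have 2: "compact_op V (op_mult V S (op_mult V T (P d)))"
      by (rule compact_op_mult_left[OF nice_compact(2)[OF T d] b(1)])
    show ?thesis using 1 2 b d by (simp add: op_mult_assoc)
  qed
  ultimately show ?thesis using b unfolding nice_def by blast
qed

lemma nice_scale:
  assumes S: "nice S"
  shows "nice (op_scale V c S)"
proof -
  have b: "S \<in> bounded_ops V" using S nice_bounded by auto
  obtain R where p: "propagation_le S R" using S unfolding nice_def by blast
  have cz: "c \<odot> \<zero> = \<zero>" by (rule ip_eqI) simp_all
  have "propagation_le (op_scale V c S) R"
    using p b cz unfolding propagation_le_def by (simp add: bo_smult bo_closed)
  moreover have "compact_op V (op_mult V (P d) (op_scale V c S)) \<and> compact_op V (op_mult V (op_scale V c S) (P d))"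
    if d: "d \<in> D" for d
  proof -
    have "op_mult V (P d) (op_scale V c S) = op_mult V (op_scale V c (op_id V)) (op_mult V (P d) S)"
      "op_mult V (op_scale V c S) (P d) = op_mult V (op_scale V c (op_id V)) (op_mult V S (P d))"
      by (rule bo_eqI; use b d in \<open>simp add: bo_closed bo_smult\<close>)+
    then show ?thesis
      using compact_op_mult_left[OF nice_compact(1)[OF S d], of "op_scale V c (op_id V)"]
        compact_op_mult_left[OF nice_compact(2)[OF S d], of "op_scale V c (op_id V)"] by simp
  qed
  ultimately show ?thesis using b unfolding nice_def by blast
qed

lemma roe_setD:
  assumes "T \<in> roe_set" "\<epsilon> > 0"
  obtains S where "nice S" "\<And>v. v \<in> carrier V \<Longrightarrow> hnorm V (vsub V (T v) (S v)) \<le> \<epsilon> * hnorm V v"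
  using assms unfolding roe_set_def by blast

lemma roe_bounded: "T \<in> roe_set \<Longrightarrow> T \<in> bounded_ops V"
  by (simp add: roe_set_def)

lemma roe_setI:
  assumes "T \<in> bounded_ops V"
    "\<And>\<epsilon>. \<epsilon> > 0 \<Longrightarrow> \<exists>S. nice S \<and> (\<forall>v\<in>carrier V. hnorm V (vsub V (T v) (S v)) \<le> \<epsilon> * hnorm V v)"
  shows "T \<in> roe_set"
  using assms by (simp add: roe_set_def)

sublocale op_star_algebra V roe_set
proof
  fix T assume T: "T \<in> roe_set"
  show Tb: "T \<in> bounded_ops V" by (rule roe_bounded[OF T])
  show "adjoint V T \<in> roe_set"
  proof (rule roe_setI)
    fix \<epsilon> :: real assume e: "\<epsilon> > 0"
    obtain S where S: "nice S" "\<And>v. v \<in> carrier V \<Longrightarrow> hnorm V (vsub V (T v) (S v)) \<le> \<epsilon> * hnorm V v"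
      using roe_setD[OF T e] by blast
    have Sb: "S \<in> bounded_ops V" by (rule nice_bounded[OF S(1)])
    define Q where "Q = op_add V T (op_scale V (-1) S)"
    have Qb: "Q \<in> bounded_ops V" using Tb Sb by (simp add: Q_def)
    have Qv: "Q v = vsub V (T v) (S v)" if "v \<in> carrier V" for v using that by (simp add: Q_def vsub_def)
    have "hnorm V (adjoint V Q v) \<le> \<epsilon> * hnorm V v" if "v \<in> carrier V" for v
      by (rule adjoint_norm_le[OF Qb]) (use e S(2) that in \<open>auto simp: Qv\<close>)
    moreover have "adjoint V Q v = vsub V (adjoint V T v) (adjoint V S v)" if "v \<in> carrier V" for v
      using Tb Sb that by (simp add: Q_def adjoint_add adjoint_scale vsub_def)
    ultimately show "\<exists>S. nice S \<and> (\<forall>v\<in>carrier V. hnorm V (vsub V (adjoint V T v) (S v)) \<le> \<epsilon> * hnorm V v)"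
      using nice_adjoint[OF S(1)] by (intro exI[of _ "adjoint V S"]) simp
  qed (use Tb in simp)
  show "op_scale V c T \<in> roe_set" for c
  proof (rule roe_setI)
    fix \<epsilon> :: real assume e: "\<epsilon> > 0"
    \<comment> \<open>The added 1 covers \<open>c = 0\<close>.\<close>
    define \<delta> where "\<delta> = \<epsilon> / (cmod c + 1)"
    have c1: "cmod c + 1 > 0" using norm_ge_zero[of c] by linarith
    have d: "\<delta> > 0" using e c1 by (simp add: \<delta>_def)
    have cd: "cmod c * \<delta> \<le> \<epsilon>" using e c1 by (simp add: \<delta>_def field_simps)
    obtain S where S: "nice S" "\<And>v. v \<in> carrier V \<Longrightarrow> hnorm V (vsub V (T v) (S v)) \<le> \<delta> * hnorm V v"
      using roe_setD[OF T d] by blast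
    have Sb: "S \<in> bounded_ops V" by (rule nice_bounded[OF S(1)])
    have "hnorm V (vsub V (op_scale V c T v) (op_scale V c S v)) \<le> \<epsilon> * hnorm V v" if v: "v \<in> carrier V" for v
    proof -
      have cl: "T v \<in> carrier V" "S v \<in> carrier V" using v Tb Sb bo_closed by auto
      have "vsub V (c \<odot> T v) (c \<odot> S v) = c \<odot> vsub V (T v) (S v)"
        by (rule ip_eqI) (use cl in \<open>simp_all add: algebra_simps\<close>)
      then have "hnorm V (vsub V (op_scale V c T v) (op_scale V c S v)) = cmod c * hnorm V (vsub V (T v) (S v))"
        using v cl by simp
      also have "\<dots> \<le> cmod c * (\<delta> * hnorm V v)" by (rule mult_left_mono[OF S(2)[OF v]]) simp
      also have "\<dots> = (cmod c * \<delta>) * hnorm V v" by simp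
      also have "\<dots> \<le> \<epsilon> * hnorm V v" by (rule mult_right_mono[OF cd]) (use v in simp)
      finally show ?thesis .
    qed
    then show "\<exists>S. nice S \<and> (\<forall>v\<in>carrier V. hnorm V (vsub V (op_scale V c T v) (S v)) \<le> \<epsilon> * hnorm V v)"
      using nice_scale[OF S(1)] by blast
  qed (use Tb in simp)
  fix T' assume T': "T' \<in> roe_set"
  have Tb': "T' \<in> bounded_ops V" by (rule roe_bounded[OF T'])
  show "op_add V T T' \<in> roe_set"
  proof (rule roe_setI)
    fix \<epsilon> :: real assume e: "\<epsilon> > 0"
    then have e2: "\<epsilon> / 2 > 0" by simp
    obtain S where S: "nice S" "\<And>v. v \<in> carrier V \<Longrightarrow> hnorm V (vsub V (T v) (S v)) \<le> \<epsilon> / 2 * hnorm V v"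
      using roe_setD[OF T e2] by blast
    obtain S' where S': "nice S'" "\<And>v. v \<in> carrier V \<Longrightarrow> hnorm V (vsub V (T' v) (S' v)) \<le> \<epsilon> / 2 * hnorm V v"
      using roe_setD[OF T' e2] by blast
    have Sb: "S \<in> bounded_ops V" "S' \<in> bounded_ops V" using S S' nice_bounded by auto
    have "hnorm V (vsub V (op_add V T T' v) (op_add V S S' v)) \<le> \<epsilon> * hnorm V v" if v: "v \<in> carrier V" for v
    proof -
      have cl: "T v \<in> carrier V" "S v \<in> carrier V" "T' v \<in> carrier V" "S' v \<in> carrier V"
        using v Tb Tb' Sb bo_closed by auto
      have "vsub V (T v \<oplus> T' v) (S v \<oplus> S' v) = vsub V (T v) (S v) \<oplus> vsub V (T' v) (S' v)"
        by (rule ip_eqI) (use cl in \<open>simp_all add: algebra_simps\<close>)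
      then have "hnorm V (vsub V (op_add V T T' v) (op_add V S S' v)) \<le>
          hnorm V (vsub V (T v) (S v)) + hnorm V (vsub V (T' v) (S' v))"
        using v cl hnorm_triangle[of "vsub V (T v) (S v)" "vsub V (T' v) (S' v)"] by simp
      then show ?thesis using S(2)[OF v] S'(2)[OF v] by simp
    qed
    then show "\<exists>S. nice S \<and> (\<forall>v\<in>carrier V. hnorm V (vsub V (op_add V T T' v) (S v)) \<le> \<epsilon> * hnorm V v)"
      using nice_add[OF S(1) S'(1)] by blast
  qed (use Tb Tb' in simp)
  show "op_mult V T T' \<in> roe_set"
  proof (rule roe_setI)
    fix \<epsilon> :: real assume e: "\<epsilon> > 0"
    obtain A where A: "A \<ge> 0" "\<And>v. v \<in> carrier V \<Longrightarrow> hnorm V (T v) \<le> A * hnorm V v"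
      using bo_bound[OF Tb] by blast
    obtain B where B: "B \<ge> 0" "\<And>v. v \<in> carrier V \<Longrightarrow> hnorm V (T' v) \<le> B * hnorm V v"
      using bo_bound[OF Tb'] by blast
    \<comment> \<open>From \<open>T T' - S S' = T (T' - S') + (T - S) S'\<close> the error is at
      most \<open>\<delta> (A + B + 1)\<close>; the cap at 1 serves to bound the norm of
      \<open>S'\<close> by \<open>B + 1\<close>.\<close>
    define \<delta> where "\<delta> = min 1 (\<epsilon> / (A + B + 1))"
    have d: "\<delta> > 0" "\<delta> \<le> 1" using e A(1) B(1) by (auto simp: \<delta>_def)
    have "\<delta> * (A + B + 1) \<le> \<epsilon> / (A + B + 1) * (A + B + 1)"
      using A(1) B(1) by (intro mult_right_mono) (auto simp: \<delta>_def)
    then have dAB: "\<delta> * (A + B + 1) \<le> \<epsilon>" using A(1) B(1) by simp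
    obtain S where S: "nice S" "\<And>v. v \<in> carrier V \<Longrightarrow> hnorm V (vsub V (T v) (S v)) \<le> \<delta> * hnorm V v"
      using roe_setD[OF T d(1)] by blast
    obtain S' where S': "nice S'" "\<And>v. v \<in> carrier V \<Longrightarrow> hnorm V (vsub V (T' v) (S' v)) \<le> \<delta> * hnorm V v"
      using roe_setD[OF T' d(1)] by blast
    have Sb: "S \<in> bounded_ops V" "S' \<in> bounded_ops V" using S S' nice_bounded by auto
    have "hnorm V (vsub V (op_mult V T T' v) (op_mult V S S' v)) \<le> \<epsilon> * hnorm V v" if v: "v \<in> carrier V" for v
    proof -
      have cl: "T' v \<in> carrier V" "S' v \<in> carrier V" using v Tb' Sb bo_closed by auto
      have cl2: "T (T' v) \<in> carrier V" "T (S' v) \<in> carrier V" "S (S' v) \<in> carrier V"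
        using cl Tb Sb bo_closed by auto
      have nv: "hnorm V v \<ge> 0" using v by simp
      have 1: "hnorm V (vsub V (T (T' v)) (T (S' v))) \<le> A * (\<delta> * hnorm V v)"
        using A(2)[of "vsub V (T' v) (S' v)"] cl mult_left_mono[OF S'(2)[OF v] A(1)]
        by (simp add: bo_vsub[OF Tb])
      have "hnorm V (S' v) \<le> hnorm V (T' v) + hnorm V (vsub V (S' v) (T' v))" by (rule hnorm_le_add[OF cl(2,1)])
      also have "\<dots> \<le> B * hnorm V v + 1 * hnorm V v"
        using B(2)[OF v] S'(2)[OF v] hnorm_vsub_commute[OF cl(2,1)] mult_right_mono[OF d(2) nv] by linarith
      finally have "hnorm V (S' v) \<le> (B + 1) * hnorm V v" by (simp add: algebra_simps)
      then have 2: "hnorm V (vsub V (T (S' v)) (S (S' v))) \<le> \<delta> * ((B + 1) * hnorm V v)"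
        using S(2)[OF cl(2)] mult_left_mono[of "hnorm V (S' v)" "(B + 1) * hnorm V v" \<delta>] d by linarith
      have "hnorm V (vsub V (T (T' v)) (S (S' v))) \<le> A * (\<delta> * hnorm V v) + \<delta> * ((B + 1) * hnorm V v)"
        using hnorm_vsub_triangle[OF cl2] 1 2 by linarith
      also have "\<dots> = (\<delta> * (A + B + 1)) * hnorm V v" by (simp add: algebra_simps)
      also have "\<dots> \<le> \<epsilon> * hnorm V v" by (rule mult_right_mono[OF dAB nv])
      finally show ?thesis using v by simp
    qed
    then show "\<exists>S. nice S \<and> (\<forall>v\<in>carrier V. hnorm V (vsub V (op_mult V T T' v) (S v)) \<le> \<epsilon> * hnorm V v)"
      using nice_mult[OF S(1) S'(1)] by blast
  qed (use Tb Tb' in simp)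
qed (rule nice_roe[OF nice_zero])

subsection \<open>Localised orthonormal families\<close>

text \<open>The support condition of a Wannier basis in terms of cells, with one radius for the
  whole family.\<close>

definition localised :: "'d set \<Rightarrow> ('d \<Rightarrow> 'v) \<Rightarrow> bool"
  where "localised I a \<longleftrightarrow> onf V I a \<and> (\<exists>R. \<forall>x\<in>I. \<forall>d\<in>D. dist d x > R \<longrightarrow> P d (a x) = \<zero>)"

lemma frame_op_mult:
  assumes "onf V I a" "onf V I b" "onf V I c"
  shows "op_mult V (frame V V I b c) (frame V V I a b) = frame V V I a c"
proof (rule bo_eqI)
  have A: "hilb_pair V V I a b" and B: "hilb_pair V V I b c" by unfold_locales (use assms in auto)
  fix u v assume "v \<in> carrier V"
  then show "ip V u (op_mult V (frame V V I b c) (frame V V I a b) v) = ip V u (frame V V I a c v)"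
    using frame_compose[OF A B] by simp
qed (use assms frame_bounded in auto)

text \<open>Only finitely many \<open>b x\<close> reach a given cell, since their indices lie in a
  ball and \<open>I\<close> is part of \<open>D\<close>; hence \<open>P d\<close> times the frame is
  a finite sum of rank one operators. The other corner is the adjoint of this one for the families
  exchanged. The propagation is bounded by the sum of the two radii.\<close>

lemma nice_frame:
  assumes a: "localised I a" and b: "localised I b" and ID: "I \<subseteq> D"
  shows "nice (frame V V I a b)"
proof -
  have half: "compact_op V (op_mult V (P d) (frame V V I a b))"
    if a: "localised I a" and b: "localised I b" and d: "d \<in> D" for a b d
  proof -
    have on: "onf V I a" "onf V I b" using a b by (auto simp: localised_def)
    interpret A: hilb_pair V V I a b by unfold_locales (use on in auto)
    obtain R where R: "\<And>x d. \<lbrakk>x \<in> I; d \<in> D; dist d x > R\<rbrakk> \<Longrightarrow> P d (b x) = \<zero>"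
      using b unfolding localised_def by blast
    define J where "J = {x \<in> I. dist d x \<le> R}"
    have J: "finite J" "J \<subseteq> I"
      using ID unfolding J_def by (auto intro: finite_subset[OF _ balls_finite[of d R]])
    have ac: "a x \<in> carrier V" "b x \<in> carrier V" if "x \<in> I" for x
      using onf_closed[OF on(1) that] onf_closed[OF on(2) that] by auto
    show ?thesis
    proof (rule compact_op_finite_sum[OF J(1), of "\<lambda>x. \<lambda>v\<in>carrier V. ip V (a x) v \<odot> P d (b x)"])
      show "compact_op V (\<lambda>v\<in>carrier V. ip V (a x) v \<odot> P d (b x))" if "x \<in> J" for x
        by (rule compact_op_rank_one) (use that J ac d in auto)
      show "op_mult V (P d) (frame V V I a b) \<in> bounded_ops V" using frame_bounded[OF on] d by simp
      fix u v assume uv: "u \<in> carrier V" "v \<in> carrier V"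
      have "ip V u (op_mult V (P d) (frame V V I a b) v) = ip V (P d u) (frame V V I a b v)"
        using uv d by (simp add: P_adj A.frame_closed)
      also have "\<dots> = (\<Sum>\<^sub>\<infinity>x\<in>I. ip V (a x) v * ip V (P d u) (b x))"
        by (rule A.frame_ip) (use uv d in auto)
      also have "\<dots> = (\<Sum>\<^sub>\<infinity>x\<in>J. ip V (a x) v * ip V u (P d (b x)))"
      proof (rule infsum_cong_neutral)
        fix x assume "x \<in> I - J"
        then have "P d (b x) = \<zero>" using R d by (auto simp: J_def)
        then show "ip V (a x) v * ip V (P d u) (b x) = 0"
          using uv d ac \<open>x \<in> I - J\<close> by (simp add: P_adj)
      qed (use J uv d ac in \<open>auto simp: P_adj\<close>)
      also have "\<dots> = (\<Sum>x\<in>J. ip V u ((\<lambda>v\<in>carrier V. ip V (a x) v \<odot> P d (b x)) v))"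
        using J uv d ac by (subst infsum_finite) (auto intro!: sum.cong)
      finally show "ip V u (op_mult V (P d) (frame V V I a b) v) =
        (\<Sum>x\<in>J. ip V u ((\<lambda>v\<in>carrier V. ip V (a x) v \<odot> P d (b x)) v))" .
    qed
  qed
  have on: "onf V I a" "onf V I b" using a b by (auto simp: localised_def)
  interpret A: hilb_pair V V I a b by unfold_locales (use on in auto)
  have fb: "frame V V I a b \<in> bounded_ops V" "frame V V I b a \<in> bounded_ops V"
    using frame_bounded[OF on] frame_bounded[OF on(2,1)] by auto
  have "compact_op V (op_mult V (frame V V I a b) (P d))" if d: "d \<in> D" for d
  proof -
    have "op_mult V (frame V V I a b) (P d) = adjoint V (op_mult V (P d) (frame V V I b a))"
      using fb d by (simp add: adjoint_mult P_adjoint adjoint_frame[OF on(2,1)])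
    then show ?thesis using compact_op_adjoint half[OF b a d] by simp
  qed
  moreover obtain R where R: "\<And>x d. \<lbrakk>x \<in> I; d \<in> D; dist d x > R\<rbrakk> \<Longrightarrow> P d (b x) = \<zero>"
    using b unfolding localised_def by blast
  moreover obtain R' where R': "\<And>x d. \<lbrakk>x \<in> I; d \<in> D; dist d x > R'\<rbrakk> \<Longrightarrow> P d (a x) = \<zero>"
    using a unfolding localised_def by blast
  have "propagation_le (frame V V I a b) (R + R')"
    unfolding propagation_le_def
  proof (intro ballI impI)
    fix d d' v assume d: "d \<in> D" "d' \<in> D" "R + R' < dist d d'" "v \<in> carrier V"
    show "P d (frame V V I a b (P d' v)) = \<zero>"
    proof (rule ip_eqI)
      fix u assume u: "u \<in> carrier V"
      have "ip V u (P d (frame V V I a b (P d' v))) = ip V (P d u) (frame V V I a b (P d' v))"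
        using u d by (simp add: P_adj A.frame_closed)
      also have "\<dots> = (\<Sum>\<^sub>\<infinity>x\<in>I. ip V (a x) (P d' v) * ip V (P d u) (b x))"
        by (rule A.frame_ip) (use u d in auto)
      also have "\<dots> = 0"
      proof (rule infsum_0)
        fix x assume x: "x \<in> I"
        have xc: "a x \<in> carrier V" "b x \<in> carrier V" using onf_closed[OF on(1) x] onf_closed[OF on(2) x] by auto
        have "dist d d' \<le> dist d x + dist d' x" by (rule dist_triangle2)
        then have "R < dist d x \<or> R' < dist d' x" using d(3) by linarith
        then have "P d (b x) = \<zero> \<or> P d' (a x) = \<zero>" using R R' x d by blast
        moreover have "ip V (a x) (P d' v) = ip V (P d' (a x)) v" "ip V (P d u) (b x) = ip V u (P d (b x))"
          using xc u d by (simp_all add: P_adj)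
        ultimately show "ip V (a x) (P d' v) * ip V (P d u) (b x) = 0"
          using u d by auto
      qed
      finally show "ip V u (P d (frame V V I a b (P d' v))) = ip V u \<zero>" using u by simp
    qed (use d A.frame_closed in auto)
  qed
  ultimately show ?thesis using half[OF a b] fb unfolding nice_def by blast
qed

end

subsection \<open>Bases adapted to the decomposition\<close>

context gmod
begin

definition cell_vectors :: "'v set"
  where "cell_vectors = {v \<in> carrier V. \<exists>d\<in>D. P d v = v}"

text \<open>A maximal orthonormal set among the vectors over single cells is already total. If
  \<open>v\<close> is orthogonal to it, so is every component \<open>P d v\<close>, because basis
  vectors over other cells are orthogonal to that component anyway; a nonzero component could be
  normalised and added.\<close>

lemma cell_basis_ex:
  "\<exists>E\<subseteq>cell_vectors. onf V E (\<lambda>e. e) \<and> (\<forall>v\<in>carrier V. (\<forall>e\<in>E. ip V e v = 0) \<longrightarrow> v = \<zero>)"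
proof -
  have "cell_vectors \<subseteq> carrier V" by (auto simp: cell_vectors_def)
  from max_onf_ex[OF this] obtain E where E: "E \<subseteq> cell_vectors" "onf V E (\<lambda>e. e)"
    and max: "\<And>x. \<lbrakk>x \<in> cell_vectors; ip V x x = 1; \<forall>e\<in>E. ip V e x = 0\<rbrakk> \<Longrightarrow> False" by blast
  have "v = \<zero>" if v: "v \<in> carrier V" and o: "\<forall>e\<in>E. ip V e v = 0" for v
  proof (rule P_eq_zero[OF v])
    fix d assume d: "d \<in> D"
    define x where "x = P d v"
    have x: "x \<in> carrier V" using d v by (simp add: x_def)
    have ox: "ip V e x = 0" if e: "e \<in> E" for e
    proof -
      obtain d' where d': "d' \<in> D" "P d' e = e" "e \<in> carrier V" using e E(1) by (auto simp: cell_vectors_def)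
      have "ip V e x = ip V (P d e) v" using d d' v by (simp add: x_def P_adj)
      also have "\<dots> = 0"
      proof (cases "d = d'")
        case True then show ?thesis using d' o e by simp
      next
        case False
        have "P d (P d' e) = \<zero>" by (rule P_orth) (use d d' False in auto)
        then have "P d e = \<zero>" using d' by simp
        then show ?thesis using v by simp
      qed
      finally show ?thesis .
    qed
    show "P d v = \<zero>"
    proof (rule ccontr)
      assume "P d v \<noteq> \<zero>"
      then have "hnorm V x \<noteq> 0" using hnorm_eq_0[OF x] by (auto simp: x_def)
      then have nx: "hnorm V x > 0" using hnorm_nonneg[OF x] by linarith
      define c where "c = complex_of_real (1 / hnorm V x)"
      have "ip V (c \<odot> x) (c \<odot> x) = cnj c * (c * ip V x x)" using x by simp
      also have "\<dots> = 1" unfolding ip_self[OF x] c_def using nx by (simp add: power2_eq_square)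
      finally have 1: "ip V (c \<odot> x) (c \<odot> x) = 1" .
      have 2: "c \<odot> x \<in> cell_vectors"
        unfolding cell_vectors_def using x d v by (auto intro!: bexI[of _ d] simp: bo_smult x_def)
      have Ec: "e \<in> carrier V" if "e \<in> E" for e using that E(1) by (auto simp: cell_vectors_def)
      show False by (rule max[OF 2 1]) (use ox x Ec in simp)
    qed
  qed
  then show ?thesis using E by blast
qed

lemma total_frame:
  assumes E: "onf V E (\<lambda>e. e)" and tot: "\<And>v. \<lbrakk>v \<in> carrier V; \<forall>e\<in>E. ip V e v = 0\<rbrakk> \<Longrightarrow> v = \<zero>"
    and v: "v \<in> carrier V"
  shows "frame V V E (\<lambda>e. e) (\<lambda>e. e) v = v"
proof -
  interpret A: hilb_pair V V E "\<lambda>e. e" "\<lambda>e. e" by unfold_locales (use E in auto)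
  have "vsub V (frame V V E (\<lambda>e. e) (\<lambda>e. e) v) v = \<zero>"
  proof (rule tot)
    show "\<forall>e\<in>E. ip V e (vsub V (frame V V E (\<lambda>e. e) (\<lambda>e. e) v) v) = 0"
      using A.ip_basis_frame[OF v] onf_closed[OF E] v by simp
  qed (use v in simp)
  then have "hnorm V (vsub V (frame V V E (\<lambda>e. e) (\<lambda>e. e) v) v) = 0" by simp
  then show ?thesis using v by (intro vsub_eq_zero) simp_all
qed

text \<open>Parseval's identity: each term of the series for \<open><x, y>\<close> has a vanishing
  factor.\<close>

lemma total_orthogonal:
  assumes E: "onf V E (\<lambda>e. e)" and tot: "\<And>v. \<lbrakk>v \<in> carrier V; \<forall>e\<in>E. ip V e v = 0\<rbrakk> \<Longrightarrow> v = \<zero>"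
    and x: "x \<in> carrier V" and y: "y \<in> carrier V" and o: "\<And>e. e \<in> E \<Longrightarrow> ip V e x = 0 \<or> ip V e y = 0"
  shows "ip V x y = 0"
proof -
  interpret A: hilb_pair V V E "\<lambda>e. e" "\<lambda>e. e" by unfold_locales (use E in auto)
  have "ip V x y = ip V x (frame V V E (\<lambda>e. e) (\<lambda>e. e) y)" using total_frame[OF E tot y] by simp
  also have "\<dots> = (\<Sum>\<^sub>\<infinity>e\<in>E. ip V e y * ip V x e)" by (rule A.frame_ip[OF y x])
  also have "\<dots> = 0"
    by (rule infsum_0) (use o ip_cnj[OF x onf_closed[OF E]] in auto)
  finally show ?thesis .
qed

lemma onf_inj_seq:
  assumes E: "onf V E (\<lambda>e. e)" and f: "inj f" "range f \<subseteq> E"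
  shows "onf V (UNIV::nat set) f"
  using onf_reindex[OF E, of f UNIV] f by auto

text \<open>An infinite set would contain an orthonormal sequence, which tends weakly to 0. A norm
  limit \<open>l\<close> of its image under \<open>K\<close> then satisfies
  \<open><l, l> = 0\<close>, since \<open><l, K f>\<close> equals \<open><K* l, f>\<close>,
  contradicting the lower bound \<open>c\<close>.\<close>

lemma compact_onf_finite:
  assumes K: "compact_op V K" and E: "onf V E (\<lambda>e. e)" and c: "c > 0"
  shows "finite {e \<in> E. hnorm V (K e) > c}"
proof (rule ccontr)
  have Kb: "K \<in> bounded_ops V" by (rule compact_op_bounded[OF K])
  assume "infinite {e \<in> E. hnorm V (K e) > c}"
  then obtain f :: "nat \<Rightarrow> 'v" where f: "inj f" "range f \<subseteq> {e \<in> E. hnorm V (K e) > c}"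
    using infinite_countable_subset by blast
  have on: "onf V UNIV f" by (rule onf_inj_seq[OF E f(1)]) (use f in auto)
  have fc: "f n \<in> carrier V" for n by (rule onf_closed[OF on]) simp
  have n1: "hnorm V (f n) \<le> 1" for n using onf_ip[OF on, of n n] by (simp add: hnorm_def)
  obtain r l where l: "l \<in> carrier V" "strict_mono r" "(\<lambda>n. hnorm V (vsub V (K (f (r n))) l)) \<longlonglongrightarrow> 0"
    using compact_opD[OF K, of f 1, OF fc n1] by blast
  have Kc: "K (f (r n)) \<in> carrier V" for n by (rule bo_closed[OF Kb fc])
  have onr: "onf V UNIV (\<lambda>n. f (r n))"
    by (rule onf_reindex[OF on]) (use l(2) strict_mono_imp_inj_on in auto)
  have "(\<lambda>n. ip V l (K (f (r n)))) \<longlonglongrightarrow> ip V l l"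
    by (rule ip_tendsto_left[OF _ l(1) l(1) l(3)]) (rule Kc)
  moreover have "(\<lambda>n. ip V l (K (f (r n)))) \<longlonglongrightarrow> 0"
    using onf_tendsto_0[OF onr adjoint_closed[OF Kb l(1)]] ip_adjoint_left[OF Kb l(1) fc] by simp
  ultimately have "ip V l l = 0" using LIMSEQ_unique by blast
  then have "hnorm V l = 0" by (simp add: hnorm_def)
  moreover have "(\<lambda>n. hnorm V (K (f (r n)))) \<longlonglongrightarrow> hnorm V l"
    by (rule hnorm_tendsto[OF _ l(1) l(3)]) (rule Kc)
  moreover have "\<And>n. c \<le> hnorm V (K (f (r n)))" using f(2) less_imp_le by blast
  ultimately show False using LIMSEQ_le_const[of _ "hnorm V l" c] c by fastforce
qed

lemma compact_onf_countable:
  assumes K: "compact_op V K" and E: "onf V E (\<lambda>e. e)"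
  shows "countable {e \<in> E. K e \<noteq> \<zero>}"
proof -
  have "{e \<in> E. K e \<noteq> \<zero>} \<subseteq> (\<Union>n::nat. {e \<in> E. hnorm V (K e) > 1 / real (Suc n)})"
  proof safe
    fix e assume e: "e \<in> E" "K e \<noteq> \<zero>"
    have Ke: "K e \<in> carrier V" by (rule bo_closed[OF compact_op_bounded[OF K] onf_closed[OF E e(1)]])
    have "hnorm V (K e) > 0" using hnorm_eq_0[OF Ke] e(2) hnorm_nonneg[OF Ke] by fastforce
    then obtain n where "inverse (real (Suc n)) < hnorm V (K e)" using reals_Archimedean by blast
    then show "e \<in> (\<Union>n::nat. {e \<in> E. hnorm V (K e) > 1 / real (Suc n)})"
      using e(1) by (auto simp: inverse_eq_divide)
  qed
  moreover have "countable (\<Union>n::nat. {e \<in> E. hnorm V (K e) > 1 / real (Suc n)})"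
    by (intro countable_UN countableI_type countable_finite compact_onf_finite[OF K E]) simp
  ultimately show ?thesis using countable_subset by blast
qed

text \<open>If all terms of an approximating sequence \<open>S n\<close> kill \<open>e\<close>, then
  so does \<open>T\<close>. For \<open>e\<close> over the cell of \<open>d\<close> the value
  \<open>S n e\<close> is that of the compact operator \<open>S n P d\<close>, which is nonzero on
  countably many basis vectors only.\<close>

lemma roe_onf_countable:
  assumes T: "T \<in> roe_set" and E: "onf V E (\<lambda>e. e)" and d: "d \<in> D"
  shows "countable {e \<in> E. P d e = e \<and> T e \<noteq> \<zero>}"
proof -
  have Tb: "T \<in> bounded_ops V" by (rule roe_bounded[OF T])
  have "\<exists>S. nice S \<and> (\<forall>v\<in>carrier V. hnorm V (vsub V (T v) (S v)) \<le> 1 / real (Suc n) * hnorm V v)" for n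
    using roe_setD[OF T, of "1 / real (Suc n)"] by (metis of_nat_0_less_iff zero_less_Suc zero_less_divide_1_iff)
  then obtain S where S: "\<And>n. nice (S n)"
      "\<And>n v. v \<in> carrier V \<Longrightarrow> hnorm V (vsub V (T v) (S n v)) \<le> 1 / real (Suc n) * hnorm V v" by metis
  have "{e \<in> E. P d e = e \<and> T e \<noteq> \<zero>} \<subseteq> (\<Union>n. {e \<in> E. op_mult V (S n) (P d) e \<noteq> \<zero>})"
  proof safe
    fix e assume e: "e \<in> E" "P d e = e" "T e \<noteq> \<zero>"
    have ec: "e \<in> carrier V" by (rule onf_closed[OF E e(1)])
    have Te: "T e \<in> carrier V" by (rule bo_closed[OF Tb ec])
    have "hnorm V (T e) > 0" using hnorm_eq_0[OF Te] e(3) hnorm_nonneg[OF Te] by fastforce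
    then obtain n where n: "inverse (real (Suc n)) < hnorm V (T e)" using reals_Archimedean by blast
    have e1: "hnorm V e = 1" using onf_ip[OF E e(1) e(1)] by (simp add: hnorm_def)
    have "S n e \<noteq> \<zero>"
    proof
      assume z: "S n e = \<zero>"
      have "vsub V (T e) \<zero> = T e" by (rule ip_eqI) (use Te in simp_all)
      then have "hnorm V (T e) \<le> 1 / real (Suc n)" using S(2)[OF ec, of n] z e1 by simp
      then show False using n by (simp add: inverse_eq_divide)
    qed
    then show "e \<in> (\<Union>n. {e \<in> E. op_mult V (S n) (P d) e \<noteq> \<zero>})" using e ec by auto
  qed
  moreover have "countable (\<Union>n. {e \<in> E. op_mult V (S n) (P d) e \<noteq> \<zero>})"
    by (intro countable_UN countableI_type compact_onf_countable[OF _ E] nice_compact(2)[OF S(1) d])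
  ultimately show ?thesis using countable_subset by blast
qed

lemma P_finite_expansion:
  assumes E: "E \<subseteq> cell_vectors" "onf V E (\<lambda>e. e)"
    and tot: "\<And>v. \<lbrakk>v \<in> carrier V; \<forall>e\<in>E. ip V e v = 0\<rbrakk> \<Longrightarrow> v = \<zero>"
    and d: "d \<in> D" and fin: "finite {e \<in> E. P d e = e}" and uv: "u \<in> carrier V" "v \<in> carrier V"
  shows "ip V u (P d v) = (\<Sum>e\<in>{e \<in> E. P d e = e}. ip V e v * ip V u e)"
proof -
  interpret A: hilb_pair V V E "\<lambda>e. e" "\<lambda>e. e" by unfold_locales (use E in auto)
  let ?F = "{e \<in> E. P d e = e}"
  \<comment> \<open>Each basis vector lives over a single cell, so \<open>P d\<close> either fixes
    or kills it.\<close>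
  have Pe: "P d e = (if P d e = e then e else \<zero>)" if e: "e \<in> E" for e
  proof -
    obtain d' where d': "d' \<in> D" "P d' e = e" "e \<in> carrier V" using e E(1) by (auto simp: cell_vectors_def)
    show ?thesis
    proof (cases "d = d'")
      case False
      have "P d (P d' e) = \<zero>" by (rule P_orth) (use d d' False in auto)
      then show ?thesis using d' by auto
    qed (use d' in simp)
  qed
  have "ip V u (P d v) = ip V u (frame V V E (\<lambda>e. e) (\<lambda>e. e) (P d v))"
    using total_frame[OF E(2) tot, of "P d v"] d uv by simp
  also have "\<dots> = (\<Sum>\<^sub>\<infinity>e\<in>E. ip V e (P d v) * ip V u e)" by (rule A.frame_ip) (use uv d in auto)
  also have "\<dots> = (\<Sum>\<^sub>\<infinity>e\<in>?F. ip V e v * ip V u e)"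
  proof (rule infsum_cong_neutral)
    fix e assume "e \<in> E - ?F"
    then have e: "e \<in> E" "P d e = \<zero>" using Pe[of e] by auto
    have "ip V e (P d v) = ip V (P d e) v" using d uv onf_closed[OF E(2) e(1)] by (simp add: P_adj)
    then show "ip V e (P d v) * ip V u e = 0" using e uv by simp
  next
    fix e assume "e \<in> E \<inter> ?F"
    then have e: "e \<in> E" "P d e = e" by auto
    have "ip V e (P d v) = ip V (P d e) v" using d uv onf_closed[OF E(2) e(1)] by (simp add: P_adj)
    then show "ip V e (P d v) * ip V u e = ip V e v * ip V u e" using e by simp
  qed auto
  finally show ?thesis using fin by simp
qed

text \<open>A cell with finitely many basis vectors would make \<open>P d\<close> a finite rank operator.\<close>

lemma cell_sequence_ex:
  assumes d: "d \<in> D" and nc: "\<not> compact_op V (P d)"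
  shows "\<exists>\<beta>. onf V (UNIV::nat set) \<beta> \<and> (\<forall>n. P d (\<beta> n) = \<beta> n)"
proof -
  obtain E where E: "E \<subseteq> cell_vectors" "onf V E (\<lambda>e. e)"
    and tot: "\<And>v. \<lbrakk>v \<in> carrier V; \<forall>e\<in>E. ip V e v = 0\<rbrakk> \<Longrightarrow> v = \<zero>"
    using cell_basis_ex by blast
  have "infinite {e \<in> E. P d e = e}"
  proof
    assume fin: "finite {e \<in> E. P d e = e}"
    have "compact_op V (P d)"
    proof (rule compact_op_finite_sum[OF fin, of "\<lambda>e. \<lambda>v\<in>carrier V. ip V e v \<odot> e"])
      show "compact_op V (\<lambda>v\<in>carrier V. ip V e v \<odot> e)" if "e \<in> {e \<in> E. P d e = e}" for e
        using that onf_closed[OF E(2)] by (intro compact_op_rank_one) auto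
      fix u v assume uv: "u \<in> carrier V" "v \<in> carrier V"
      show "ip V u (P d v) = (\<Sum>e\<in>{e \<in> E. P d e = e}. ip V u ((\<lambda>v\<in>carrier V. ip V e v \<odot> e) v))"
        by (rule trans[OF P_finite_expansion[OF E tot d fin uv] sum.cong]) (use uv onf_closed[OF E(2)] in auto)
    qed (use d in simp)
    then show False using nc by simp
  qed
  then obtain f :: "nat \<Rightarrow> 'v" where f: "inj f" "range f \<subseteq> {e \<in> E. P d e = e}"
    using infinite_countable_subset by blast
  then show ?thesis using onf_inj_seq[OF E(2) f(1)] by blast
qed

end

subsection \<open>Transfer between two modules\<close>

text \<open>The map \<open>c\<close> names the common cell of \<open>a i\<close> and
  \<open>b i\<close>; it is what makes the partial isometry between the two families preserve
  cells.\<close>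

locale gmod_pair = V: gmod V P D + W: gmod W Q D + hilb_pair V W I a b
  for V :: "('v, 'y) ip_space_scheme" and P :: "'d::metric_space \<Rightarrow> 'v \<Rightarrow> 'v" and D :: "'d set"
    and W :: "('w, 'z) ip_space_scheme" and Q :: "'d \<Rightarrow> 'w \<Rightarrow> 'w"
    and I :: "'i set" and a :: "'i \<Rightarrow> 'v" and b :: "'i \<Rightarrow> 'w" +
  fixes c :: "'i \<Rightarrow> 'd"
  assumes c: "i \<in> I \<Longrightarrow> c i \<in> D" and Pa: "i \<in> I \<Longrightarrow> P (c i) (a i) = a i" and Qb: "i \<in> I \<Longrightarrow> Q (c i) (b i) = b i"
begin

abbreviation "J \<equiv> frame V W I a b"
abbreviation "Js \<equiv> frame W V I b a"

interpretation S: hilb_pair W V I b a by (rule hilb_pair_swap)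

lemmas Js_closed = S.frame_closed

lemma P_a: "\<lbrakk>d \<in> D; i \<in> I\<rbrakk> \<Longrightarrow> P d (a i) = (if d = c i then a i else \<zero>\<^bsub>V\<^esub>)"
  using V.P_orth[of d "c i" "a i"] Pa[of i] c[of i] onf_closed[OF a, of i] by auto

lemma Q_b: "\<lbrakk>d \<in> D; i \<in> I\<rbrakk> \<Longrightarrow> Q d (b i) = (if d = c i then b i else \<zero>\<^bsub>W\<^esub>)"
  using W.P_orth[of d "c i" "b i"] Qb[of i] c[of i] onf_closed[OF b, of i] by auto

text \<open>In the series for \<open>J\<close> the projection keeps or kills the term of index
  \<open>i\<close> according to whether \<open>d = c i\<close>, and does so on both sides
  alike.\<close>

lemma Q_J:
  assumes d: "d \<in> D" and v: "v \<in> carrier V"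
  shows "Q d (J v) = J (P d v)"
proof (rule W.ip_eqI)
  fix w assume w: "w \<in> carrier W"
  have "ip W w (Q d (J v)) = ip W (Q d w) (J v)" using w d v by (simp add: W.P_adj)
  also have "\<dots> = (\<Sum>\<^sub>\<infinity>i\<in>I. ip V (a i) v * ip W (Q d w) (b i))" by (rule frame_ip) (use w d v in auto)
  also have "\<dots> = (\<Sum>\<^sub>\<infinity>i\<in>I. ip V (a i) (P d v) * ip W w (b i))"
  proof (rule infsum_cong)
    fix i assume i: "i \<in> I"
    have "ip W (Q d w) (b i) = ip W w (Q d (b i))" "ip V (a i) (P d v) = ip V (P d (a i)) v"
      using i d w v onf_closed[OF a] onf_closed[OF b] by (simp_all add: V.P_adj W.P_adj)
    then show "ip V (a i) v * ip W (Q d w) (b i) = ip V (a i) (P d v) * ip W w (b i)"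
      using i d w v by (simp add: P_a Q_b)
  qed
  also have "\<dots> = ip W w (J (P d v))" by (rule frame_ip[symmetric]) (use w d v in auto)
  finally show "ip W w (Q d (J v)) = ip W w (J (P d v))" .
qed (use d v in auto)

lemma P_Js:
  assumes d: "d \<in> D" and w: "w \<in> carrier W"
  shows "P d (Js w) = Js (Q d w)"
proof (rule V.ip_eqI)
  fix v assume v: "v \<in> carrier V"
  have "ip V v (P d (Js w)) = ip V (P d v) (Js w)" using w d v by (simp add: V.P_adj Js_closed)
  also have "\<dots> = ip W (J (P d v)) w" by (rule S.frame_adjoint) (use w d v in auto)
  also have "\<dots> = ip W (Q d (J v)) w" by (simp only: Q_J[OF d v])
  also have "\<dots> = ip W (J v) (Q d w)" using w d v by (simp add: W.P_adj)
  also have "\<dots> = ip V v (Js (Q d w))" by (rule S.frame_adjoint[symmetric]) (use w d v in auto)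
  finally show "ip V v (P d (Js w)) = ip V v (Js (Q d w))" .
qed (use d w Js_closed in auto)

lemma J_linear:
  "\<lbrakk>u \<in> carrier V; v \<in> carrier V\<rbrakk> \<Longrightarrow> J (u \<oplus>\<^bsub>V\<^esub> v) = J u \<oplus>\<^bsub>W\<^esub> J v"
  "v \<in> carrier V \<Longrightarrow> J (k \<odot>\<^bsub>V\<^esub> v) = k \<odot>\<^bsub>W\<^esub> J v"
  "\<lbrakk>u \<in> carrier V; v \<in> carrier V\<rbrakk> \<Longrightarrow> J (vsub V u v) = vsub W (J u) (J v)"
  by (rule W.ip_eqI; simp add: frame_adjoint Js_closed)+

lemma J_zero: "J \<zero>\<^bsub>V\<^esub> = \<zero>\<^bsub>W\<^esub>"
  by (rule W.ip_eqI) (simp_all add: frame_adjoint Js_closed)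

definition transport :: "('v \<Rightarrow> 'v) \<Rightarrow> 'w \<Rightarrow> 'w"
  where "transport T = (\<lambda>w\<in>carrier W. J (T (Js w)))"

lemma transport_apply [simp]: "w \<in> carrier W \<Longrightarrow> transport T w = J (T (Js w))"
  by (simp add: transport_def)

lemma transport_ip:
  assumes T: "T \<in> bounded_ops V" and "u \<in> carrier W" "w \<in> carrier W"
  shows "ip W u (transport T w) = ip W (transport (adjoint V T) u) w"
  using assms S.frame_adjoint[of w] 
  by (simp add: frame_adjoint V.bo_closed V.adjoint_closed Js_closed S.frame_adjoint[symmetric] V.ip_adjoint_left)

lemma transport_diff:
  assumes S: "S \<in> bounded_ops V" and T: "T \<in> bounded_ops V" and w: "w \<in> carrier W"
    and e: "\<epsilon> \<ge> 0" "\<And>v. v \<in> carrier V \<Longrightarrow> hnorm V (vsub V (T v) (S v)) \<le> \<epsilon> * hnorm V v"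
  shows "hnorm W (vsub W (transport T w) (transport S w)) \<le> \<epsilon> * hnorm W w"
proof -
  have c: "Js w \<in> carrier V" "T (Js w) \<in> carrier V" "S (Js w) \<in> carrier V"
    using w S T V.bo_closed Js_closed by auto
  have "hnorm W (vsub W (transport T w) (transport S w)) = hnorm W (J (vsub V (T (Js w)) (S (Js w))))"
    using c w by (simp add: J_linear)
  also have "\<dots> \<le> hnorm V (vsub V (T (Js w)) (S (Js w)))" by (rule frame_norm) (use c in simp)
  also have "\<dots> \<le> \<epsilon> * hnorm V (Js w)" by (rule e(2)[OF c(1)])
  also have "\<dots> \<le> \<epsilon> * hnorm W w" by (rule mult_left_mono[OF S.frame_norm[OF w] e(1)])
  finally show ?thesis .
qed

lemma transport_bounded [simp]:
  assumes T: "T \<in> bounded_ops V"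
  shows "transport T \<in> bounded_ops W"
proof -
  obtain C where C: "C \<ge> 0" "\<And>v. v \<in> carrier V \<Longrightarrow> hnorm V (T v) \<le> C * hnorm V v"
    using V.bo_bound[OF T] by blast
  show ?thesis
  proof (rule W.bounded_opsI[where S = "transport (adjoint V T)" and C = C])
    show "transport T \<in> carrier W \<rightarrow>\<^sub>E carrier W"
      using T by (auto simp: transport_def V.bo_closed Js_closed)
    fix w assume w: "w \<in> carrier W"
    have c: "Js w \<in> carrier V" "T (Js w) \<in> carrier V" using w T V.bo_closed Js_closed by auto
    have "hnorm W (transport T w) \<le> hnorm V (T (Js w))" using w c by (simp add: frame_norm)
    also have "\<dots> \<le> C * hnorm V (Js w)" by (rule C(2)[OF c(1)])
    also have "\<dots> \<le> C * hnorm W w" by (rule mult_left_mono[OF S.frame_norm[OF w] C(1)])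
    finally show "hnorm W (transport T w) \<le> C * hnorm W w" .
  qed (use T transport_ip in \<open>auto simp: V.adjoint_closed Js_closed\<close>)
qed

lemma transport_adjoint:
  assumes T: "T \<in> bounded_ops V"
  shows "adjoint W (transport T) = transport (adjoint V T)"
  using transport_ip[of "adjoint V T"] T
  by (intro W.adjointI) (simp_all add: V.adjoint_adjoint del: transport_apply)

lemma transport_compact:
  assumes K: "compact_op V K"
  shows "compact_op W (transport K)"
proof (rule W.compact_opI)
  have Kb: "K \<in> bounded_ops V" by (rule V.compact_op_bounded[OF K])
  then show "transport K \<in> bounded_ops W" by simp
  fix s and C :: real assume s: "\<And>n::nat. s n \<in> carrier W \<and> hnorm W (s n) \<le> C"
  have sc: "Js (s n) \<in> carrier V" for n using s Js_closed by blast
  have sC: "hnorm V (Js (s n)) \<le> C" for n using S.frame_norm[of "s n"] s[of n] by linarith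
  obtain r l where l: "l \<in> carrier V" "strict_mono r" "(\<lambda>n. hnorm V (vsub V (K (Js (s (r n)))) l)) \<longlonglongrightarrow> 0"
    using V.compact_opD[OF K, of "\<lambda>n. Js (s n)" C, OF sc sC] by blast
  have Kc: "K (Js (s (r n))) \<in> carrier V" for n by (rule V.bo_closed[OF Kb sc])
  have "(\<lambda>n. hnorm W (vsub W (transport K (s (r n))) (J l))) \<longlonglongrightarrow> 0"
  proof (rule Lim_null_comparison[OF _ l(3)])
    show "\<forall>\<^sub>F n in sequentially. norm (hnorm W (vsub W (transport K (s (r n))) (J l)))
        \<le> hnorm V (vsub V (K (Js (s (r n)))) l)"
    proof (intro always_eventually allI)
      fix n
      have "vsub W (transport K (s (r n))) (J l) = J (vsub V (K (Js (s (r n)))) l)"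
        using s Kc l(1) by (simp add: J_linear)
      then show "norm (hnorm W (vsub W (transport K (s (r n))) (J l))) \<le> hnorm V (vsub V (K (Js (s (r n)))) l)"
        using frame_norm[of "vsub V (K (Js (s (r n)))) l"] Kc[of n] l(1) by simp
    qed
  qed
  then show "\<exists>r. \<exists>l\<in>carrier W. strict_mono r \<and> (\<lambda>n. hnorm W (vsub W (transport K (s (r n))) l)) \<longlonglongrightarrow> 0"
    using l frame_closed[OF l(1)] by blast
qed

text \<open>Since \<open>J\<close> and \<open>Js\<close> commute with the cell projections, the
  corners of the transported operator are the transported corners, and the propagation bound is the
  same.\<close>

lemma transport_nice:
  assumes S: "V.nice S"
  shows "W.nice (transport S)"
proof -
  have b: "S \<in> bounded_ops V" by (rule V.nice_bounded[OF S])
  obtain R where R: "V.propagation_le S R" using S unfolding V.nice_def by blast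
  have "W.propagation_le (transport S) R"
    unfolding W.propagation_le_def
  proof (intro ballI impI)
    fix d d' w assume d: "d \<in> D" "d' \<in> D" "R < dist d d'" and w: "w \<in> carrier W"
    have Sc: "S (Js (Q d' w)) \<in> carrier V" using d w b by (simp add: V.bo_closed Js_closed)
    have "Q d (transport S (Q d' w)) = J (P d (S (P d' (Js w))))"
      using d w Sc by (simp add: Q_J P_Js)
    also have "P d (S (P d' (Js w))) = \<zero>\<^bsub>V\<^esub>"
      using R d Js_closed[OF w] unfolding V.propagation_le_def by blast
    finally show "Q d (transport S (Q d' w)) = \<zero>\<^bsub>W\<^esub>" by (simp add: J_zero)
  qed
  moreover have "compact_op W (op_mult W (Q d) (transport S)) \<and> compact_op W (op_mult W (transport S) (Q d))"
    if d: "d \<in> D" for d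
  proof -
    have "op_mult W (Q d) (transport S) = transport (op_mult V (P d) S)"
      by (rule W.bo_eqI) (use d b in \<open>simp_all add: Q_J V.bo_closed Js_closed\<close>)
    moreover have "op_mult W (transport S) (Q d) = transport (op_mult V S (P d))"
      by (rule W.bo_eqI) (use d b in \<open>simp_all add: P_Js V.bo_closed Js_closed\<close>)
    ultimately show ?thesis using transport_compact V.nice_compact[OF S d] by simp
  qed
  ultimately show ?thesis using transport_bounded[OF b] unfolding W.nice_def by blast
qed

lemma transport_roe:
  assumes T: "T \<in> V.roe_set"
  shows "transport T \<in> W.roe_set"
proof (rule W.roe_setI)
  have Tb: "T \<in> bounded_ops V" by (rule V.roe_bounded[OF T])
  then show "transport T \<in> bounded_ops W" by simp
  fix \<epsilon> :: real assume e: "\<epsilon> > 0"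
  obtain S where S: "V.nice S" "\<And>v. v \<in> carrier V \<Longrightarrow> hnorm V (vsub V (T v) (S v)) \<le> \<epsilon> * hnorm V v"
    using V.roe_setD[OF T e] by blast
  have "hnorm W (vsub W (transport T w) (transport S w)) \<le> \<epsilon> * hnorm W w" if "w \<in> carrier W" for w
    by (rule transport_diff[OF V.nice_bounded[OF S(1)] Tb that _ S(2)]) (use e in auto)
  then show "\<exists>S. W.nice S \<and> (\<forall>v\<in>carrier W. hnorm W (vsub W (transport T v) (S v)) \<le> \<epsilon> * hnorm W v)"
    using transport_nice[OF S(1)] by blast
qed

text \<open>\<open>Js J\<close> is the projection onto the closed span of the family
  \<open>a\<close>. The operators it fixes from both sides form the corner on which conjugation with
  \<open>J\<close> respects products.\<close>

definition supported :: "('v \<Rightarrow> 'v) set"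
  where "supported = {T \<in> V.roe_set. \<forall>v\<in>carrier V. Js (J (T v)) = T v \<and> T (Js (J v)) = T v}"

lemma supportedI:
  assumes "T \<in> V.roe_set" "\<And>v. v \<in> carrier V \<Longrightarrow> Js (J (T v)) = T v"
    "\<And>v. v \<in> carrier V \<Longrightarrow> T (Js (J v)) = T v"
  shows "T \<in> supported"
  using assms by (simp add: supported_def)

lemma supported_adjoint:
  assumes T: "T \<in> supported"
  shows "adjoint V T \<in> supported"
proof -
  have r: "T \<in> V.roe_set" and q: "\<And>v. v \<in> carrier V \<Longrightarrow> Js (J (T v)) = T v" "\<And>v. v \<in> carrier V \<Longrightarrow> T (Js (J v)) = T v"
    using T by (auto simp: supported_def)
  have Tb: "T \<in> bounded_ops V" by (rule V.roe_bounded[OF r])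
  have sa: "ip V u (Js (J v)) = ip V (Js (J u)) v" if "u \<in> carrier V" "v \<in> carrier V" for u v
  proof -
    have "ip V u (Js (J v)) = ip W (J u) (J v)" by (rule S.frame_adjoint) (use that in auto)
    also have "\<dots> = ip V (Js (J u)) v" by (rule frame_adjoint) (use that in auto)
    finally show ?thesis .
  qed
  have cl: "Js (J v) \<in> carrier V" if "v \<in> carrier V" for v using that Js_closed frame_closed by blast
  have "Js (J (adjoint V T v)) = adjoint V T v" if v: "v \<in> carrier V" for v
    by (rule V.ip_eqI) (use v Tb cl q in \<open>simp_all add: V.adjoint_closed sa V.ip_adjoint_right\<close>)
  moreover have "adjoint V T (Js (J v)) = adjoint V T v" if v: "v \<in> carrier V" for v
    by (rule V.ip_eqI) (use v Tb cl q in \<open>simp_all add: V.adjoint_closed sa V.ip_adjoint_right V.bo_closed\<close>)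
  ultimately show ?thesis using V.alg_adjoint[OF r] by (simp add: supported_def)
qed

text \<open>The scalar of the unitization travels unchanged, so the formal unit is preserved
  although \<open>J\<close> is only a partial isometry.\<close>

lemma partial_hom:
  "partial_star_hom V.Au W.Au (supported \<times> UNIV) (\<lambda>(T, s). (transport T, s))"
proof (rule partial_star_hom.intro[OF V.U.star_ring_axioms W.U.star_ring_axioms], unfold_locales)
  note bnd = V.roe_bounded
  have sup: "T \<in> V.roe_set" "T \<in> bounded_ops V" if "T \<in> supported" for T
    using that bnd by (auto simp: supported_def)
  have J1: "Js (J (T v)) = T v" and J2: "T (Js (J v)) = T v" if "T \<in> supported" "v \<in> carrier V" for T v
    using that by (auto simp: supported_def)
  have cl: "Js (J v) \<in> carrier V" if "v \<in> carrier V" for v using that Js_closed frame_closed by blast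
  have JsJ_lin: "Js (J (u \<oplus>\<^bsub>V\<^esub> v)) = Js (J u) \<oplus>\<^bsub>V\<^esub> Js (J v)" "Js (J (k \<odot>\<^bsub>V\<^esub> v)) = k \<odot>\<^bsub>V\<^esub> Js (J v)"
    if "u \<in> carrier V" "v \<in> carrier V" for u v k
    by (rule V.ip_eqI; use that in \<open>simp add: S.frame_adjoint Js_closed J_linear\<close>)+
  have JsJ0: "Js (J \<zero>\<^bsub>V\<^esub>) = \<zero>\<^bsub>V\<^esub>"
    by (rule V.ip_eqI) (simp_all add: S.frame_adjoint Js_closed J_zero)
  have sz: "op_zero V \<in> supported" by (rule supportedI) (simp_all add: V.alg_zero JsJ0 cl)
  have sadd: "op_add V S T \<in> supported" if ST: "S \<in> supported" "T \<in> supported" for S T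
  proof (rule supportedI)
    fix v assume v: "v \<in> carrier V"
    have c: "S v \<in> carrier V" "T v \<in> carrier V" using V.bo_closed sup(2) ST v by blast+
    show "Js (J (op_add V S T v)) = op_add V S T v"
      by (simp only: V.op_apply[OF v] JsJ_lin(1)[OF c] J1[OF ST(1) v] J1[OF ST(2) v])
    show "op_add V S T (Js (J v)) = op_add V S T v"
      by (simp only: V.op_apply[OF v] V.op_apply[OF cl[OF v]] J2[OF ST(1) v] J2[OF ST(2) v])
  qed (rule V.alg_add[OF sup(1)[OF ST(1)] sup(1)[OF ST(2)]])
  have smult: "op_mult V S T \<in> supported" if ST: "S \<in> supported" "T \<in> supported" for S T
  proof (rule supportedI)
    fix v assume v: "v \<in> carrier V"
    have c: "T v \<in> carrier V" using V.bo_closed sup(2) ST v by blast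
    show "Js (J (op_mult V S T v)) = op_mult V S T v"
      by (simp only: V.op_apply[OF v] J1[OF ST(1) c])
    show "op_mult V S T (Js (J v)) = op_mult V S T v"
      by (simp only: V.op_apply[OF v] V.op_apply[OF cl[OF v]] J2[OF ST(2) v])
  qed (rule V.alg_mult[OF sup(1)[OF ST(1)] sup(1)[OF ST(2)]])
  have sscale: "op_scale V k T \<in> supported" if T: "T \<in> supported" for k T
  proof (rule supportedI)
    fix v assume v: "v \<in> carrier V"
    have c: "T v \<in> carrier V" using V.bo_closed sup(2) T v by blast
    show "Js (J (op_scale V k T v)) = op_scale V k T v"
      by (simp only: V.op_apply[OF v] JsJ_lin(2)[OF c c] J1[OF T v])
    show "op_scale V k T (Js (J v)) = op_scale V k T v"
      by (simp only: V.op_apply[OF v] V.op_apply[OF cl[OF v]] J2[OF T v])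
  qed (rule V.alg_scale[OF sup(1)[OF T]])
  have tadd: "transport (op_add V S T) = op_add W (transport S) (transport T)" if "S \<in> supported" "T \<in> supported" for S T
    by (rule W.bo_eqI) (use sup[OF that(1)] sup[OF that(2)] in \<open>simp_all add: J_linear V.bo_closed Js_closed\<close>)
  have tscale: "transport (op_scale V k T) = op_scale W k (transport T)" if "T \<in> supported" for k T
    by (rule W.bo_eqI) (use sup[OF that] in \<open>simp_all add: J_linear V.bo_closed Js_closed\<close>)
  \<comment> \<open>The factor \<open>Js J\<close> that appears between the two conjugated operators
    is absorbed by \<open>T\<close>.\<close>
  have tmult: "transport (op_mult V S T) = op_mult W (transport S) (transport T)" if "S \<in> supported" "T \<in> supported" for S T
  proof (rule W.bo_eqI)
    fix u w assume "u \<in> carrier W" and w: "w \<in> carrier W"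
    have "T (Js w) \<in> carrier V" using V.bo_closed sup(2) that(2) Js_closed[OF w] by blast
    then show "ip W u (transport (op_mult V S T) w) = ip W u (op_mult W (transport S) (transport T) w)"
      using w J1[OF that(2) Js_closed[OF w]] Js_closed[OF w] by simp
  qed (use sup[OF that(1)] sup[OF that(2)] in simp_all)
  show "supported \<times> UNIV \<subseteq> carrier V.Au" using sup by (auto simp: V.Au_carrier)
  show "\<zero>\<^bsub>V.Au\<^esub> \<in> supported \<times> UNIV" using sz by (simp add: V.Au_simps)
  have "transport (op_zero V) = op_zero W"
    by (rule W.bo_eqI) (simp_all add: J_zero Js_closed)
  then show "(\<lambda>(T, s). (transport T, s)) \<zero>\<^bsub>V.Au\<^esub> = \<zero>\<^bsub>W.Au\<^esub>" by (simp add: V.Au_simps W.Au_simps)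
  fix x assume x: "x \<in> supported \<times> (UNIV :: complex set)"
  obtain S s where [simp]: "x = (S, s)" by (cases x)
  have S: "S \<in> supported" using x by simp
  show "star V.Au x \<in> supported \<times> UNIV" using S by (simp add: V.Au_simps supported_adjoint)
  show "(\<lambda>(T, s). (transport T, s)) x \<in> carrier W.Au" using S sup transport_roe by (simp add: W.Au_carrier)
  show "(\<lambda>(T, s). (transport T, s)) (star V.Au x) = star W.Au ((\<lambda>(T, s). (transport T, s)) x)"
    using S sup by (simp add: V.Au_simps W.Au_simps transport_adjoint)
  fix y assume y: "y \<in> supported \<times> (UNIV :: complex set)"
  obtain T t where [simp]: "y = (T, t)" by (cases y)
  have T: "T \<in> supported" using y by simp
  show "x \<oplus>\<^bsub>V.Au\<^esub> y \<in> supported \<times> UNIV" using S T by (simp add: V.Au_simps sadd)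
  show "x \<otimes>\<^bsub>V.Au\<^esub> y \<in> supported \<times> UNIV" using S T by (simp add: V.Au_simps sadd smult sscale)
  show "(\<lambda>(T, s). (transport T, s)) (x \<oplus>\<^bsub>V.Au\<^esub> y) =
      (\<lambda>(T, s). (transport T, s)) x \<oplus>\<^bsub>W.Au\<^esub> (\<lambda>(T, s). (transport T, s)) y"
    using S T by (simp add: V.Au_simps W.Au_simps tadd)
  show "(\<lambda>(T, s). (transport T, s)) (x \<otimes>\<^bsub>V.Au\<^esub> y) =
      (\<lambda>(T, s). (transport T, s)) x \<otimes>\<^bsub>W.Au\<^esub> (\<lambda>(T, s). (transport T, s)) y"
    using S T by (simp add: V.Au_simps W.Au_simps tadd tmult tscale sadd smult sscale)
qed

end

section \<open>Projections onto localised families, within one module and under transport\<close>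

context gmod
begin

lemma frame_projection:
  assumes a: "localised I a" and I: "I \<subseteq> D"
  shows "frame V V I a a \<in> roe_set" "mat1 (frame V V I a a, 0) \<in> projections Au"
proof -
  have on: "onf V I a" using a by (simp add: localised_def)
  show r: "frame V V I a a \<in> roe_set" by (rule nice_roe[OF nice_frame[OF a a I]])
  show "mat1 (frame V V I a a, 0) \<in> projections Au"
    by (rule mat1_projection[OF r frame_op_mult[OF on on on] adjoint_frame[OF on on]])
qed

lemma frame_mvn:
  assumes a: "localised I a" and b: "localised I b" and I: "I \<subseteq> D"
  shows "(mat1 (frame V V I a a, 0), mat1 (frame V V I b b, 0)) \<in> mvn Au"
proof -
  have on: "onf V I a" "onf V I b" using a b by (simp_all add: localised_def)
  have r: "frame V V I a b \<in> roe_set" "frame V V I b a \<in> roe_set"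
    by (rule nice_roe[OF nice_frame[OF a b I]], rule nice_roe[OF nice_frame[OF b a I]])
  have s: "star Au (frame V V I a b, 0) = (frame V V I b a, 0)"
    by (simp add: Au_simps adjoint_frame[OF on])
  show ?thesis
  proof (rule U.mvn_mat1[where v = "(frame V V I a b, 0)"])
    show "star Au (frame V V I a b, 0) \<otimes>\<^bsub>Au\<^esub> (frame V V I a b, 0) = (frame V V I a a, 0)"
      unfolding s Au_mult_0[OF r(2,1)] frame_op_mult[OF on(1,2,1)] ..
    show "(frame V V I a b, 0) \<otimes>\<^bsub>Au\<^esub> star Au (frame V V I a b, 0) = (frame V V I b b, 0)"
      unfolding s Au_mult_0[OF r(1,2)] frame_op_mult[OF on(2,1,2)] ..
  qed (use frame_projection[OF a I] frame_projection[OF b I] r in \<open>simp_all add: Au_carrier\<close>)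
qed

end

context gmod_pair
begin

lemma Js_adjoint: "\<lbrakk>w \<in> carrier W; v \<in> carrier V\<rbrakk> \<Longrightarrow> ip V v (Js w) = ip W (J v) w"
  using hilb_pair.frame_adjoint[OF hilb_pair_swap] .

text \<open>Support of the projection means that \<open>Js J\<close> fixes every member of the
  family. Hence \<open>J\<close> preserves the inner products of its members, and it does not move
  them to other cells.\<close>

lemma transport_frame:
  assumes \<phi>: "V.localised K \<phi>" and K: "K \<subseteq> D" and sup: "frame V V K \<phi> \<phi> \<in> supported"
  shows "W.localised K (\<lambda>x. J (\<phi> x))"
    and "transport (frame V V K \<phi> \<phi>) = frame W W K (\<lambda>x. J (\<phi> x)) (\<lambda>x. J (\<phi> x))"
proof -
  have on: "onf V K \<phi>" using \<phi> by (simp add: V.localised_def)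
  have pc: "\<phi> x \<in> carrier V" if "x \<in> K" for x by (rule onf_closed[OF on that])
  interpret F: hilb_pair V V K \<phi> \<phi> by unfold_locales (rule on)+
  have pfix: "Js (J (\<phi> x)) = \<phi> x" if x: "x \<in> K" for x
    using sup F.frame_basis[OF x] pc[OF x] unfolding supported_def by force
  have onJ: "onf W K (\<lambda>x. J (\<phi> x))"
    unfolding onf_def
  proof (intro conjI ballI)
    fix x y assume xy: "x \<in> K" "y \<in> K"
    have "ip W (J (\<phi> x)) (J (\<phi> y)) = ip V (Js (J (\<phi> x))) (\<phi> y)"
      by (rule frame_adjoint) (use pc xy in auto)
    then show "ip W (J (\<phi> x)) (J (\<phi> y)) = (if x = y then 1 else 0)"
      unfolding pfix[OF xy(1)] using onf_ip[OF on xy] by simp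
  qed (use pc in auto)
  obtain R where R: "\<And>x d. \<lbrakk>x \<in> K; d \<in> D; dist d x > R\<rbrakk> \<Longrightarrow> P d (\<phi> x) = \<zero>\<^bsub>V\<^esub>"
    using \<phi> unfolding V.localised_def by blast
  have "Q d (J (\<phi> x)) = \<zero>\<^bsub>W\<^esub>" if "x \<in> K" "d \<in> D" "dist d x > R" for x d
    using Q_J[OF that(2) pc[OF that(1)]] R[OF that] J_zero by simp
  then show loc: "W.localised K (\<lambda>x. J (\<phi> x))" using onJ unfolding W.localised_def by blast
  interpret G: hilb_pair W W K "\<lambda>x. J (\<phi> x)" "\<lambda>x. J (\<phi> x)" by unfold_locales (rule onJ)+
  show "transport (frame V V K \<phi> \<phi>) = frame W W K (\<lambda>x. J (\<phi> x)) (\<lambda>x. J (\<phi> x))"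
  proof (rule W.bo_eqI)
    show "transport (frame V V K \<phi> \<phi>) \<in> bounded_ops W" using V.frame_bounded[OF on on] by simp
    show "frame W W K (\<lambda>x. J (\<phi> x)) (\<lambda>x. J (\<phi> x)) \<in> bounded_ops W" by (rule W.frame_bounded[OF onJ onJ])
    fix u w assume uw: "u \<in> carrier W" "w \<in> carrier W"
    have c: "Js u \<in> carrier V" "Js w \<in> carrier V" using uw Js_closed by auto
    have "ip W u (transport (frame V V K \<phi> \<phi>) w) = ip V (Js u) (frame V V K \<phi> \<phi> (Js w))"
      using uw c frame_adjoint[OF F.frame_closed[OF c(2)] uw(1)] by simp
    also have "\<dots> = (\<Sum>\<^sub>\<infinity>x\<in>K. ip V (\<phi> x) (Js w) * ip V (Js u) (\<phi> x))" by (rule F.frame_ip[OF c(2,1)])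
    also have "\<dots> = (\<Sum>\<^sub>\<infinity>x\<in>K. ip W (J (\<phi> x)) w * ip W u (J (\<phi> x)))"
      by (rule infsum_cong) (use Js_adjoint[OF uw(2) pc] frame_adjoint[OF pc uw(1)] in simp)
    also have "\<dots> = ip W u (frame W W K (\<lambda>x. J (\<phi> x)) (\<lambda>x. J (\<phi> x)) w)"
      by (rule G.frame_ip[OF uw(2,1), symmetric])
    finally show "ip W u (transport (frame V V K \<phi> \<phi>) w) = ip W u (frame W W K (\<lambda>x. J (\<phi> x)) (\<lambda>x. J (\<phi> x)) w)" .
  qed
qed

end

text \<open>Of an orthonormal basis adapted to the cells, only countably many vectors per cell are moved by
  finitely many given Roe operators or their adjoints; these are mapped into the corresponding cell
  of the other module, and the remaining ones can be ignored.\<close>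

lemma gmod_pair_ex:
  assumes V: "gmod V P D" and W: "gmod W Q D" and nc: "\<And>d. d \<in> D \<Longrightarrow> \<not> compact_op W (Q d)"
    and F: "finite F" "F \<subseteq> gmod.roe_set V P D"
  shows "\<exists>I b c. gmod_pair V P D W Q I (\<lambda>e. e) b c \<and> F \<subseteq> gmod_pair.supported V P D W I (\<lambda>e. e) b"
proof -
  interpret V: gmod V P D by (rule V)
  interpret W: gmod W Q D by (rule W)
  obtain E where E: "E \<subseteq> V.cell_vectors" "onf V E (\<lambda>e. e)"
    and tot: "\<And>v. \<lbrakk>v \<in> carrier V; \<forall>e\<in>E. ip V e v = 0\<rbrakk> \<Longrightarrow> v = \<zero>\<^bsub>V\<^esub>"
    using V.cell_basis_ex by blast
  have Fb: "T \<in> bounded_ops V" if "T \<in> F" for T using that F(2) V.roe_bounded by blast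
  define c where "c e = (SOME d. d \<in> D \<and> P d e = e)" for e
  have c: "c e \<in> D \<and> P (c e) e = e" if "e \<in> E" for e
    unfolding c_def by (rule someI_ex) (use that E(1) in \<open>auto simp: V.cell_vectors_def\<close>)
  \<comment> \<open>Both \<open>T\<close> and its adjoint are needed: vanishing of \<open>T\<close>
    outside \<open>I\<close> gives \<open>T Js J = T\<close>, vanishing of the adjoint gives
    \<open>Js J T = T\<close>.\<close>
  define I where "I = {e \<in> E. \<exists>T\<in>F. T e \<noteq> \<zero>\<^bsub>V\<^esub> \<or> adjoint V T e \<noteq> \<zero>\<^bsub>V\<^esub>}"
  have IE: "I \<subseteq> E" by (auto simp: I_def)
  have onI: "onf V I (\<lambda>e. e)" by (rule onf_subset[OF E(2) IE])
  define Ic where "Ic d = {e \<in> I. c e = d}" for d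
  have cnt: "countable (Ic d)" if d: "d \<in> D" for d
  proof -
    have "Ic d \<subseteq> (\<Union>T\<in>F. {e \<in> E. P d e = e \<and> T e \<noteq> \<zero>\<^bsub>V\<^esub>} \<union> {e \<in> E. P d e = e \<and> adjoint V T e \<noteq> \<zero>\<^bsub>V\<^esub>})"
      using c by (auto simp: Ic_def I_def)
    moreover have "countable \<dots>"
    proof (intro countable_UN countable_Un countable_finite[OF F(1)])
      fix T assume "T \<in> F"
      then have T: "T \<in> V.roe_set" using F(2) by blast
      show "countable {e \<in> E. P d e = e \<and> T e \<noteq> \<zero>\<^bsub>V\<^esub>}"
        by (rule V.roe_onf_countable[OF T E(2) d])
      show "countable {e \<in> E. P d e = e \<and> adjoint V T e \<noteq> \<zero>\<^bsub>V\<^esub>}"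
        by (rule V.roe_onf_countable[OF V.alg_adjoint[OF T] E(2) d])
    qed
    ultimately show ?thesis using countable_subset by blast
  qed
  have "\<exists>\<beta>. onf W (UNIV::nat set) \<beta> \<and> (\<forall>n. Q d (\<beta> n) = \<beta> n)" if "d \<in> D" for d
    by (rule W.cell_sequence_ex[OF that nc[OF that]])
  then obtain \<beta> where \<beta>: "\<And>d. d \<in> D \<Longrightarrow> onf W (UNIV::nat set) (\<beta> d)" "\<And>d n. d \<in> D \<Longrightarrow> Q d (\<beta> d n) = \<beta> d n"
    by metis
  \<comment> \<open>The countably many selected vectors of a cell are numbered and sent to the terms
    of an orthonormal sequence in the same cell of the target.\<close>
  define b where "b e = \<beta> (c e) (to_nat_on (Ic (c e)) e)" for e
  have Qb: "Q (c e) (b e) = b e" and bc: "b e \<in> carrier W" if "e \<in> I" for e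
    using that IE c \<beta> onf_closed[OF \<beta>(1)] unfolding b_def by blast+
  have onb: "onf W I b"
    unfolding onf_def
  proof (intro conjI ballI)
    fix e f assume ef: "e \<in> I" "f \<in> I"
    show "ip W (b e) (b f) = (if e = f then 1 else 0)"
    proof (cases "c e = c f")
      case True
      have d: "c e \<in> D" using c ef IE by blast
      have "e \<in> Ic (c e)" "f \<in> Ic (c e)" using ef True by (auto simp: Ic_def)
      then have "to_nat_on (Ic (c e)) e = to_nat_on (Ic (c e)) f \<longleftrightarrow> e = f"
        using cnt[OF d] by simp
      then show ?thesis using onf_ip[OF \<beta>(1)[OF d]] True by (simp add: b_def)
    next
      case False
      have d: "c e \<in> D" "c f \<in> D" using c ef IE by blast+
      have "ip W (b e) (b f) = ip W (Q (c e) (b e)) (Q (c f) (b f))" using Qb ef by simp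
      also have "\<dots> = ip W (b e) (Q (c e) (Q (c f) (b f)))" by (rule W.P_adj) (use d bc ef in auto)
      also have "\<dots> = 0" using W.P_orth[OF d False] bc ef by simp
      finally show ?thesis using False by auto
    qed
  qed (use bc in auto)
  interpret X: gmod_pair V P D W Q I "\<lambda>e. e" b c
    by unfold_locales (use onI onb c IE Qb in auto)
  interpret A: hilb_pair V V I "\<lambda>e. e" "\<lambda>e. e" by unfold_locales (rule onI)+
  have JJ: "X.Js (X.J v) = frame V V I (\<lambda>e. e) (\<lambda>e. e) v" if "v \<in> carrier V" for v
    by (rule frame_compose[OF X.hilb_pair_axioms X.hilb_pair_swap that])
  \<comment> \<open>The difference of \<open>v\<close> and \<open>Js J v\<close> is orthogonal to
    the basis vectors in \<open>I\<close>, while the adjoint of \<open>S\<close> applied to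
    \<open>u\<close> is orthogonal to the others; so the two are orthogonal to each other.\<close>
  have stable: "S (X.Js (X.J v)) = S v"
    if S: "S \<in> bounded_ops V" and S0: "\<And>e. e \<in> E - I \<Longrightarrow> S e = \<zero>\<^bsub>V\<^esub>" and v: "v \<in> carrier V" for S v
  proof (rule V.ip_eqI)
    have q: "X.Js (X.J v) \<in> carrier V" using JJ[OF v] A.frame_closed[OF v] by simp
    then show "S (X.Js (X.J v)) \<in> carrier V" "S v \<in> carrier V" using S v V.bo_closed by auto
    fix u assume u: "u \<in> carrier V"
    have Su: "adjoint V S u \<in> carrier V" by (rule V.adjoint_closed[OF S u])
    have "ip V (adjoint V S u) (vsub V (X.Js (X.J v)) v) = 0"
    proof (rule V.total_orthogonal[OF E(2) tot Su])
      fix e assume e: "e \<in> E"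
      have ec: "e \<in> carrier V" by (rule onf_closed[OF E(2) e])
      show "ip V e (adjoint V S u) = 0 \<or> ip V e (vsub V (X.Js (X.J v)) v) = 0"
      proof (cases "e \<in> I")
        case True
        then show ?thesis using A.ip_basis_frame[OF v True] JJ[OF v] q v ec by simp
      next
        case False
        then show ?thesis using S0[of e] e V.ip_adjoint_right[OF S ec u] u by simp
      qed
    qed (use q v in simp_all)
    then show "ip V u (S (X.Js (X.J v))) = ip V u (S v)"
      using q v Su by (simp add: V.ip_adjoint_left[OF S u])
  qed
  have "T \<in> X.supported" if T: "T \<in> F" for T
  proof (rule X.supportedI)
    show "T \<in> V.roe_set" using T F(2) by blast
    have Tb: "T \<in> bounded_ops V" and Ta: "adjoint V T \<in> bounded_ops V" using Fb[OF T] by auto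
    have 0: "T e = \<zero>\<^bsub>V\<^esub>" "adjoint V T e = \<zero>\<^bsub>V\<^esub>" if "e \<in> E - I" for e
      using that T by (auto simp: I_def)
    fix v assume v: "v \<in> carrier V"
    show "T (X.Js (X.J v)) = T v" by (rule stable[OF Tb 0(1) v])
    have Tv: "T v \<in> carrier V" by (rule V.bo_closed[OF Tb v])
    show "X.Js (X.J (T v)) = T v"
    proof (rule V.ip_eqI)
      show q: "X.Js (X.J (T v)) \<in> carrier V" using JJ[OF Tv] A.frame_closed[OF Tv] by simp
      fix u assume u: "u \<in> carrier V"
      have qu: "X.Js (X.J u) \<in> carrier V" using JJ[OF u] A.frame_closed[OF u] by simp
      have "ip V u (X.Js (X.J (T v))) = ip V (X.Js (X.J u)) (T v)"
        unfolding JJ[OF u] JJ[OF Tv] by (rule A.frame_adjoint[OF Tv u])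
      also have "\<dots> = ip V (adjoint V T (X.Js (X.J u))) v" by (rule V.ip_adjoint_left[OF Tb qu v, symmetric])
      also have "\<dots> = ip V (adjoint V T u) v" using stable[OF Ta 0(2) u] by simp
      also have "\<dots> = ip V u (T v)" by (rule V.ip_adjoint_left[OF Tb u v])
      finally show "ip V u (X.Js (X.J (T v))) = ip V u (T v)" .
    qed (rule Tv)
  qed
  then show ?thesis using X.gmod_pair_axioms by blast
qed

text \<open>Infinite-dimensional cells are required of the target only, because it must have room
  for countably many vectors per cell of the source.\<close>

theorem roe_transfer:
  assumes V: "gmod V P D" and W: "gmod W Q D" and nc: "\<And>d. d \<in> D \<Longrightarrow> \<not> compact_op W (Q d)"
    and \<phi>: "gmod.localised V P D K \<phi>" and \<psi>: "gmod.localised W Q D K \<psi>" and K: "K \<subseteq> D"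
    and trivial: "K0_class (op_algebra V (gmod.roe_set V P D)) (frame V V K \<phi> \<phi>) =
      \<one>\<^bsub>K0 (op_algebra V (gmod.roe_set V P D))\<^esub>"
  shows "K0_class (op_algebra W (gmod.roe_set W Q D)) (frame W W K \<psi> \<psi>) =
      \<one>\<^bsub>K0 (op_algebra W (gmod.roe_set W Q D))\<^esub>"
proof -
  interpret V: gmod V P D by (rule V)
  interpret W: gmod W Q D by (rule W)
  let ?p = "frame V V K \<phi> \<phi>" and ?q = "frame W W K \<psi> \<psi>"
  note pV = V.frame_projection[OF \<phi> K] and pW = W.frame_projection[OF \<psi> K]
  have "\<exists>y\<in>projections W.Au. (dsum W.Au (mat1 (?q, 0)) y, y) \<in> mvn W.Au"
  proof (rule absorbing_transfer[OF V.U.star_ring_axioms W.U.star_ring_axioms pV(2) pW(2)])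
    show "\<exists>y\<in>projections V.Au. (dsum V.Au (mat1 (?p, 0)) y, y) \<in> mvn V.Au"
      using trivial K0_class_trivial_iff[OF V.U.star_ring_axioms pV(2)] by simp
    fix F assume F: "finite F" "F \<subseteq> carrier V.Au"
    \<comment> \<open>The projection joins the list so that it is supported as well and its
      transport is again the projection onto a localised family.\<close>
    define F1 where "F1 = insert ?p (fst ` F)"
    have F1: "finite F1" "F1 \<subseteq> V.roe_set" using F pV(1) by (auto simp: F1_def V.Au_carrier)
    obtain I b c where X: "gmod_pair V P D W Q I (\<lambda>e. e) b c"
        and sup: "F1 \<subseteq> gmod_pair.supported V P D W I (\<lambda>e. e) b"
      using gmod_pair_ex[OF V W nc F1] by blast
    interpret X: gmod_pair V P D W Q I "\<lambda>e. e" b c by (rule X)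
    have ps: "?p \<in> X.supported" using sup by (auto simp: F1_def)
    have "(mat1 (X.transport ?p, 0), mat1 (?q, 0)) \<in> mvn W.Au"
      unfolding X.transport_frame(2)[OF \<phi> K ps]
      by (rule W.frame_mvn[OF X.transport_frame(1)[OF \<phi> K ps] \<psi> K])
    moreover have "F \<subseteq> X.supported \<times> UNIV"
    proof
      fix z assume "z \<in> F"
      then have "fst z \<in> X.supported" using sup by (auto simp: F1_def)
      then show "z \<in> X.supported \<times> UNIV" by (cases z) auto
    qed
    ultimately show "\<exists>A1 h. partial_star_hom V.Au W.Au A1 h \<and> F \<subseteq> A1 \<and>
        ((?p, 0) \<in> A1 \<longrightarrow> mat1 (h (?p, 0)) \<in> projections W.Au \<longrightarrow> (mat1 (h (?p, 0)), mat1 (?q, 0)) \<in> mvn W.Au)"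
      using X.partial_hom by (intro exI[of _ "X.supported \<times> UNIV"] exI[of _ "\<lambda>(T, s). (X.transport T, s)"]) simp
  qed
  then show ?thesis using K0_class_trivial_iff[OF W.U.star_ring_axioms pW(2)] by simp
qed

section \<open>The Hilbert space of square integrable functions\<close>

text \<open>Views the value space as an instance of \<open>hilb\<close>, from which Cauchy--Schwarz
  and homogeneity of the norm are taken over.\<close>

definition type_ip :: "'h::chilbert_space ip_space"
  where "type_ip = \<lparr>carrier = UNIV, mult = undefined, one = undefined, zero = 0, add = (+),
    smult = scaleC, ip = cinner\<rparr>"

lemma cinner_zero_right [simp]: "cinner x (0::'h::chilbert_space) = 0"
  using cinner_add_right[of x 0 0] by simp

lemma cinner_zero_left [simp]: "cinner (0::'h::chilbert_space) x = 0"
  by (subst cinner_commute) simp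

lemma scaleC_one [simp]: "1 *\<^sub>C (x::'h::chilbert_space) = x"
  using scaleC_of_real[of 1 x] by simp

lemma scaleC_minus_one: "(-1) *\<^sub>C (x::'h::chilbert_space) = - x"
  using scaleC_of_real[of "-1" x] by simp

lemma scaleC_zero_left [simp]: "0 *\<^sub>C (x::'h::chilbert_space) = 0"
  using scaleC_of_real[of 0 x] by simp

lemma cinner_self: "cinner x x = complex_of_real ((norm (x::'h::chilbert_space))\<^sup>2)"
proof -
  have "Im (cinner x x) = 0" using cinner_commute[of x x] by (simp add: complex_eq_iff)
  moreover have "Re (cinner x x) \<ge> 0"
    using norm_ge_zero[of x] unfolding norm_eq_sqrt_cinner by simp
  ultimately show ?thesis by (simp add: norm_eq_sqrt_cinner complex_eq_iff)
qed

lemma cinner_minus_right: "cinner x (- y) = - cinner x (y::'h::chilbert_space)"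
  using cinner_scaleC_right[of x "-1" y] by (simp add: scaleC_minus_one)

lemma cinner_diff_right: "cinner x (y - z) = cinner x y - cinner x (z::'h::chilbert_space)"
  using cinner_add_right[of x y "- z"] by (simp add: cinner_minus_right)

lemma cinner_eqI: "(\<And>w. cinner w u = cinner w v) \<Longrightarrow> u = (v::'h::chilbert_space)"
  using cinner_diff_right[of "u - v" u v] cinner_self[of "u - v"] by simp

lemma type_hnorm: "hnorm type_ip x = norm (x::'h::chilbert_space)"
  by (simp add: hnorm_def type_ip_def norm_eq_sqrt_cinner)

lemma type_vsub: "vsub type_ip x y = x - (y::'h::chilbert_space)"
  by (simp add: vsub_def type_ip_def scaleC_minus_one)

lemma hilb_type: "hilb (type_ip :: 'h::chilbert_space ip_space)"
proof
  show "\<And>u v w. u \<in> carrier type_ip \<Longrightarrow> v \<in> carrier type_ip \<Longrightarrow> w \<in> carrier type_ip \<Longrightarrow>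
      ip type_ip (u::'h) (v \<oplus>\<^bsub>type_ip\<^esub> w) = ip type_ip u v + ip type_ip u w"
    by (simp add: type_ip_def cinner_add_right)
  show "\<And>u v c. u \<in> carrier type_ip \<Longrightarrow> v \<in> carrier type_ip \<Longrightarrow>
      ip type_ip (u::'h) (c \<odot>\<^bsub>type_ip\<^esub> v) = c * ip type_ip u v"
    by (simp add: type_ip_def cinner_scaleC_right)
  show "\<And>u v. u \<in> carrier type_ip \<Longrightarrow> v \<in> carrier type_ip \<Longrightarrow> ip type_ip (u::'h) v = cnj (ip type_ip v u)"
    unfolding type_ip_def using cinner_commute by simp
  show "\<And>v. v \<in> carrier type_ip \<Longrightarrow> 0 \<le> Re (ip type_ip (v::'h) v)"
    by (simp add: type_ip_def cinner_self)
  show "u = v" if "\<And>w. w \<in> carrier type_ip \<Longrightarrow> ip type_ip w u = ip type_ip w v" for u v :: 'h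
    by (rule cinner_eqI) (use that in \<open>simp add: type_ip_def\<close>)
  fix s :: "nat \<Rightarrow> 'h"
  assume "\<And>\<epsilon>. 0 < \<epsilon> \<Longrightarrow> \<exists>N. \<forall>i\<ge>N. \<forall>j\<ge>N. hnorm type_ip (vsub type_ip (s i) (s j)) < \<epsilon>"
  then have "Cauchy s" unfolding type_hnorm type_vsub Cauchy_iff by blast
  then obtain l where "s \<longlonglongrightarrow> l" by (auto simp: Cauchy_convergent_iff convergent_def)
  then have "(\<lambda>n. norm (s n - l)) \<longlonglongrightarrow> 0" by (simp add: LIM_zero tendsto_norm_zero)
  then show "\<exists>l\<in>carrier type_ip. (\<lambda>n. hnorm type_ip (vsub type_ip (s n) l)) \<longlonglongrightarrow> 0"
    unfolding type_hnorm type_vsub by (auto simp: type_ip_def)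
qed (simp_all add: type_ip_def)

lemma cinner_cauchy_schwarz: "cmod (cinner x y) \<le> norm x * norm (y::'h::chilbert_space)"
  using hilb.cauchy_schwarz[OF hilb_type, of x y] unfolding type_hnorm by (simp add: type_ip_def)

lemma norm_scaleC [simp]: "norm (c *\<^sub>C x) = cmod c * norm (x::'h::chilbert_space)"
  using hilb.hnorm_smult[OF hilb_type, of x c] unfolding type_hnorm by (simp add: type_ip_def)

lemma cinner_add_left: "cinner (x + y) z = cinner x z + cinner y (z::'h::chilbert_space)"
  by (subst (1 2 3) cinner_commute) (simp add: cinner_add_right)

lemma cinner_scaleC_left: "cinner (c *\<^sub>C x) y = cnj c * cinner x (y::'h::chilbert_space)"
  by (subst (1 2) cinner_commute) (simp add: cinner_scaleC_right)

text \<open>Supplies the joint continuity behind the measurability of pointwise products.\<close>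

lemma bounded_bilinear_scaleC: "bounded_bilinear (scaleC :: complex \<Rightarrow> 'h::chilbert_space \<Rightarrow> 'h)"
proof
  show "\<exists>K. \<forall>a b. norm (a *\<^sub>C (b::'h)) \<le> norm a * norm b * K" by (rule exI[of _ 1]) simp
qed (simp_all add: scaleC_add_left scaleC_add_right scaleC_of_real[symmetric] scaleC_scaleC
    scaleR_conv_of_real scaleC_complex_def mult.commute)

lemma bounded_bilinear_cinner: "bounded_bilinear (cinner :: 'h::chilbert_space \<Rightarrow> 'h \<Rightarrow> complex)"
proof
  show "\<exists>K. \<forall>a b. cmod (cinner a (b::'h)) \<le> norm a * norm b * K"
    by (rule exI[of _ 1]) (simp add: cinner_cauchy_schwarz)
qed (simp_all add: cinner_add_left cinner_add_right scaleC_of_real[symmetric] cinner_scaleC_left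
    cinner_scaleC_right scaleR_conv_of_real scaleC_complex_def)

text \<open>Strong measurability. For non-separable values Borel measurability alone is not known to
  survive sums: the Borel sets of a product may exceed the product sigma-algebra.\<close>

definition smeas :: "'x measure \<Rightarrow> ('x \<Rightarrow> 'b::metric_space) \<Rightarrow> bool"
  where "smeas M f \<longleftrightarrow> f \<in> borel_measurable M \<and> (\<exists>C. countable C \<and> f ` space M \<subseteq> closure C)"

lemma smeas_measurable: "smeas M f \<Longrightarrow> f \<in> borel_measurable M"
  by (simp add: smeas_def)

lemma smeas_const: "smeas M (\<lambda>x. c)"
  unfolding smeas_def using closure_subset[of "{c}"] by (auto intro!: exI[of _ "{c}"])

lemma smeas_complex:
  fixes f :: "'x \<Rightarrow> complex"
  assumes "f \<in> borel_measurable M"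
  shows "smeas M f"
proof -
  obtain C :: "complex set" where "countable C" "UNIV \<subseteq> closure C"
    using separable[of "UNIV :: complex set"] by auto
  then show ?thesis unfolding smeas_def using assms by blast
qed

text \<open>\<open>k n x\<close> is the first index of a point of a countable set that is within
  \<open>1 / (n + 1)\<close> of \<open>f x\<close>. The approximants thus factor through the natural
  numbers, where measurability is a statement about single indices.\<close>

lemma smeas_approx:
  fixes f :: "'x \<Rightarrow> 'b::metric_space"
  assumes f: "smeas M f"
  shows "\<exists>c k. (\<forall>n. k n \<in> measurable M (count_space (UNIV::nat set))) \<and>
    (\<forall>x\<in>space M. (\<lambda>n. c (k n x :: nat) :: 'b) \<longlonglongrightarrow> f x)"
proof (cases "space M = {}")
  case True
  then show ?thesis by (auto simp: measurable_def intro!: exI[of _ "\<lambda>_. undefined"] exI[of _ "\<lambda>_ _. 0"])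
next
  case False
  obtain C where C: "countable C" "f ` space M \<subseteq> closure C" using f by (auto simp: smeas_def)
  then have "C \<noteq> {}" using False by auto
  define c where "c = from_nat_into C"
  have rc: "range c = C" unfolding c_def by (rule range_from_nat_into[OF \<open>C \<noteq> {}\<close> C(1)])
  define k where "k n x = (LEAST i. dist (f x) (c i) < inverse (real (Suc n)))" for n x
  have "k n \<in> measurable M (count_space UNIV)" for n
    unfolding k_def
  proof (rule measurable_Least)
    fix i
    have "f -` ball (c i) (inverse (real (Suc n))) \<inter> space M \<in> sets M"
      using f by (intro measurable_sets[of f M borel]) (auto simp: smeas_def)
    moreover have "f -` ball (c i) (inverse (real (Suc n))) \<inter> space M =
        {x \<in> space M. dist (f x) (c i) < inverse (real (Suc n))}" by (auto simp: dist_commute)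
    ultimately show "Measurable.pred M (\<lambda>x. dist (f x) (c i) < inverse (real (Suc n)))"
      by (simp add: pred_def)
  qed
  moreover have "(\<lambda>n. c (k n x)) \<longlonglongrightarrow> f x" if x: "x \<in> space M" for x
  proof -
    have "dist (c (k n x)) (f x) < inverse (real (Suc n))" for n
    proof -
      have "f x \<in> closure C" using C x by auto
      moreover have "0 < inverse (real (Suc n))" by simp
      ultimately obtain y where y: "y \<in> C" "dist y (f x) < inverse (real (Suc n))"
        unfolding closure_approachable by blast
      obtain i where "y = c i" using y(1) rc by blast
      then have "dist (f x) (c i) < inverse (real (Suc n))" using y(2) by (simp add: dist_commute)
      then have "dist (f x) (c (k n x)) < inverse (real (Suc n))" unfolding k_def by (rule LeastI)
      then show ?thesis by (simp add: dist_commute)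
    qed
    then have "\<forall>n. norm (dist (c (k n x)) (f x)) \<le> inverse (real (Suc n))" by (simp add: less_imp_le)
    then have "(\<lambda>n. dist (c (k n x)) (f x)) \<longlonglongrightarrow> 0"
      by (intro Lim_null_comparison[OF _ LIMSEQ_inverse_real_of_nat]) simp
    then show ?thesis by (subst tendsto_dist_iff)
  qed
  ultimately show ?thesis by (intro exI[of _ c] exI[of _ k]) simp
qed

text \<open>Both functions are approximated by countably valued ones, so the approximants of the
  combination are measurable by a countable case distinction; continuity passes to the limit,
  without recourse to a product sigma-algebra.\<close>

lemma smeas_continuous2:
  fixes \<Phi> :: "'a::metric_space \<times> 'b::metric_space \<Rightarrow> 'c::metric_space"
  assumes f: "smeas M f" and g: "smeas M g" and \<Phi>: "continuous_on UNIV \<Phi>"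
  shows "smeas M (\<lambda>x. \<Phi> (f x, g x))"
proof -
  obtain c k where k: "\<And>n. k n \<in> measurable M (count_space (UNIV::nat set))"
      "\<And>x. x \<in> space M \<Longrightarrow> (\<lambda>n. c (k n x)) \<longlonglongrightarrow> f x" using smeas_approx[OF f] by blast
  obtain d l where l: "\<And>n. l n \<in> measurable M (count_space (UNIV::nat set))"
      "\<And>x. x \<in> space M \<Longrightarrow> (\<lambda>n. d (l n x)) \<longlonglongrightarrow> g x" using smeas_approx[OF g] by blast
  have "(\<lambda>x. \<Phi> (f x, g x)) \<in> borel_measurable M"
  proof (rule borel_measurable_LIMSEQ_metric)
    fix n
    have "(\<lambda>x. \<Phi> (c i, d (l n x))) \<in> borel_measurable M" for i
      by (rule measurable_compose[OF l(1)]) simp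
    then show "(\<lambda>x. \<Phi> (c (k n x), d (l n x))) \<in> borel_measurable M"
      by (rule measurable_compose_countable[OF _ k(1)])
  next
    fix x assume x: "x \<in> space M"
    have "(\<lambda>n. (c (k n x), d (l n x))) \<longlonglongrightarrow> (f x, g x)" by (intro tendsto_Pair k(2)[OF x] l(2)[OF x])
    then show "(\<lambda>n. \<Phi> (c (k n x), d (l n x))) \<longlonglongrightarrow> \<Phi> (f x, g x)"
      by (rule continuous_on_tendsto_compose[OF \<Phi>]) simp_all
  qed
  moreover obtain C where C: "countable C" "f ` space M \<subseteq> closure C" using f by (auto simp: smeas_def)
  moreover obtain D where D: "countable D" "g ` space M \<subseteq> closure D" using g by (auto simp: smeas_def)
  moreover have "(\<lambda>x. \<Phi> (f x, g x)) ` space M \<subseteq> closure (\<Phi> ` (C \<times> D))"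
  proof -
    have "(\<lambda>x. \<Phi> (f x, g x)) ` space M \<subseteq> \<Phi> ` closure (C \<times> D)"
      using C D by (auto simp: closure_Times)
    also have "\<dots> \<subseteq> closure (\<Phi> ` (C \<times> D))"
      by (rule continuous_image_closure_subset[OF \<Phi>]) simp
    finally show ?thesis .
  qed
  ultimately show ?thesis unfolding smeas_def by (meson countable_SIGMA countable_image)
qed

lemma smeas_add: "\<lbrakk>smeas M f; smeas M g\<rbrakk> \<Longrightarrow> smeas M (\<lambda>x. f x + (g x :: 'b::real_normed_vector))"
  using smeas_continuous2[of M f g "\<lambda>(u, v). u + v"] by (simp add: case_prod_unfold continuous_intros)

lemma smeas_diff: "\<lbrakk>smeas M f; smeas M g\<rbrakk> \<Longrightarrow> smeas M (\<lambda>x. f x - (g x :: 'b::real_normed_vector))"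
  using smeas_continuous2[of M f g "\<lambda>(u, v). u - v"] by (simp add: case_prod_unfold continuous_intros)

lemma smeas_scaleC: "\<lbrakk>smeas M f; smeas M g\<rbrakk> \<Longrightarrow> smeas M (\<lambda>x. f x *\<^sub>C (g x :: 'h::chilbert_space))"
  using smeas_continuous2[of M f g "\<lambda>(u, v). u *\<^sub>C v"]
  by (simp add: case_prod_unfold bounded_bilinear.continuous_on[OF bounded_bilinear_scaleC] continuous_intros)

lemma smeas_cinner: "\<lbrakk>smeas M f; smeas M g\<rbrakk> \<Longrightarrow> smeas M (\<lambda>x. cinner (f x) (g x :: 'h::chilbert_space))"
  using smeas_continuous2[of M f g "\<lambda>(u, v). cinner u v"]
  by (simp add: case_prod_unfold bounded_bilinear.continuous_on[OF bounded_bilinear_cinner] continuous_intros)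

lemma smeas_LIMSEQ:
  fixes f :: "nat \<Rightarrow> 'x \<Rightarrow> 'b::metric_space"
  assumes f: "\<And>n. smeas M (f n)" and lim: "\<And>x. x \<in> space M \<Longrightarrow> (\<lambda>n. f n x) \<longlonglongrightarrow> g x"
  shows "smeas M g"
proof -
  have "\<forall>n. \<exists>C. countable C \<and> f n ` space M \<subseteq> closure C" using f by (simp add: smeas_def)
  then obtain C where C: "\<And>n. countable (C n)" "\<And>n. f n ` space M \<subseteq> closure (C n)" by metis
  have "g x \<in> closure (\<Union>n. C n)" if x: "x \<in> space M" for x
  proof (rule Lim_in_closed_set[OF closed_closure _ _ lim[OF x]])
    have "f n x \<in> closure (\<Union>n. C n)" for n
      using C(2)[of n] x closure_mono[of "C n" "\<Union>n. C n"] by blast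
    then show "\<forall>\<^sub>F n in sequentially. f n x \<in> closure (\<Union>n. C n)" by simp
  qed simp
  moreover have "countable (\<Union>n. C n)" using C(1) by simp
  moreover have "g \<in> borel_measurable M"
    by (rule borel_measurable_LIMSEQ_metric[OF smeas_measurable[OF f] lim])
  ultimately show ?thesis unfolding smeas_def by blast
qed

section \<open>Square integrable functions with values in a Hilbert space\<close>

lemma square_int_iff:
  "f \<in> square_int M \<longleftrightarrow> smeas M f \<and> integrable M (\<lambda>x. (norm (f x))\<^sup>2)"
  by (auto simp: square_int_def smeas_def)

lemma square_int_smeas: "f \<in> square_int M \<Longrightarrow> smeas M f"
  by (simp add: square_int_iff)

lemma norm_measurable: "smeas M f \<Longrightarrow> (\<lambda>x. norm (f x :: 'b::real_normed_vector)) \<in> borel_measurable M"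
  by (rule measurable_compose[OF smeas_measurable borel_measurable_norm])

lemma square_int_bound:
  fixes f :: "'x \<Rightarrow> 'h::chilbert_space"
  assumes "smeas M f" "integrable M g" "AE x in M. (norm (f x))\<^sup>2 \<le> (g x :: real)"
  shows "f \<in> square_int M"
  unfolding square_int_iff
proof
  show "integrable M (\<lambda>x. (norm (f x))\<^sup>2)"
    by (rule Bochner_Integration.integrable_bound[OF assms(2)])
       (use assms norm_measurable in \<open>auto intro!: borel_measurable_power\<close>)
qed (rule assms)

lemma norm_add_sq_le: "(norm (x + y :: 'b::real_normed_vector))\<^sup>2 \<le> 2 * (norm x)\<^sup>2 + 2 * (norm y)\<^sup>2"
proof -
  have "(norm (x + y))\<^sup>2 \<le> (norm x + norm y)\<^sup>2" by (intro power_mono norm_triangle_ineq) simp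
  also have "\<dots> \<le> 2 * (norm x)\<^sup>2 + 2 * (norm y)\<^sup>2"
    using sum_squares_bound[of "norm x" "norm y"] by (simp add: power2_sum)
  finally show ?thesis .
qed

lemma square_int_add:
  assumes f: "f \<in> square_int M" and g: "g \<in> square_int M"
  shows "(\<lambda>x. f x + (g x :: 'h::chilbert_space)) \<in> square_int M"
  by (rule square_int_bound[where g = "\<lambda>x. 2 * (norm (f x))\<^sup>2 + 2 * (norm (g x))\<^sup>2"])
     (use f g in \<open>auto simp: square_int_iff smeas_add norm_add_sq_le\<close>)

lemma square_int_mult:
  fixes f :: "'x \<Rightarrow> complex" and g :: "'x \<Rightarrow> 'h::chilbert_space"
  assumes f: "f \<in> borel_measurable M" "\<And>x. x \<in> space M \<Longrightarrow> cmod (f x) \<le> B" and g: "g \<in> square_int M"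
  shows "(\<lambda>x. f x *\<^sub>C g x) \<in> square_int M"
proof (rule square_int_bound[where g = "\<lambda>x. B\<^sup>2 * (norm (g x))\<^sup>2"])
  show "smeas M (\<lambda>x. f x *\<^sub>C g x)" by (intro smeas_scaleC smeas_complex f square_int_smeas g)
  show "AE x in M. (norm (f x *\<^sub>C g x))\<^sup>2 \<le> B\<^sup>2 * (norm (g x))\<^sup>2"
    by (rule AE_I2) (use f in \<open>auto simp: power_mult_distrib intro!: mult_right_mono power_mono\<close>)
qed (use g in \<open>simp add: square_int_iff\<close>)

lemma square_int_scale: "f \<in> square_int M \<Longrightarrow> (\<lambda>x. c *\<^sub>C (f x :: 'h::chilbert_space)) \<in> square_int M"
  by (rule square_int_mult[where B = "cmod c"]) simp_all

lemma square_int_diff: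
  assumes f: "f \<in> square_int M" and g: "g \<in> square_int M"
  shows "(\<lambda>x. f x - (g x :: 'h::chilbert_space)) \<in> square_int M"
  using square_int_add[OF f square_int_scale[OF g, of "-1"]] by (simp add: scaleC_minus_one)

lemma square_int_zero [simp]: "(\<lambda>x. 0 :: 'h::chilbert_space) \<in> square_int M"
  by (simp add: square_int_iff smeas_const)

lemma cinner_integrable:
  fixes f g :: "'x \<Rightarrow> 'h::chilbert_space"
  assumes f: "f \<in> square_int M" and g: "g \<in> square_int M"
  shows "integrable M (\<lambda>x. cinner (f x) (g x))"
proof (rule Bochner_Integration.integrable_bound)
  show "integrable M (\<lambda>x. (norm (f x))\<^sup>2 + (norm (g x))\<^sup>2)" using f g by (simp add: square_int_iff)
  show "(\<lambda>x. cinner (f x) (g x)) \<in> borel_measurable M"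
    by (intro smeas_measurable smeas_cinner square_int_smeas f g)
  have "cmod (cinner u v) \<le> (norm u)\<^sup>2 + (norm v)\<^sup>2" for u v :: 'h
  proof -
    have "norm u * norm v \<le> (norm u)\<^sup>2 + (norm v)\<^sup>2"
      using sum_squares_bound[of "norm u" "norm v"] mult_nonneg_nonneg[OF norm_ge_zero[of u] norm_ge_zero[of v]]
      by linarith
    then show ?thesis using cinner_cauchy_schwarz[of u v] by linarith
  qed
  then show "AE x in M. norm (cinner (f x) (g x)) \<le> norm ((norm (f x))\<^sup>2 + (norm (g x))\<^sup>2)" by simp
qed

section \<open>Classes modulo null sets and their representatives\<close>

lemma L2_class_self: "f \<in> square_int M \<Longrightarrow> f \<in> L2_class M f"
  by (simp add: L2_class_def)

lemma L2_class_eq_iff: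
  assumes "f \<in> square_int M" "g \<in> square_int M"
  shows "L2_class M f = L2_class M g \<longleftrightarrow> (AE x in M. f x = g x)"
proof
  assume "L2_class M f = L2_class M g"
  then have "f \<in> L2_class M g" using L2_class_self[OF assms(1)] by simp
  then show "AE x in M. f x = g x" by (simp add: L2_class_def)
next
  assume *: "AE x in M. f x = g x"
  have "(AE x in M. h x = f x) \<longleftrightarrow> (AE x in M. h x = g x)" for h
  proof
    assume "AE x in M. h x = f x" with * show "AE x in M. h x = g x" by eventually_elim simp
  next
    assume "AE x in M. h x = g x" with * show "AE x in M. h x = f x" by eventually_elim simp
  qed
  then show "L2_class M f = L2_class M g" by (simp add: L2_class_def)
qed

lemma L2_carrier_iff: "a \<in> carrier (L2 M) \<longleftrightarrow> (\<exists>f\<in>square_int M. a = L2_class M f)"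
  by (auto simp: L2_def)

lemma L2_class_closed [simp, intro]: "f \<in> square_int M \<Longrightarrow> L2_class M f \<in> carrier (L2 M)"
  by (auto simp: L2_carrier_iff)

lemma rep_L2_class:
  assumes "f \<in> square_int M"
  shows "rep (L2_class M f) \<in> square_int M" "AE x in M. rep (L2_class M f) x = f x"
proof -
  have "rep (L2_class M f) \<in> L2_class M f"
    unfolding rep_def by (rule someI[of "\<lambda>g. g \<in> L2_class M f", OF L2_class_self[OF assms]])
  then show "rep (L2_class M f) \<in> square_int M" "AE x in M. rep (L2_class M f) x = f x"
    by (simp_all add: L2_class_def)
qed

lemma rep_square_int [simp]: "a \<in> carrier (L2 M) \<Longrightarrow> rep a \<in> square_int M"
  using rep_L2_class(1) by (auto simp: L2_carrier_iff)

lemma L2_class_rep [simp]: assumes "a \<in> carrier (L2 M)" shows "L2_class M (rep a) = a"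
proof -
  obtain f where f: "f \<in> square_int M" "a = L2_class M f" using assms by (auto simp: L2_carrier_iff)
  show ?thesis unfolding f(2) L2_class_eq_iff[OF rep_L2_class(1)[OF f(1)] f(1)] by (rule rep_L2_class(2)[OF f(1)])
qed

lemma L2_eqI:
  assumes "a \<in> carrier (L2 M)" "b \<in> carrier (L2 M)" "AE x in M. rep a x = rep b x"
  shows "a = b"
  using assms L2_class_eq_iff[of "rep a" M "rep b"] by simp

lemma L2_simps:
  "a \<oplus>\<^bsub>L2 M\<^esub> b = L2_class M (\<lambda>x. rep a x + rep b x)"
  "c \<odot>\<^bsub>L2 M\<^esub> a = L2_class M (\<lambda>x. c *\<^sub>C rep a x)"
  "\<zero>\<^bsub>L2 M\<^esub> = L2_class M (\<lambda>x. 0)"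
  "ip (L2 M) a b = (\<integral>x. cinner (rep a x) (rep b x) \<partial>M)"
  by (simp_all add: L2_def)

lemma ip_L2_class:
  fixes f g :: "'x \<Rightarrow> 'h::chilbert_space"
  assumes f: "f \<in> square_int M" and g: "g \<in> square_int M"
  shows "ip (L2 M) (L2_class M f) (L2_class M g) = (\<integral>x. cinner (f x) (g x) \<partial>M)"
  unfolding L2_simps
proof (rule integral_cong_AE)
  show "AE x in M. cinner (rep (L2_class M f) x) (rep (L2_class M g) x) = cinner (f x) (g x)"
    using rep_L2_class(2)[OF f] rep_L2_class(2)[OF g] by eventually_elim simp
qed (use rep_L2_class(1) f g in \<open>auto intro!: borel_measurable_integrable cinner_integrable\<close>)

lemma ip_L2_class_right:
  assumes a: "a \<in> carrier (L2 M)" and g: "g \<in> square_int M"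
  shows "ip (L2 M) a (L2_class M g) = (\<integral>x. cinner (rep a x) (g x :: 'h::chilbert_space) \<partial>M)"
  using ip_L2_class[OF rep_square_int[OF a] g] a by simp

lemma L2_norm_eq:
  fixes f :: "'x \<Rightarrow> 'h::chilbert_space"
  assumes f: "f \<in> square_int M"
  shows "ip (L2 M) (L2_class M f) (L2_class M f) = complex_of_real (\<integral>x. (norm (f x))\<^sup>2 \<partial>M)"
    and "(hnorm (L2 M) (L2_class M f))\<^sup>2 = (\<integral>x. (norm (f x))\<^sup>2 \<partial>M)"
proof -
  show e: "ip (L2 M) (L2_class M f) (L2_class M f) = complex_of_real (\<integral>x. (norm (f x))\<^sup>2 \<partial>M)"
    unfolding ip_L2_class[OF f f] cinner_self by (rule integral_complex_of_real)
  show "(hnorm (L2 M) (L2_class M f))\<^sup>2 = (\<integral>x. (norm (f x))\<^sup>2 \<partial>M)"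
    unfolding hnorm_def e by simp
qed

lemma L2_vsub_class:
  fixes a b :: "('x \<Rightarrow> 'h::chilbert_space) set"
  assumes a: "a \<in> carrier (L2 M)" and b: "b \<in> carrier (L2 M)"
  shows "vsub (L2 M) a b = L2_class M (\<lambda>x. rep a x - rep b x)"
proof -
  have sb: "(\<lambda>x. (-1) *\<^sub>C rep b x) \<in> square_int M" using b by (simp add: square_int_scale)
  have "vsub (L2 M) a b = L2_class M (\<lambda>x. rep a x + rep (L2_class M (\<lambda>x. (-1) *\<^sub>C rep b x)) x)"
    by (simp add: vsub_def L2_simps)
  also have "\<dots> = L2_class M (\<lambda>x. rep a x - rep b x)"
  proof (subst L2_class_eq_iff)
    show "AE x in M. rep a x + rep (L2_class M (\<lambda>x. (-1) *\<^sub>C rep b x)) x = rep a x - rep b x"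
      using rep_L2_class(2)[OF sb] by eventually_elim (simp add: scaleC_minus_one)
  qed (use a b sb rep_L2_class(1)[OF sb] in \<open>auto intro!: square_int_add square_int_diff\<close>)
  finally show ?thesis .
qed

text \<open>As an extended nonnegative integral the distance can be used with Fatou's lemma before
  the limit is known to be square integrable.\<close>

lemma L2_dist_nn:
  fixes a b :: "('x \<Rightarrow> 'h::chilbert_space) set"
  assumes a: "a \<in> carrier (L2 M)" and b: "b \<in> carrier (L2 M)"
  shows "ennreal ((hnorm (L2 M) (vsub (L2 M) a b))\<^sup>2) = (\<integral>\<^sup>+x. ennreal ((norm (rep a x - rep b x))\<^sup>2) \<partial>M)"
proof -
  have d: "(\<lambda>x. rep a x - rep b x) \<in> square_int M" using a b by (simp add: square_int_diff)
  show ?thesis unfolding L2_vsub_class[OF a b] L2_norm_eq(2)[OF d]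
    using d by (intro nn_integral_eq_integral[symmetric]) (auto simp: square_int_iff)
qed

text \<open>Summing \<open>4\<^sup>k \<parallel>G\<^sub>k\<^sub>+\<^sub>1 - G\<^sub>k\<parallel>\<^sup>2\<close> instead of \<open>\<parallel>G\<^sub>k\<^sub>+\<^sub>1 - G\<^sub>k\<parallel>\<close> avoids Minkowski's inequality.\<close>

lemma AE_convergent_of_summable_distance:
  fixes G :: "nat \<Rightarrow> 'x \<Rightarrow> 'h::chilbert_space"
  assumes G: "\<And>k. G k \<in> square_int M"
    and small: "\<And>k. (\<integral>\<^sup>+x. ennreal ((norm (G (Suc k) x - G k x))\<^sup>2) \<partial>M) \<le> ennreal ((1 / 16) ^ k)"
  shows "AE x in M. convergent (\<lambda>k. G k x)"
proof -
  define u where "u k x = ennreal (4 ^ k * (norm (G (Suc k) x - G k x))\<^sup>2)" for k x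
  have mG: "(\<lambda>x. norm (G (Suc k) x - G k x)) \<in> borel_measurable M" for k
    using square_int_diff[OF G G] by (intro norm_measurable square_int_smeas)
  have um: "u k \<in> borel_measurable M" for k
    unfolding u_def using mG by measurable
  have "(\<integral>\<^sup>+x. u k x \<partial>M) \<le> ennreal ((1 / 4) ^ k)" for k
  proof -
    have "(\<integral>\<^sup>+x. u k x \<partial>M) = ennreal (4 ^ k) * (\<integral>\<^sup>+x. ennreal ((norm (G (Suc k) x - G k x))\<^sup>2) \<partial>M)"
      unfolding u_def using mG by (subst nn_integral_cmult[symmetric]) (auto simp: ennreal_mult)
    also have "\<dots> \<le> ennreal (4 ^ k) * ennreal ((1 / 16) ^ k)" by (intro mult_left_mono small) simp
    also have "\<dots> = ennreal ((1 / 4) ^ k)"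
      by (simp add: ennreal_mult[symmetric] power_mult_distrib[symmetric])
    finally show ?thesis .
  qed
  then have "(\<Sum>k. \<integral>\<^sup>+x. u k x \<partial>M) \<le> (\<Sum>k. ennreal ((1 / 4) ^ k))"
    by (intro suminf_le) auto
  also have "\<dots> = ennreal (\<Sum>k. (1 / 4) ^ k)"
    by (rule suminf_ennreal2) (auto intro: summable_geometric)
  finally have "(\<integral>\<^sup>+x. (\<Sum>k. u k x) \<partial>M) \<le> ennreal (\<Sum>k. (1 / 4) ^ k)"
    by (simp add: nn_integral_suminf[OF um])
  then have "(\<integral>\<^sup>+x. (\<Sum>k. u k x) \<partial>M) \<noteq> \<infinity>" 
    using neq_top_trans[OF ennreal_neq_top] by simp
  then have "AE x in M. (\<Sum>k. u k x) \<noteq> \<infinity>"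
    by (intro nn_integral_PInf_AE) (use um in auto)
  then show ?thesis
  proof eventually_elim
    case (elim x)
    then obtain B where B: "B \<ge> 0" "(\<Sum>k. u k x) = ennreal B" by (cases "\<Sum>k. u k x") auto
    \<comment> \<open>A single term of the series is at most its sum \<open>B\<close>; the weight
      \<open>4 ^ k\<close> becomes geometric decay with ratio 1/2 after taking the root.\<close>
    have "norm (G (Suc k) x - G k x) \<le> sqrt B * (1 / 2) ^ k" for k
    proof -
      have "(\<Sum>i\<in>{k}. u i x) \<le> (\<Sum>i. u i x)" by (rule sum_le_suminf) auto
      then have "u k x \<le> ennreal B" using B by simp
      then have "4 ^ k * (norm (G (Suc k) x - G k x))\<^sup>2 \<le> B" using B(1) by (simp add: u_def)
      moreover have "(4::real) ^ k = (2 ^ k)\<^sup>2" by (simp add: power2_eq_square power_mult_distrib[symmetric])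
      ultimately have "(2 ^ k * norm (G (Suc k) x - G k x))\<^sup>2 \<le> B" by (simp add: power_mult_distrib)
      then have "2 ^ k * norm (G (Suc k) x - G k x) \<le> sqrt B" by (rule real_le_rsqrt)
      then show ?thesis by (simp add: field_simps power_divide)
    qed
    note bound = this
    have "summable (\<lambda>k. sqrt B * (1 / 2 :: real) ^ k)" by (rule summable_mult[OF summable_geometric]) simp
    then have "summable (\<lambda>k. G (Suc k) x - G k x)" by (rule summable_comparison_test') (rule bound)
    then have "convergent (\<lambda>n. \<Sum>k<n. G (Suc k) x - G k x)" by (simp add: summable_iff_convergent)
    then have "convergent (\<lambda>n. G n x - G 0 x)" 
      by (simp only: sum_lessThan_telescope[of "\<lambda>k. G k x"])
    then show ?case unfolding convergent_diff_const_right_iff .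
  qed
qed

text \<open>Fatou's lemma for the squared distances to a fixed function \<open>f\<close>.\<close>

lemma nn_integral_sq_limit:
  fixes G :: "nat \<Rightarrow> 'x \<Rightarrow> 'h::chilbert_space"
  assumes G: "\<And>k. smeas M (G k)" and f: "smeas M f" and lim: "AE x in M. (\<lambda>k. G k x) \<longlonglongrightarrow> g x"
    and bound: "\<And>k. k \<ge> K \<Longrightarrow> (\<integral>\<^sup>+x. ennreal ((norm (G k x - f x))\<^sup>2) \<partial>M) \<le> C"
  shows "(\<integral>\<^sup>+x. ennreal ((norm (g x - f x))\<^sup>2) \<partial>M) \<le> C"
proof -
  have m: "(\<lambda>x. norm (G k x - f x)) \<in> borel_measurable M" for k
    by (intro norm_measurable smeas_diff G f)
  have "(\<integral>\<^sup>+x. ennreal ((norm (g x - f x))\<^sup>2) \<partial>M) = (\<integral>\<^sup>+x. liminf (\<lambda>k. ennreal ((norm (G k x - f x))\<^sup>2)) \<partial>M)"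
  proof (rule nn_integral_cong_AE)
    show "AE x in M. ennreal ((norm (g x - f x))\<^sup>2) = liminf (\<lambda>k. ennreal ((norm (G k x - f x))\<^sup>2))"
      using lim
    proof eventually_elim
      case (elim x)
      then have "(\<lambda>k. ennreal ((norm (G k x - f x))\<^sup>2)) \<longlonglongrightarrow> ennreal ((norm (g x - f x))\<^sup>2)"
        by (intro tendsto_intros)
      then show ?case by (rule lim_imp_Liminf[symmetric, rotated]) simp
    qed
  qed
  also have "\<dots> \<le> liminf (\<lambda>k. \<integral>\<^sup>+x. ennreal ((norm (G k x - f x))\<^sup>2) \<partial>M)"
    by (rule nn_integral_liminf) (use m in measurable)
  also have "\<dots> \<le> C"
    by (rule Liminf_le) (use bound in \<open>auto simp: eventually_sequentially\<close>)
  finally show ?thesis .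
qed

text \<open>Riesz--Fischer: a rapidly converging subsequence of representatives converges almost
  everywhere, and the Cauchy condition passes to the limit function by Fatou.\<close>

lemma L2_complete:
  fixes s :: "nat \<Rightarrow> ('x \<Rightarrow> 'h::chilbert_space) set"
  assumes s: "\<And>n. s n \<in> carrier (L2 M)"
    and cauchy: "\<And>\<epsilon>. \<epsilon> > 0 \<Longrightarrow> \<exists>N. \<forall>i\<ge>N. \<forall>j\<ge>N. hnorm (L2 M) (vsub (L2 M) (s i) (s j)) < \<epsilon>"
  shows "\<exists>l\<in>carrier (L2 M). (\<lambda>n. hnorm (L2 M) (vsub (L2 M) (s n) l)) \<longlonglongrightarrow> 0"
proof -
  define F where "F n = rep (s n)" for n
  have F: "F n \<in> square_int M" for n using s by (simp add: F_def)
  have nonneg: "hnorm (L2 M) (vsub (L2 M) (s i) (s j)) \<ge> 0" for i j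
  proof -
    have "(\<lambda>x. rep (s i) x - rep (s j) x) \<in> square_int M" using s by (simp add: square_int_diff)
    then show ?thesis by (simp add: L2_vsub_class[OF s s] hnorm_def L2_norm_eq(1))
  qed
  have dist: "(\<integral>\<^sup>+x. ennreal ((norm (F i x - F j x))\<^sup>2) \<partial>M) \<le> ennreal (\<epsilon>\<^sup>2)"
    if "hnorm (L2 M) (vsub (L2 M) (s i) (s j)) < \<epsilon>" for i j \<epsilon>
    unfolding F_def L2_dist_nn[OF s s, symmetric]
    using that nonneg[of i j] by (intro ennreal_leI power_mono) auto
  have "\<forall>k. \<exists>N. \<forall>i\<ge>N. \<forall>j\<ge>N. hnorm (L2 M) (vsub (L2 M) (s i) (s j)) < (1 / 4) ^ k"
    using cauchy by simp
  then obtain N where N: "\<And>k i j. \<lbrakk>i \<ge> N k; j \<ge> N k\<rbrakk> \<Longrightarrow> hnorm (L2 M) (vsub (L2 M) (s i) (s j)) < (1 / 4) ^ k"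
    by metis
  \<comment> \<open>The sum makes \<open>r\<close> monotone and at least \<open>N k\<close>, and the
    summand \<open>k\<close> makes it unbounded, without a recursive choice.\<close>
  define r where "r k = k + (\<Sum>i\<le>k. N i)" for k
  have rN: "N k \<le> r k" for k using member_le_sum[of k "{..k}" N] by (simp add: r_def)
  have rS: "r k \<le> r (Suc k)" for k by (simp add: r_def)
  have rk: "k \<le> r k" for k by (simp add: r_def)
  define G where "G k = F (r k)" for k
  have G: "G k \<in> square_int M" for k using F by (simp add: G_def)
  have "(\<integral>\<^sup>+x. ennreal ((norm (G (Suc k) x - G k x))\<^sup>2) \<partial>M) \<le> ennreal ((1 / 16) ^ k)" for k
  proof -
    have "hnorm (L2 M) (vsub (L2 M) (s (r (Suc k))) (s (r k))) < (1 / 4) ^ k"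
      by (rule N) (use rN[of k] rS[of k] in linarith)+
    moreover have "((1 / 4 :: real) ^ k)\<^sup>2 = (1 / 16) ^ k" by (simp add: power2_eq_square power_mult_distrib[symmetric])
    ultimately show ?thesis using dist[of "r (Suc k)" "r k" "(1 / 4) ^ k"] by (simp only: G_def)
  qed
  from AE_convergent_of_summable_distance[OF G this]
  obtain Z where Z: "{x \<in> space M. \<not> convergent (\<lambda>k. G k x)} \<subseteq> Z" "emeasure M Z = 0" "Z \<in> sets M"
    by (rule AE_E)
  \<comment> \<open>On a measurable null set containing the points of divergence the sequence is
    replaced by 0, so that the limit exists everywhere and is strongly measurable.\<close>
  define g where "g x = lim (\<lambda>k. if x \<in> Z then 0 else G k x)" for x
  have lim: "(\<lambda>k. if x \<in> Z then 0 else G k x) \<longlonglongrightarrow> g x" if "x \<in> space M" for x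
  proof -
    have "convergent (\<lambda>k. if x \<in> Z then 0 else G k x)"
      using Z(1) that by (cases "x \<in> Z") (auto intro: convergent_const)
    then show ?thesis unfolding g_def by (simp add: convergent_LIMSEQ_iff)
  qed
  have sg: "smeas M g"
  proof (rule smeas_LIMSEQ[OF _ lim])
    fix k
    have "smeas M (\<lambda>x. (if x \<in> Z then 0 else 1 :: complex) *\<^sub>C G k x)"
      by (intro smeas_scaleC smeas_complex square_int_smeas G measurable_If_set) (use Z in auto)
    moreover have "(\<lambda>x. (if x \<in> Z then 0 else 1 :: complex) *\<^sub>C G k x) = (\<lambda>x. if x \<in> Z then 0 else G k x)"
      by (auto simp: fun_eq_iff)
    ultimately show "smeas M (\<lambda>x. if x \<in> Z then 0 else G k x)" by simp
  qed
  have AElim: "AE x in M. (\<lambda>k. G k x) \<longlonglongrightarrow> g x"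
  proof (rule AE_I[OF _ Z(2,3)], safe)
    fix x assume x: "x \<in> space M" "\<not> (\<lambda>k. G k x) \<longlonglongrightarrow> g x"
    then show "x \<in> Z" using lim[OF x(1)] by (cases "x \<in> Z") auto
  qed
  have close: "\<exists>N. \<forall>i\<ge>N. (\<integral>\<^sup>+x. ennreal ((norm (g x - F i x))\<^sup>2) \<partial>M) \<le> ennreal (\<epsilon>\<^sup>2)" if e: "\<epsilon> > 0" for \<epsilon>
  proof -
    obtain N' where N': "\<And>i j. \<lbrakk>i \<ge> N'; j \<ge> N'\<rbrakk> \<Longrightarrow> hnorm (L2 M) (vsub (L2 M) (s i) (s j)) < \<epsilon>"
      using cauchy[OF e] by blast
    have "(\<integral>\<^sup>+x. ennreal ((norm (g x - F i x))\<^sup>2) \<partial>M) \<le> ennreal (\<epsilon>\<^sup>2)" if i: "i \<ge> N'" for i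
    proof (rule nn_integral_sq_limit[OF square_int_smeas[OF G] square_int_smeas[OF F] AElim])
      fix k assume "N' \<le> k"
      then have "r k \<ge> N'" using rk[of k] by linarith
      then show "(\<integral>\<^sup>+x. ennreal ((norm (G k x - F i x))\<^sup>2) \<partial>M) \<le> ennreal (\<epsilon>\<^sup>2)"
        unfolding G_def by (intro dist N' i)
    qed
    then show ?thesis by blast
  qed
  \<comment> \<open>Finite distance to one square integrable \<open>F i\<close> is enough.\<close>
  have gS: "g \<in> square_int M"
  proof -
    obtain i where i: "(\<integral>\<^sup>+x. ennreal ((norm (g x - F i x))\<^sup>2) \<partial>M) \<le> ennreal (1\<^sup>2)"
      using close[of 1] by auto
    have sd: "smeas M (\<lambda>x. g x - F i x)" by (intro smeas_diff sg square_int_smeas F)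
    have "integrable M (\<lambda>x. (norm (g x - F i x))\<^sup>2)"
    proof (rule integrableI_nonneg)
      show "(\<lambda>x. (norm (g x - F i x))\<^sup>2) \<in> borel_measurable M"
        using norm_measurable[OF sd] by measurable
      show "(\<integral>\<^sup>+x. ennreal ((norm (g x - F i x))\<^sup>2) \<partial>M) < \<infinity>" by (rule le_less_trans[OF i]) simp
    qed simp
    then have "(\<lambda>x. g x - F i x) \<in> square_int M" using sd by (simp add: square_int_iff)
    from square_int_add[OF this F[of i]] show ?thesis by simp
  qed
  define l where "l = L2_class M g"
  have l: "l \<in> carrier (L2 M)" using gS by (simp add: l_def)
  have "(\<lambda>n. hnorm (L2 M) (vsub (L2 M) (s n) l)) \<longlonglongrightarrow> 0"
  proof (rule LIMSEQ_I)
    fix \<epsilon> :: real assume e: "\<epsilon> > 0"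
    then have "\<epsilon> / 2 > 0" by simp
    from close[OF this] obtain N' where
      N': "\<And>i. i \<ge> N' \<Longrightarrow> (\<integral>\<^sup>+x. ennreal ((norm (g x - F i x))\<^sup>2) \<partial>M) \<le> ennreal ((\<epsilon> / 2)\<^sup>2)" by blast
    have "norm (hnorm (L2 M) (vsub (L2 M) (s i) l) - 0) < \<epsilon>" if i: "i \<ge> N'" for i
    proof -
      have "ennreal ((hnorm (L2 M) (vsub (L2 M) (s i) l))\<^sup>2) = (\<integral>\<^sup>+x. ennreal ((norm (rep (s i) x - rep l x))\<^sup>2) \<partial>M)"
        by (rule L2_dist_nn[OF s l])
      also have "\<dots> = (\<integral>\<^sup>+x. ennreal ((norm (g x - F i x))\<^sup>2) \<partial>M)"
      proof (rule nn_integral_cong_AE)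
        show "AE x in M. ennreal ((norm (rep (s i) x - rep l x))\<^sup>2) = ennreal ((norm (g x - F i x))\<^sup>2)"
          using rep_L2_class(2)[OF gS] by eventually_elim (simp add: l_def F_def norm_minus_commute)
      qed
      also have "\<dots> \<le> ennreal ((\<epsilon> / 2)\<^sup>2)" by (rule N'[OF i])
      finally have sq: "(hnorm (L2 M) (vsub (L2 M) (s i) l))\<^sup>2 \<le> (\<epsilon> / 2)\<^sup>2" using e by simp
      have d: "(\<lambda>x. rep (s i) x - rep l x) \<in> square_int M" using s l by (simp add: square_int_diff)
      have "hnorm (L2 M) (vsub (L2 M) (s i) l) \<ge> 0" by (simp add: L2_vsub_class[OF s l] hnorm_def L2_norm_eq(1)[OF d])
      moreover have "hnorm (L2 M) (vsub (L2 M) (s i) l) \<le> \<epsilon> / 2" by (rule power2_le_imp_le[OF sq]) (use e in simp)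
      ultimately show ?thesis using e by simp
    qed
    then show "\<exists>N. \<forall>n\<ge>N. norm (hnorm (L2 M) (vsub (L2 M) (s n) l) - 0) < \<epsilon>" by blast
  qed
  then show ?thesis using l by blast
qed

text \<open>Nondegeneracy is tested with the class of the difference of the two representatives: the
  integral of its squared norm vanishes, so they agree almost everywhere.\<close>

lemma hilb_L2: "hilb (L2 M :: ('x \<Rightarrow> 'h::chilbert_space) set ip_space)"
proof
  fix u v :: "('x \<Rightarrow> 'h) set" assume u: "u \<in> carrier (L2 M)" and v: "v \<in> carrier (L2 M)"
  have iu: "rep u \<in> square_int M" and iv: "rep v \<in> square_int M" using u v by simp_all
  show "u \<oplus>\<^bsub>L2 M\<^esub> v \<in> carrier (L2 M)" using iu iv by (simp add: L2_simps square_int_add)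
  show "ip (L2 M) u v = cnj (ip (L2 M) v u)"
    unfolding L2_simps Bochner_Integration.integral_cnj[symmetric] cinner_commute[symmetric] ..
  show "ip (L2 M) u (c \<odot>\<^bsub>L2 M\<^esub> v) = c * ip (L2 M) u v" for c
    unfolding L2_simps(2) ip_L2_class_right[OF u square_int_scale[OF iv]]
    by (simp add: cinner_scaleC_right L2_simps)
  fix w :: "('x \<Rightarrow> 'h) set" assume w: "w \<in> carrier (L2 M)"
  have iw: "rep w \<in> square_int M" using w by simp
  show "ip (L2 M) u (v \<oplus>\<^bsub>L2 M\<^esub> w) = ip (L2 M) u v + ip (L2 M) u w"
    unfolding L2_simps(1) ip_L2_class_right[OF u square_int_add[OF iv iw]]
    by (simp add: cinner_add_right L2_simps Bochner_Integration.integral_add cinner_integrable iu iv iw)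
next
  fix u :: "('x \<Rightarrow> 'h) set" assume u: "u \<in> carrier (L2 M)"
  have iu: "rep u \<in> square_int M" using u by simp
  show "c \<odot>\<^bsub>L2 M\<^esub> u \<in> carrier (L2 M)" for c using iu by (simp add: L2_simps square_int_scale)
  show "ip (L2 M) u \<zero>\<^bsub>L2 M\<^esub> = 0" unfolding L2_simps(3) ip_L2_class_right[OF u square_int_zero] by simp
  show "0 \<le> Re (ip (L2 M) u u)" using L2_norm_eq(1)[OF iu] u by simp
next
  fix u v :: "('x \<Rightarrow> 'h) set" assume u: "u \<in> carrier (L2 M)" and v: "v \<in> carrier (L2 M)"
    and eq: "\<And>w. w \<in> carrier (L2 M) \<Longrightarrow> ip (L2 M) w u = ip (L2 M) w v"
  have iu: "rep u \<in> square_int M" and iv: "rep v \<in> square_int M" using u v by simp_all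
  define d where "d x = rep u x - rep v x" for x
  have d: "d \<in> square_int M" unfolding d_def by (rule square_int_diff[OF iu iv])
  have "ip (L2 M) (L2_class M d) (L2_class M d) = ip (L2 M) (L2_class M d) u - ip (L2 M) (L2_class M d) v"
  proof -
    have "ip (L2 M) (L2_class M d) u = (\<integral>x. cinner (d x) (rep u x) \<partial>M)"
      "ip (L2 M) (L2_class M d) v = (\<integral>x. cinner (d x) (rep v x) \<partial>M)"
      using ip_L2_class[OF d iu] ip_L2_class[OF d iv] u v by simp_all
    moreover have "ip (L2 M) (L2_class M d) (L2_class M d) = (\<integral>x. cinner (d x) (rep u x) - cinner (d x) (rep v x) \<partial>M)"
      unfolding ip_L2_class[OF d d] by (rule Bochner_Integration.integral_cong) (simp_all add: d_def cinner_diff_right)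
    ultimately show ?thesis by (simp add: Bochner_Integration.integral_diff cinner_integrable d iu iv)
  qed
  also have "\<dots> = 0" using eq[of "L2_class M d"] d by simp
  finally have "(\<integral>x. (norm (d x))\<^sup>2 \<partial>M) = 0" unfolding L2_norm_eq(1)[OF d] by simp
  then have "AE x in M. (norm (d x))\<^sup>2 = 0"
    using integral_nonneg_eq_0_iff_AE[of M "\<lambda>x. (norm (d x))\<^sup>2"] d by (simp add: square_int_iff)
  then have "AE x in M. rep u x = rep v x" by eventually_elim (simp add: d_def)
  then show "u = v" by (rule L2_eqI[OF u v])
qed (simp_all add: L2_simps L2_complete)

subsection \<open>Multiplication operators\<close>

text \<open>A common home for \<open>C0\<close> functions and indicator functions of cells, closed
  under products and conjugation.\<close>

definition bmeas :: "'x measure \<Rightarrow> ('x \<Rightarrow> complex) \<Rightarrow> bool"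
  where "bmeas M f \<longleftrightarrow> f \<in> borel_measurable M \<and> (\<exists>B. \<forall>x\<in>space M. cmod (f x) \<le> B)"

lemma bmeas_square_int:
  "\<lbrakk>bmeas M f; g \<in> square_int M\<rbrakk> \<Longrightarrow> (\<lambda>x. f x *\<^sub>C (g x :: 'h::chilbert_space)) \<in> square_int M"
  unfolding bmeas_def using square_int_mult by blast

lemma bmeas_mult: assumes "bmeas M f" "bmeas M g" shows "bmeas M (\<lambda>x. f x * g x)"
proof -
  obtain A B where AB: "\<And>x. x \<in> space M \<Longrightarrow> cmod (f x) \<le> A" "\<And>x. x \<in> space M \<Longrightarrow> cmod (g x) \<le> B"
    using assms unfolding bmeas_def by blast
  have "cmod (f x * g x) \<le> A * B" if x: "x \<in> space M" for x
    unfolding norm_mult using AB[OF x] by (intro mult_mono) (auto intro: order_trans[OF norm_ge_zero])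
  moreover have "(\<lambda>x. f x * g x) \<in> borel_measurable M"
    by (rule borel_measurable_times) (use assms in \<open>simp_all add: bmeas_def\<close>)
  ultimately show ?thesis unfolding bmeas_def by blast
qed

lemma bmeas_cnj: "bmeas M f \<Longrightarrow> bmeas M (\<lambda>x. cnj (f x))"
  unfolding bmeas_def by (auto intro: measurable_compose[OF _ borel_measurable_continuous_onI] continuous_intros)

lemma mult_op_eq: "a \<in> carrier (L2 M) \<Longrightarrow> mult_op M f a = L2_class M (\<lambda>x. f x *\<^sub>C rep a x)"
  by (simp add: mult_op_def)

lemma mult_op_closed:
  "\<lbrakk>bmeas M f; a \<in> carrier (L2 M)\<rbrakk> \<Longrightarrow> mult_op M f a \<in> carrier (L2 M :: ('x \<Rightarrow> 'h::chilbert_space) set ip_space)"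
  by (simp add: mult_op_eq bmeas_square_int)

lemma rep_mult_op:
  fixes a :: "('x \<Rightarrow> 'h::chilbert_space) set"
  assumes "bmeas M f" "a \<in> carrier (L2 M)"
  shows "AE x in M. rep (mult_op M f a) x = f x *\<^sub>C rep a x"
  unfolding mult_op_eq[OF assms(2)] by (rule rep_L2_class(2)) (use assms in \<open>simp add: bmeas_square_int\<close>)

lemma mult_op_cong_AE:
  fixes a b :: "('x \<Rightarrow> 'h::chilbert_space) set"
  assumes f: "bmeas M f" and g: "bmeas M g" and ab: "a \<in> carrier (L2 M)" "b \<in> carrier (L2 M)"
    and eq: "AE x in M. f x *\<^sub>C rep a x = g x *\<^sub>C rep b x"
  shows "mult_op M f a = mult_op M g b"
  unfolding mult_op_eq[OF ab(1)] mult_op_eq[OF ab(2)]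
  by (subst L2_class_eq_iff) (use assms in \<open>auto simp: bmeas_square_int\<close>)

lemma mult_op_ip:
  fixes a b :: "('x \<Rightarrow> 'h::chilbert_space) set"
  assumes f: "bmeas M f" and a: "a \<in> carrier (L2 M)" and b: "b \<in> carrier (L2 M)"
  shows "ip (L2 M) a (mult_op M f b) = (\<integral>x. f x * cinner (rep a x) (rep b x) \<partial>M)"
    and "ip (L2 M) a (mult_op M f b) = ip (L2 M) (mult_op M (\<lambda>x. cnj (f x)) a) b"
proof -
  show 1: "ip (L2 M) a (mult_op M f b) = (\<integral>x. f x * cinner (rep a x) (rep b x) \<partial>M)"
    unfolding mult_op_eq[OF b] ip_L2_class_right[OF a bmeas_square_int[OF f rep_square_int[OF b]]]
    by (simp add: cinner_scaleC_right)
  have c: "(\<lambda>x. cnj (f x) *\<^sub>C rep a x) \<in> square_int M" using f a by (simp add: bmeas_cnj bmeas_square_int)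
  have "ip (L2 M) (mult_op M (\<lambda>x. cnj (f x)) a) b = (\<integral>x. cinner (cnj (f x) *\<^sub>C rep a x) (rep b x) \<partial>M)"
    using ip_L2_class[OF c rep_square_int[OF b]] a b by (simp add: mult_op_eq)
  then show "ip (L2 M) a (mult_op M f b) = ip (L2 M) (mult_op M (\<lambda>x. cnj (f x)) a) b"
    unfolding 1 by (simp add: cinner_scaleC_left)
qed

lemma mult_op_norm:
  fixes a :: "('x \<Rightarrow> 'h::chilbert_space) set"
  assumes f: "f \<in> borel_measurable M" "\<And>x. x \<in> space M \<Longrightarrow> cmod (f x) \<le> B" and B: "B \<ge> 0"
    and a: "a \<in> carrier (L2 M)"
  shows "hnorm (L2 M) (mult_op M f a) \<le> B * hnorm (L2 M) a"
proof -
  interpret hilb "L2 M :: ('x \<Rightarrow> 'h) set ip_space" by (rule hilb_L2)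
  have bf: "bmeas M f" using f by (auto simp: bmeas_def)
  have i: "(\<lambda>x. f x *\<^sub>C rep a x) \<in> square_int M" using bf a by (simp add: bmeas_square_int)
  have "(hnorm (L2 M) (mult_op M f a))\<^sup>2 = (\<integral>x. (norm (f x *\<^sub>C rep a x))\<^sup>2 \<partial>M)"
    unfolding mult_op_eq[OF a] by (rule L2_norm_eq(2)[OF i])
  also have "\<dots> \<le> (\<integral>x. B\<^sup>2 * (norm (rep a x))\<^sup>2 \<partial>M)"
  proof (rule integral_mono)
    show "(norm (f x *\<^sub>C rep a x))\<^sup>2 \<le> B\<^sup>2 * (norm (rep a x))\<^sup>2" if "x \<in> space M" for x
      using f(2)[OF that] by (auto simp: power_mult_distrib intro!: mult_right_mono power_mono)
  qed (use i rep_square_int[OF a] in \<open>simp_all add: square_int_iff\<close>)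
  also have "\<dots> = (B * hnorm (L2 M) a)\<^sup>2"
    using L2_norm_eq(2)[OF rep_square_int[OF a]] a by (simp add: power_mult_distrib)
  finally show ?thesis by (rule power2_le_imp_le) (use B a in simp)
qed

lemma mult_op_bounded:
  assumes f: "bmeas M f"
  shows "mult_op M f \<in> bounded_ops (L2 M :: ('x \<Rightarrow> 'h::chilbert_space) set ip_space)"
proof -
  interpret hilb "L2 M :: ('x \<Rightarrow> 'h) set ip_space" by (rule hilb_L2)
  obtain B where B: "\<And>x. x \<in> space M \<Longrightarrow> cmod (f x) \<le> B" using f unfolding bmeas_def by blast
  show ?thesis
  proof (rule bounded_opsI[where S = "mult_op M (\<lambda>x. cnj (f x))" and C = "max B 0"])
    show "mult_op M f \<in> carrier (L2 M) \<rightarrow>\<^sub>E carrier (L2 M :: ('x \<Rightarrow> 'h) set ip_space)"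
      by (rule PiE_I) (simp_all add: mult_op_closed[OF f], simp add: mult_op_def)
    show "hnorm (L2 M) (mult_op M f v) \<le> max B 0 * hnorm (L2 M) v"
      if "v \<in> carrier (L2 M)" for v :: "('x \<Rightarrow> 'h) set"
    proof (rule mult_op_norm[OF _ _ _ that])
      show "cmod (f x) \<le> max B 0" if "x \<in> space M" for x
        by (rule order_trans[OF B[OF that]]) simp
    qed (use f in \<open>simp_all add: bmeas_def\<close>)
  qed (use f in \<open>auto simp: mult_op_ip(2) mult_op_closed bmeas_cnj\<close>)
qed

lemma mult_op_mult_op:
  fixes a :: "('x \<Rightarrow> 'h::chilbert_space) set"
  assumes f: "bmeas M f" and g: "bmeas M g" and a: "a \<in> carrier (L2 M)"
  shows "mult_op M f (mult_op M g a) = mult_op M (\<lambda>x. f x * g x) a"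
proof -
  have ga: "mult_op M g a \<in> carrier (L2 M)" by (rule mult_op_closed[OF g a])
  have "mult_op M f (mult_op M g a) = L2_class M (\<lambda>x. f x *\<^sub>C rep (mult_op M g a) x)"
    by (rule mult_op_eq[OF ga])
  also have "\<dots> = L2_class M (\<lambda>x. (f x * g x) *\<^sub>C rep a x)"
  proof (subst L2_class_eq_iff)
    show "AE x in M. f x *\<^sub>C rep (mult_op M g a) x = (f x * g x) *\<^sub>C rep a x"
      using rep_mult_op[OF g a] by eventually_elim (simp add: scaleC_scaleC)
    show "(\<lambda>x. f x *\<^sub>C rep (mult_op M g a) x) \<in> square_int M"
      by (rule bmeas_square_int[OF f rep_square_int[OF ga]])
    show "(\<lambda>x. (f x * g x) *\<^sub>C rep a x) \<in> square_int M"
      by (rule bmeas_square_int[OF bmeas_mult[OF f g] rep_square_int[OF a]])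
  qed
  also have "\<dots> = mult_op M (\<lambda>x. f x * g x) a" by (rule mult_op_eq[OF a, symmetric])
  finally show ?thesis .
qed

section \<open>Roe algebras of partitioned spaces\<close>

lemma C0_vanish: "\<lbrakk>f \<in> C0 Y; \<epsilon> > 0\<rbrakk> \<Longrightarrow> \<exists>K\<subseteq>Y. compact K \<and> (\<forall>x\<in>Y - K. cmod (f x) < \<epsilon>)"
  by (simp add: C0_def)

text \<open>The cells are the fibres of \<open>c\<close>. The locale serves both spaces: in
  \<open>X\<close> the map \<open>c\<close> picks a nearest point of \<open>D\<close>, on
  \<open>D\<close> itself it is the identity and \<open>C = 0\<close>.\<close>

locale cells =
  fixes M :: "'x::metric_space measure" and D :: "'x set" and c :: "'x \<Rightarrow> 'x" and C :: real
  assumes c_D: "x \<in> space M \<Longrightarrow> c x \<in> D"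
    and c_sets: "d \<in> D \<Longrightarrow> {x \<in> space M. c x = d} \<in> sets M"
    and c_dist: "x \<in> space M \<Longrightarrow> dist x (c x) \<le> C"
    and D_space: "D \<subseteq> space M"
    and finite_balls: "\<And>x r. finite {d \<in> D. dist x d \<le> r}"
    and closed_space: "closed (space M)"
    and proper: "\<And>(x::'x) r. compact (cball x r)"
    and C0_measurable: "f \<in> C0 (space M) \<Longrightarrow> f \<in> borel_measurable M"
begin

lemma D_countable: "countable D"
proof (cases "D = {}")
  case False
  then obtain a where "a \<in> D" by blast
  have "D \<subseteq> (\<Union>n::nat. {d \<in> D. dist a d \<le> real n})"
    using real_arch_simple by fastforce
  moreover have "countable (\<Union>n::nat. {d \<in> D. dist a d \<le> real n})"
    using finite_balls by (intro countable_UN countableI_type countable_finite)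
  ultimately show ?thesis using countable_subset by blast
qed simp

definition cell :: "'x \<Rightarrow> 'x \<Rightarrow> complex"
  where "cell d x = (if c x = d then 1 else 0)"

abbreviation P :: "'x \<Rightarrow> ('x \<Rightarrow> 'h::chilbert_space) set \<Rightarrow> ('x \<Rightarrow> 'h) set"
  where "P d \<equiv> mult_op M (cell d)"

lemma cell_bmeas: "d \<in> D \<Longrightarrow> bmeas M (cell d)"
  unfolding bmeas_def
proof
  assume "d \<in> D"
  then show "cell d \<in> borel_measurable M"
    unfolding cell_def[abs_def] by (intro measurable_If) (use c_sets in auto)
  show "\<exists>B. \<forall>x\<in>space M. cmod (cell d x) \<le> B" by (rule exI[of _ 1]) (simp add: cell_def)
qed

lemma C0_bmeas:
  assumes f: "f \<in> C0 (space M)"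
  shows "bmeas M f"
  unfolding bmeas_def
proof
  show "f \<in> borel_measurable M" by (rule C0_measurable[OF f])
  obtain K where K: "K \<subseteq> space M" "compact K" "\<forall>x\<in>space M - K. cmod (f x) < 1"
    using C0_vanish[OF f, of 1] by auto
  have "continuous_on K f" using f K(1) unfolding C0_def by (auto intro: continuous_on_subset)
  then have "bounded (f ` K)" using K(2) compact_continuous_image compact_imp_bounded by blast
  then obtain B where "\<And>x. x \<in> K \<Longrightarrow> cmod (f x) \<le> B" unfolding bounded_iff by blast
  then have "\<forall>x\<in>space M. cmod (f x) \<le> max B 1" using K(3) by (metis DiffI less_imp_le max.coboundedI1 max.coboundedI2)
  then show "\<exists>B. \<forall>x\<in>space M. cmod (f x) \<le> B" by blast
qed

section \<open>Indicator functions of cells as a geometric module\<close>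

lemma mult_op_zero:
  fixes a :: "('x \<Rightarrow> 'h::chilbert_space) set"
  assumes "\<And>x. x \<in> space M \<Longrightarrow> f x = 0" "a \<in> carrier (L2 M)"
  shows "mult_op M f a = \<zero>\<^bsub>L2 M\<^esub>"
proof -
  have z: "bmeas M (\<lambda>x. 0)" by (auto simp: bmeas_def)
  have m: "f \<in> borel_measurable M" using assms(1) measurable_cong[of M f "\<lambda>x. 0" borel] by simp
  then have "bmeas M f" using assms(1) by (auto simp: bmeas_def)
  from mult_op_cong_AE[OF this z assms(2,2)] have "mult_op M f a = mult_op M (\<lambda>x. 0) a"
    using assms(1) by (auto intro: AE_I2)
  then show ?thesis using assms(2) by (simp add: mult_op_eq L2_simps)
qed

lemma P_mult_zero:
  fixes a :: "('x \<Rightarrow> 'h::chilbert_space) set"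
  assumes d: "d \<in> D" and f: "bmeas M f" "\<And>x. \<lbrakk>x \<in> space M; c x = d\<rbrakk> \<Longrightarrow> f x = 0" and a: "a \<in> carrier (L2 M)"
  shows "P d (mult_op M f a) = \<zero>\<^bsub>L2 M\<^esub>"
  unfolding mult_op_mult_op[OF cell_bmeas[OF d] f(1) a]
  by (rule mult_op_zero[OF _ a]) (use f(2) in \<open>auto simp: cell_def\<close>)

lemma P_eq_zero_iff:
  fixes a :: "('x \<Rightarrow> 'h::chilbert_space) set"
  assumes d: "d \<in> D" and a: "a \<in> carrier (L2 M)"
  shows "P d a = \<zero>\<^bsub>L2 M\<^esub> \<longleftrightarrow> (AE x in M. c x = d \<longrightarrow> rep a x = 0)"
proof -
  have "P d a = \<zero>\<^bsub>L2 M\<^esub> \<longleftrightarrow> (AE x in M. cell d x *\<^sub>C rep a x = 0)"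
    unfolding mult_op_eq[OF a] L2_simps
    by (rule L2_class_eq_iff) (use cell_bmeas[OF d] a in \<open>simp_all add: bmeas_square_int\<close>)
  also have "\<dots> \<longleftrightarrow> (AE x in M. c x = d \<longrightarrow> rep a x = 0)"
    by (rule AE_cong) (simp add: cell_def)
  finally show ?thesis .
qed

lemma gmod_L2: "gmod (L2 M :: ('x \<Rightarrow> 'h::chilbert_space) set ip_space) P D"
proof (rule gmod.intro[OF hilb_L2], unfold_locales)
  fix d assume d: "d \<in> D"
  note b = cell_bmeas[OF d]
  show "P d \<in> bounded_ops (L2 M :: ('x \<Rightarrow> 'h) set ip_space)" by (rule mult_op_bounded[OF b])
  have cnj: "(\<lambda>x. cnj (cell d x)) = cell d" by (auto simp: cell_def)
  fix u :: "('x \<Rightarrow> 'h) set" assume u: "u \<in> carrier (L2 M)"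
  have "(\<lambda>x. cell d x * cell d x) = cell d" by (auto simp: cell_def)
  then show "P d (P d u) = P d u" using mult_op_mult_op[OF b b u] by simp
  show "P d (P d' u) = \<zero>\<^bsub>L2 M\<^esub>" if "d' \<in> D" "d \<noteq> d'" for d'
    by (rule P_mult_zero[OF d cell_bmeas[OF that(1)] _ u]) (use that(2) in \<open>simp add: cell_def\<close>)
  fix v :: "('x \<Rightarrow> 'h) set" assume v: "v \<in> carrier (L2 M)"
  show "ip (L2 M) (P d u) v = ip (L2 M) u (P d v)" using mult_op_ip(2)[OF b u v] unfolding cnj by simp
next
  fix u v :: "('x \<Rightarrow> 'h) set" assume u: "u \<in> carrier (L2 M)" and v: "v \<in> carrier (L2 M)"
    and o: "\<And>d. d \<in> D \<Longrightarrow> P d u = \<zero>\<^bsub>L2 M\<^esub> \<or> P d v = \<zero>\<^bsub>L2 M\<^esub>"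
  have "\<forall>d\<in>D. AE x in M. c x = d \<longrightarrow> cinner (rep u x) (rep v x) = 0"
  proof
    fix d assume d: "d \<in> D"
    show "AE x in M. c x = d \<longrightarrow> cinner (rep u x) (rep v x) = 0"
    proof (cases "P d u = \<zero>\<^bsub>L2 M\<^esub>")
      case True
      then have "AE x in M. c x = d \<longrightarrow> rep u x = 0" by (simp add: P_eq_zero_iff[OF d u])
      then show ?thesis by eventually_elim auto
    next
      case False
      then have "AE x in M. c x = d \<longrightarrow> rep v x = 0" using o[OF d] by (simp add: P_eq_zero_iff[OF d v])
      then show ?thesis by eventually_elim auto
    qed
  qed
  \<comment> \<open>There are countably many cells, so the exceptional null sets can be
    united.\<close>
  then have "AE x in M. \<forall>d\<in>D. c x = d \<longrightarrow> cinner (rep u x) (rep v x) = 0"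
    by (subst AE_ball_countable[OF D_countable])
  then have "AE x in M. cinner (rep u x) (rep v x) = 0"
    using AE_space by eventually_elim (use c_D in blast)
  then show "ip (L2 M) u v = 0" unfolding L2_simps by (rule integral_eq_zero_AE)
qed (rule finite_balls)

text \<open>A continuous stand-in for the indicator function of a cell: with \<open>r = C\<close> it
  is 1 on the cell of \<open>d\<close>, so it can be inserted next to \<open>P d\<close>.\<close>

definition cutoff :: "'x \<Rightarrow> real \<Rightarrow> 'x \<Rightarrow> complex"
  where "cutoff d r x = complex_of_real (max 0 (min 1 (r + 1 - dist x d)))"

lemma cutoff_C0: "cutoff d r \<in> C0 (space M)"
  unfolding C0_def
proof (intro CollectI conjI allI impI)
  show "continuous_on (space M) (cutoff d r)"
    unfolding cutoff_def[abs_def] by (intro continuous_intros)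
  fix \<epsilon> :: real assume e: "\<epsilon> > 0"
  show "\<exists>K\<subseteq>space M. compact K \<and> (\<forall>x\<in>space M - K. cmod (cutoff d r x) < \<epsilon>)"
  proof (intro exI[of _ "space M \<inter> cball d (r + 1)"] conjI ballI)
    show "compact (space M \<inter> cball d (r + 1))" using closed_Int_compact[OF closed_space proper] .
    fix x assume "x \<in> space M - space M \<inter> cball d (r + 1)"
    then have "r + 1 - dist x d < 0" by (auto simp: dist_commute)
    then have "cutoff d r x = 0" by (simp add: cutoff_def max_def min_def)
    then show "cmod (cutoff d r x) < \<epsilon>" using e by simp
  qed simp
qed

lemma cutoff_one: "dist x d \<le> r \<Longrightarrow> cutoff d r x = 1"
  by (simp add: cutoff_def)

lemma cutoff_supp: "supp (space M) (cutoff d r) \<subseteq> cball d (r + 1)"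
proof -
  have "{x \<in> space M. cutoff d r x \<noteq> 0} \<subseteq> cball d (r + 1)"
    by (auto simp: cutoff_def dist_commute split: if_splits)
  then have "closure {x \<in> space M. cutoff d r x \<noteq> 0} \<subseteq> cball d (r + 1)" by (simp add: closure_minimal)
  then show ?thesis by (auto simp: supp_def)
qed

lemma supp_memI: "\<lbrakk>x \<in> space M; f x \<noteq> 0\<rbrakk> \<Longrightarrow> x \<in> supp (space M) f"
  unfolding supp_def using closure_subset[of "{x \<in> space M. f x \<noteq> 0}"] by blast

lemma
  fixes v :: "('x \<Rightarrow> 'h::chilbert_space) set"
  assumes d: "d \<in> D" and v: "v \<in> carrier (L2 M)"
  shows P_cutoff: "P d (mult_op M (cutoff d C) v) = P d v" and cutoff_P: "mult_op M (cutoff d C) (P d v) = P d v"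
proof -
  have b: "bmeas M (cutoff d C)" by (rule C0_bmeas[OF cutoff_C0])
  have e: "cell d x * cutoff d C x = cell d x" if "x \<in> space M" for x
    using c_dist[OF that] by (auto simp: cell_def intro: cutoff_one)
  show "P d (mult_op M (cutoff d C) v) = P d v"
    unfolding mult_op_mult_op[OF cell_bmeas[OF d] b v]
    by (rule mult_op_cong_AE[OF bmeas_mult[OF cell_bmeas[OF d] b] cell_bmeas[OF d] v v]) (rule AE_I2, simp add: e)
  show "mult_op M (cutoff d C) (P d v) = P d v"
    unfolding mult_op_mult_op[OF b cell_bmeas[OF d] v]
    by (rule mult_op_cong_AE[OF bmeas_mult[OF b cell_bmeas[OF d]] cell_bmeas[OF d] v v])
       (rule AE_I2, simp add: e mult.commute[of "cutoff d C _"])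
qed

lemma mult_op_vsub:
  fixes v :: "('x \<Rightarrow> 'h::chilbert_space) set"
  assumes f: "bmeas M f" and g: "bmeas M g" and v: "v \<in> carrier (L2 M)" and fg: "bmeas M (\<lambda>x. f x - g x)"
  shows "vsub (L2 M) (mult_op M f v) (mult_op M g v) = mult_op M (\<lambda>x. f x - g x) v"
proof -
  interpret hilb "L2 M :: ('x \<Rightarrow> 'h) set ip_space" by (rule hilb_L2)
  have i: "integrable M (\<lambda>x. h x * cinner (rep u x) (rep v x))"
    if h: "bmeas M h" and u: "u \<in> carrier (L2 M)" for u :: "('x \<Rightarrow> 'h) set" and h
    using cinner_integrable[OF rep_square_int[OF u] bmeas_square_int[OF h rep_square_int[OF v]]]
    by (simp add: cinner_scaleC_right)
  show ?thesis
  proof (rule ip_eqI)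
    fix u :: "('x \<Rightarrow> 'h) set" assume u: "u \<in> carrier (L2 M)"
    show "ip (L2 M) u (vsub (L2 M) (mult_op M f v) (mult_op M g v)) = ip (L2 M) u (mult_op M (\<lambda>x. f x - g x) v)"
      using u v f g fg
      by (simp add: mult_op_closed mult_op_ip(1) left_diff_distrib Bochner_Integration.integral_diff i)
  qed (use f g fg v in \<open>simp_all add: mult_op_closed\<close>)
qed

lemma adjoint_mult_op:
  assumes f: "bmeas M f"
  shows "adjoint (L2 M :: ('x \<Rightarrow> 'h::chilbert_space) set ip_space) (mult_op M f) = mult_op M (\<lambda>x. cnj (f x))"
proof -
  interpret hilb "L2 M :: ('x \<Rightarrow> 'h) set ip_space" by (rule hilb_L2)
  show ?thesis
  proof (rule adjointI[OF mult_op_bounded[OF f] mult_op_bounded[OF bmeas_cnj[OF f]]])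
    fix u v :: "('x \<Rightarrow> 'h) set" assume "u \<in> carrier (L2 M)" "v \<in> carrier (L2 M)"
    from mult_op_ip(2)[OF bmeas_cnj[OF f] this]
    show "ip (L2 M) (mult_op M f u) v = ip (L2 M) u (mult_op M (\<lambda>x. cnj (f x)) v)" by simp
  qed
qed

section \<open>Comparison of the descriptions by \<open>C0\<close> functions and by cells\<close>

lemma finite_cells_of_compact:
  assumes K: "compact K"
  obtains E where "finite E" "E \<subseteq> D" "\<And>x. \<lbrakk>x \<in> space M; x \<in> K\<rbrakk> \<Longrightarrow> c x \<in> E"
proof -
  obtain a r where ar: "K \<subseteq> cball a r" using compact_imp_bounded[OF K] bounded_subset_cball by blast
  have "c x \<in> {d \<in> D. dist a d \<le> r + C}" if x: "x \<in> space M" "x \<in> K" for x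
  proof -
    have "dist a x \<le> r" using ar x(2) by auto
    then have "dist a (c x) \<le> r + C" using dist_triangle[of a "c x" x] c_dist[OF x(1)] by linarith
    then show ?thesis using c_D[OF x(1)] by simp
  qed
  then show ?thesis using that[of "{d \<in> D. dist a d \<le> r + C}"] finite_balls by blast
qed

text \<open>Outside a compact set \<open>f\<close> is small, and a compact set meets finitely many
  cells. The restriction \<open>g\<close> of \<open>f\<close> to these cells gives a finite sum of
  compact operators \<open>S P d f\<close>, and \<open>S g\<close> approximates \<open>S f\<close>
  in norm.\<close>

lemma nice_mult_compact:
  fixes S :: "('x \<Rightarrow> 'h::chilbert_space) set \<Rightarrow> ('x \<Rightarrow> 'h) set"
  assumes S: "gmod.nice (L2 M) P D S" and f: "f \<in> C0 (space M)"
  shows "compact_op (L2 M) (op_mult (L2 M) S (mult_op M f))"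
proof -
  interpret G: gmod "L2 M :: ('x \<Rightarrow> 'h) set ip_space" P D by (rule gmod_L2)
  have Sb: "S \<in> bounded_ops (L2 M)" by (rule G.nice_bounded[OF S])
  have fb: "bmeas M f" by (rule C0_bmeas[OF f])
  have fop: "mult_op M f \<in> bounded_ops (L2 M :: ('x \<Rightarrow> 'h) set ip_space)" by (rule mult_op_bounded[OF fb])
  obtain B where B: "B \<ge> 0" "\<And>v. v \<in> carrier (L2 M) \<Longrightarrow> hnorm (L2 M) (S v) \<le> B * hnorm (L2 M) v"
    using G.bo_bound[OF Sb] by blast
  show ?thesis
  proof (rule G.compact_op_limit[OF G.op_mult_bounded[OF Sb fop]])
    fix \<epsilon> :: real assume e: "\<epsilon> > 0"
    \<comment> \<open>\<open>S\<close> enlarges errors by at most \<open>B\<close>; the added 1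
      avoids division by zero.\<close>
    define \<delta> where "\<delta> = \<epsilon> / (B + 1)"
    have d: "\<delta> > 0" using e B(1) by (simp add: \<delta>_def)
    have Bd: "B * \<delta> \<le> \<epsilon>" using e B(1) by (simp add: \<delta>_def field_simps)
    obtain K where K: "compact K" "\<And>x. x \<in> space M - K \<Longrightarrow> cmod (f x) < \<delta>"
      using C0_vanish[OF f d] by blast
    obtain E where E: "finite E" "E \<subseteq> D" "\<And>x. \<lbrakk>x \<in> space M; x \<in> K\<rbrakk> \<Longrightarrow> c x \<in> E"
      by (rule finite_cells_of_compact[OF K(1)]) blast
    define g where "g x = (\<Sum>d\<in>E. cell d x * f x)" for x
    have gx: "g x = (if c x \<in> E then f x else 0)" for x
    proof -
      have "g x = (\<Sum>d\<in>E. if c x = d then f x else 0)" unfolding g_def by (rule sum.cong) (auto simp: cell_def)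
      also have "\<dots> = (if c x \<in> E then f x else 0)" using E(1) by simp
      finally show ?thesis .
    qed
    have cb: "bmeas M (\<lambda>x. cell d x * f x)" if "d \<in> E" for d
      using bmeas_mult[OF cell_bmeas fb] that E(2) by blast
    have gm: "g \<in> borel_measurable M"
      unfolding g_def[abs_def] by (rule borel_measurable_sum) (use cb in \<open>simp add: bmeas_def\<close>)
    obtain A where A: "\<And>x. x \<in> space M \<Longrightarrow> cmod (f x) \<le> A" using fb unfolding bmeas_def by blast
    have A0: "0 \<le> A" if "x \<in> space M" for x by (rule order_trans[OF norm_ge_zero A[OF that]])
    have gb: "bmeas M g"
      unfolding bmeas_def
    proof
      show "\<exists>B. \<forall>x\<in>space M. cmod (g x) \<le> B"
        by (rule exI[of _ A]) (simp add: gx A A0)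
    qed (rule gm)
    have fgb: "bmeas M (\<lambda>x. f x - g x)"
      unfolding bmeas_def
    proof
      show "(\<lambda>x. f x - g x) \<in> borel_measurable M"
        by (rule borel_measurable_diff) (use fb gm in \<open>simp_all add: bmeas_def\<close>)
      show "\<exists>B. \<forall>x\<in>space M. cmod (f x - g x) \<le> B"
        by (rule exI[of _ A]) (simp add: gx A A0)
    qed
    have gop: "mult_op M g \<in> bounded_ops (L2 M :: ('x \<Rightarrow> 'h) set ip_space)" by (rule mult_op_bounded[OF gb])
    have "compact_op (L2 M) (op_mult (L2 M) S (mult_op M g))"
    proof (rule G.compact_op_finite_sum[OF E(1), of "\<lambda>d. op_mult (L2 M) (op_mult (L2 M) S (P d)) (mult_op M f)"])
      show "compact_op (L2 M) (op_mult (L2 M) (op_mult (L2 M) S (P d)) (mult_op M f))" if "d \<in> E" for d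
        using that E(2) by (intro G.compact_op_mult_right[OF G.nice_compact(2)[OF S] fop]) blast
      show "op_mult (L2 M) S (mult_op M g) \<in> bounded_ops (L2 M)" using Sb gop by simp
      fix u v :: "('x \<Rightarrow> 'h) set" assume u: "u \<in> carrier (L2 M)" and v: "v \<in> carrier (L2 M)"
      define w where "w = adjoint (L2 M) S u"
      have w: "w \<in> carrier (L2 M)" unfolding w_def by (rule G.adjoint_closed[OF Sb u])
      have i: "integrable M (\<lambda>x. h x * cinner (rep w x) (rep v x))" if h: "bmeas M h" for h
        using cinner_integrable[OF rep_square_int[OF w] bmeas_square_int[OF h rep_square_int[OF v]]]
        by (simp add: cinner_scaleC_right)
      have "ip (L2 M) u (op_mult (L2 M) S (mult_op M g) v) = ip (L2 M) w (mult_op M g v)"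
        using u v Sb gop by (simp add: w_def G.ip_adjoint_left G.bo_closed)
      also have "\<dots> = (\<integral>x. (\<Sum>d\<in>E. cell d x * f x * cinner (rep w x) (rep v x)) \<partial>M)"
        unfolding mult_op_ip(1)[OF gb w v] g_def by (simp add: sum_distrib_right)
      also have "\<dots> = (\<Sum>d\<in>E. \<integral>x. cell d x * f x * cinner (rep w x) (rep v x) \<partial>M)"
        by (rule Bochner_Integration.integral_sum) (rule i[OF cb])
      also have "\<dots> = (\<Sum>d\<in>E. ip (L2 M) u (op_mult (L2 M) (op_mult (L2 M) S (P d)) (mult_op M f) v))"
      proof (rule sum.cong[OF refl])
        fix d assume dE: "d \<in> E"
        then have dD: "d \<in> D" using E(2) by blast
        have "(\<integral>x. cell d x * f x * cinner (rep w x) (rep v x) \<partial>M) = ip (L2 M) w (P d (mult_op M f v))"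
          unfolding mult_op_mult_op[OF cell_bmeas[OF dD] fb v] by (rule mult_op_ip(1)[OF cb[OF dE] w v, symmetric])
        also have "\<dots> = ip (L2 M) u (S (P d (mult_op M f v)))"
          unfolding w_def by (rule G.ip_adjoint_left[OF Sb u]) (use dD v fop in \<open>simp add: G.bo_closed\<close>)
        finally show "(\<integral>x. cell d x * f x * cinner (rep w x) (rep v x) \<partial>M) =
            ip (L2 M) u (op_mult (L2 M) (op_mult (L2 M) S (P d)) (mult_op M f) v)"
          using v fop dD by (simp add: G.bo_closed)
      qed
      finally show "ip (L2 M) u (op_mult (L2 M) S (mult_op M g) v) =
        (\<Sum>d\<in>E. ip (L2 M) u (op_mult (L2 M) (op_mult (L2 M) S (P d)) (mult_op M f) v))" .
    qed
    moreover have "hnorm (L2 M) (vsub (L2 M) (op_mult (L2 M) S (mult_op M f) v) (op_mult (L2 M) S (mult_op M g) v))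
        \<le> \<epsilon> * hnorm (L2 M) v" if v: "v \<in> carrier (L2 M)" for v
    proof -
      have cl: "mult_op M f v \<in> carrier (L2 M)" "mult_op M g v \<in> carrier (L2 M)"
        using mult_op_closed[OF fb v] mult_op_closed[OF gb v] by auto
      have "vsub (L2 M) (op_mult (L2 M) S (mult_op M f) v) (op_mult (L2 M) S (mult_op M g) v) =
          S (mult_op M (\<lambda>x. f x - g x) v)"
        using v by (simp add: G.bo_vsub[OF Sb cl, symmetric] mult_op_vsub[OF fb gb v fgb])
      moreover have "hnorm (L2 M) (S (mult_op M (\<lambda>x. f x - g x) v)) \<le> B * hnorm (L2 M) (mult_op M (\<lambda>x. f x - g x) v)"
        by (rule B(2)[OF mult_op_closed[OF fgb v]])
      moreover have "hnorm (L2 M) (mult_op M (\<lambda>x. f x - g x) v) \<le> \<delta> * hnorm (L2 M) v"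
      proof (rule mult_op_norm[OF _ _ _ v])
        show "(\<lambda>x. f x - g x) \<in> borel_measurable M" using fgb by (simp add: bmeas_def)
        show "cmod (f x - g x) \<le> \<delta>" if "x \<in> space M" for x
          using K(2)[of x] E(3)[of x] that d by (cases "x \<in> K") (auto simp: gx less_imp_le)
      qed (use d in simp)
      moreover have "B * (\<delta> * hnorm (L2 M) v) \<le> \<epsilon> * hnorm (L2 M) v"
        using mult_right_mono[OF Bd, of "hnorm (L2 M) v"] v by (simp add: mult.assoc)
      ultimately show ?thesis
        using mult_left_mono[of "hnorm (L2 M) (mult_op M (\<lambda>x. f x - g x) v)" "\<delta> * hnorm (L2 M) v" B] B(1) by simp
    qed
    ultimately show "\<exists>K. compact_op (L2 M) K \<and> (\<forall>v\<in>carrier (L2 M).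
        hnorm (L2 M) (vsub (L2 M) (op_mult (L2 M) S (mult_op M f) v) (K v)) \<le> \<epsilon> * hnorm (L2 M) v)" by blast
  qed
qed

lemma C0_cnj: "f \<in> C0 (space M) \<Longrightarrow> (\<lambda>x. cnj (f x)) \<in> C0 (space M)"
  unfolding C0_def by (auto intro: continuous_intros)

text \<open>From cells to functions, local compactness comes by truncating functions to finitely
  many cells and propagation by moving points to the centres of their cells. Conversely, continuous
  cutoffs are inserted next to the cell projections.\<close>

lemma nice_iff:
  fixes S :: "('x \<Rightarrow> 'h::chilbert_space) set \<Rightarrow> ('x \<Rightarrow> 'h) set"
  shows "gmod.nice (L2 M) P D S \<longleftrightarrow> S \<in> bounded_ops (L2 M) \<and> locally_compact M S \<and> finite_propagation M S"
proof -
  interpret G: gmod "L2 M :: ('x \<Rightarrow> 'h) set ip_space" P D by (rule gmod_L2)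
  show ?thesis
  proof safe
    assume S: "G.nice S"
    show Sb: "S \<in> bounded_ops (L2 M)" by (rule G.nice_bounded[OF S])
    show "locally_compact M S"
      unfolding locally_compact_def
    proof (intro ballI conjI)
      fix f assume f: "f \<in> C0 (space M)"
      show "compact_op (L2 M) (op_mult (L2 M) S (mult_op M f))" by (rule nice_mult_compact[OF S f])
      have fb: "bmeas M f" by (rule C0_bmeas[OF f])
      have "compact_op (L2 M) (adjoint (L2 M) (op_mult (L2 M) (adjoint (L2 M) S) (mult_op M (\<lambda>x. cnj (f x)))))"
        by (rule G.compact_op_adjoint[OF nice_mult_compact[OF G.nice_adjoint[OF S] C0_cnj[OF f]]])
      moreover have "adjoint (L2 M) (op_mult (L2 M) (adjoint (L2 M) S) (mult_op M (\<lambda>x. cnj (f x)))) =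
          op_mult (L2 M) (mult_op M f) S"
        using adjoint_mult_op[OF bmeas_cnj[OF fb], where 'h = 'h]
        by (simp add: G.adjoint_mult[OF G.adjoint_bounded[OF Sb] mult_op_bounded[OF bmeas_cnj[OF fb]]]
            G.adjoint_adjoint[OF Sb])
      ultimately show "compact_op (L2 M) (op_mult (L2 M) (mult_op M f) S)" by simp
    qed
    obtain R where R: "G.propagation_le S R" using S unfolding G.nice_def by blast
    show "finite_propagation M S"
      unfolding finite_propagation_def
    \<comment> \<open>Points of the supports are within \<open>C\<close> of the centres of their
      cells, whence the term with factor 2; absolute values and the added 1 make the radius
      positive.\<close>
    proof (intro exI[of _ "\<bar>R\<bar> + 2 * \<bar>C\<bar> + 1"] conjI ballI impI)
      fix f g assume f: "f \<in> C0 (space M)" and g: "g \<in> C0 (space M)"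
        and far: "setdist (supp (space M) f) (supp (space M) g) > \<bar>R\<bar> + 2 * \<bar>C\<bar> + 1"
      have fb: "bmeas M f" and gb: "bmeas M g" using C0_bmeas f g by auto
      note fop = mult_op_bounded[OF fb, where 'h = 'h] and gop = mult_op_bounded[OF gb, where 'h = 'h]
      have key: "d = c x \<Longrightarrow> d' = c y \<Longrightarrow> dist d' d > R"
        if x: "x \<in> space M" "g x \<noteq> 0" and y: "y \<in> space M" "f y \<noteq> 0" for x y d d'
      proof -
        assume dd: "d = c x" "d' = c y"
        have "dist y x \<ge> setdist (supp (space M) f) (supp (space M) g)"
          by (rule setdist_le_dist) (use supp_memI x y in auto)
        moreover have "dist y x \<le> dist y d' + dist d' d + dist x d"
          using dist_triangle[of y x d'] dist_triangle[of d' x d] by (simp add: dist_commute)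
        ultimately show "dist d' d > R" using far c_dist[OF x(1)] c_dist[OF y(1)] unfolding dd by linarith
      qed
      have "ip (L2 M) u (mult_op M f (S (mult_op M g v))) = 0"
        if u: "u \<in> carrier (L2 M)" and v: "v \<in> carrier (L2 M)" for u v
      proof -
        define a where "a = mult_op M (\<lambda>x. cnj (f x)) u"
        define b where "b = mult_op M g v"
        have a: "a \<in> carrier (L2 M)" and b: "b \<in> carrier (L2 M)"
          unfolding a_def b_def using mult_op_closed[OF bmeas_cnj[OF fb] u] mult_op_closed[OF gb v] by auto
        have Sb': "S b \<in> carrier (L2 M)" by (rule G.bo_closed[OF Sb b])
        have "ip (L2 M) u (mult_op M f (S b)) = ip (L2 M) (adjoint (L2 M) S a) b"
          unfolding mult_op_ip(2)[OF fb u Sb'] a_def[symmetric] by (rule G.ip_adjoint_left[OF Sb a b, symmetric])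
        also have "\<dots> = 0"
        proof (rule G.P_total[OF G.adjoint_closed[OF Sb a] b])
          fix d assume d: "d \<in> D"
          show "P d (adjoint (L2 M) S a) = \<zero>\<^bsub>L2 M\<^esub> \<or> P d b = \<zero>\<^bsub>L2 M\<^esub>"
          \<comment> \<open>A cell not met by \<open>g\<close> kills \<open>b\<close>. A cell met by
            \<open>g\<close> is farther than \<open>R\<close> from every cell met by
            \<open>f\<close>, so \<open>S\<close> carries nothing from it to where \<open>a\<close>
            lives.\<close>
          proof (cases "\<exists>x\<in>space M. c x = d \<and> g x \<noteq> 0")
            case False
            then have "P d b = \<zero>\<^bsub>L2 M\<^esub>" unfolding b_def by (intro P_mult_zero[OF d gb _ v]) auto
            then show ?thesis ..
          next
            case True
            then obtain x where x: "x \<in> space M" "c x = d" "g x \<noteq> 0" by blast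
            have "P d (adjoint (L2 M) S a) = \<zero>\<^bsub>L2 M\<^esub>"
            proof (rule G.ip_eqI)
              fix w :: "('x \<Rightarrow> 'h) set" assume w: "w \<in> carrier (L2 M)"
              have Pw: "P d w \<in> carrier (L2 M)" using d w by simp
              have "ip (L2 M) w (P d (adjoint (L2 M) S a)) = ip (L2 M) (P d w) (adjoint (L2 M) S a)"
                by (rule G.P_adj[symmetric]) (use d w G.adjoint_closed[OF Sb a] in auto)
              also have "\<dots> = ip (L2 M) (S (P d w)) a" by (rule G.ip_adjoint_right[OF Sb Pw a])
              also have "\<dots> = 0"
              proof (rule G.P_total[OF G.bo_closed[OF Sb Pw] a])
                fix d' assume d': "d' \<in> D"
                show "P d' (S (P d w)) = \<zero>\<^bsub>L2 M\<^esub> \<or> P d' a = \<zero>\<^bsub>L2 M\<^esub>"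
                proof (cases "\<exists>y\<in>space M. c y = d' \<and> f y \<noteq> 0")
                  case False
                  then have "P d' a = \<zero>\<^bsub>L2 M\<^esub>" unfolding a_def by (intro P_mult_zero[OF d' bmeas_cnj[OF fb] _ u]) auto
                  then show ?thesis ..
                next
                  case True
                  then obtain y where y: "y \<in> space M" "c y = d'" "f y \<noteq> 0" by blast
                  have "dist d' d > R" using key[OF x(1,3) y(1,3)] x(2) y(2) by blast
                  then show ?thesis using R d d' w unfolding G.propagation_le_def by blast
                qed
              qed
              finally show "ip (L2 M) w (P d (adjoint (L2 M) S a)) = ip (L2 M) w \<zero>\<^bsub>L2 M\<^esub>" using w by simp
            qed (use d G.adjoint_closed[OF Sb a] in auto)
            then show ?thesis ..
          qed
        qed
        finally show ?thesis unfolding b_def .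
      qed
      then show "op_mult (L2 M) (mult_op M f) (op_mult (L2 M) S (mult_op M g)) = op_zero (L2 M)"
        by (intro G.bo_eqI) (use Sb fop gop in simp_all)
    qed simp
  next
    assume Sb: "S \<in> bounded_ops (L2 M)" and lc: "locally_compact M S" and fp: "finite_propagation M S"
    have gop: "mult_op M (cutoff d C) \<in> bounded_ops (L2 M :: ('x \<Rightarrow> 'h) set ip_space)" for d
      by (rule mult_op_bounded[OF C0_bmeas[OF cutoff_C0]])
    have lc': "compact_op (L2 M) (op_mult (L2 M) S (mult_op M (cutoff d C)))"
      "compact_op (L2 M) (op_mult (L2 M) (mult_op M (cutoff d C)) S)" for d
      using lc cutoff_C0 unfolding locally_compact_def by auto
    have "compact_op (L2 M) (op_mult (L2 M) (P d) S) \<and> compact_op (L2 M) (op_mult (L2 M) S (P d))" if d: "d \<in> D" for d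
    proof -
      have "op_mult (L2 M) (P d) S = op_mult (L2 M) (P d) (op_mult (L2 M) (mult_op M (cutoff d C)) S)"
        by (rule G.bo_eqI) (use Sb d gop in \<open>simp_all add: P_cutoff G.bo_closed\<close>)
      moreover have "op_mult (L2 M) S (P d) = op_mult (L2 M) (op_mult (L2 M) S (mult_op M (cutoff d C))) (P d)"
        by (rule G.bo_eqI) (use Sb d gop in \<open>simp_all add: cutoff_P\<close>)
      ultimately show ?thesis
        using G.compact_op_mult_left[OF lc'(2) G.P_bounded[OF d]] G.compact_op_mult_right[OF lc'(1) G.P_bounded[OF d]] by simp
    qed
    moreover obtain R where R: "R > 0" "\<And>f g. \<lbrakk>f \<in> C0 (space M); g \<in> C0 (space M);
        setdist (supp (space M) f) (supp (space M) g) > R\<rbrakk> \<Longrightarrow>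
        op_mult (L2 M) (mult_op M f) (op_mult (L2 M) S (mult_op M g)) = op_zero (L2 M)"
      using fp unfolding finite_propagation_def by blast
    \<comment> \<open>The cutoff at \<open>d\<close> is supported within \<open>C + 1\<close> of
      \<open>d\<close>, on either side.\<close>
    have "G.propagation_le S (R + 2 * (C + 1))"
      unfolding G.propagation_le_def
    proof (intro ballI impI)
      fix d d' and v :: "('x \<Rightarrow> 'h) set"
      assume d: "d \<in> D" and d': "d' \<in> D" and far: "R + 2 * (C + 1) < dist d d'" and v: "v \<in> carrier (L2 M)"
      have C: "C \<ge> 0"
        by (rule order_trans[OF zero_le_dist c_dist]) (use d D_space in blast)
      \<comment> \<open>\<open>setdist\<close> is 0 when one of the sets is empty, so both supports
        must be seen to be nonempty.\<close>
      have ne: "e \<in> supp (space M) (cutoff e C)" if "e \<in> D" for e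
        by (rule supp_memI) (use that D_space C cutoff_one[of e e C] in auto)
      have "dist d d' - 2 * (C + 1) \<le> setdist (supp (space M) (cutoff d C)) (supp (space M) (cutoff d' C))"
      proof (rule le_setdistI)
        fix x y assume "x \<in> supp (space M) (cutoff d C)" "y \<in> supp (space M) (cutoff d' C)"
        then have xy: "dist d x \<le> C + 1" "dist d' y \<le> C + 1"
          using cutoff_supp[of d C] cutoff_supp[of d' C] by auto
        have "dist d d' \<le> dist d x + dist x y + dist d' y"
          using dist_triangle[of d d' x] dist_triangle[of x d' y] by (simp add: dist_commute)
        then show "dist d d' - 2 * (C + 1) \<le> dist x y" using xy by (simp add: distrib_left)
      qed (use ne d d' in auto)
      then have "setdist (supp (space M) (cutoff d C)) (supp (space M) (cutoff d' C)) > R" using far by linarith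
      from R(2)[OF cutoff_C0 cutoff_C0 this]
      have z: "mult_op M (cutoff d C) (S (mult_op M (cutoff d' C) w)) = \<zero>\<^bsub>L2 M\<^esub>" if "w \<in> carrier (L2 M)" for w
        using that by (metis G.op_apply(2,4))
      have Pv: "P d' v \<in> carrier (L2 M)" using d' v by simp
      have "P d (S (P d' v)) = P d (mult_op M (cutoff d C) (S (mult_op M (cutoff d' C) (P d' v))))"
        unfolding cutoff_P[OF d' v] by (rule P_cutoff[OF d G.bo_closed[OF Sb Pv], symmetric])
      also have "\<dots> = \<zero>\<^bsub>L2 M\<^esub>" unfolding z[OF Pv] by (rule G.bo_zero[OF G.P_bounded[OF d]])
      finally show "P d (S (P d' v)) = \<zero>\<^bsub>L2 M\<^esub>" .
    qed
    ultimately show "G.nice S" using Sb unfolding G.nice_def by blast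
  qed
qed

text \<open>Once \<open>nice\<close> is identified, only the way of measuring distance differs:
  \<open>op_dist\<close> on one side, a pointwise bound on the other.\<close>

lemma roe_eq:
  "(roe M :: (('x \<Rightarrow> 'h::chilbert_space) set \<Rightarrow> ('x \<Rightarrow> 'h) set) star_algebra) =
    op_algebra (L2 M) (gmod.roe_set (L2 M) P D)"
proof -
  interpret G: gmod "L2 M :: ('x \<Rightarrow> 'h) set ip_space" P D by (rule gmod_L2)
  have "(\<forall>\<epsilon>>0. \<exists>S\<in>bounded_ops (L2 M). locally_compact M S \<and> finite_propagation M S \<and> op_dist (L2 M) T S < \<epsilon>) \<longleftrightarrow>
      (\<forall>\<epsilon>>0. \<exists>S. G.nice S \<and> (\<forall>v\<in>carrier (L2 M). hnorm (L2 M) (vsub (L2 M) (T v) (S v)) \<le> \<epsilon> * hnorm (L2 M) v))"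
    (is "?L \<longleftrightarrow> ?R") if T: "T \<in> bounded_ops (L2 M)" for T :: "('x \<Rightarrow> 'h) set \<Rightarrow> ('x \<Rightarrow> 'h) set"
  proof
    assume L: ?L
    show ?R
    proof (intro allI impI)
      fix \<epsilon> :: real assume "\<epsilon> > 0"
      then obtain S where S: "S \<in> bounded_ops (L2 M)" "locally_compact M S" "finite_propagation M S" "op_dist (L2 M) T S < \<epsilon>"
        using L by blast
      have "hnorm (L2 M) (vsub (L2 M) (T v) (S v)) \<le> \<epsilon> * hnorm (L2 M) v" if v: "v \<in> carrier (L2 M)" for v
        using G.op_dist_bound[OF T S(1) v] mult_right_mono[of "op_dist (L2 M) T S" \<epsilon> "hnorm (L2 M) v"] S(4) v by simp
      then show "\<exists>S. G.nice S \<and> (\<forall>v\<in>carrier (L2 M). hnorm (L2 M) (vsub (L2 M) (T v) (S v)) \<le> \<epsilon> * hnorm (L2 M) v)"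
        using S nice_iff by blast
    qed
  next
    assume R: ?R
    show ?L
    proof (intro allI impI)
      fix \<epsilon> :: real assume e: "\<epsilon> > 0"
      \<comment> \<open>Half of \<open>\<epsilon>\<close>, because the pointwise bound controls
        \<open>op_dist\<close> only non-strictly.\<close>
      then have "\<epsilon> / 2 > 0" by simp
      then obtain S where S: "G.nice S" "\<And>v. v \<in> carrier (L2 M) \<Longrightarrow> hnorm (L2 M) (vsub (L2 M) (T v) (S v)) \<le> \<epsilon> / 2 * hnorm (L2 M) v"
        using R by blast
      have n: "S \<in> bounded_ops (L2 M)" "locally_compact M S" "finite_propagation M S" using S(1) nice_iff by auto
      have "op_dist (L2 M) T S \<le> \<epsilon> / 2" by (rule G.op_dist_le[OF T n(1) _ S(2)]) (use e in auto)
      then have "op_dist (L2 M) T S < \<epsilon>" using e by linarith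
      then show "\<exists>S\<in>bounded_ops (L2 M). locally_compact M S \<and> finite_propagation M S \<and> op_dist (L2 M) T S < \<epsilon>"
        using n by blast
    qed
  qed
  then have "{T \<in> bounded_ops (L2 M). \<forall>\<epsilon>>0. \<exists>S\<in>bounded_ops (L2 M).
      locally_compact M S \<and> finite_propagation M S \<and> op_dist (L2 M) T S < \<epsilon>} = G.roe_set"
    unfolding G.roe_set_def by blast
  then show ?thesis by (simp add: roe_def op_algebra_def)
qed

end

text \<open>A uniformly discrete set is closed, so it meets a compact ball in a compact discrete
  set.\<close>

lemma finite_balls_uniform_discrete:
  assumes D: "uniform_discrete D" and proper: "\<And>(x::'x::metric_space) r. compact (cball x r)"
  shows "finite {d \<in> D. dist (x::'x) d \<le> r}"
proof -
  have "closed D" by (rule uniform_discrete_imp_closed[OF D])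
  then have "compact (D \<inter> cball x r)" using closed_Int_compact proper by blast
  moreover have "discrete (D \<inter> cball x r)"
    by (rule uniform_discrete_imp_discrete[OF uniform_discrete_subset[OF D]]) simp
  ultimately have "finite (D \<inter> cball x r)" using discrete_compact_finite_iff by blast
  moreover have "{d \<in> D. dist x d \<le> r} = D \<inter> cball x r" by auto
  ultimately show ?thesis by simp
qed

subsection \<open>Uniformly discrete spaces\<close>

lemma cells_count_space:
  assumes D: "uniform_discrete (D :: 'x::metric_space set)" and proper: "\<And>(x::'x) r. compact (cball x r)"
  shows "cells (count_space D) D (\<lambda>x. x) 0"
proof
  show "finite {d \<in> D. dist x d \<le> r}" for x r by (rule finite_balls_uniform_discrete[OF D proper])
  show "closed (space (count_space D))" using uniform_discrete_imp_closed[OF D] by simp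
qed (use proper in auto)

section \<open>Point masses in the L2 space of a discrete set\<close>

lemma L2_class_cong: "(\<And>x. x \<in> space M \<Longrightarrow> f x = g x) \<Longrightarrow> L2_class M f = L2_class M g"
  unfolding L2_class_def by (intro Collect_cong conj_cong refl AE_cong) auto

lemma count_space_eqI:
  assumes "a \<in> carrier (L2 (count_space D))" "b \<in> carrier (L2 (count_space D))" "\<And>x. x \<in> D \<Longrightarrow> rep a x = rep b x"
  shows "a = b"
  by (rule L2_eqI[OF assms(1,2)]) (use assms(3) in \<open>simp add: AE_count_space\<close>)

lemma rep_count_space: "\<lbrakk>f \<in> square_int (count_space D); x \<in> D\<rbrakk> \<Longrightarrow> rep (L2_class (count_space D) f) x = f x"
  using rep_L2_class(2)[of f "count_space D"] by (simp add: AE_count_space)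

definition delta :: "'x set \<Rightarrow> 'x \<Rightarrow> 'h \<Rightarrow> ('x \<Rightarrow> 'h::chilbert_space) set"
  where "delta D x h = L2_class (count_space D) (\<lambda>y. if y = x then h else 0)"

lemma delta_square_int: "(\<lambda>y. if y = x then h else (0::'h::chilbert_space)) \<in> square_int (count_space D)"
  unfolding square_int_iff
proof
  show "smeas (count_space D) (\<lambda>y. if y = x then h else 0)"
    unfolding smeas_def using closure_subset[of "{h, 0}"] by (auto intro!: exI[of _ "{h, 0}"])
  have "finite {a \<in> D. 0 < ennreal (norm ((norm (if a = x then h else 0))\<^sup>2))}"
    by (rule finite_subset[of _ "{x}"]) (auto split: if_splits)
  then show "integrable (count_space D) (\<lambda>y. (norm (if y = x then h else 0))\<^sup>2)"
    unfolding integrable_iff_bounded by (subst nn_integral_count_space) auto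
qed

lemma delta_closed [simp, intro]: "delta D x h \<in> carrier (L2 (count_space D))"
  unfolding delta_def by (rule L2_class_closed[OF delta_square_int])

lemma rep_delta: "y \<in> D \<Longrightarrow> rep (delta D x h) y = (if y = x then h else 0)"
  unfolding delta_def by (rule rep_count_space[OF delta_square_int])

text \<open>Evaluation at a point becomes an inner product, which turns weak identities into
  pointwise ones.\<close>

lemma ip_delta:
  assumes b: "b \<in> carrier (L2 (count_space D))" and x: "x \<in> D"
  shows "ip (L2 (count_space D)) (delta D x h) b = cinner h (rep b x)"
proof -
  let ?f = "\<lambda>y. cinner (if y = x then h else 0) (rep b y)"
  have "ip (L2 (count_space D)) (delta D x h) b = (\<integral>y. ?f y \<partial>count_space D)"
    using ip_L2_class[OF delta_square_int rep_square_int[OF b]] b by (simp add: delta_def)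
  also have "\<dots> = (\<Sum>y | y \<in> D \<and> ?f y \<noteq> 0. ?f y)"
    by (rule lebesgue_integral_count_space_finite_support) (rule finite_subset[of _ "{x}"], auto split: if_splits)
  also have "\<dots> = (\<Sum>y\<in>{x}. ?f y)"
    by (rule sum.mono_neutral_left) (use x in \<open>auto split: if_splits\<close>)
  finally show ?thesis by simp
qed

lemma elem_tensor_square_int:
  assumes a: "a \<in> carrier (L2 M)"
  shows "(\<lambda>x. rep a x *\<^sub>C (v::'h::chilbert_space)) \<in> square_int M"
proof -
  have i: "rep a \<in> square_int M" using a by simp
  show ?thesis
    unfolding square_int_iff
  proof
    show "smeas M (\<lambda>x. rep a x *\<^sub>C v)" by (intro smeas_scaleC square_int_smeas i smeas_const)
    show "integrable M (\<lambda>x. (norm (rep a x *\<^sub>C v))\<^sup>2)"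
      using i by (simp add: square_int_iff power_mult_distrib)
  qed
qed

text \<open>If \<open>P d\<close> were compact, then the values at \<open>d\<close> of the finitely many basis vectors living in the
  cell of \<open>d\<close> would span \<open>H\<close>.\<close>

lemma P_not_compact_count_space:
  assumes D: "uniform_discrete (D :: 'x::metric_space set)" and proper: "\<And>(x::'x) r. compact (cball x r)"
    and inf: "\<not> cfinite_dim TYPE('h::chilbert_space)" and d: "d \<in> D"
  shows "\<not> compact_op (L2 (count_space D) :: ('x \<Rightarrow> 'h) set ip_space) (mult_op (count_space D) (cells.cell (\<lambda>x. x) d))"
proof
  interpret X: cells "count_space D" D "\<lambda>x. x" 0 by (rule cells_count_space[OF D proper])
  interpret G: gmod "L2 (count_space D) :: ('x \<Rightarrow> 'h) set ip_space" X.P D by (rule X.gmod_L2)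
  assume K: "compact_op (L2 (count_space D) :: ('x \<Rightarrow> 'h) set ip_space) (X.P d)"
  obtain E where E: "E \<subseteq> G.cell_vectors" "onf (L2 (count_space D)) E (\<lambda>e. e)"
    and tot: "\<And>v. \<lbrakk>v \<in> carrier (L2 (count_space D)); \<forall>e\<in>E. ip (L2 (count_space D)) e v = 0\<rbrakk> \<Longrightarrow> v = \<zero>\<^bsub>L2 (count_space D)\<^esub>"
    using G.cell_basis_ex by blast
  \<comment> \<open>Each of these basis vectors is fixed by \<open>P d\<close> and has norm 1, so
    compactness leaves finitely many; the threshold 1/2 is any number below 1.\<close>
  define F where "F = {e \<in> E. X.P d e = e}"
  have "F \<subseteq> {e \<in> E. hnorm (L2 (count_space D)) (X.P d e) > 1 / 2}"
    using onf_ip[OF E(2)] by (auto simp: F_def hnorm_def)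
  then have F: "finite F" using G.compact_onf_finite[OF K E(2), of "1 / 2"] finite_subset by auto
  have Ec: "e \<in> carrier (L2 (count_space D))" if "e \<in> F" for e
    using onf_closed[OF E(2)] that by (simp add: F_def)
  \<comment> \<open>Every \<open>h\<close> is the value at \<open>d\<close> of a point mass, which
    lies in the cell of \<open>d\<close> and is expanded along \<open>F\<close>.\<close>
  have span: "h = (\<Sum>e\<in>F. cnj (cinner h (rep e d)) *\<^sub>C rep e d)" for h :: 'h
  proof (rule cinner_eqI)
    fix k
    have "X.P d (delta D d h) = delta D d h"
    proof (rule count_space_eqI)
      fix y assume y: "y \<in> D"
      show "rep (X.P d (delta D d h)) y = rep (delta D d h) y"
        using rep_mult_op[OF X.cell_bmeas[OF d], of "delta D d h"] y
        by (auto simp: AE_count_space X.cell_def rep_delta)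
    qed (use d in \<open>simp_all add: G.P_closed\<close>)
    then have "cinner k h = ip (L2 (count_space D)) (delta D d k) (X.P d (delta D d h))"
      using d by (simp add: ip_delta rep_delta)
    also have "\<dots> = (\<Sum>e\<in>F. ip (L2 (count_space D)) e (delta D d h) * ip (L2 (count_space D)) (delta D d k) e)"
      unfolding F_def by (rule G.P_finite_expansion[OF E tot d]) (use F in \<open>simp_all add: F_def\<close>)
    also have "\<dots> = (\<Sum>e\<in>F. cnj (cinner h (rep e d)) * cinner k (rep e d))"
    proof (rule sum.cong[OF refl])
      fix e assume e: "e \<in> F"
      have "ip (L2 (count_space D)) e (delta D d h) = cnj (cinner h (rep e d))"
        using G.ip_cnj[OF Ec[OF e] delta_closed] ip_delta[OF Ec[OF e] d] by simp
      then show "ip (L2 (count_space D)) e (delta D d h) * ip (L2 (count_space D)) (delta D d k) e =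
          cnj (cinner h (rep e d)) * cinner k (rep e d)"
        using ip_delta[OF Ec[OF e] d] by simp
    qed
    also have "\<dots> = cinner k (\<Sum>e\<in>F. cnj (cinner h (rep e d)) *\<^sub>C rep e d)"
      by (simp add: bounded_bilinear.sum_right[OF bounded_bilinear_cinner] cinner_scaleC_right)
    finally show "cinner k h = cinner k (\<Sum>e\<in>F. cnj (cinner h (rep e d)) *\<^sub>C rep e d)" .
  qed
  have "\<exists>c. h = (\<Sum>b\<in>(\<lambda>e. rep e d) ` F. c b *\<^sub>C b)" for h :: 'h
  \<comment> \<open>Different basis vectors may have the same value at \<open>d\<close>; their
    coefficients are added up.\<close>
  proof (rule exI[of _ "\<lambda>b. \<Sum>e | e \<in> F \<and> rep e d = b. cnj (cinner h (rep e d))"])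
    have "h = (\<Sum>b\<in>(\<lambda>e. rep e d) ` F. \<Sum>e | e \<in> F \<and> rep e d = b. cnj (cinner h (rep e d)) *\<^sub>C rep e d)"
      using span[of h] sum.image_gen[OF F, of "\<lambda>e. cnj (cinner h (rep e d)) *\<^sub>C rep e d" "\<lambda>e. rep e d"] by simp
    also have "\<dots> = (\<Sum>b\<in>(\<lambda>e. rep e d) ` F. (\<Sum>e | e \<in> F \<and> rep e d = b. cnj (cinner h (rep e d))) *\<^sub>C b)"
      unfolding bounded_bilinear.sum_left[OF bounded_bilinear_scaleC] by (intro sum.cong refl) auto
    finally show "h = (\<Sum>b\<in>(\<lambda>e. rep e d) ` F. (\<Sum>e | e \<in> F \<and> rep e d = b. cnj (cinner h (rep e d))) *\<^sub>C b)" .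
  qed
  then have "cfinite_dim TYPE('h)" unfolding cfinite_dim_def using F by (intro exI[of _ "(\<lambda>e. rep e d) ` F"]) simp
  then show False using inf by simp
qed

text \<open>For a unit vector \<open>u\<close> spanning the range, \<open>e u = u\<close> and
  self-adjointness give \<open><u, e v> = <u, v>\<close>, which is the coefficient of
  \<open>e v\<close>.\<close>

lemma rank_one_projectionE:
  assumes e: "rank_one_projection (e :: 'h::chilbert_space \<Rightarrow> 'h)"
  obtains u where "norm u = 1" "\<And>v. e v = cinner u v *\<^sub>C u"
proof -
  obtain u0 where u0: "u0 \<noteq> 0" "range e = range (\<lambda>c. c *\<^sub>C u0)" using e unfolding rank_one_projection_def by blast
  have idem: "e (e v) = e v" and sa: "cinner (e v) w = cinner v (e w)" for v w
    using e unfolding rank_one_projection_def by blast+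
  define u where "u = complex_of_real (1 / norm u0) *\<^sub>C u0"
  have nu: "norm u = 1" using u0(1) by (simp add: u_def norm_divide)
  have "u \<in> range e" unfolding u0(2) u_def by blast
  then have eu: "e u = u" using idem by auto
  have "e v = cinner u v *\<^sub>C u" for v
  proof -
    obtain c where c: "e v = c *\<^sub>C u0" using u0(2) by (metis rangeI rangeE)
    have "u0 = complex_of_real (norm u0) *\<^sub>C u" using u0(1) by (simp add: u_def scaleC_scaleC)
    then have ev: "e v = (c * complex_of_real (norm u0)) *\<^sub>C u" using c by (metis scaleC_scaleC)
    have "cinner u v = cinner u (e v)" using sa[of u v] eu by simp
    also have "\<dots> = c * complex_of_real (norm u0)"
      unfolding ev cinner_scaleC_right using nu by (simp add: cinner_self)
    finally show ?thesis using ev by simp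
  qed
  then show ?thesis using that nu by blast
qed

section \<open>The projection on the discrete side as the frame of point masses\<close>

lemma iota_C_one:
  assumes "D0 \<subseteq> D" and a: "a \<in> carrier (L2 (count_space D))"
  shows "iota_C D0 D \<one>\<^bsub>uniform_roe D0\<^esub> a \<in> carrier (L2 (count_space D))"
    and "x \<in> D \<Longrightarrow> rep (iota_C D0 D \<one>\<^bsub>uniform_roe D0\<^esub> a) x = (if x \<in> D0 then rep a x else 0)"
proof -
  let ?\<chi> = "\<lambda>x. if x \<in> D0 then 1 else 0 :: complex"
  have b: "bmeas (count_space D) ?\<chi>" by (auto simp: bmeas_def intro!: exI[of _ 1])
  have i: "rep a \<in> square_int (count_space D0)"
    unfolding square_int_iff
  proof
    have s: "smeas (count_space D) (rep a)" and int: "integrable (count_space D) (\<lambda>x. (norm (rep a x))\<^sup>2)"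
      using rep_square_int[OF a] by (simp_all add: square_int_iff)
    show "smeas (count_space D0) (rep a)" by (rule smeas_complex) simp
    show "integrable (count_space D0) (\<lambda>x. (norm (rep a x))\<^sup>2)"
      using int Infinite_Set_Sum.abs_summable_on_subset[OF _ assms(1)] unfolding Infinite_Set_Sum.abs_summable_on_def by blast
  qed
  have op: "\<one>\<^bsub>uniform_roe D0\<^esub> = op_id (L2 (count_space D0))" by (simp add: roe_def)
  have "iota_C D0 D \<one>\<^bsub>uniform_roe D0\<^esub> a = L2_class (count_space D) (\<lambda>x. ?\<chi> x *\<^sub>C rep a x)"
    unfolding iota_C_def op using a i
    by (simp, intro L2_class_cong) (auto simp: op_id_def rep_count_space scaleC_complex_def)
  then have eq: "iota_C D0 D \<one>\<^bsub>uniform_roe D0\<^esub> a = mult_op (count_space D) ?\<chi> a" using a by (simp add: mult_op_eq)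
  show "iota_C D0 D \<one>\<^bsub>uniform_roe D0\<^esub> a \<in> carrier (L2 (count_space D))"
    unfolding eq by (rule mult_op_closed[OF b a])
  show "rep (iota_C D0 D \<one>\<^bsub>uniform_roe D0\<^esub> a) x = (if x \<in> D0 then rep a x else 0)" if "x \<in> D"
    unfolding eq using rep_mult_op[OF b a] that by (auto simp: AE_count_space scaleC_complex_def)
qed

lemma onf_delta:
  assumes "D0 \<subseteq> D" and u: "norm (u::'h::chilbert_space) = 1"
  shows "onf (L2 (count_space D)) D0 (\<lambda>x. delta D x u)"
  unfolding onf_def
proof (intro conjI ballI)
  fix x y assume "x \<in> D0" "y \<in> D0"
  then have "x \<in> D" "y \<in> D" using assms(1) by auto
  then show "ip (L2 (count_space D)) (delta D x u) (delta D y u) = (if x = y then 1 else 0)"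
    using u by (simp add: ip_delta rep_delta cinner_self)
qed simp

text \<open>The definite description in \<open>tensor_op\<close> has to be resolved. The frame
  satisfies it pointwise, and any other solution agrees with the frame on point masses because these
  are elementary tensors.\<close>

lemma i_D_one:
  fixes e :: "'h::chilbert_space \<Rightarrow> 'h"
  assumes D0: "D0 \<subseteq> D" and u: "norm u = 1" and e: "\<And>v. e v = cinner u v *\<^sub>C u"
  shows "i_D D e (iota_C D0 D \<one>\<^bsub>uniform_roe D0\<^esub>) =
    frame (L2 (count_space D)) (L2 (count_space D)) D0 (\<lambda>x. delta D x u) (\<lambda>x. delta D x u)"
proof -
  let ?V = "L2 (count_space D) :: ('a \<Rightarrow> 'h) set ip_space"
  let ?F = "frame ?V ?V D0 (\<lambda>x. delta D x u) (\<lambda>x. delta D x u)"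
  let ?T = "iota_C D0 D \<one>\<^bsub>uniform_roe D0\<^esub>"
  interpret H: hilb ?V by (rule hilb_L2)
  note on = onf_delta[OF D0 u]
  interpret A: hilb_pair ?V ?V D0 "\<lambda>x. delta D x u" "\<lambda>x. delta D x u" by unfold_locales (rule on)+
  have Fb: "?F \<in> bounded_ops ?V" by (rule H.frame_bounded[OF on on])
  have rep_F: "rep (?F b) x = (if x \<in> D0 then cinner u (rep b x) *\<^sub>C u else 0)" if b: "b \<in> carrier ?V" and x: "x \<in> D" for b x
  proof (rule cinner_eqI)
    fix k
    have "cinner k (rep (?F b) x) = ip ?V (delta D x k) (?F b)" by (rule ip_delta[OF A.frame_closed[OF b] x, symmetric])
    also have "\<dots> = (\<Sum>\<^sub>\<infinity>y\<in>D0. ip ?V (delta D y u) b * ip ?V (delta D x k) (delta D y u))"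
      by (rule A.frame_ip[OF b]) simp
    also have "\<dots> = (if x \<in> D0 then ip ?V (delta D x u) b * ip ?V (delta D x k) (delta D x u) else 0)"
      by (rule infsum_single) (use x in \<open>simp add: ip_delta rep_delta\<close>)
    also have "\<dots> = cinner k (if x \<in> D0 then cinner u (rep b x) *\<^sub>C u else 0)"
      using x b by (simp add: ip_delta rep_delta cinner_scaleC_right)
    finally show "cinner k (rep (?F b) x) = cinner k (if x \<in> D0 then cinner u (rep b x) *\<^sub>C u else 0)" .
  qed
  have F_tensor: "?F (elem_tensor (count_space D) a v) = elem_tensor (count_space D) (?T a) (e v)"
    if a: "a \<in> carrier (L2 (count_space D))" for a v
  proof (rule count_space_eqI)
    have c: "elem_tensor (count_space D) a v \<in> carrier ?V"
      unfolding elem_tensor_def by (rule L2_class_closed[OF elem_tensor_square_int[OF a]])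
    show "?F (elem_tensor (count_space D) a v) \<in> carrier ?V" by (rule A.frame_closed[OF c])
    fix x assume x: "x \<in> D"
    have T: "?T a \<in> carrier (L2 (count_space D))" by (rule iota_C_one(1)[OF D0 a])
    show "rep (?F (elem_tensor (count_space D) a v)) x = rep (elem_tensor (count_space D) (?T a) (e v)) x"
      unfolding rep_F[OF c x]
      unfolding elem_tensor_def rep_count_space[OF elem_tensor_square_int[OF a] x]
        rep_count_space[OF elem_tensor_square_int[OF T] x] iota_C_one(2)[OF D0 a x]
      by (simp add: e cinner_scaleC_right scaleC_scaleC)
  next
    show "elem_tensor (count_space D) (?T a) (e v) \<in> carrier ?V"
      unfolding elem_tensor_def by (rule L2_class_closed[OF elem_tensor_square_int[OF iota_C_one(1)[OF D0 a]]])
  qed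
  have "tensor_op (count_space D) ?T e = ?F"
    unfolding tensor_op_def
  proof (rule the_equality)
    show "?F \<in> bounded_ops ?V \<and> (\<forall>a\<in>carrier (L2 (count_space D)). \<forall>v.
        ?F (elem_tensor (count_space D) a v) = elem_tensor (count_space D) (?T a) (e v))"
      using Fb F_tensor by blast
    fix W assume W: "W \<in> bounded_ops ?V \<and> (\<forall>a\<in>carrier (L2 (count_space D)). \<forall>v.
        W (elem_tensor (count_space D) a v) = elem_tensor (count_space D) (?T a) (e v))"
    then have Wb: "W \<in> bounded_ops ?V" by blast
    have WF: "W (delta D x h) = ?F (delta D x h)" if x: "x \<in> D" for x h
    proof -
      have d: "delta D x h = elem_tensor (count_space D) (delta D x 1) h"
        unfolding elem_tensor_def
      proof (subst delta_def, rule L2_class_cong)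
        fix y assume "y \<in> space (count_space D)"
        then show "(if y = x then h else 0) = rep (delta D x 1) y *\<^sub>C h" by (simp add: rep_delta)
      qed
      show ?thesis unfolding d using W F_tensor delta_closed by metis
    qed
    show "W = ?F"
    proof (rule H.bo_eqI[OF Wb Fb])
      fix w b assume w: "w \<in> carrier ?V" and b: "b \<in> carrier ?V"
      have ac: "adjoint ?V W w \<in> carrier ?V" "adjoint ?V ?F w \<in> carrier ?V"
        by (rule H.adjoint_closed[OF Wb w], rule H.adjoint_closed[OF Fb w])
      \<comment> \<open>Agreement on all point masses says that the adjoints have the same values at
        every point; this takes the place of a density argument.\<close>
      have "adjoint ?V W w = adjoint ?V ?F w"
      proof (rule count_space_eqI[OF ac])
        fix x assume x: "x \<in> D"
        show "rep (adjoint ?V W w) x = rep (adjoint ?V ?F w) x"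
        proof (rule cinner_eqI)
          fix h
          have "ip ?V (delta D x h) (adjoint ?V W w) = ip ?V (delta D x h) (adjoint ?V ?F w)"
            unfolding H.ip_adjoint_right[OF Wb delta_closed w] H.ip_adjoint_right[OF Fb delta_closed w] WF[OF x] ..
          then show "cinner h (rep (adjoint ?V W w) x) = cinner h (rep (adjoint ?V ?F w) x)"
            by (simp only: ip_delta[OF ac(1) x] ip_delta[OF ac(2) x])
        qed
      qed
      then show "ip ?V w (W b) = ip ?V w (?F b)"
        using H.ip_adjoint_left[OF Wb w b] H.ip_adjoint_left[OF Fb w b] by simp
    qed
  qed
  then show ?thesis by (simp add: i_D_def)
qed

subsection \<open>Proper metric measure spaces\<close>

text \<open>Every point is assigned to a nearest point of \<open>D\<close>, ties being broken by an enumeration.\<close>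

lemma cells_proper:
  assumes m: "proper_metric_measure (m :: 'x::metric_space measure)" and D: "uniform_discrete D" and ce: "coarsely_equivalent D"
  shows "\<exists>c C. cells m D c C \<and> (\<forall>d\<in>D. \<exists>r>0. \<forall>x. dist x d < r \<longrightarrow> c x = d)"
proof -
  have proper: "compact (cball x r)" for x :: 'x and r using m by (simp add: proper_metric_measure_def)
  have sets: "sets m = sets borel" using m by (simp add: proper_metric_measure_def)
  have space: "space m = UNIV" using sets_eq_imp_space_eq[OF sets] by simp
  have fin: "finite {d \<in> D. dist x d \<le> r}" for x :: 'x and r
    by (rule finite_balls_uniform_discrete[OF D proper])
  obtain C where C: "C > 0" "\<And>x. \<exists>y\<in>D. dist x y < C" using ce unfolding coarsely_equivalent_def by blast
  have ne: "D \<noteq> {}" using C(2) by blast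
  have cnt: "countable D"
  proof -
    obtain a where "a \<in> D" using ne by blast
    have "D \<subseteq> (\<Union>n::nat. {d \<in> D. dist a d \<le> real n})" using real_arch_simple by fastforce
    moreover have "countable (\<Union>n::nat. {d \<in> D. dist a d \<le> real n})"
      using fin by (intro countable_UN countableI_type countable_finite)
    ultimately show ?thesis using countable_subset by blast
  qed
  define q where "q = from_nat_into D"
  have rq: "range q = D" unfolding q_def by (rule range_from_nat_into[OF ne cnt])
  define near where "near x n \<longleftrightarrow> (\<forall>d\<in>D. dist x (q n) \<le> dist x d)" for x n
  define c where "c x = q (LEAST n. near x n)" for x
  have near_ex: "\<exists>n. near x n" for x
  proof -
    \<comment> \<open>Coarse equivalence puts a point of \<open>D\<close> within \<open>C\<close> of
      \<open>x\<close>, so the nearest point is a minimum over a finite nonempty set.\<close>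
    obtain y where y: "y \<in> D" "dist x y < C" using C(2) by blast
    let ?F = "{d \<in> D. dist x d \<le> C}"
    have "?F \<noteq> {}" using y by auto
    then obtain z where z: "z \<in> ?F" "\<And>d. d \<in> ?F \<Longrightarrow> dist x z \<le> dist x d"
      using ex_is_arg_min_if_finite[OF fin, of x C "dist x"] unfolding is_arg_min_def by (auto simp: not_less)
    have "dist x z \<le> dist x d" if "d \<in> D" for d
    proof (cases "dist x d \<le> C")
      case True then show ?thesis using z(2) that by simp
    next
      case False then show ?thesis using z(1) by simp
    qed
    moreover obtain n where "z = q n" using z(1) rq by blast
    ultimately show ?thesis unfolding near_def by blast
  qed
  have cnear: "dist x (c x) \<le> dist x d" if "d \<in> D" for x d
    using LeastI_ex[OF near_ex[of x]] that unfolding c_def near_def by blast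
  have cD: "c x \<in> D" for x using rq unfolding c_def by blast
  have cm: "{x. c x = d} \<in> sets m" for d
  proof -
    have "(\<lambda>x. LEAST n. near x n) \<in> measurable m (count_space UNIV)"
    proof (rule measurable_Least)
      fix n
      have "{x. near x n} = (\<Inter>d\<in>D. {x. dist x (q n) \<le> dist x d})" by (auto simp: near_def)
      moreover have "closed \<dots>"
        by (intro closed_INT ballI closed_Collect_le continuous_intros)
      ultimately have "{x. near x n} \<in> sets m" unfolding sets by simp
      then show "Measurable.pred m (\<lambda>x. near x n)" by (simp add: pred_def space)
    qed
    from measurable_sets[OF this, of "q -` {d}"]
    show ?thesis by (simp add: space c_def vimage_def)
  qed
  have "cells m D c C"
  proof
    show "dist x (c x) \<le> C" if "x \<in> space m" for x
    proof -
      obtain y where "y \<in> D" "dist x y < C" using C(2) by blast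
      then show ?thesis using cnear[of y x] by linarith
    qed
    show "f \<in> borel_measurable m" if f: "f \<in> C0 (space m)" for f
    proof -
      have "f \<in> borel_measurable borel"
        using f by (intro borel_measurable_continuous_onI) (simp add: C0_def space)
      then show ?thesis using measurable_cong_sets[OF sets refl] by blast
    qed
  qed (use cD cm fin proper in \<open>simp_all add: space\<close>)
  moreover have "\<exists>r>0. \<forall>x. dist x d < r \<longrightarrow> c x = d" if d: "d \<in> D" for d
  proof -
    obtain \<delta> where \<delta>: "\<delta> > 0" "\<And>x y. \<lbrakk>x \<in> D; y \<in> D; dist x y < \<delta>\<rbrakk> \<Longrightarrow> x = y"
      using D unfolding uniform_discrete_def by blast
    \<comment> \<open>The nearest point \<open>c x\<close> is no farther from \<open>x\<close> than
      \<open>d\<close> is, hence at distance less than the separation constant from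
      \<open>d\<close>.\<close>
    have "c x = d" if x: "dist x d < \<delta> / 2" for x
    proof (rule \<delta>(2)[OF cD d])
      have "dist (c x) d \<le> dist x (c x) + dist x d" using dist_triangle[of "c x" d x] by (simp add: dist_commute)
      then show "dist (c x) d < \<delta>" using cnear[OF d, of x] x by linarith
    qed
    then show ?thesis using \<delta>(1) by (intro exI[of _ "\<delta> / 2"]) simp
  qed
  ultimately show ?thesis by blast
qed

text \<open>A bump function \<open>f\<close> around \<open>d\<close> vanishes off the cell of
  \<open>d\<close>, so multiplication by \<open>f\<close> factors through \<open>P d\<close>.
  Compactness of \<open>P d\<close> would make this nonzero \<open>C0\<close> function act
  compactly.\<close>

lemma (in cells) P_not_compact:
  assumes amp: "ample_L2 M" and d: "d \<in> D" and r: "r > 0" "\<And>x. dist x d < r \<Longrightarrow> c x = d"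
  shows "\<not> compact_op (L2 M :: ('x \<Rightarrow> complex) set ip_space) (P d)"
proof
  interpret G: gmod "L2 M :: ('x \<Rightarrow> complex) set ip_space" P D by (rule gmod_L2)
  assume K: "compact_op (L2 M :: ('x \<Rightarrow> complex) set ip_space) (P d)"
  define f where "f x = complex_of_real (max 0 (1 - dist x d / r))" for x
  have f: "f \<in> C0 (space M)"
    unfolding C0_def
  proof (intro CollectI conjI allI impI)
    show "continuous_on (space M) f" unfolding f_def[abs_def] using r(1) by (intro continuous_intros) auto
    fix \<epsilon> :: real assume e: "\<epsilon> > 0"
    show "\<exists>K\<subseteq>space M. compact K \<and> (\<forall>x\<in>space M - K. cmod (f x) < \<epsilon>)"
    proof (intro exI[of _ "space M \<inter> cball d r"] conjI ballI)
      show "compact (space M \<inter> cball d r)" using closed_Int_compact[OF closed_space proper] .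
      fix x assume "x \<in> space M - space M \<inter> cball d r"
      then have "dist x d > r" by (auto simp: dist_commute)
      then have "1 - dist x d / r < 0" using r(1) by (simp add: field_simps)
      then show "cmod (f x) < \<epsilon>" using e by (simp add: f_def max_def)
    qed simp
  qed
  have fb: "bmeas M f" by (rule C0_bmeas[OF f])
  have ff: "f x * cell d x = f x" for x
  proof (cases "dist x d < r")
    case True then show ?thesis using r(2) by (simp add: cell_def)
  next
    case False
    then have "1 - dist x d / r \<le> 0" using r(1) by (simp add: field_simps)
    then show ?thesis by (simp add: f_def max_def)
  qed
  have fop: "mult_op M f \<in> bounded_ops (L2 M :: ('x \<Rightarrow> complex) set ip_space)" by (rule mult_op_bounded[OF fb])
  have "op_mult (L2 M) (mult_op M f) (P d) = (mult_op M f :: ('x \<Rightarrow> complex) set \<Rightarrow> _)"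
    by (rule G.bo_eqI) (use fop d in \<open>simp_all add: mult_op_mult_op[OF fb cell_bmeas[OF d]] ff\<close>)
  then have "compact_op (L2 M :: ('x \<Rightarrow> complex) set ip_space) (mult_op M f)"
    using G.compact_op_mult_left[OF K fop] by simp
  moreover have "\<exists>x\<in>space M. f x \<noteq> 0" using d D_space by (intro bexI[of _ d]) (auto simp: f_def)
  ultimately show False using amp f unfolding ample_L2_def by blast
qed

text \<open>The complement of the essential support is a union of possibly uncountably many open
  sets, on each of which the function vanishes almost everywhere. A cell lies in a compact ball, and
  finitely many of these sets cover that ball once it is far from \<open>x\<close>.\<close>

lemma (in cells) wannier_localised:
  assumes w: "wannier_basis M D0 \<phi>" and D0: "D0 \<subseteq> D"
  shows "gmod.localised (L2 M) P D D0 \<phi>"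
proof -
  interpret G: gmod "L2 M :: ('x \<Rightarrow> complex) set ip_space" P D by (rule gmod_L2)
  have pc: "\<phi> x \<in> carrier (L2 M)" if "x \<in> D0" for x using w that by (simp add: wannier_basis_def)
  obtain R where R: "\<And>x. x \<in> D0 \<Longrightarrow> ess_supp M (\<phi> x) \<subseteq> cball x R" using w unfolding wannier_basis_def by blast
  have "P d (\<phi> x) = \<zero>\<^bsub>L2 M\<^esub>" if x: "x \<in> D0" and d: "d \<in> D" and far: "dist d x > R + C" for x d
  proof -
    define \<U> where "\<U> = {U. open U \<and> (AE y in M. y \<in> U \<longrightarrow> rep (\<phi> x) y = 0)}"
    have "compact (space M \<inter> cball d C)" using closed_Int_compact[OF closed_space proper] .
    moreover have "space M \<inter> cball d C \<subseteq> \<Union>\<U>"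
    proof
      fix y assume y: "y \<in> space M \<inter> cball d C"
      have "dist d x \<le> dist d y + dist x y" using dist_triangle[of d x y] by (simp add: dist_commute)
      then have "y \<notin> cball x R" using y far by auto
      then have "y \<notin> ess_supp M (\<phi> x)" using R[OF x] by blast
      then show "y \<in> \<Union>\<U>" using y unfolding ess_supp_def \<U>_def by blast
    qed
    moreover have "\<And>U. U \<in> \<U> \<Longrightarrow> open U" by (simp add: \<U>_def)
    ultimately obtain \<F> where F: "\<F> \<subseteq> \<U>" "finite \<F>" "space M \<inter> cball d C \<subseteq> \<Union>\<F>"
      by (rule compactE)
    have "AE y in M. \<forall>U\<in>\<F>. y \<in> U \<longrightarrow> rep (\<phi> x) y = 0"
      using F(1,2) by (intro AE_finite_allI) (auto simp: \<U>_def)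
    then have "AE y in M. c y = d \<longrightarrow> rep (\<phi> x) y = 0"
      using AE_space
    proof eventually_elim
      case (elim y)
      then show ?case using F(3) c_dist[of y] by (auto simp: dist_commute)
    qed
    then show ?thesis by (simp add: P_eq_zero_iff[OF d pc[OF x]])
  qed
  moreover have "onf (L2 M) D0 \<phi>" using w by (auto simp: wannier_basis_def onf_def)
  ultimately show ?thesis unfolding G.localised_def by blast
qed

lemma delta_localised:
  assumes D: "uniform_discrete (D :: 'x::metric_space set)" and proper: "\<And>(x::'x) r. compact (cball x r)"
    and D0: "D0 \<subseteq> D" and u: "norm (u::'h::chilbert_space) = 1"
  shows "gmod.localised (L2 (count_space D)) (\<lambda>d. mult_op (count_space D) (cells.cell (\<lambda>x. x) d)) D D0 (\<lambda>x. delta D x u)"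
proof -
  interpret X: cells "count_space D" D "\<lambda>x. x" 0 by (rule cells_count_space[OF D proper])
  interpret G: gmod "L2 (count_space D) :: ('x \<Rightarrow> 'h) set ip_space" X.P D by (rule X.gmod_L2)
  have "X.P d (delta D x u) = \<zero>\<^bsub>L2 (count_space D)\<^esub>" if "d \<in> D" "dist d x > 0" for x d
    unfolding X.P_eq_zero_iff[OF that(1) delta_closed] AE_count_space using that by (auto simp: rep_delta)
  then show ?thesis unfolding G.localised_def using onf_delta[OF D0 u] by blast
qed

theorem theorem4:
  fixes m :: "'x::metric_space measure"
    and D0 D :: "'x set"
    and p :: "('x \<Rightarrow> complex) set \<Rightarrow> ('x \<Rightarrow> complex) set"
    and e :: "'h::chilbert_space \<Rightarrow> 'h"
  assumes "proper_metric_measure m"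
    and "ample_L2 m"
    and "non_atomic m"
    and "uniform_discrete D0"
    and "wannier_projection m D0 p"
    and "uniform_discrete D"
    and "D0 \<subseteq> D"
    and "coarsely_equivalent D"
    and "\<not> cfinite_dim TYPE('h)"
    and "rank_one_projection e"
  shows "K0_class (roe m) p = \<one>\<^bsub>K0 (roe m)\<^esub> \<longleftrightarrow>
    K0_class (roe (count_space D)) (i_D D e (iota_C D0 D (\<one>\<^bsub>uniform_roe D0\<^esub>))) =
      \<one>\<^bsub>K0 (roe (count_space D))\<^esub>"
proof -
  have proper: "compact (cball x r)" for x :: 'x and r using assms(1) by (simp add: proper_metric_measure_def)
  obtain c C where X: "cells m D c C" and nbhd: "\<And>d. d \<in> D \<Longrightarrow> \<exists>r>0. \<forall>x. dist x d < r \<longrightarrow> c x = d"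
    using cells_proper[OF assms(1,6,8)] by blast
  interpret X: cells m D c C by (rule X)
  interpret Y: cells "count_space D" D "\<lambda>x. x" 0 by (rule cells_count_space[OF assms(6) proper])
  obtain \<phi> where w: "wannier_basis m D0 \<phi>" and p: "p = orth_proj (L2 m) (closed_span (L2 m) (\<phi> ` D0))"
    using assms(5) unfolding wannier_projection_def by blast
  obtain u where u: "norm u = 1" "\<And>v. e v = cinner u v *\<^sub>C u" using rank_one_projectionE[OF assms(10)] by blast
  note V = X.gmod_L2[where 'h = complex] and W = Y.gmod_L2[where 'h = 'h]
  note \<phi> = X.wannier_localised[OF w assms(7)] and \<psi> = delta_localised[OF assms(6) proper assms(7) u(1)]
  have on: "onf (L2 m) D0 \<phi>" using \<phi> unfolding gmod.localised_def[OF V] by blast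
  have p': "p = frame (L2 m) (L2 m) D0 \<phi> \<phi>" unfolding p by (rule hilb.orth_proj_closed_span[OF hilb_L2 on])
  have ncV: "\<not> compact_op (L2 m :: ('x \<Rightarrow> complex) set ip_space) (X.P d)" if "d \<in> D" for d
    using X.P_not_compact[OF assms(2) that] nbhd[OF that] by blast
  note ncW = P_not_compact_count_space[OF assms(6) proper assms(9)]
  \<comment> \<open>The forward transfer uses infinite-dimensional cells over \<open>D\<close> with
    values in \<open>H\<close>, the backward one those of \<open>L2(X)\<close>.\<close>
  show ?thesis
    unfolding X.roe_eq Y.roe_eq p' i_D_one[OF assms(7) u]
    using roe_transfer[OF V W ncW \<phi> \<psi> assms(7)] roe_transfer[OF W V ncV \<psi> \<phi> assms(7)] by blast
qed


end
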